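(* Let $P_0\in X=\mathbb{R}\times L^1[0,l]$ with $P_0\ge 0$ and $\|P_0\|_X=1$, let $0\le t_1<\dots<t_N\le T$, and let $\beta_1,\dots,\beta_N\ge 0$. Consider the problem of minimizing $$J(b_1,\dots,b_N)=\frac12\int_0^T\Big|\int_0^l p_1(x,t)\,dx\Big|^2dt+\frac12\sum_{i=1}^N\beta_i\int_0^l|b_i(x)|^2\,dx+\frac12\Big|\int_0^l p_1(x,T)\,dx\Big|^2$$ over $U=[b_1,\dots,b_N]^T\in U_{ad}$, where $P=[p_0,p_1]^T$ is the weak solution, with $P(0)=P_0$, of the controlled system $$\dot P(t)=\mathcal{A}P(t)+\sum_{i=1}^N\delta(t-t_i)\Big[\int_0^l b_i(x)p_1(x,t_i)\,dx,\ -b_i(x)p_1(x,t_i)\Big]^T.$$ Then there exists an optimal solution $(U^*,P^* )$: there are $U^*\in U_{ad}$ and a weak solution $P^*$ of the controlled system corresponding to $U^*$ with $P^*(0)=P_0$, such that $J(U^* )=\inf_{U\in U_{ad}}J(U)$.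
   Context: Fix $0<l<\infty$, $T>0$, a constant failure rate $\lambda_1>0$, and a measurable repair rate $\mu_1\ge 0$ on $[0,l]$ with $\int_0^{l'}\mu_1(x)\,dx<\infty$ for every $l'<l$ and $\int_0^l\mu_1(x)\,dx=\infty$. The state space is $X=\mathbb{R}\times L^1[0,l]$ with norm $\|(p_0,p_1)\|_X=|p_0|+\|p_1\|_{L^1[0,l]}$; $P\ge0$ means $p_0\ge 0$ and $p_1\ge 0$ a.e. Its dual is $X^*=\mathbb{R}\times L^\infty[0,l]$ with pairing $(P,Q)=p_0q_0+\int_0^l p_1q_1\,dx$. The operator $\mathcal{A}$ on $X$ is $$\mathcal{A}P=\Big[-\lambda_1p_0+\int_0^l\mu_1(x)p_1(x)\,dx,\ -\Big(\frac{d}{dx}+\mu_1(x)\Big)p_1(x)\Big]^T,$$ $$D(\mathcal{A})=\Big\{P\in X:\ \frac{dp_1}{dx}\in L^1[0,l],\ \int_0^l\mu_1(x)p_1(x)\,dx<\infty,\ p_1(0)=\lambda_1p_0\Big\}.$$ It is known that $\mathcal{A}$ generates a positive $C_0$-semigroup of contractions on $X$. $\mathcal{A}^*$ denotes the Banach space adjoint of $\mathcal{A}$. $PWC_l([0,T];X)$ is the space of piecewise continuous functions $[0,T]\to X$ that are left continuous and possess right-hand limits. In particular $p_1(\cdot,t_i)$ denotes the value just before the impulse at $t_i$. Admissible controls: $U_{ad}$ is the set of $U=[b_1,\dots,b_N]^T\in(L^2[0,l])^N$ with $0\le b_i\le 1$ and $b_i$ equicontinuous on $[0,l]$; that is, a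 modulus of continuity $\omega:[0,\infty)\to[0,\infty)$ with $\lim_{r\to0^+}\omega(r)=\omega(0)=0$ is fixed and $$U_{ad}=\{U:\ 0\le b_i\le 1,\ |b_i(x)-b_i(y)|\le\omega(|x-y|)\ \text{for all } x,y\in[0,l],\ i=1,\dots,N\}.$$ Weak solution: write $F_i=\big[\int_0^l b_i(x)p_1(x,t_i)\,dx,\ -b_i(x)p_1(x,t_i)\big]^T$. A function $P=[p_0,p_1]^T\in PWC_l([0,T];X)$ is a weak solution if $(\dot P(t),Q)=(\mathcal{A}P(t),Q)+\sum_{i=1}^N\delta(t-t_i)(F_i,Q)$ for all test elements $Q\in X^*$, and $P(0)=P_0$. The equation is understood in integrated form: for all $Q\in D(\mathcal{A}^* )$ and all $\psi\in C^1[0,T]$ with $\psi(T)=0$, $$-\int_0^T(P(t),Q)\dot\psi(t)\,dt=\int_0^T(P(t),\mathcal{A}^*Q)\psi(t)\,dt+\sum_{i=1}^N(F_i,Q)\psi(t_i)+(P_0,Q)\psi(0).$$ *)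

theory Defs
  imports "HOL-Analysis.Analysis"
begin

text \<open>
  Elements of \<open>X = R \<times> L\<^sup>1[0,l]\<close> and of its dual \<open>R \<times> L\<^sup>\<infinity>[0,l]\<close> are represented by pairs of a real and a
  function; the function stands for its almost-everywhere class, and only its values on \<open>[0,l]\<close> matter.
\<close>

type_synonym state = "real \<times> (real \<Rightarrow> real)"

definition X_space :: "real \<Rightarrow> state set" where
  "X_space l = {P. integrable (lebesgue_on {0..l}) (snd P)}"

definition X_norm :: "real \<Rightarrow> state \<Rightarrow> real" where
  "X_norm l P = \<bar>fst P\<bar> + (LINT x|lebesgue_on {0..l}. \<bar>snd P x\<bar>)"

definition X_diff :: "state \<Rightarrow> state \<Rightarrow> state" where
  "X_diff P R = (fst P - fst R, \<lambda>x. snd P x - snd R x)"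

definition X_eq :: "real \<Rightarrow> state \<Rightarrow> state \<Rightarrow> bool" where
  "X_eq l P R \<longleftrightarrow> fst P = fst R \<and> (AE x in lebesgue_on {0..l}. snd P x = snd R x)"

definition X_nonneg :: "real \<Rightarrow> state \<Rightarrow> bool" where
  "X_nonneg l P \<longleftrightarrow> 0 \<le> fst P \<and> (AE x in lebesgue_on {0..l}. 0 \<le> snd P x)"

definition X_dual :: "real \<Rightarrow> state set" where
  "X_dual l = {Q. snd Q \<in> borel_measurable (lebesgue_on {0..l}) \<and>
                  (\<exists>C. AE x in lebesgue_on {0..l}. \<bar>snd Q x\<bar> \<le> C)}"

definition pairing :: "real \<Rightarrow> state \<Rightarrow> state \<Rightarrow> real" where
  "pairing l P Q = fst P * fst Q + (LINT x|lebesgue_on {0..l}. snd P x * snd Q x)"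

text \<open>
  \<open>f\<close> lies in \<open>W\<^sup>1\<^sup>,\<^sup>1(0,l)\<close> with derivative \<open>g\<close>, and \<open>f\<close> is its absolutely continuous representative,
  so that \<open>f 0\<close> is the boundary value of the class.
\<close>

definition has_L1_deriv :: "real \<Rightarrow> (real \<Rightarrow> real) \<Rightarrow> (real \<Rightarrow> real) \<Rightarrow> bool" where
  "has_L1_deriv l f g \<longleftrightarrow>
     integrable (lebesgue_on {0..l}) g \<and>
     (\<forall>x\<in>{0..l}. f x = f 0 + (LINT y|lebesgue_on {0..x}. g y))"

text \<open>The derivative is determined up to a null set only; any representative may be chosen.\<close>

definition L1_deriv :: "real \<Rightarrow> (real \<Rightarrow> real) \<Rightarrow> real \<Rightarrow> real" where
  "L1_deriv l f = (SOME g. has_L1_deriv l f g)"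

definition repair_rate :: "real \<Rightarrow> (real \<Rightarrow> real) \<Rightarrow> bool" where
  "repair_rate l \<mu> \<longleftrightarrow>
     \<mu> \<in> borel_measurable (lebesgue_on {0..l}) \<and>
     (\<forall>x\<in>{0..l}. 0 \<le> \<mu> x) \<and>
     (\<forall>l'. 0 \<le> l' \<and> l' < l \<longrightarrow> (\<integral>\<^sup>+x. ennreal (\<mu> x) \<partial>lebesgue_on {0..l'}) < \<infinity>) \<and>
     (\<integral>\<^sup>+x. ennreal (\<mu> x) \<partial>lebesgue_on {0..l}) = \<infinity>"

definition sys_op :: "real \<Rightarrow> real \<Rightarrow> (real \<Rightarrow> real) \<Rightarrow> state \<Rightarrow> state" where
  "sys_op l lam1 \<mu> P =
     (- lam1 * fst P + (LINT x|lebesgue_on {0..l}. \<mu> x * snd P x),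
      \<lambda>x. - (L1_deriv l (snd P) x + \<mu> x * snd P x))"

definition sys_dom :: "real \<Rightarrow> real \<Rightarrow> (real \<Rightarrow> real) \<Rightarrow> state set" where
  "sys_dom l lam1 \<mu> =
     {P \<in> X_space l. (\<exists>g. has_L1_deriv l (snd P) g) \<and>
        integrable (lebesgue_on {0..l}) (\<lambda>x. \<mu> x * snd P x) \<and>
        snd P 0 = lam1 * fst P}"

definition adjoint_rel ::
  "real \<Rightarrow> (state \<Rightarrow> state) \<Rightarrow> state set \<Rightarrow> state \<Rightarrow> state \<Rightarrow> bool" where
  "adjoint_rel l A D Q R \<longleftrightarrow>
     Q \<in> X_dual l \<and> R \<in> X_dual l \<and> (\<forall>P\<in>D. pairing l (A P) Q = pairing l P R)"

definition adjoint_dom :: "real \<Rightarrow> (state \<Rightarrow> state) \<Rightarrow> state set \<Rightarrow> state set" where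
  "adjoint_dom l A D = {Q. \<exists>R. adjoint_rel l A D Q R}"

text \<open>For a densely defined operator the value is unique up to a null set.\<close>

definition adjoint_op :: "real \<Rightarrow> (state \<Rightarrow> state) \<Rightarrow> state set \<Rightarrow> state \<Rightarrow> state" where
  "adjoint_op l A D Q = (SOME R. adjoint_rel l A D Q R)"

definition X_tendsto :: "real \<Rightarrow> (real \<Rightarrow> state) \<Rightarrow> state \<Rightarrow> real filter \<Rightarrow> bool" where
  "X_tendsto l P R F \<longleftrightarrow> ((\<lambda>s. X_norm l (X_diff (P s) R)) \<longlongrightarrow> 0) F"

definition PWC_left :: "real \<Rightarrow> real \<Rightarrow> (real \<Rightarrow> state) set" where
  "PWC_left l T =
     {P. (\<forall>t\<in>{0..T}. P t \<in> X_space l) \<and>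
         (\<forall>t\<in>{0<..T}. X_tendsto l P (P t) (at_left t)) \<and>
         (\<forall>t\<in>{0..<T}. \<exists>R\<in>X_space l. X_tendsto l P R (at_right t)) \<and>
         finite {t\<in>{0..<T}. \<not> X_tendsto l P (P t) (at_right t)}}"

definition modulus_of_continuity :: "(real \<Rightarrow> real) \<Rightarrow> bool" where
  "modulus_of_continuity \<omega> \<longleftrightarrow>
     (\<forall>r\<ge>0. 0 \<le> \<omega> r) \<and> \<omega> 0 = 0 \<and> (\<omega> \<longlongrightarrow> 0) (at_right 0)"

text \<open>
  A control \<open>[b\<^sub>1, \<dots>, b\<^sub>N]\<close> is a function \<open>b\<close> of which only \<open>b i\<close>, \<open>1 \<le> i \<le> N\<close>, on \<open>[0,l]\<close> matter.
  Membership in \<open>L\<^sup>2[0,l]\<close> follows from boundedness and continuity.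
\<close>

definition U_ad :: "real \<Rightarrow> nat \<Rightarrow> (real \<Rightarrow> real) \<Rightarrow> (nat \<Rightarrow> real \<Rightarrow> real) set" where
  "U_ad l N \<omega> =
     {b. \<forall>i\<in>{1..N}. (\<forall>x\<in>{0..l}. 0 \<le> b i x \<and> b i x \<le> 1) \<and>
                    (\<forall>x\<in>{0..l}. \<forall>y\<in>{0..l}. \<bar>b i x - b i y\<bar> \<le> \<omega> \<bar>x - y\<bar>)}"

definition impulse :: "real \<Rightarrow> (real \<Rightarrow> real) \<Rightarrow> state \<Rightarrow> state" where
  "impulse l c P = (LINT x|lebesgue_on {0..l}. c x * snd P x, \<lambda>x. - (c x * snd P x))"

text \<open>
  The initial condition is a separate conjunct: if \<open>\<tau> 1 = 0\<close>, the integrated equation only fixes the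
  right-hand limit at \<open>0\<close>, i.e. the state after the impulse.
\<close>

definition weak_solution ::
  "real \<Rightarrow> real \<Rightarrow> real \<Rightarrow> (real \<Rightarrow> real) \<Rightarrow> nat \<Rightarrow> (nat \<Rightarrow> real) \<Rightarrow> state \<Rightarrow>
   (nat \<Rightarrow> real \<Rightarrow> real) \<Rightarrow> (real \<Rightarrow> state) \<Rightarrow> bool" where
  "weak_solution l T lam1 \<mu> N \<tau> P0 b P \<longleftrightarrow>
     P \<in> PWC_left l T \<and> X_eq l (P 0) P0 \<and>
     (\<forall>Q \<in> adjoint_dom l (sys_op l lam1 \<mu>) (sys_dom l lam1 \<mu>). \<forall>\<psi> \<psi>'.
        (\<forall>t\<in>{0..T}. (\<psi> has_real_derivative \<psi>' t) (at t within {0..T})) \<and>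
        continuous_on {0..T} \<psi>' \<and> \<psi> T = 0 \<longrightarrow>
        - (LINT t|lebesgue_on {0..T}. pairing l (P t) Q * \<psi>' t) =
          (LINT t|lebesgue_on {0..T}.
             pairing l (P t) (adjoint_op l (sys_op l lam1 \<mu>) (sys_dom l lam1 \<mu>) Q) * \<psi> t)
          + (\<Sum>i=1..N. pairing l (impulse l (b i) (P (\<tau> i))) Q * \<psi> (\<tau> i))
          + pairing l P0 Q * \<psi> 0)"

definition cost ::
  "real \<Rightarrow> real \<Rightarrow> nat \<Rightarrow> (nat \<Rightarrow> real) \<Rightarrow> (nat \<Rightarrow> real \<Rightarrow> real) \<Rightarrow> (real \<Rightarrow> state) \<Rightarrow> real" where
  "cost l T N \<beta> b P =
     1/2 * (LINT t|lebesgue_on {0..T}. \<bar>LINT x|lebesgue_on {0..l}. snd (P t) x\<bar>\<^sup>2)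
     + 1/2 * (\<Sum>i=1..N. \<beta> i * (LINT x|lebesgue_on {0..l}. \<bar>b i x\<bar>\<^sup>2))
     + 1/2 * \<bar>LINT x|lebesgue_on {0..l}. snd (P T) x\<bar>\<^sup>2"

text \<open>
  The objective as a function of the control alone. The weak solution is unique only up to null sets
  in \<open>x\<close>, so the description is of the common cost of all its representatives.
\<close>

definition J ::
  "real \<Rightarrow> real \<Rightarrow> real \<Rightarrow> (real \<Rightarrow> real) \<Rightarrow> nat \<Rightarrow> (nat \<Rightarrow> real) \<Rightarrow> (nat \<Rightarrow> real) \<Rightarrow> state \<Rightarrow>
   (nat \<Rightarrow> real \<Rightarrow> real) \<Rightarrow> real" where
  "J l T lam1 \<mu> N \<tau> \<beta> P0 b =
     (THE c. \<exists>P. weak_solution l T lam1 \<mu> N \<tau> P0 b P \<and> c = cost l T N \<beta> b P)"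

end

theory Submission
  imports Defs "HOL-Complex_Analysis.Great_Picard"
begin

text \<open>
  Why an optimal control exists.  The controls form a set that is bounded and equicontinuous, hence, by
  Arzela--Ascoli, sequentially compact for uniform convergence on \<open>[0,l]\<close> (\<open>U_ad_compact\<close>).  So it is enough
  that every control has exactly one weak solution, up to null sets in \<open>x\<close>, and that its cost depends
  continuously on the control; a minimizing sequence then has a limit that attains the infimum.

  Let \<open>F(x) = exp (- \<integral>\<^sub>0\<^sup>x \<mu>)\<close> be the probability that a repair lasts longer than \<open>x\<close>; it vanishes at \<open>l\<close> because
  \<open>\<mu>\<close> is not integrable.  Along characteristics \<open>p\<^sub>1/F\<close> is merely transported, so without impulses
  \<open>p\<^sub>1(x,t) = F(x) h(x - t)\<close>, where \<open>h\<close> is \<open>p\<^sub>1(\<cdot>,0)/F\<close> on \<open>[0,l)\<close> and \<open>h(-s) = \<lambda>\<^sub>1 p\<^sub>0(s)\<close> records the boundary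
  condition.  Conservation of mass turns the equation of \<open>p\<^sub>0\<close>, whose source \<open>\<integral> \<mu> p\<^sub>1\<close> is singular, into the
  Volterra equation \<open>p\<^sub>0 = g - \<lambda>\<^sub>1 F * p\<^sub>0\<close> with continuous bounded data; it is solved by a weighted contraction
  (\<open>volterra_solution_exists\<close>).  The resulting semiflow is Lipschitz in the state (\<open>flow_lipschitz\<close>) and
  continuous in time (\<open>flow_continuous\<close>), and its time integral lies in the domain of the system operator,
  which maps it to the increment of the semiflow.  Pairing with an arbitrary element of the domain of the
  adjoint gives the weak equation (\<open>flow_weak\<close>) although that domain is not known explicitly.

  Restarting the semiflow after each impulse yields a trajectory (\<open>traj\<close>).  For a piecewise continuous
  function the weak equation is equivalent to an equation integrated in time, in which an impulse is a jump
  (\<open>mild_weak\<close>, \<open>weak_imp_mild\<close>), so the trajectory is a weak solution (\<open>traj_weak_solution\<close>).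

  Uniqueness is by induction on the number of impulses and reduces to the difference \<open>W = (w\<^sub>0, w\<^sub>1)\<close> of two
  solutions on an interval where the impulses no longer contribute.  Few explicit test elements suffice:
  \<open>(1,1)\<close>, with adjoint value \<open>0\<close>, expresses conservation of mass, and \<open>(0, (c - x)\<^sub>+\<^sup>k / F)\<close> for \<open>k = 1, 2\<close> give
  a first order equation in time and \<open>c\<close> for the repeated integrals of \<open>w\<^sub>1/F\<close>.  Solving it along
  characteristics bounds the mass of \<open>w\<^sub>1\<close> at time \<open>s\<close> by \<open>\<lambda>\<^sub>1 \<integral>\<^sub>0\<^sup>s |w\<^sub>0|\<close>; as \<open>w\<^sub>0\<close> is minus that mass, Gronwall's
  inequality forces \<open>W = 0\<close> (\<open>impulse_free_zero\<close>).

  Finally the Lipschitz bounds for semiflow and impulses show by induction on the impulses that trajectory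
  and cost are Lipschitz in the control for the supremum norm (\<open>traj_lipschitz\<close>, \<open>cost_lipschitz\<close>).
\<close>

section \<open>Absolutely continuous functions\<close>

lemma finite_measure_lebesgue_on_Icc: "finite_measure (lebesgue_on {a..b::real})"
  by (rule finite_measure_lebesgue_on) simp

lemma integral_lebesgue_on_restrict:
  fixes f :: "real \<Rightarrow> real"
  assumes "A \<subseteq> B" "A \<in> sets lebesgue" "B \<in> sets lebesgue"
  shows "(LINT x|lebesgue_on B. indicator A x * f x) = (LINT x|lebesgue_on A. f x)"
proof -
  have "(\<lambda>x. indicator A x * f x) = (\<lambda>x. if x \<in> A then f x else 0)"
    by (auto simp: indicator_def)
  then show ?thesis
    using integral_restrict[OF assms, of f] by simp
qed

text \<open>
  By Lebesgue's differentiation theorem \<open>g\<close> is almost everywhere the limit of its means over \<open>[x, x+h]\<close>, and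
  these means vanish.
\<close>
lemma AE_zero_if_indefinite_integral_zero:
  fixes g :: "real \<Rightarrow> real"
  assumes g: "integrable (lebesgue_on {0..l}) g"
    and z: "\<And>x. x \<in> {0..l} \<Longrightarrow> (LINT y|lebesgue_on {0..x}. g y) = 0"
  shows "AE x in lebesgue_on {0..l}. g x = 0"
proof -
  define f where "f = (\<lambda>x. if x \<in> {0..l} then g x else 0)"
  have gi: "g integrable_on {0..l}" using g by (simp add: integrable_on_lebesgue_on)
  have fi: "f integrable_on UNIV" unfolding f_def using gi integrable_restrict_UNIV by blast
  have "f integrable_on cbox a b" for a b
    using integrable_on_subcbox[OF fi] by simp
  then obtain N where N: "negligible N"
      "\<And>x e. \<lbrakk>x \<notin> N; 0 < e\<rbrakk> \<Longrightarrow> \<exists>d>0. \<forall>h. 0 < h \<and> h < d \<longrightarrow>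
                         norm(integral (cbox x (x + h *\<^sub>R One)) f /\<^sub>R h ^ DIM(real) - f x) < e"
    using integrable_ccontinuous_explicit by blast
  have zz: "integral {0..x} g = 0" if "x \<in> {0..l}" for x
  proof -
    have "integrable (lebesgue_on {0..x}) g"
      by (rule integrable_subinterval[OF g]) (use that in auto)
    then show ?thesis using z[OF that] by (simp add: lebesgue_integral_eq_integral)
  qed
  have "g x = 0" if x: "x \<notin> N" "0 < x" "x < l" for x
  proof (rule ccontr)
    assume "g x \<noteq> 0"
    then have "0 < \<bar>g x\<bar>" by simp
    then obtain d where d: "d>0" "\<And>h. 0 < h \<and> h < d \<Longrightarrow>
                         norm(integral (cbox x (x + h *\<^sub>R One)) f /\<^sub>R h ^ DIM(real) - f x) < \<bar>g x\<bar>"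
      using N(2)[OF x(1)] by metis
    \<comment> \<open>small enough for the differentiation theorem, and such that \<open>[x, x+h]\<close> stays in \<open>[0,l]\<close>\<close>
    define h where "h = min (d/2) (l - x)"
    have h: "0 < h" "h < d" "x + h \<le> l" using d x by (auto simp: h_def)
    have "integral {x..x+h} g = 0"
    proof -
      have "integral {0..x} g + integral {x..x+h} g = integral {0..x+h} g"
        by (rule Henstock_Kurzweil_Integration.integral_combine)
           (use x h in \<open>auto intro!: integrable_on_subinterval[OF gi]\<close>)
      then show ?thesis using zz[of x] zz[of "x+h"] x h by simp
    qed
    moreover have "integral {x..x+h} f = integral {x..x+h} g"
      by (rule integral_cong) (use x h in \<open>auto simp: f_def\<close>)
    ultimately have "norm (0 - f x) < \<bar>g x\<bar>"
      using d(2)[of h] h by simp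
    then show False using x by (simp add: f_def)
  qed
  then have sub: "{x\<in>{0..l}. g x \<noteq> 0} \<subseteq> N \<union> {0,l}" by fastforce
  have "negligible (N \<union> {0,l})" using N(1) by simp
  then have "negligible {x\<in>{0..l}. g x \<noteq> 0}" using sub negligible_subset by blast
  then have "{x\<in>{0..l}. g x \<noteq> 0} \<in> null_sets lebesgue" by (simp add: negligible_iff_null_sets)
  then have "AE x in lebesgue. x \<in> {0..l} \<longrightarrow> g x = 0"
    by (rule AE_I') auto
  then show ?thesis by (simp add: AE_restrict_space_iff)
qed

text \<open>
  Fubini on the square \<open>[0,c]\<^sup>2\<close>, cut along its diagonal.  This is integration by parts for indefinite
  integrals and yields the product rule below.
\<close>
lemma integral_product_triangle:
  fixes u v :: "real \<Rightarrow> real"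
  assumes u: "integrable (lebesgue_on {0..c}) u" and v: "integrable (lebesgue_on {0..c}) v"
  shows "integrable (lebesgue_on {0..c}) (\<lambda>s. u s * (LINT r|lebesgue_on {0..s}. v r))"
    and "(LINT s|lebesgue_on {0..c}. u s) * (LINT s|lebesgue_on {0..c}. v s) =
     (LINT s|lebesgue_on {0..c}. u s * (LINT r|lebesgue_on {0..s}. v r)) +
     (LINT s|lebesgue_on {0..c}. v s * (LINT r|lebesgue_on {0..s}. u r))"
proof -
  let ?M = "lebesgue_on {0..c}"
  interpret M: finite_measure ?M by (rule finite_measure_lebesgue_on_Icc)
  interpret P: pair_sigma_finite ?M ?M ..
  have idm[measurable]: "(\<lambda>x. x) \<in> borel_measurable ?M"
    using id_borel_measurable_lebesgue_on by (simp add: id_def)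
  have [measurable]: "u \<in> borel_measurable ?M" "v \<in> borel_measurable ?M"
    using u v by auto
  have tri: "integrable (?M \<Otimes>\<^sub>M ?M) (\<lambda>(s,r). f s * (indicator {..s} r * g r))"
    and tri': "integrable (?M \<Otimes>\<^sub>M ?M) (\<lambda>(s,r). f s * (indicator {s<..} r * g r))"
    if fi: "integrable ?M f" and gi: "integrable ?M g" for f g :: "real \<Rightarrow> real"
  proof -
    have [measurable]: "f \<in> borel_measurable ?M" "g \<in> borel_measurable ?M" using fi gi by auto
    have base: "integrable (?M \<Otimes>\<^sub>M ?M) (\<lambda>x. f (fst x) * g (snd x))"
    proof (rule P.Fubini_integrable)
      show "integrable ?M (\<lambda>x. \<integral>y. norm (f (fst (x, y)) * g (snd (x, y))) \<partial>?M)"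
        using fi by (simp add: abs_mult)
    qed (use gi in auto)
    have m1: "(\<lambda>x. indicator {..fst x} (snd x) :: real) = (\<lambda>x. if snd x \<le> fst x then 1 else 0)"
      by (auto simp: indicator_def)
    have m2: "(\<lambda>x. indicator {fst x<..} (snd x) :: real) = (\<lambda>x. if fst x < snd x then 1 else 0)"
      by (auto simp: indicator_def)
    have i1: "(\<lambda>x. indicator {..fst x} (snd x) :: real) \<in> borel_measurable (?M \<Otimes>\<^sub>M ?M)"
      unfolding m1 by measurable
    have i2: "(\<lambda>x. indicator {fst x<..} (snd x) :: real) \<in> borel_measurable (?M \<Otimes>\<^sub>M ?M)"
      unfolding m2 by measurable
    have "integrable (?M \<Otimes>\<^sub>M ?M) (\<lambda>x. f (fst x) * (indicator {..fst x} (snd x) * g (snd x)))"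
      by (rule Bochner_Integration.integrable_bound[OF base])
         (use i1 in \<open>auto simp: indicator_def\<close>)
    then show "integrable (?M \<Otimes>\<^sub>M ?M) (\<lambda>(s,r). f s * (indicator {..s} r * g r))"
      unfolding case_prod_beta .
    have "integrable (?M \<Otimes>\<^sub>M ?M) (\<lambda>x. f (fst x) * (indicator {fst x<..} (snd x) * g (snd x)))"
      by (rule Bochner_Integration.integrable_bound[OF base])
         (use i2 in \<open>auto simp: indicator_def\<close>)
    then show "integrable (?M \<Otimes>\<^sub>M ?M) (\<lambda>(s,r). f s * (indicator {s<..} r * g r))"
      unfolding case_prod_beta .
  qed
  have inner: "(LINT r|?M. indicator {..s} r * g r) = (LINT r|lebesgue_on {0..s}. g r)"
    if "s \<in> {0..c}" for s and g :: "real \<Rightarrow> real"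
  proof -
    have "(LINT r|?M. indicator {..s} r * g r) = (LINT r|?M. indicator {0..s} r * g r)"
      by (rule Bochner_Integration.integral_cong) (auto simp: indicator_def)
    then show ?thesis using that by (subst (asm) integral_lebesgue_on_restrict) auto
  qed
  have inner': "(LINT r|?M. indicator {..<s} r * g r) = (LINT r|lebesgue_on {0..s}. g r)"
    if "s \<in> {0..c}" and gi: "integrable ?M g" for s and g :: "real \<Rightarrow> real"
  proof -
    have [measurable]: "g \<in> borel_measurable ?M" using gi by auto
    have "AE r in lebesgue. r \<noteq> s"
      by (rule AE_completion[OF AE_lborel_singleton])
    then have "AE r in lebesgue. r \<in> {0..c} \<longrightarrow> r \<noteq> s"
      by eventually_elim simp
    then have ne: "AE r in ?M. r \<noteq> s"
      by (subst AE_restrict_space_iff) simp_all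
    have "(LINT r|?M. indicator {..<s} r * g r) = (LINT r|?M. indicator {..s} r * g r)"
      by (rule Bochner_Integration.integral_cong_AE) (use ne in \<open>auto simp: indicator_def\<close>)
    then show ?thesis using inner[OF that(1)] by simp
  qed
  have "integrable ?M (\<lambda>s. LINT r|?M. u s * (indicator {..s} r * v r))"
    by (rule P.integrable_fst[OF tri[OF u v]])
  then show "integrable ?M (\<lambda>s. u s * (LINT r|lebesgue_on {0..s}. v r))"
    by (rule Bochner_Integration.integrable_cong[THEN iffD1, rotated -1]) (auto simp: inner)
  have split: "v r = indicator {..s} r * v r + indicator {s<..} r * v r" for r s
    by (auto simp: indicator_def)
  have vi: "integrable ?M (\<lambda>r. indicator A r * v r)" if "A \<in> sets borel" for A
  proof (rule Bochner_Integration.integrable_bound[OF v])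
    have "A \<inter> {0..c} \<in> sets ?M" using that by (auto simp: sets_restrict_space)
    then have "A \<inter> space ?M \<in> sets ?M" by simp
    then have "(indicator A :: real \<Rightarrow> real) \<in> borel_measurable ?M"
      by (subst borel_measurable_indicator_iff) (simp add: Int_commute)
    then show "(\<lambda>r. indicator A r * v r) \<in> borel_measurable ?M" by auto
  qed (auto simp: indicator_def)
  have "(LINT s|?M. u s) * (LINT r|?M. v r) = (LINT s|?M. u s * (LINT r|?M. v r))" by simp
  also have "\<dots> = (LINT s|?M. (LINT r|?M. u s * (indicator {..s} r * v r)) + (LINT r|?M. u s * (indicator {s<..} r * v r)))"
  proof (rule Bochner_Integration.integral_cong[OF refl])
    fix s
    have "(LINT r|?M. v r) = (LINT r|?M. indicator {..s} r * v r) + (LINT r|?M. indicator {s<..} r * v r)"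
      by (subst split[of _ s], rule Bochner_Integration.integral_add) (auto intro!: vi)
    then show "u s * (LINT r|?M. v r) = (LINT r|?M. u s * (indicator {..s} r * v r)) + (LINT r|?M. u s * (indicator {s<..} r * v r))"
      by (simp add: distrib_left)
  qed
  also have "\<dots> = (LINT s|?M. (LINT r|?M. u s * (indicator {..s} r * v r))) + (LINT s|?M. (LINT r|?M. u s * (indicator {s<..} r * v r)))"
    by (rule Bochner_Integration.integral_add[OF P.integrable_fst[OF tri[OF u v]] P.integrable_fst[OF tri'[OF u v]]])
  also have "(LINT s|?M. (LINT r|?M. u s * (indicator {s<..} r * v r))) = (LINT r|?M. (LINT s|?M. u s * (indicator {s<..} r * v r)))"
    by (rule P.Fubini_integral[OF tri'[OF u v], symmetric])
  also have "\<dots> = (LINT r|?M. v r * (LINT s|lebesgue_on {0..r}. u s))"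
  proof (rule Bochner_Integration.integral_cong[OF refl])
    fix r assume "r \<in> space ?M"
    then have r: "r \<in> {0..c}" by simp
    have "(LINT s|?M. u s * (indicator {s<..} r * v r)) = (LINT s|?M. (indicator {..<r} s * u s) * v r)"
      by (rule Bochner_Integration.integral_cong) (auto simp: indicator_def)
    also have "\<dots> = (LINT s|?M. (indicator {..<r} s * u s)) * v r" by simp
    finally show "(LINT s|?M. u s * (indicator {s<..} r * v r)) = v r * (LINT s|lebesgue_on {0..r}. u s)"
      using inner'[OF r u] by (simp add: mult.commute)
  qed
  also have "(LINT s|?M. (LINT r|?M. u s * (indicator {..s} r * v r))) = (LINT s|?M. u s * (LINT r|lebesgue_on {0..s}. v r))"
    by (rule Bochner_Integration.integral_cong) (auto simp: inner)
  finally show "(LINT s|?M. u s) * (LINT s|?M. v s) =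
     (LINT s|?M. u s * (LINT r|lebesgue_on {0..s}. v r)) +
     (LINT s|?M. v s * (LINT r|lebesgue_on {0..s}. u r))" .
qed

lemma has_L1_derivD:
  assumes "has_L1_deriv l f g"
  shows "integrable (lebesgue_on {0..l}) g"
    and "\<And>x. x \<in> {0..l} \<Longrightarrow> f x = f 0 + (LINT y|lebesgue_on {0..x}. g y)"
  using assms unfolding has_L1_deriv_def by blast+

lemma has_L1_deriv_subinterval:
  assumes "has_L1_deriv l f g" "c \<le> l"
  shows "has_L1_deriv c f g"
  unfolding has_L1_deriv_def
proof (intro conjI ballI)
  show "integrable (lebesgue_on {0..c}) g"
    by (rule integrable_subinterval[OF has_L1_derivD(1)[OF assms(1)]]) (use assms(2) in auto)
  fix x assume "x \<in> {0..c}"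
  then show "f x = f 0 + (LINT y|lebesgue_on {0..x}. g y)"
    by (intro has_L1_derivD(2)[OF assms(1)]) (use assms(2) in auto)
qed

lemma has_L1_deriv_cong:
  assumes "has_L1_deriv l f g" "\<And>x. x \<in> {0..l} \<Longrightarrow> f x = f' x" "\<And>x. x \<in> {0..l} \<Longrightarrow> g x = g' x"
  shows "has_L1_deriv l f' g'"
  unfolding has_L1_deriv_def
proof (intro conjI ballI)
  show "integrable (lebesgue_on {0..l}) g'"
    by (rule Bochner_Integration.integrable_cong[THEN iffD1, OF refl _ has_L1_derivD(1)[OF assms(1)]]) (use assms in auto)
  fix x assume x: "x \<in> {0..l}"
  have "(LINT y|lebesgue_on {0..x}. g y) = (LINT y|lebesgue_on {0..x}. g' y)"
    by (rule Bochner_Integration.integral_cong) (use assms x in auto)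
  moreover have "f x = f' x" "f 0 = f' 0" using assms(2) x by auto
  ultimately show "f' x = f' 0 + (LINT y|lebesgue_on {0..x}. g' y)"
    using has_L1_derivD(2)[OF assms(1) x] by simp
qed

lemma has_L1_deriv_continuous_on:
  assumes "has_L1_deriv l f g" shows "continuous_on {0..l} f"
proof -
  have "continuous_on {0..l} (\<lambda>x. f 0 + (LINT y|lebesgue_on {0..x}. g y))"
    by (intro continuous_intros indefinite_integral_continuous_real has_L1_derivD[OF assms])
  then show ?thesis
    by (rule continuous_on_cong[THEN iffD2, OF refl, rotated]) (rule has_L1_derivD(2)[OF assms])
qed

lemma has_L1_deriv_const: "has_L1_deriv l (\<lambda>x. c) (\<lambda>x. 0)"
  by (simp add: has_L1_deriv_def)

lemma integral_lebesgue_on_singleton [simp]: "(LINT y|lebesgue_on {a::real}. g y :: real) = 0"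
  by (rule integral_eq_zero_null_sets) (simp add: negligible_iff_null_sets[symmetric])

lemma has_L1_deriv_indefinite:
  assumes "integrable (lebesgue_on {0..l}) g"
  shows "has_L1_deriv l (\<lambda>x. a + (LINT y|lebesgue_on {0..x}. g y)) g"
  using assms by (auto simp: has_L1_deriv_def)

lemma has_L1_deriv_add:
  assumes "has_L1_deriv l f f'" "has_L1_deriv l g g'"
  shows "has_L1_deriv l (\<lambda>x. f x + g x) (\<lambda>x. f' x + g' x)"
  unfolding has_L1_deriv_def
proof (intro conjI ballI)
  show "integrable (lebesgue_on {0..l}) (\<lambda>x. f' x + g' x)"
    using assms has_L1_derivD(1) by auto
  fix x assume x: "x \<in> {0..l}"
  have "integrable (lebesgue_on {0..x}) f'" "integrable (lebesgue_on {0..x}) g'"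
    using integrable_subinterval[OF has_L1_derivD(1)[OF assms(1)], of 0 x]
      integrable_subinterval[OF has_L1_derivD(1)[OF assms(2)], of 0 x] x by auto
  then show "f x + g x = f 0 + g 0 + (LINT y|lebesgue_on {0..x}. f' y + g' y)"
    using has_L1_derivD(2)[OF assms(1) x] has_L1_derivD(2)[OF assms(2) x] by simp
qed

lemma has_L1_deriv_cmult:
  assumes "has_L1_deriv l f f'"
  shows "has_L1_deriv l (\<lambda>x. c * f x) (\<lambda>x. c * f' x)"
  unfolding has_L1_deriv_def
proof (intro conjI ballI)
  show "integrable (lebesgue_on {0..l}) (\<lambda>x. c * f' x)"
    using has_L1_derivD(1)[OF assms] by simp
  fix x assume "x \<in> {0..l}"
  then have "f x = f 0 + (LINT y|lebesgue_on {0..x}. f' y)" by (rule has_L1_derivD(2)[OF assms])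
  then show "c * f x = c * f 0 + (LINT y|lebesgue_on {0..x}. c * f' y)"
    by (simp add: distrib_left)
qed

lemma has_L1_deriv_mult:
  assumes f: "has_L1_deriv l f f'" and g: "has_L1_deriv l g g'"
  shows "has_L1_deriv l (\<lambda>x. f x * g x) (\<lambda>x. f' x * g x + f x * g' x)"
  unfolding has_L1_deriv_def
proof (intro conjI ballI)
  have A: "integrable (lebesgue_on {0..x}) (\<lambda>y. f' y * g y)"
          "integrable (lebesgue_on {0..x}) (\<lambda>y. f y * g' y)"
          "f x * g x = f 0 * g 0 + (LINT y|lebesgue_on {0..x}. f' y * g y + f y * g' y)"
     if x: "x \<in> {0..l}" for x
  proof -
    let ?M = "lebesgue_on {0..x}"
    have fi: "integrable ?M f'" and gi: "integrable ?M g'"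
      using integrable_subinterval[OF has_L1_derivD(1)[OF f], of 0 x]
      integrable_subinterval[OF has_L1_derivD(1)[OF g], of 0 x] x by auto
    let ?F = "\<lambda>s. LINT r|lebesgue_on {0..s}. f' r" and ?G = "\<lambda>s. LINT r|lebesgue_on {0..s}. g' r"
    note tf = integral_product_triangle[OF fi gi] and tg = integral_product_triangle(1)[OF gi fi]
    have 1: "f' y * g y = f' y * g 0 + f' y * ?G y" if "y \<in> {0..x}" for y
    proof -
      have "g y = g 0 + ?G y" by (rule has_L1_derivD(2)[OF g]) (use that x in auto)
      then show ?thesis by (metis distrib_left)
    qed
    have 2: "f y * g' y = f 0 * g' y + g' y * ?F y" if "y \<in> {0..x}" for y
    proof -
      have "f y = f 0 + ?F y" by (rule has_L1_derivD(2)[OF f]) (use that x in auto)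
      then show ?thesis by (metis distrib_right mult.commute)
    qed
    have i1: "integrable ?M (\<lambda>y. f' y * g 0 + f' y * ?G y)" using fi tf(1) by auto
    have i2: "integrable ?M (\<lambda>y. f 0 * g' y + g' y * ?F y)" using gi tg by auto
    show a1: "integrable ?M (\<lambda>y. f' y * g y)"
      by (rule Bochner_Integration.integrable_cong[THEN iffD2, OF refl _ i1]) (use 1 in auto)
    show a2: "integrable ?M (\<lambda>y. f y * g' y)"
      by (rule Bochner_Integration.integrable_cong[THEN iffD2, OF refl _ i2]) (use 2 in auto)
    have "(LINT y|?M. f' y * g y) = (LINT y|?M. f' y * g 0 + f' y * ?G y)"
      by (rule Bochner_Integration.integral_cong) (use 1 in auto)
    also have "\<dots> = ?F x * g 0 + (LINT y|?M. f' y * ?G y)"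
      using fi tf(1) by simp
    finally have e1: "(LINT y|?M. f' y * g y) = ?F x * g 0 + (LINT y|?M. f' y * ?G y)" .
    have "(LINT y|?M. f y * g' y) = (LINT y|?M. f 0 * g' y + g' y * ?F y)"
      by (rule Bochner_Integration.integral_cong) (use 2 in auto)
    also have "\<dots> = f 0 * ?G x + (LINT y|?M. g' y * ?F y)"
      using gi tg by simp
    finally have e2: "(LINT y|?M. f y * g' y) = f 0 * ?G x + (LINT y|?M. g' y * ?F y)" .
    have "f x * g x = (f 0 + ?F x) * (g 0 + ?G x)"
      using has_L1_derivD(2)[OF f x] has_L1_derivD(2)[OF g x] by (rule arg_cong2[where f="(*)"])
    also have "\<dots> = f 0 * g 0 + (?F x * g 0 + f 0 * ?G x + ?F x * ?G x)"
      by (simp add: algebra_simps)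
    also have "?F x * ?G x = (LINT y|?M. f' y * ?G y) + (LINT y|?M. g' y * ?F y)"
      using tf(2) by simp
    finally show "f x * g x = f 0 * g 0 + (LINT y|?M. f' y * g y + f y * g' y)"
      using a1 a2 e1 e2 by simp
  qed
  show "integrable (lebesgue_on {0..l}) (\<lambda>x. f' x * g x + f x * g' x)"
  proof (cases "0 \<le> l")
    case True
    then show ?thesis using A(1)[of l] A(2)[of l] by simp
  next
    case False
    then show ?thesis by simp
  qed
  fix x assume "x \<in> {0..l}"
  then show "f x * g x = f 0 * g 0 + (LINT y|lebesgue_on {0..x}. f' y * g y + f y * g' y)"
    by (rule A(3))
qed

lemma has_L1_deriv_power:
  assumes "has_L1_deriv l f g"
  shows "has_L1_deriv l (\<lambda>x. f x ^ Suc n) (\<lambda>x. real (Suc n) * f x ^ n * g x)"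
proof (induction n)
  case 0
  then show ?case using assms by simp
next
  case (Suc n)
  show ?case
    by (rule has_L1_deriv_cong[OF has_L1_deriv_mult[OF Suc assms]]) (auto simp: algebra_simps)
qed

lemma continuous_times_integrable:
  fixes f g :: "real \<Rightarrow> real"
  assumes f: "continuous_on {a..b} f" and g: "integrable (lebesgue_on {a..b}) g"
  shows "integrable (lebesgue_on {a..b}) (\<lambda>x. f x * g x)"
proof -
  have "bounded (f ` {a..b})" using compact_continuous_image[OF f] compact_imp_bounded by blast
  then obtain B where "\<forall>y\<in>f ` {a..b}. norm y \<le> B" unfolding bounded_iff by blast
  then have B: "\<And>x. x \<in> {a..b} \<Longrightarrow> \<bar>f x\<bar> \<le> B" by simp
  have "f \<in> borel_measurable (lebesgue_on {a..b})"
    using continuous_imp_integrable_real[OF f] by auto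
  show ?thesis
  proof (rule Bochner_Integration.integrable_bound)
    show "integrable (lebesgue_on {a..b}) (\<lambda>x. \<bar>B\<bar> * \<bar>g x\<bar>)" using g by simp
    show "(\<lambda>x. f x * g x) \<in> borel_measurable (lebesgue_on {a..b})"
      using \<open>f \<in> _\<close> g by auto
    have "\<bar>f x\<bar> * \<bar>g x\<bar> \<le> \<bar>B\<bar> * \<bar>g x\<bar>" if "x \<in> {a..b}" for x
      using B[OF that] by (intro mult_right_mono) auto
    then show "AE x in lebesgue_on {a..b}. norm (f x * g x) \<le> norm (\<bar>B\<bar> * \<bar>g x\<bar>)"
      by (intro AE_I2) (simp add: abs_mult)
  qed
qed

text \<open>
  The partial sums \<open>s\<^sub>n\<close> of the exponential series of \<open>f\<close> satisfy \<open>s\<^sub>n\<^sub>+\<^sub>1' = s\<^sub>n f'\<close> by the product rule, and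
  dominated convergence carries this to the limit.
\<close>
lemma has_L1_deriv_exp:
  assumes fg: "has_L1_deriv l f g"
  shows "has_L1_deriv l (\<lambda>x. exp (f x)) (\<lambda>x. exp (f x) * g x)"
  unfolding has_L1_deriv_def
proof (intro conjI ballI)
  have cf: "continuous_on {0..l} f" by (rule has_L1_deriv_continuous_on[OF fg])
  have gi: "integrable (lebesgue_on {0..l}) g" by (rule has_L1_derivD[OF fg])
  show "integrable (lebesgue_on {0..l}) (\<lambda>x. exp (f x) * g x)"
    by (intro continuous_times_integrable continuous_intros cf gi)
  fix x assume x: "x \<in> {0..l}"
  let ?M = "lebesgue_on {0..x}"
  define s where "s n y = (\<Sum>i<n. f y ^ i /\<^sub>R fact i)" for n y
  have cfx: "continuous_on {0..x} f" by (rule continuous_on_subset[OF cf]) (use x in auto)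
  have gx: "integrable ?M g" by (rule integrable_subinterval[OF gi]) (use x in auto)
  have step: "s (Suc n) x = s (Suc n) 0 + (LINT y|?M. s n y * g y)" for n
  proof -
    have trm: "has_L1_deriv l (\<lambda>y. f y ^ i /\<^sub>R fact i) (\<lambda>y. (if i = 0 then 0 else f y ^ (i - 1) /\<^sub>R fact (i - 1)) * g y)" for i
    proof (cases i)
      case (Suc j)
      show ?thesis
        by (rule has_L1_deriv_cong[OF has_L1_deriv_cmult[OF has_L1_deriv_power[OF fg, of j], of "1/fact i"]])
           (auto simp: Suc divide_inverse simp del: of_nat_Suc)
    qed (use has_L1_deriv_const in simp)
    have "has_L1_deriv l (\<lambda>y. \<Sum>i<n. f y ^ i /\<^sub>R fact i) (\<lambda>y. (\<Sum>i<n. if i = 0 then 0 else f y ^ (i - 1) /\<^sub>R fact (i - 1)) * g y)" for n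
    proof (induction n)
      case (Suc n)
      show ?case
        by (rule has_L1_deriv_cong[OF has_L1_deriv_add[OF Suc trm[of n]]]) (auto simp: algebra_simps)
    qed (use has_L1_deriv_const[of l 0] in simp)
    from this[of "Suc n"] have "s (Suc n) x = s (Suc n) 0 + (LINT y|?M. (\<Sum>i<Suc n. if i = 0 then 0 else f y ^ (i - 1) /\<^sub>R fact (i - 1)) * g y)"
      using x unfolding s_def by (rule has_L1_derivD(2))
    also have "(\<lambda>y. \<Sum>i<Suc n. if i = 0 then 0 else f y ^ (i - 1) /\<^sub>R fact (i - 1)) = s n"
      by (simp add: s_def fun_eq_iff sum.lessThan_Suc_shift del: sum.lessThan_Suc)
    finally show ?thesis .
  qed
  have lim: "(\<lambda>n. s n y) \<longlonglongrightarrow> exp (f y)" for y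
    unfolding s_def using exp_converges[of "f y"] by (simp add: sums_def)
  have bnd: "\<bar>s n y\<bar> \<le> exp \<bar>f y\<bar>" for n y
  proof -
    have "\<bar>s n y\<bar> \<le> (\<Sum>i<n. \<bar>f y\<bar> ^ i /\<^sub>R fact i)"
      unfolding s_def by (rule order_trans[OF sum_abs]) (simp add: power_abs abs_mult)
    also have "\<dots> \<le> exp \<bar>f y\<bar>"
      using sum_le_suminf[OF exp_converges[of "\<bar>f y\<bar>", THEN sums_summable], of "{..<n}"]
        exp_converges[of "\<bar>f y\<bar>", THEN sums_unique] by simp
    finally show ?thesis .
  qed
  have sm: "continuous_on {0..x} (s n)" for n
    unfolding s_def by (intro continuous_intros cfx)
  have "(\<lambda>n. LINT y|?M. s n y * g y) \<longlonglongrightarrow> (LINT y|?M. exp (f y) * g y)"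
  proof (rule integral_dominated_convergence)
    show "(\<lambda>y. exp (f y) * g y) \<in> borel_measurable ?M"
      using continuous_times_integrable[OF continuous_on_exp[OF cfx] gx] by auto
    show "(\<lambda>y. s n y * g y) \<in> borel_measurable ?M" for n
      using continuous_times_integrable[OF sm gx] by auto
    show "integrable ?M (\<lambda>y. exp \<bar>f y\<bar> * \<bar>g y\<bar>)"
      by (intro continuous_times_integrable continuous_intros cfx) (use gx in auto)
    show "AE y in ?M. norm (s n y * g y) \<le> exp \<bar>f y\<bar> * \<bar>g y\<bar>" for n
      by (auto simp: abs_mult intro!: AE_I2 mult_right_mono bnd)
  qed (auto intro!: AE_I2 tendsto_intros lim)
  then have "(\<lambda>n. s (Suc n) 0 + (LINT y|?M. s n y * g y)) \<longlonglongrightarrow> exp (f 0) + (LINT y|?M. exp (f y) * g y)"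
    by (intro tendsto_add LIMSEQ_Suc[OF lim])
  moreover have "(\<lambda>n. s (Suc n) 0 + (LINT y|?M. s n y * g y)) \<longlonglongrightarrow> exp (f x)"
    using LIMSEQ_Suc[OF lim[of x]] by (simp only: step)
  ultimately show "exp (f x) = exp (f 0) + (LINT y|?M. exp (f y) * g y)"
    using LIMSEQ_unique by blast
qed

text \<open>
  Everything about \<open>\<mu>\<close> is controlled on \<open>[0,c]\<close> with \<open>c < l\<close> only; statements at \<open>l\<close> are reached along this
  sequence.
\<close>
lemma exhausting_seq:
  assumes "0 < (l::real)"
  shows "0 \<le> l - l / real (n+2)" "l - l / real (n+2) < l" "(\<lambda>n. l - l / real (n+2)) \<longlonglongrightarrow> l"
proof -
  have "(\<lambda>n. l - l / real (n + 2)) \<longlonglongrightarrow> l - 0"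
    by (intro tendsto_intros LIMSEQ_ignore_initial_segment[OF lim_const_over_n])
  then show "(\<lambda>n. l - l / real (n+2)) \<longlonglongrightarrow> l" by simp
qed (use assms in \<open>auto simp: field_simps\<close>)

lemma AE_not_endpoint: "AE x in lebesgue_on {0..l::real}. x \<noteq> l"
proof -
  have "AE x in lebesgue. x \<noteq> l" by (rule AE_completion[OF AE_lborel_singleton])
  then have "AE x in lebesgue. x \<in> {0..l} \<longrightarrow> x \<noteq> l" by eventually_elim simp
  then show ?thesis by (subst AE_restrict_space_iff) simp_all
qed

text \<open>
  Monotone convergence along an exhaustion of \<open>[0,l)\<close>.
\<close>
lemma integrable_if_bounded_integrals:
  fixes g :: "real \<Rightarrow> real"
  assumes l: "0 < l" and nn: "\<And>x. x \<in> {0..l} \<Longrightarrow> 0 \<le> g x"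
    and m: "g \<in> borel_measurable (lebesgue_on {0..l})"
    and i: "\<And>c. 0 \<le> c \<Longrightarrow> c < l \<Longrightarrow> integrable (lebesgue_on {0..c}) g"
    and b: "\<And>c. 0 \<le> c \<Longrightarrow> c < l \<Longrightarrow> (LINT x|lebesgue_on {0..c}. g x) \<le> B"
  shows "integrable (lebesgue_on {0..l}) g"
proof -
  define c where "c n = l - l / real (n+2)" for n :: nat
  note cs = exhausting_seq[OF l, folded c_def]
  have cmono: "c n \<le> c m" if "n \<le> m" for n m
    using that l by (auto simp: c_def intro!: divide_left_mono)
  let ?f = "\<lambda>n x. indicator {0..c n} x * g x"
  have res: "(LINT x|lebesgue_on {0..l}. ?f n x) = (LINT x|lebesgue_on {0..c n}. g x)" for n
    by (rule integral_lebesgue_on_restrict) (use cs(1)[of n] cs(2)[of n] in auto)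
  have ri: "integrable (lebesgue_on {0..l}) (?f n)" for n
  proof -
    have "integrable lebesgue (\<lambda>x. if x \<in> {0..c n} then g x else 0)"
      by (rule Lebesgue_Measure.integrable_restrict_UNIV[THEN iffD2, OF _ i[OF cs(1)[of n] cs(2)[of n]]]) simp
    also have "(\<lambda>x. if x \<in> {0..c n} then g x else 0) = (\<lambda>x. indicator {0..l} x *\<^sub>R ?f n x)"
      using cs(2)[of n] by (auto simp: indicator_def)
    finally show ?thesis by (simp add: integrable_restrict_space)
  qed
  have inc: "incseq (\<lambda>n. LINT x|lebesgue_on {0..l}. ?f n x)"
    unfolding incseq_def
  proof (intro allI impI Bochner_Integration.integral_mono ri)
    fix n m :: nat and x assume "n \<le> m" "x \<in> space (lebesgue_on {0..l})"
    then show "?f n x \<le> ?f m x" using cmono[OF \<open>n \<le> m\<close>] nn[of x] by (auto simp: indicator_def)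
  qed
  have "\<And>n. (LINT x|lebesgue_on {0..l}. ?f n x) \<le> B" using res b[OF cs(1,2)] by simp
  then obtain L where L: "(\<lambda>n. LINT x|lebesgue_on {0..l}. ?f n x) \<longlonglongrightarrow> L"
    using incseq_convergent[OF inc] by blast
  show ?thesis
  proof (rule integral_monotone_convergence_nonneg(1)[of _ ?f])
    show "AE x in lebesgue_on {0..l}. mono (\<lambda>n. ?f n x)"
    proof (intro AE_I2 monoI)
      fix n m :: nat and x assume "n \<le> m" "x \<in> space (lebesgue_on {0..l})"
      then show "?f n x \<le> ?f m x" using cmono[OF \<open>n \<le> m\<close>] nn[of x] by (auto simp: indicator_def)
    qed
    show "AE x in lebesgue_on {0..l}. (\<lambda>n. ?f n x) \<longlonglongrightarrow> g x"
      using AE_not_endpoint[of l] AE_space[of "lebesgue_on {0..l}"]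
    proof eventually_elim
      case (elim x)
      then have "0 \<le> x" "x < l" by auto
      then have "eventually (\<lambda>n. x < c n) sequentially" using cs(3) order_tendstoD(1) by blast
      then have "eventually (\<lambda>n. ?f n x = g x) sequentially"
        by eventually_elim (use \<open>0 \<le> x\<close> in \<open>auto simp: indicator_def\<close>)
      then show ?case by (rule tendsto_eventually)
    qed
  qed (use ri L m nn in \<open>auto simp: indicator_def\<close>)
qed

text \<open>
  Functions such as \<open>1/F\<close> are absolutely continuous only away from \<open>l\<close>; products with \<open>F\<close> are first treated
  there and then extended to the closed interval, where the value at \<open>l\<close> must be the limit.
\<close>
lemma has_L1_deriv_extend:
  assumes l: "0 < l" and d: "\<And>c. 0 \<le> c \<Longrightarrow> c < l \<Longrightarrow> has_L1_deriv c f g"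
    and g: "integrable (lebesgue_on {0..l}) g"
    and lim: "(\<lambda>n. f (l - l / real (n+2))) \<longlonglongrightarrow> f l"
  shows "has_L1_deriv l f g"
  unfolding has_L1_deriv_def
proof (intro conjI ballI g)
  fix x assume x: "x \<in> {0..l}"
  show "f x = f 0 + (LINT y|lebesgue_on {0..x}. g y)"
  proof (cases "x < l")
    case True
    then show ?thesis using has_L1_derivD(2)[OF d[of x], of x] x by simp
  next
    case False
    then have [simp]: "x = l" using x by simp
    define c where "c n = l - l / real (n+2)" for n :: nat
    note cs = exhausting_seq[OF l, folded c_def]
    have "continuous_on {0..l} (\<lambda>x. LINT y|lebesgue_on {0..x}. g y)"
      by (rule indefinite_integral_continuous_real[OF g])
    then have "(\<lambda>n. LINT y|lebesgue_on {0..c n}. g y) \<longlonglongrightarrow> (LINT y|lebesgue_on {0..l}. g y)"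
      by (rule continuous_on_tendsto_compose) (use cs l in \<open>auto simp: less_imp_le\<close>)
    then have "(\<lambda>n. f 0 + (LINT y|lebesgue_on {0..c n}. g y)) \<longlonglongrightarrow> f 0 + (LINT y|lebesgue_on {0..l}. g y)"
      by (intro tendsto_intros)
    moreover have "f 0 + (LINT y|lebesgue_on {0..c n}. g y) = f (c n)" for n
      using has_L1_derivD(2)[OF d[OF cs(1)[of n] cs(2)[of n]], of "c n"] cs(1)[of n] by simp
    ultimately have "(\<lambda>n. f (c n)) \<longlonglongrightarrow> f 0 + (LINT y|lebesgue_on {0..l}. g y)" by simp
    then show ?thesis using lim LIMSEQ_unique unfolding c_def by fastforce
  qed
qed

lemma has_L1_deriv_C1:
  assumes "\<And>x. x \<in> {0..l} \<Longrightarrow> (f has_real_derivative f' x) (at x within {0..l})"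
    and c: "continuous_on {0..l} f'"
  shows "has_L1_deriv l f f'"
  unfolding has_L1_deriv_def
proof (intro conjI ballI)
  show fi: "integrable (lebesgue_on {0..l}) f'" by (rule continuous_imp_integrable_real[OF c])
  fix x assume x: "x \<in> {0..l}"
  have "(f' has_integral (f x - f 0)) {0..x}"
  proof (rule fundamental_theorem_of_calculus)
    fix y assume "y \<in> {0..x}"
    then have "(f has_real_derivative f' y) (at y within {0..x})"
      by (intro DERIV_subset[OF assms(1)]) (use x in auto)
    then show "(f has_vector_derivative f' y) (at y within {0..x})"
      by (simp add: has_real_derivative_iff_has_vector_derivative)
  qed (use x in simp)
  moreover have "integrable (lebesgue_on {0..x}) f'"
    by (rule integrable_subinterval[OF fi]) (use x in auto)
  ultimately show "f x = f 0 + (LINT y|lebesgue_on {0..x}. f' y)"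
    by (simp add: lebesgue_integral_eq_integral integral_unique)
qed

lemma has_L1_deriv_unique:
  assumes "has_L1_deriv l f g" "has_L1_deriv l f g'"
  shows "AE x in lebesgue_on {0..l}. g x = g' x"
proof -
  have d: "has_L1_deriv l (\<lambda>x. 0) (\<lambda>x. g x + (- 1) * g' x)"
    by (rule has_L1_deriv_cong[OF has_L1_deriv_add[OF assms(1) has_L1_deriv_cmult[OF assms(2), of "-1"]]]) auto
  have "AE x in lebesgue_on {0..l}. g x + (- 1) * g' x = 0"
  proof (rule AE_zero_if_indefinite_integral_zero[OF has_L1_derivD(1)[OF d]])
    fix x assume "x \<in> {0..l}"
    then have "0 = 0 + (LINT y|lebesgue_on {0..x}. g y + (- 1) * g' y)"
      by (rule has_L1_derivD(2)[OF d])
    then show "(LINT y|lebesgue_on {0..x}. g y + (- 1) * g' y) = 0" by linarith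
  qed
  then show ?thesis by eventually_elim simp
qed

section \<open>Growth estimates and the Volterra equation\<close>

lemma integral_exp_weight:
  fixes a :: real
  assumes "a \<noteq> 0" "0 \<le> t"
  shows "integrable (lebesgue_on {0..t}) (\<lambda>s. exp (a * s))"
    and "(LINT s|lebesgue_on {0..t}. exp (a * s)) = (exp (a * t) - 1) / a"
proof -
  have d: "has_L1_deriv t (\<lambda>s. exp (a * s) / a) (\<lambda>s. exp (a * s))"
    by (rule has_L1_deriv_C1) (use assms in \<open>auto intro!: derivative_eq_intros continuous_intros\<close>)
  show "integrable (lebesgue_on {0..t}) (\<lambda>s. exp (a * s))" by (rule has_L1_derivD(1)[OF d])
  have "exp (a * t) / a = exp (a * 0) / a + (LINT s|lebesgue_on {0..t}. exp (a * s))"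
    by (rule has_L1_derivD(2)[OF d]) (use assms in simp)
  then show "(LINT s|lebesgue_on {0..t}. exp (a * s)) = (exp (a * t) - 1) / a"
    by (simp add: diff_divide_distrib)
qed

text \<open>
  Put \<open>N = sup u(t) exp (- 2 \<lambda> t)\<close>, finite because \<open>u\<close> is bounded.  The hypothesis gives \<open>N \<le> e + N/2\<close>.  Since
  boundedness and integrability suffice, it applies to components of piecewise continuous solutions.
\<close>
lemma gronwall_bounded:
  fixes u :: "real \<Rightarrow> real"
  assumes lam: "0 < lam" and e: "0 \<le> e"
    and i: "integrable (lebesgue_on {0..T}) u"
    and b: "\<And>t. t \<in> {0..T} \<Longrightarrow> 0 \<le> u t \<and> u t \<le> B"
    and le: "\<And>t. t \<in> {0..T} \<Longrightarrow> u t \<le> e + lam * (LINT s|lebesgue_on {0..t}. u s)"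
    and t: "t \<in> {0..T}"
  shows "u t \<le> 2 * e * exp (2 * lam * t)"
proof -
  define V where "V = (\<lambda>t. u t * exp (- 2 * lam * t)) ` {0..T}"
  define N where "N = Sup V"
  have T: "0 \<le> T" using t by auto
  have B0: "0 \<le> B" using b[OF t] by linarith
  have bdd: "bdd_above V"
  proof (rule bdd_aboveI)
    fix y assume "y \<in> V"
    then obtain s where s: "s \<in> {0..T}" "y = u s * exp (- 2 * lam * s)" by (auto simp: V_def)
    have "exp (- 2 * lam * s) \<le> 1" using s lam by simp
    then have "u s * exp (- 2 * lam * s) \<le> B * 1"
      using b[OF s(1)] B0 by (intro mult_mono) auto
    then show "y \<le> B" using s by simp
  qed
  have le_N: "u s * exp (- 2 * lam * s) \<le> N" if "s \<in> {0..T}" for s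
    unfolding N_def by (rule cSup_upper[OF _ bdd]) (use that in \<open>auto simp: V_def\<close>)
  have uN: "u s \<le> N * exp (2 * lam * s)" if "s \<in> {0..T}" for s
    using mult_right_mono[OF le_N[OF that], of "exp (2 * lam * s)"]
    by (simp add: mult.assoc exp_add[symmetric])
  have N0: "0 \<le> N" using le_N[of 0] b[of 0] T by auto
  have ub: "u s * exp (- 2 * lam * s) \<le> e + N / 2" if s: "s \<in> {0..T}" for s
  proof -
    have "(LINT r|lebesgue_on {0..s}. u r) \<le> (LINT r|lebesgue_on {0..s}. N * exp (2 * lam * r))"
    proof (rule Bochner_Integration.integral_mono)
      show "integrable (lebesgue_on {0..s}) u"
        by (rule integrable_subinterval[OF i]) (use s in auto)
      show "integrable (lebesgue_on {0..s}) (\<lambda>r. N * exp (2 * lam * r))"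
        using integral_exp_weight(1)[of "2 * lam" s] lam s by simp
    qed (use uN s in auto)
    also have "\<dots> = N * ((exp (2 * lam * s) - 1) / (2 * lam))"
      using integral_exp_weight(2)[of "2 * lam" s] lam s by simp
    finally have "lam * (LINT r|lebesgue_on {0..s}. u r) \<le> lam * (N * ((exp (2 * lam * s) - 1) / (2 * lam)))"
      using lam by (intro mult_left_mono) auto
    also have "\<dots> = N / 2 * (exp (2 * lam * s) - 1)" using lam by (simp add: field_simps)
    also have "\<dots> \<le> N / 2 * exp (2 * lam * s)" using N0 by (intro mult_left_mono) auto
    finally have "u s \<le> e + N / 2 * exp (2 * lam * s)" using le[OF s] by linarith
    then have "u s * exp (- 2 * lam * s) \<le> (e + N / 2 * exp (2 * lam * s)) * exp (- 2 * lam * s)"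
      by (intro mult_right_mono) auto
    also have "\<dots> = e * exp (- 2 * lam * s) + N / 2"
      by (simp add: distrib_right mult.assoc exp_add[symmetric])
    also have "e * exp (- 2 * lam * s) \<le> e * 1" using e s lam by (intro mult_left_mono) auto
    finally show ?thesis by simp
  qed
  have "N \<le> e + N / 2"
    unfolding N_def
    by (rule cSup_least) (use ub t in \<open>auto simp: V_def N_def\<close>)
  then have "N \<le> 2 * e" by simp
  then have "N * exp (2 * lam * t) \<le> 2 * e * exp (2 * lam * t)" by (intro mult_right_mono) auto
  then show ?thesis using uN[OF t] by linarith
qed

lemma borel_measurable_lebesgue_continuous:
  fixes f :: "real \<Rightarrow> real"
  assumes "continuous_on UNIV f"
  shows "f \<in> borel_measurable lebesgue"
  by (intro measurable_completion) (use borel_measurable_continuous_onI[OF assms] in simp)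

lemma LINT_lebesgue_on_indicator:
  fixes f :: "real \<Rightarrow> real"
  assumes "A \<in> sets lebesgue"
  shows "(LINT x|lebesgue_on A. f x) = (LINT x|lebesgue. indicator A x * f x)"
    and "integrable (lebesgue_on A) f \<longleftrightarrow> integrable lebesgue (\<lambda>x. indicator A x * f x)"
  using assms by (simp_all add: integral_restrict_space integrable_restrict_space)

text \<open>
  The indicator of the moving interval converges except at the single point \<open>x = s\<^sub>0\<close>.
\<close>
lemma convolution_seq_continuous:
  fixes k q :: "real \<Rightarrow> real"
  assumes k: "continuous_on UNIV k" "\<And>x. \<bar>k x\<bar> \<le> K"
    and q: "continuous_on UNIV q" "\<And>x. \<bar>q x\<bar> \<le> Q"
    and s: "s \<longlonglongrightarrow> (s0::real)" "\<And>n. 0 \<le> s n"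
  shows "(\<lambda>n. LINT x|lebesgue_on {0..s n}. k x * q (s n - x)) \<longlonglongrightarrow> (LINT x|lebesgue_on {0..s0}. k x * q (s0 - x))"
proof -
  have s0: "0 \<le> s0" by (rule LIMSEQ_le_const[OF s(1)]) (use s(2) in auto)
  obtain S where S: "\<And>n. s n \<le> S"
    using convergent_imp_Bseq[OF convergentI[OF s(1)]] unfolding Bseq_def
    by (metis abs_le_iff real_norm_def)
  have S0: "s0 \<le> S" by (rule LIMSEQ_le_const2[OF s(1)]) (use S in auto)
  have m: "(\<lambda>x. indicator {0..r} x * (k x * q (r - x))) \<in> borel_measurable lebesgue" for r
  proof -
    have "continuous_on UNIV (\<lambda>x. k x * q (r - x))"
      by (intro continuous_intros k continuous_on_compose2[OF q(1)]) auto
    then show ?thesis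
      by (intro borel_measurable_times[OF borel_measurable_indicator borel_measurable_lebesgue_continuous]) auto
  qed
  have K0: "0 \<le> K" using k(2)[of 0] by linarith
  have "(\<lambda>n. LINT x|lebesgue. indicator {0..s n} x * (k x * q (s n - x))) \<longlonglongrightarrow> (LINT x|lebesgue. indicator {0..s0} x * (k x * q (s0 - x)))"
  proof (rule integral_dominated_convergence)
    show "integrable lebesgue (\<lambda>x. indicator {0..S} x * (K * Q))"
      by (intro integrable_mult_left) (simp add: integrable_indicator_iff emeasure_lborel_Icc_eq)
    have bd: "\<bar>k x * q y\<bar> \<le> K * Q" for x y
      unfolding abs_mult by (intro mult_mono k q K0) auto
    show "AE x in lebesgue. norm (indicator {0..s n} x * (k x * q (s n - x))) \<le> indicator {0..S} x * (K * Q)" for n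
    proof (intro AE_I2)
      fix x
      show "norm (indicator {0..s n} x * (k x * q (s n - x))) \<le> indicator {0..S} x * (K * Q)"
        using bd[of x "s n - x"] S[of n] by (auto simp: indicator_def)
    qed
    have "AE x in lebesgue. x \<noteq> s0" by (rule AE_completion[OF AE_lborel_singleton])
    then show "AE x in lebesgue. (\<lambda>n. indicator {0..s n} x * (k x * q (s n - x))) \<longlonglongrightarrow> indicator {0..s0} x * (k x * q (s0 - x))"
    proof eventually_elim
      case (elim x)
      have c: "(\<lambda>n. k x * q (s n - x)) \<longlonglongrightarrow> k x * q (s0 - x)"
      proof (intro tendsto_intros)
        have "isCont q (s0 - x)" using q(1) by (simp add: continuous_on_eq_continuous_at)
        then show "(\<lambda>n. q (s n - x)) \<longlonglongrightarrow> q (s0 - x)"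
          by (rule isCont_tendsto_compose) (intro tendsto_intros s(1))
      qed
      have "(\<lambda>n. indicator {0..s n} x :: real) \<longlonglongrightarrow> indicator {0..s0} x"
      proof (cases "x < s0")
        case True
        then have "eventually (\<lambda>n. x < s n) sequentially" using s(1) order_tendstoD(1) by blast
        then have "eventually (\<lambda>n. indicator {0..s n} x = (indicator {0..s0} x::real)) sequentially"
          by eventually_elim (use True in \<open>auto simp: indicator_def\<close>)
        then show ?thesis by (rule tendsto_eventually)
      next
        case False
        then have "s0 < x" using elim by simp
        then have "eventually (\<lambda>n. s n < x) sequentially" using s(1) order_tendstoD(2) by blast
        then have "eventually (\<lambda>n. indicator {0..s n} x = (indicator {0..s0} x::real)) sequentially"
          by eventually_elim (use \<open>s0 < x\<close> in \<open>auto simp: indicator_def\<close>)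
        then show ?thesis by (rule tendsto_eventually)
      qed
      then show ?case by (intro tendsto_mult c)
    qed
  qed (use m in auto)
  then show ?thesis by (simp add: LINT_lebesgue_on_indicator)
qed

text \<open>
  With the weight \<open>w(t) = exp (- 2 \<lambda> t)\<close> the kernel has mass at most \<open>1/2\<close>, so the equation for \<open>w p\<close> is a
  contraction on bounded continuous functions.  Times are clamped at \<open>0\<close> to work on the whole line.
\<close>
lemma volterra_solution_exists:
  fixes k g :: "real \<Rightarrow> real"
  assumes lam: "0 < lam" and k: "continuous_on UNIV k" "\<And>x. \<bar>k x\<bar> \<le> lam"
    and g: "continuous_on {0..} g" "\<And>t. 0 \<le> t \<Longrightarrow> \<bar>g t\<bar> \<le> G"
  shows "\<exists>p. continuous_on UNIV p \<and> (\<forall>t\<ge>0. p t = g t - (LINT x|lebesgue_on {0..t}. k x * p (t - x)))"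
proof -
  define w where "w x = exp (- (2 * lam) * x)" for x :: real
  define kw where "kw x = k x * w (max 0 x)" for x
  define \<Phi> where "\<Phi> q t = w (max 0 t) * g (max 0 t) - (LINT x|lebesgue_on {0..max 0 t}. kw x * q (max 0 t - x))"
    for q :: "real \<Rightarrow> real" and t
  have w01: "0 < w x" "0 \<le> x \<Longrightarrow> w x \<le> 1" for x using lam by (auto simp: w_def)
  have cw: "continuous_on UNIV w" unfolding w_def by (intro continuous_intros)
  have ckw: "continuous_on UNIV kw" unfolding kw_def
    by (intro continuous_intros k continuous_on_compose2[OF cw]) auto
  have bkw: "\<bar>kw x\<bar> \<le> lam" for x
    using mult_mono[OF k(2)[of x] w01(2)[of "max 0 x"]] lam w01(1)[of "max 0 x"] by (auto simp: kw_def abs_mult)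
  have kwle: "\<bar>kw x\<bar> \<le> lam * w x" if "0 \<le> x" for x
    using mult_right_mono[OF k(2)[of x], of "w x"] that w01(1)[of x] by (auto simp: kw_def abs_mult)
  have ci: "integrable (lebesgue_on {0..t}) (\<lambda>x. kw x * q (t - x))" if "continuous_on UNIV q" for q t
  proof (rule continuous_imp_integrable_real)
    show "continuous_on {0..t} (\<lambda>x. kw x * q (t - x))"
      by (intro continuous_intros continuous_on_subset[OF ckw] continuous_on_compose2[OF that]) auto
  qed
  have wint: "integrable (lebesgue_on {0..t}) w" "lam * (LINT x|lebesgue_on {0..t}. w x) \<le> 1 / 2" if "0 \<le> t" for t
  proof -
    show "integrable (lebesgue_on {0..t}) w"
      unfolding w_def by (rule integral_exp_weight) (use lam that in auto)
    have "(LINT x|lebesgue_on {0..t}. w x) = (exp (- (2 * lam) * t) - 1) / (- (2 * lam))"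
      unfolding w_def by (rule integral_exp_weight) (use lam that in auto)
    then have "lam * (LINT x|lebesgue_on {0..t}. w x) = (1 - exp (- (2 * lam) * t)) / 2"
      using lam by (simp add: field_simps)
    then show "lam * (LINT x|lebesgue_on {0..t}. w x) \<le> 1 / 2" by simp
  qed
  have est: "\<bar>LINT x|lebesgue_on {0..t}. kw x * q (t - x)\<bar> \<le> 1 / 2 * D"
    if q: "continuous_on UNIV q" "\<And>x. \<bar>q x\<bar> \<le> D" and t: "0 \<le> t" for q t D
  proof -
    have D0: "0 \<le> D" using q(2)[of 0] by linarith
    have "\<bar>LINT x|lebesgue_on {0..t}. kw x * q (t - x)\<bar> \<le> (LINT x|lebesgue_on {0..t}. \<bar>kw x * q (t - x)\<bar>)"
      by (rule integral_abs_bound)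
    also have "\<dots> \<le> (LINT x|lebesgue_on {0..t}. D * (lam * w x))"
    proof (rule Bochner_Integration.integral_mono)
      fix x assume "x \<in> space (lebesgue_on {0..t})"
      then have "0 \<le> x" by simp
      have "\<bar>kw x * q (t - x)\<bar> \<le> (lam * w x) * D"
        unfolding abs_mult by (rule mult_mono[OF kwle[OF \<open>0 \<le> x\<close>] q(2)]) (use lam w01(1)[of x] in auto)
      then show "\<bar>kw x * q (t - x)\<bar> \<le> D * (lam * w x)" by (simp only: mult.commute)
    qed (use ci[OF q(1)] wint(1)[OF t] in auto)
    also have "\<dots> = D * (lam * (LINT x|lebesgue_on {0..t}. w x))" by simp
    also have "\<dots> \<le> D * (1 / 2)" by (intro mult_left_mono wint t D0)
    finally show ?thesis by simp
  qed
  have cont: "continuous_on UNIV (\<Phi> q)" if q: "continuous_on UNIV q" "\<And>x. \<bar>q x\<bar> \<le> D" for q D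
  proof -
    have "continuous_on UNIV (\<lambda>t. LINT x|lebesgue_on {0..max 0 t}. kw x * q (max 0 t - x))"
      unfolding continuous_on_sequentially comp_def
    proof (intro ballI allI impI)
      fix x :: "nat \<Rightarrow> real" and a :: real assume "(\<forall>n. x n \<in> UNIV) \<and> x \<longlonglongrightarrow> a"
      then have "(\<lambda>n. max 0 (x n)) \<longlonglongrightarrow> max 0 a" by (intro tendsto_intros) auto
      then show "(\<lambda>n. LINT xa|lebesgue_on {0..max 0 (x n)}. kw xa * q (max 0 (x n) - xa))
           \<longlonglongrightarrow> (LINT x|lebesgue_on {0..max 0 a}. kw x * q (max 0 a - x))"
        by (rule convolution_seq_continuous[OF ckw bkw q]) auto
    qed
    then show ?thesis unfolding \<Phi>_def
      by (intro continuous_intros continuous_on_compose2[OF cw] continuous_on_compose2[OF g(1)]) auto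
  qed
  have bnd: "\<bar>\<Phi> q t\<bar> \<le> G + 1/2 * D" if q: "continuous_on UNIV q" "\<And>x. \<bar>q x\<bar> \<le> D" for q D t
  proof -
    have "\<bar>w (max 0 t) * g (max 0 t)\<bar> \<le> 1 * G"
      unfolding abs_mult by (intro mult_mono g) (use w01[of "max 0 t"] in auto)
    then show ?thesis using est[OF q, of "max 0 t"] unfolding \<Phi>_def by linarith
  qed
  have mem: "\<Phi> (apply_bcontfun q) \<in> bcontfun" for q :: "real \<Rightarrow>\<^sub>C real"
  proof -
    have q: "continuous_on UNIV (apply_bcontfun q)" "\<And>x. \<bar>apply_bcontfun q x\<bar> \<le> norm q"
      using norm_bounded[of q] by (auto intro: continuous_on_apply_bcontfun)
    show ?thesis
      by (rule bcontfun_normI[of _ "G + 1/2 * norm q"]) (use cont[OF q] bnd[OF q] in auto)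
  qed
  define \<Psi> where "\<Psi> q = Bcontfun (\<Phi> (apply_bcontfun q))" for q :: "real \<Rightarrow>\<^sub>C real"
  have app: "apply_bcontfun (\<Psi> q) = \<Phi> (apply_bcontfun q)" for q
    unfolding \<Psi>_def by (rule Bcontfun_inverse[OF mem])
  have "dist (\<Psi> q) (\<Psi> r) \<le> 1/2 * dist q r" for q r
  proof (rule dist_bound)
    fix t
    let ?d = "\<lambda>x. apply_bcontfun q x - apply_bcontfun r x"
    have cq: "continuous_on UNIV (apply_bcontfun q)" "continuous_on UNIV (apply_bcontfun r)"
      by (auto intro: continuous_on_apply_bcontfun)
    have d: "continuous_on UNIV ?d" "\<And>x. \<bar>?d x\<bar> \<le> dist q r"
      using dist_bounded[of q _ r] cq by (auto simp: dist_real_def intro!: continuous_intros)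
    have "\<Phi> (apply_bcontfun r) t - \<Phi> (apply_bcontfun q) t = (LINT x|lebesgue_on {0..max 0 t}. kw x * ?d (max 0 t - x))"
      unfolding \<Phi>_def using ci[OF cq(1), of "max 0 t"] ci[OF cq(2), of "max 0 t"]
      by (simp add: right_diff_distrib)
    moreover have "\<bar>LINT x|lebesgue_on {0..max 0 t}. kw x * ?d (max 0 t - x)\<bar> \<le> 1/2 * dist q r"
      by (rule est[OF d]) auto
    ultimately have "\<bar>\<Phi> (apply_bcontfun r) t - \<Phi> (apply_bcontfun q) t\<bar> \<le> 1/2 * dist q r" by simp
    then show "dist (apply_bcontfun (\<Psi> q) t) (apply_bcontfun (\<Psi> r) t) \<le> 1/2 * dist q r"
      by (simp add: app dist_real_def abs_minus_commute)
  qed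
  then obtain q where q: "\<Psi> q = q"
    using banach_fix_type[of "1/2" \<Psi>] by auto
  define p where "p t = apply_bcontfun q t / w t" for t
  have "continuous_on UNIV p" unfolding p_def
    using w01(1) by (intro continuous_intros cw continuous_on_apply_bcontfun) (auto simp: less_imp_neq[symmetric])
  moreover have "p t = g t - (LINT x|lebesgue_on {0..t}. k x * p (t - x))" if t: "0 \<le> t" for t
  proof -
    have w0: "w x \<noteq> 0" for x using w01(1)[of x] by simp
    have ws: "w (t - x) = w t / w x" for x
      by (simp add: w_def exp_diff[symmetric] right_diff_distrib)
    have "apply_bcontfun q t = \<Phi> (apply_bcontfun q) t" using app[of q] q by simp
    then have "apply_bcontfun q t = w t * g t - (LINT x|lebesgue_on {0..t}. kw x * apply_bcontfun q (t - x))"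
      using t by (simp add: \<Phi>_def)
    also have "(LINT x|lebesgue_on {0..t}. kw x * apply_bcontfun q (t - x)) = (LINT x|lebesgue_on {0..t}. w t * (k x * p (t - x)))"
      by (rule Bochner_Integration.integral_cong) (use w0 in \<open>auto simp: kw_def p_def ws field_simps\<close>)
    finally have "apply_bcontfun q t = w t * (g t - (LINT x|lebesgue_on {0..t}. k x * p (t - x)))"
      by (simp add: right_diff_distrib)
    then show ?thesis using w0[of t] by (simp add: p_def field_simps)
  qed
  ultimately show ?thesis by blast
qed

section \<open>Continuity of translation in the mean\<close>

text \<open>
  Values are clamped to \<open>[-k,k]\<close> and multiplied by a continuous cutoff of \<open>[-k,k]\<close>: the same operation sends
  continuous functions to continuous functions of compact support.
\<close>
lemma L1_truncation:
  fixes f :: "real \<Rightarrow> real"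
  assumes f: "integrable lebesgue f" and e: "0 < e"
  shows "\<exists>k::nat. (LINT x|lebesgue. \<bar>f x - max (- real k) (min (real k) (f x)) * max 0 (min 1 (real k + 1 - \<bar>x\<bar>))\<bar>) < e"
proof -
  define F where "F k x = max (- real k) (min (real k) (f x)) * max 0 (min 1 (real k + 1 - \<bar>x\<bar>))" for k x
  have [measurable]: "f \<in> borel_measurable lebesgue" using f by auto
  have [measurable]: "(\<lambda>x. max 0 (min 1 (real k + 1 - \<bar>x\<bar>))) \<in> borel_measurable lebesgue" for k
    by (rule borel_measurable_lebesgue_continuous) (intro continuous_intros)
  have Fb: "\<bar>F k x\<bar> \<le> \<bar>f x\<bar>" for k x
  proof -
    have "\<bar>F k x\<bar> \<le> \<bar>f x\<bar> * 1" unfolding F_def abs_mult by (rule mult_mono) auto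
    then show ?thesis by simp
  qed
  have "(\<lambda>k. LINT x|lebesgue. \<bar>f x - F k x\<bar>) \<longlonglongrightarrow> (LINT x::real|lebesgue. 0)"
  proof (rule integral_dominated_convergence)
    show "integrable lebesgue (\<lambda>x. 2 * \<bar>f x\<bar>)" using f by simp
    show "(\<lambda>x. \<bar>f x - F k x\<bar>) \<in> borel_measurable lebesgue" for k
      unfolding F_def by measurable
    show "AE x in lebesgue. norm \<bar>f x - F k x\<bar> \<le> 2 * \<bar>f x\<bar>" for k
    proof (intro AE_I2)
      fix x show "norm \<bar>f x - F k x\<bar> \<le> 2 * \<bar>f x\<bar>" using Fb[of k x] by simp
    qed
    show "AE x in lebesgue. (\<lambda>k. \<bar>f x - F k x\<bar>) \<longlonglongrightarrow> 0"
    proof (intro AE_I2 tendsto_eventually)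
      fix x :: real
      obtain n :: nat where n: "\<bar>f x\<bar> + \<bar>x\<bar> \<le> real n" using real_arch_simple by blast
      have "\<bar>f x - F k x\<bar> = 0" if "n \<le> k" for k
      proof -
        have "real n \<le> real k" using that by simp
        then have "\<bar>f x\<bar> \<le> real k" "\<bar>x\<bar> \<le> real k" using n by linarith+
        then show ?thesis by (simp add: F_def)
      qed
      then show "\<forall>\<^sub>F k in sequentially. \<bar>f x - F k x\<bar> = 0"
        unfolding eventually_sequentially by blast
    qed
  qed auto
  then have "eventually (\<lambda>k. (LINT x|lebesgue. \<bar>f x - F k x\<bar>) < e) sequentially"
    using e by (intro order_tendstoD(2)[of _ 0]) auto
  then show ?thesis unfolding F_def eventually_sequentially by blast
qed

text \<open>
  A measurable function is almost everywhere a limit of continuous ones; after the truncation above the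
  convergence is dominated.
\<close>
lemma L1_approx_continuous:
  fixes f :: "real \<Rightarrow> real"
  assumes f: "integrable lebesgue f" and e: "0 < e"
  obtains g :: "real \<Rightarrow> real" and R :: real where "continuous_on UNIV g" "0 \<le> R" "\<And>x. \<bar>g x\<bar> \<le> R" "\<And>x. R < \<bar>x\<bar> \<Longrightarrow> g x = 0"
    "integrable lebesgue g" "(LINT x|lebesgue. \<bar>f x - g x\<bar>) < e"
proof -
  define tr where "tr k y x = max (- real k) (min (real k) y) * max 0 (min 1 (real k + 1 - \<bar>x\<bar>))" for k y and x :: real
  obtain k where k: "(LINT x|lebesgue. \<bar>f x - tr k (f x) x\<bar>) < e / 2"
    using L1_truncation[OF f, of "e/2"] e unfolding tr_def by auto
  have [measurable]: "f \<in> borel_measurable lebesgue" using f by auto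
  have [measurable]: "(\<lambda>x. max 0 (min 1 (real k + 1 - \<bar>x\<bar>))) \<in> borel_measurable lebesgue"
    by (rule borel_measurable_lebesgue_continuous) (intro continuous_intros)
  have "f measurable_on UNIV"
    by (rule lebesgue_measurable_imp_measurable_on) auto
  then obtain N g where N: "negligible N" and g: "\<And>n. continuous_on UNIV (g n :: real \<Rightarrow> real)"
    and lim: "\<And>x. x \<notin> N \<Longrightarrow> (\<lambda>n. g n x) \<longlonglongrightarrow> f x"
    unfolding measurable_on_def by auto
  have gc: "continuous_on UNIV (\<lambda>x. tr k (g n x) x)" for n
    unfolding tr_def by (intro continuous_intros g)
  have [measurable]: "(\<lambda>x. tr k (g n x) x) \<in> borel_measurable lebesgue" for n
    by (rule borel_measurable_lebesgue_continuous[OF gc])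
  have [measurable]: "(\<lambda>x. tr k (f x) x) \<in> borel_measurable lebesgue"
    unfolding tr_def by measurable
  let ?R = "real k + 1"
  have trb: "\<bar>tr k y x\<bar> \<le> indicator {-?R..?R} x * ?R" for y x
  proof (cases "x \<in> {-?R..?R}")
    case True
    have "\<bar>tr k y x\<bar> \<le> real k * 1" unfolding tr_def abs_mult by (intro mult_mono) auto
    then show ?thesis using True by simp
  next
    case False
    then have "max 0 (min 1 (?R - \<bar>x\<bar>)) = 0" by auto
    then show ?thesis by (simp add: tr_def)
  qed
  have iR: "integrable lebesgue (\<lambda>x. indicator {-?R..?R} x * ?R)"
    by (intro integrable_mult_left) (simp add: integrable_indicator_iff)
  have gi: "integrable lebesgue (\<lambda>x. tr k (g n x) x)" for n
    by (rule Bochner_Integration.integrable_bound[OF iR]) (use order_trans[OF trb abs_ge_self] in auto)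
  have fi: "integrable lebesgue (\<lambda>x. tr k (f x) x)"
    by (rule Bochner_Integration.integrable_bound[OF iR]) (use order_trans[OF trb abs_ge_self] in auto)
  have "(\<lambda>n. LINT x|lebesgue. \<bar>tr k (f x) x - tr k (g n x) x\<bar>) \<longlonglongrightarrow> (LINT x::real|lebesgue. 0)"
  proof (rule integral_dominated_convergence)
    show "integrable lebesgue (\<lambda>x. 2 * (indicator {-?R..?R} x * ?R))" using iR by (rule integrable_mult_right)
    show "AE x in lebesgue. norm \<bar>tr k (f x) x - tr k (g n x) x\<bar> \<le> 2 * (indicator {-?R..?R} x * ?R)" for n
    proof (intro AE_I2)
      fix x show "norm \<bar>tr k (f x) x - tr k (g n x) x\<bar> \<le> 2 * (indicator {-?R..?R} x * ?R)"
        using trb[of "f x" x] trb[of "g n x" x] unfolding real_norm_def by linarith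
    qed
    have "AE x in lebesgue. x \<notin> N" using N by (simp add: negligible_iff_null_sets AE_not_in)
    then show "AE x in lebesgue. (\<lambda>n. \<bar>tr k (f x) x - tr k (g n x) x\<bar>) \<longlonglongrightarrow> 0"
    proof eventually_elim
      case (elim x)
      have "(\<lambda>n. tr k (g n x) x) \<longlonglongrightarrow> tr k (f x) x"
        unfolding tr_def by (intro tendsto_intros lim elim)
      then have "(\<lambda>n. \<bar>tr k (f x) x - tr k (g n x) x\<bar>) \<longlonglongrightarrow> \<bar>tr k (f x) x - tr k (f x) x\<bar>"
        by (intro tendsto_intros)
      then show ?case by simp
    qed
  qed auto
  then have "eventually (\<lambda>n. (LINT x|lebesgue. \<bar>tr k (f x) x - tr k (g n x) x\<bar>) < e/2) sequentially"
    using e by (intro order_tendstoD(2)[of _ 0]) auto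
  then obtain n where n: "(LINT x|lebesgue. \<bar>tr k (f x) x - tr k (g n x) x\<bar>) < e/2"
    unfolding eventually_sequentially by blast
  have "(LINT x|lebesgue. \<bar>f x - tr k (g n x) x\<bar>) \<le> (LINT x|lebesgue. \<bar>f x - tr k (f x) x\<bar> + \<bar>tr k (f x) x - tr k (g n x) x\<bar>)"
    by (rule Bochner_Integration.integral_mono) (use f fi gi in auto)
  also have "\<dots> = (LINT x|lebesgue. \<bar>f x - tr k (f x) x\<bar>) + (LINT x|lebesgue. \<bar>tr k (f x) x - tr k (g n x) x\<bar>)"
    by (rule Bochner_Integration.integral_add) (use f fi gi in auto)
  finally have "(LINT x|lebesgue. \<bar>f x - tr k (g n x) x\<bar>) < e" using k n by simp
  moreover have "\<bar>tr k (g n x) x\<bar> \<le> ?R" for x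
    by (cases "x \<in> {-?R..?R}") (use trb[of "g n x" x] in auto)
  moreover have "tr k (g n x) x = 0" if "?R < \<bar>x\<bar>" for x
  proof -
    have "x \<notin> {-?R..?R}" using that by auto
    then have "\<bar>tr k (g n x) x\<bar> \<le> 0" using trb[of "g n x" x] by (metis indicator_simps(2) mult_zero_left)
    then show ?thesis by simp
  qed
  ultimately show thesis using that[of "\<lambda>x. tr k (g n x) x" ?R] gc gi by auto
qed

lemma LINT_lborel_eq_lebesgue:
  fixes f :: "real \<Rightarrow> real"
  assumes "f \<in> borel_measurable borel"
  shows "(LINT x|lebesgue. f x) = (LINT x|lborel. f x)" "integrable lebesgue f \<longleftrightarrow> integrable lborel f"
  using assms by (simp_all add: integral_completion integrable_completion)

lemma LINT_translate:
  fixes f :: "real \<Rightarrow> real"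
  assumes f: "f \<in> borel_measurable borel"
  shows "(LINT x|lebesgue. f (x + h)) = (LINT x|lebesgue. f x)"
    and "integrable lebesgue f \<Longrightarrow> integrable lebesgue (\<lambda>x. f (x + h))"
proof -
  have m: "(\<lambda>x. f (x + h)) \<in> borel_measurable borel" using f by measurable
  show "(LINT x|lebesgue. f (x + h)) = (LINT x|lebesgue. f x)"
    using lborel_integral_real_affine[of 1 f h] f m by (simp add: LINT_lborel_eq_lebesgue add.commute)
  show "integrable lebesgue (\<lambda>x. f (x + h))" if "integrable lebesgue f"
    using lborel_integrable_real_affine[of f 1 h] that f m by (simp add: LINT_lborel_eq_lebesgue add.commute)
qed

text \<open>
  For continuous functions of compact support this is dominated convergence; translation is isometric, so
  an approximation in mean suffices in general.
\<close>
lemma L1_translation_continuous: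
  fixes f :: "real \<Rightarrow> real"
  assumes f: "integrable lebesgue f" and fm: "f \<in> borel_measurable borel"
  shows "((\<lambda>h. LINT x|lebesgue. \<bar>f (x + h) - f x\<bar>) \<longlongrightarrow> 0) (at 0)"
proof (rule tendstoI)
  fix e :: real assume e: "0 < e"
  obtain g R where g: "continuous_on UNIV g" "0 \<le> R" "\<And>x. \<bar>g x\<bar> \<le> R" "\<And>x. R < \<bar>x\<bar> \<Longrightarrow> g x = 0"
    "integrable lebesgue g" "(LINT x|lebesgue. \<bar>f x - g x\<bar>) < e / 3"
    using L1_approx_continuous[OF f, of "e/3"] e by auto
  have gm: "g \<in> borel_measurable borel" by (rule borel_measurable_continuous_onI[OF g(1)])
  note [measurable] = gm fm
  have gt: "integrable lebesgue (\<lambda>x. g (x + h))" "integrable lebesgue (\<lambda>x. f (x + h))" for h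
    using LINT_translate(2)[OF gm g(5)] LINT_translate(2)[OF fm f] by auto
  have "((\<lambda>h. LINT x|lebesgue. \<bar>g (x + h) - g x\<bar>) \<longlongrightarrow> 0) (at 0)"
    unfolding tendsto_at_iff_sequentially comp_def
  proof (intro allI impI)
    fix X :: "nat \<Rightarrow> real" assume "\<forall>i. X i \<in> UNIV - {0}" and X: "X \<longlonglongrightarrow> 0"
    from X have "eventually (\<lambda>n. \<bar>X n\<bar> < 1) sequentially"
      using tendstoD[OF X, of 1] by (simp add: dist_real_def)
    then obtain n0 where n0: "\<And>n. n0 \<le> n \<Longrightarrow> \<bar>X n\<bar> < 1" unfolding eventually_sequentially by blast
    have "(\<lambda>n. LINT x|lebesgue. \<bar>g (x + X (n + n0)) - g x\<bar>) \<longlonglongrightarrow> (LINT x::real|lebesgue. 0)"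
    proof (rule integral_dominated_convergence)
      show "integrable lebesgue (\<lambda>x. indicator {-(R+1)..R+1} x * (2 * R))"
        by (intro integrable_mult_left) (simp add: integrable_indicator_iff emeasure_lborel_Icc_eq)
      show "AE x in lebesgue. norm \<bar>g (x + X (n + n0)) - g x\<bar> \<le> indicator {-(R+1)..R+1} x * (2 * R)" for n
      proof (intro AE_I2)
        fix x
        show "norm \<bar>g (x + X (n + n0)) - g x\<bar> \<le> indicator {-(R+1)..R+1} x * (2 * R)"
        proof (cases "x \<in> {-(R+1)..R+1}")
          case True
          then show ?thesis using g(3)[of x] g(3)[of "x + X (n + n0)"] by simp
        next
          case False
          then have "R < \<bar>x\<bar>" "R < \<bar>x + X (n + n0)\<bar>" using n0[of "n + n0"] by auto
          then show ?thesis using g(4) False by simp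
        qed
      qed
      show "AE x in lebesgue. (\<lambda>n. \<bar>g (x + X (n + n0)) - g x\<bar>) \<longlonglongrightarrow> 0"
      proof (intro AE_I2)
        fix x
        have "(\<lambda>n. x + X (n + n0)) \<longlonglongrightarrow> x + 0"
          by (intro tendsto_intros LIMSEQ_ignore_initial_segment X)
        moreover have "isCont g (x + 0)" using g(1) by (simp add: continuous_on_eq_continuous_at)
        ultimately have "(\<lambda>n. g (x + X (n + n0))) \<longlonglongrightarrow> g (x + 0)"
          by (rule isCont_tendsto_compose[rotated])
        then have "(\<lambda>n. \<bar>g (x + X (n + n0)) - g x\<bar>) \<longlonglongrightarrow> \<bar>g (x + 0) - g x\<bar>"
          by (intro tendsto_intros)
        then show "(\<lambda>n. \<bar>g (x + X (n + n0)) - g x\<bar>) \<longlonglongrightarrow> 0" by simp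
      qed
      show "(\<lambda>x. \<bar>g (x + X (n + n0)) - g x\<bar>) \<in> borel_measurable lebesgue" for n
        using gt(1) g(5) by auto
    qed auto
    then show "(\<lambda>n. LINT x|lebesgue. \<bar>g (x + X n) - g x\<bar>) \<longlonglongrightarrow> 0"
      using LIMSEQ_offset[of "\<lambda>n. LINT x|lebesgue. \<bar>g (x + X n) - g x\<bar>" n0 0] by simp
  qed
  then have "eventually (\<lambda>h. (LINT x|lebesgue. \<bar>g (x + h) - g x\<bar>) < e / 3) (at 0)"
    using e by (intro order_tendstoD(2)[of _ 0]) auto
  then show "eventually (\<lambda>h. dist (LINT x|lebesgue. \<bar>f (x + h) - f x\<bar>) 0 < e) (at 0)"
  proof eventually_elim
    case (elim h)
    have d: "integrable lebesgue (\<lambda>x. \<bar>f x - g x\<bar>)" using f g(5) by auto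
    have dm: "(\<lambda>x. \<bar>f x - g x\<bar>) \<in> borel_measurable borel" by measurable
    have dt: "integrable lebesgue (\<lambda>x. \<bar>f (x + h) - g (x + h)\<bar>)"
      "(LINT x|lebesgue. \<bar>f (x + h) - g (x + h)\<bar>) = (LINT x|lebesgue. \<bar>f x - g x\<bar>)"
      using LINT_translate[OF dm, of h] d by auto
    have "(LINT x|lebesgue. \<bar>f (x + h) - f x\<bar>) \<le>
        (LINT x|lebesgue. (\<bar>f (x + h) - g (x + h)\<bar> + \<bar>g (x + h) - g x\<bar>) + \<bar>f x - g x\<bar>)"
      by (rule Bochner_Integration.integral_mono) (use f gt g(5) in auto)
    also have "\<dots> = (LINT x|lebesgue. \<bar>f (x + h) - g (x + h)\<bar> + \<bar>g (x + h) - g x\<bar>) + (LINT x|lebesgue. \<bar>f x - g x\<bar>)"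
      by (rule Bochner_Integration.integral_add) (use dt d gt g(5) in auto)
    also have "(LINT x|lebesgue. \<bar>f (x + h) - g (x + h)\<bar> + \<bar>g (x + h) - g x\<bar>) = (LINT x|lebesgue. \<bar>f (x + h) - g (x + h)\<bar>) + (LINT x|lebesgue. \<bar>g (x + h) - g x\<bar>)"
      by (rule Bochner_Integration.integral_add) (use dt d gt g(5) in auto)
    finally have "(LINT x|lebesgue. \<bar>f (x + h) - f x\<bar>) < e" using elim g(6) dt(2) by linarith
    moreover have "0 \<le> (LINT x|lebesgue. \<bar>f (x + h) - f x\<bar>)" by simp
    ultimately show ?case by (simp add: dist_real_def)
  qed
qed

section \<open>The survival function\<close>

text \<open>
  Translates and products on the plane are measurable for Borel functions, not for Lebesgue measurable ones;
  passing to a Borel representative that vanishes outside \<open>[0,l)\<close> makes Fubini available.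
\<close>
lemma borel_version:
  fixes f :: "real \<Rightarrow> real"
  assumes "f \<in> borel_measurable (lebesgue_on {0..l})"
  shows "\<exists>v. v \<in> borel_measurable borel \<and> (\<forall>x. x \<notin> {0..<l} \<longrightarrow> v x = 0) \<and> (AE x in lebesgue_on {0..l}. f x = v x)"
proof -
  have "(\<lambda>x. if x \<in> {0..l} then f x else 0) \<in> borel_measurable lebesgue"
    using assms borel_measurable_if[of "{0..l}" f] by simp
  then obtain v where v: "v \<in> borel_measurable lborel" "AE x in lborel. (if x \<in> {0..l} then f x else 0) = v x"
    using completion_ex_borel_measurable_real by blast
  have vm: "v \<in> borel_measurable borel" using v(1) by simp
  have "AE x in lebesgue. (if x \<in> {0..l} then f x else 0) = v x" by (rule AE_completion[OF v(2)])
  moreover have "AE x in lebesgue. x \<noteq> l" by (rule AE_completion[OF AE_lborel_singleton])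
  ultimately have "AE x in lebesgue. x \<in> {0..l} \<longrightarrow> f x = indicator {0..<l} x * v x"
    by eventually_elim (auto simp: indicator_def)
  then have "AE x in lebesgue_on {0..l}. f x = indicator {0..<l} x * v x"
    by (subst AE_restrict_space_iff) simp_all
  moreover have "(\<lambda>x. indicator {0..<l} x * v x) \<in> borel_measurable borel"
    using vm by measurable
  ultimately show ?thesis
    by (intro exI[of _ "\<lambda>x. indicator {0..<l} x * v x"]) auto
qed

locale repair_system =
  fixes l lam1 :: real and \<mu> :: "real \<Rightarrow> real"
  assumes l_pos: "0 < l" and lam_pos: "0 < lam1" and rate: "repair_rate l \<mu>"
begin

abbreviation M where "M \<equiv> lebesgue_on {0..l}"

lemma mu_measurable: "\<mu> \<in> borel_measurable M"
  and mu_nonneg: "x \<in> {0..l} \<Longrightarrow> 0 \<le> \<mu> x"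
  and mu_nn_finite: "0 \<le> c \<Longrightarrow> c < l \<Longrightarrow> (\<integral>\<^sup>+x. ennreal (\<mu> x) \<partial>lebesgue_on {0..c}) < \<infinity>"
  and mu_nn_infinite: "(\<integral>\<^sup>+x. ennreal (\<mu> x) \<partial>M) = \<infinity>"
  using rate by (auto simp: repair_rate_def)

lemma mu_integrable:
  assumes "0 \<le> c" "c < l"
  shows "integrable (lebesgue_on {0..c}) \<mu>"
proof (rule integrableI_nonneg)
  show "\<mu> \<in> borel_measurable (lebesgue_on {0..c})"
    by (rule measurable_restrict_mono[OF mu_measurable]) (use assms in auto)
  show "(\<integral>\<^sup>+ x. ennreal (\<mu> x) \<partial>lebesgue_on {0..c}) < \<infinity>" by (rule mu_nn_finite[OF assms])
qed (use assms mu_nonneg in auto)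

lemma mu_not_integrable: "\<not> integrable M \<mu>"
proof
  assume "integrable M \<mu>"
  then have "(\<integral>\<^sup>+x. ennreal (norm (\<mu> x)) \<partial>M) < \<infinity>" by (simp add: integrable_iff_bounded)
  also have "(\<integral>\<^sup>+x. ennreal (norm (\<mu> x)) \<partial>M) = (\<integral>\<^sup>+x. ennreal (\<mu> x) \<partial>M)"
    by (rule nn_integral_cong) (use mu_nonneg in auto)
  finally show False using mu_nn_infinite by simp
qed

definition hazard :: "real \<Rightarrow> real" where
  "hazard x = (LINT y|lebesgue_on {0..x}. \<mu> y)"

lemma hazard_deriv: "0 \<le> c \<Longrightarrow> c < l \<Longrightarrow> has_L1_deriv c hazard \<mu>"
  using has_L1_deriv_indefinite[OF mu_integrable, of c 0] by (simp add: hazard_def[abs_def])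

lemma hazard_mono: "0 \<le> x \<Longrightarrow> x \<le> y \<Longrightarrow> y < l \<Longrightarrow> hazard x \<le> hazard y"
  unfolding hazard_def
  by (rule integral_mono_lebesgue_on_AE) (use mu_integrable[of y] mu_nonneg in auto)

lemma hazard_nonneg: "0 \<le> x \<Longrightarrow> x < l \<Longrightarrow> 0 \<le> hazard x"
  using hazard_mono[of 0 x] by (simp add: hazard_def)

text \<open>
  Otherwise \<open>\<mu>\<close> would be integrable on \<open>[0,l]\<close>.
\<close>
lemma hazard_unbounded: "\<exists>c. 0 \<le> c \<and> c < l \<and> B < hazard c"
proof (rule ccontr)
  assume "\<not> ?thesis"
  then have "hazard c \<le> B" if "0 \<le> c" "c < l" for c using that by (meson not_less)
  then have "integrable M \<mu>"
    unfolding hazard_def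
    by (intro integrable_if_bounded_integrals[OF l_pos, of \<mu> B] mu_measurable mu_nonneg mu_integrable) auto
  then show False using mu_not_integrable by simp
qed

text \<open>
  The survival function of the repair time, extended by \<open>1\<close> to the left and by \<open>0\<close> to the right, so that
  translates need no case distinction.
\<close>
definition F :: "real \<Rightarrow> real" where
  "F x = (if x \<le> 0 then 1 else if x < l then exp (- hazard x) else 0)"

lemma F_eq: "0 \<le> x \<Longrightarrow> x < l \<Longrightarrow> F x = exp (- hazard x)"
  by (auto simp: F_def hazard_def)
lemma F_0 [simp]: "F 0 = 1" and F_neg: "x \<le> 0 \<Longrightarrow> F x = 1" and F_l: "l \<le> x \<Longrightarrow> F x = 0"
  using l_pos by (auto simp: F_def)
lemma F_pos: "x < l \<Longrightarrow> 0 < F x" by (auto simp: F_def)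
lemma F_nonneg: "0 \<le> F x" by (auto simp: F_def)
lemma F_le_1: "F x \<le> 1" using hazard_nonneg by (auto simp: F_def)
lemma F_antimono: "x \<le> y \<Longrightarrow> F y \<le> F x"
  using hazard_mono[of x y] hazard_nonneg[of y] by (auto simp: F_def)

text \<open>
  At \<open>l\<close> continuity is the divergence of \<open>\<integral> \<mu>\<close>.
\<close>
lemma F_isCont: "isCont F x"
proof -
  consider "x < l" | "l \<le> x" by linarith
  then show ?thesis
  proof cases
    case 1
    define c where "c = (max x 0 + l) / 2"
    have c: "x < c" "0 < c" "c < l" using 1 l_pos by (auto simp: c_def)
    have "continuous_on {0..c} hazard" by (rule has_L1_deriv_continuous_on[OF hazard_deriv]) (use c in auto)
    then have "continuous_on {..<c} (\<lambda>y. hazard (max 0 y))"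
      by (rule continuous_on_compose2) (use c in \<open>auto intro!: continuous_intros\<close>)
    then have "continuous_on {..<c} (\<lambda>y. exp (- hazard (max 0 y)))"
      by (intro continuous_on_exp continuous_on_minus)
    moreover have "F y = exp (- hazard (max 0 y))" if "y \<in> {..<c}" for y
    proof (cases "y \<le> 0")
      case True
      then have "max 0 y = 0" by simp
      then show ?thesis using True by (simp add: F_def hazard_def)
    next
      case False
      then show ?thesis using F_eq[of y] that c by simp
    qed
    ultimately have "continuous_on {..<c} F"
      by (rule continuous_on_cong[THEN iffD2, OF refl, rotated])
    then show ?thesis using c by (simp add: continuous_on_eq_continuous_at)
  next
    case 2
    show ?thesis
      unfolding isCont_def tendsto_iff eventually_at dist_real_def
    proof (intro allI impI)
      fix e :: real assume e: "0 < e"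
      obtain c where c: "0 \<le> c" "c < l" "- ln e < hazard c" using hazard_unbounded by blast
      have "exp (- hazard c) < exp (ln e)" using c(3) by simp
      then have "F c < e" using c(1,2) e by (simp add: F_eq)
      have "\<bar>F y - F x\<bar> < e" if "\<bar>y - x\<bar> < x - c" for y
      proof -
        have "c \<le> y" using that by linarith
        then have "F y < e" using F_antimono[of c y] \<open>F c < e\<close> by simp
        then show ?thesis using F_l[OF 2] F_nonneg[of y] by simp
      qed
      then show "\<exists>d>0. \<forall>y\<in>UNIV. y \<noteq> x \<and> \<bar>y - x\<bar> < d \<longrightarrow> \<bar>F y - F x\<bar> < e"
        using c 2 by (intro exI[of _ "x - c"]) auto
    qed
  qed
qed

lemma F_continuous: "continuous_on A F"
  by (simp add: F_isCont continuous_at_imp_continuous_on)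

lemma F_measurable [measurable]: "F \<in> borel_measurable borel"
  by (rule borel_measurable_continuous_onI[OF F_continuous])

lemma F_deriv_sub:
  assumes "0 \<le> c" "c < l"
  shows "has_L1_deriv c F (\<lambda>x. - (\<mu> x * F x))" and "has_L1_deriv c (\<lambda>x. 1 / F x) (\<lambda>x. \<mu> x / F x)"
proof -
  have h: "has_L1_deriv c (\<lambda>x. -1 * hazard x) (\<lambda>x. -1 * \<mu> x)"
    by (intro has_L1_deriv_cmult hazard_deriv assms)
  show "has_L1_deriv c F (\<lambda>x. - (\<mu> x * F x))"
    by (rule has_L1_deriv_cong[OF has_L1_deriv_exp[OF h]]) (use assms F_eq in auto)
  show "has_L1_deriv c (\<lambda>x. 1 / F x) (\<lambda>x. \<mu> x / F x)"
    by (rule has_L1_deriv_cong[OF has_L1_deriv_exp[OF hazard_deriv[OF assms]]])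
       (use assms F_eq in \<open>auto simp: exp_minus divide_inverse\<close>)
qed

lemma F_tendsto_l: "(\<lambda>n. F (l - l / real (n+2))) \<longlonglongrightarrow> 0"
proof -
  have "(\<lambda>n. F (l - l / real (n+2))) \<longlonglongrightarrow> F l"
    by (rule isCont_tendsto_compose[OF F_isCont exhausting_seq(3)[OF l_pos]])
  then show ?thesis by (simp add: F_l)
qed

lemma mu_times_F_integrable: "integrable M (\<lambda>x. \<mu> x * F x)"
proof (rule integrable_if_bounded_integrals[OF l_pos, where B=1])
  have [measurable]: "F \<in> borel_measurable M"
    using continuous_imp_integrable_real[OF F_continuous, of 0 l] by auto
  show "(\<lambda>x. \<mu> x * F x) \<in> borel_measurable M" using mu_measurable by measurable
  fix c :: real assume c: "0 \<le> c" "c < l"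
  have "has_L1_deriv c (\<lambda>x. -1 * F x) (\<lambda>x. -1 * - (\<mu> x * F x))" by (intro has_L1_deriv_cmult F_deriv_sub c)
  then have d: "has_L1_deriv c (\<lambda>x. - F x) (\<lambda>x. \<mu> x * F x)" by simp
  show "integrable (lebesgue_on {0..c}) (\<lambda>x. \<mu> x * F x)" by (rule has_L1_derivD(1)[OF d])
  have "- F c = - F 0 + (LINT x|lebesgue_on {0..c}. \<mu> x * F x)" by (rule has_L1_derivD(2)[OF d]) (use c in auto)
  then show "(LINT x|lebesgue_on {0..c}. \<mu> x * F x) \<le> 1" using F_nonneg[of c] by simp
qed (use mu_nonneg F_nonneg in auto)

text \<open>
  If \<open>p(l) \<noteq> 0\<close>, then \<open>|p|\<close> is bounded below near \<open>l\<close> and integrability of \<open>\<mu> p\<close> would make \<open>\<mu>\<close> integrable.  Thus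
  no mass leaves at \<open>l\<close>.
\<close>
lemma dom_vanishes_at_l:
  assumes p: "has_L1_deriv l p g" and i: "integrable M (\<lambda>x. \<mu> x * p x)"
  shows "p l = 0"
proof (rule ccontr)
  assume ne: "p l \<noteq> 0"
  define e where "e = \<bar>p l\<bar> / 2"
  have e: "0 < e" using ne by (simp add: e_def)
  have "continuous (at l within {0..l}) p"
    using has_L1_deriv_continuous_on[OF p] l_pos by (simp add: continuous_on_eq_continuous_within)
  then obtain d where d: "0 < d" "\<And>x. x \<in> {0..l} \<Longrightarrow> dist x l < d \<Longrightarrow> dist (p x) (p l) < e"
    unfolding continuous_within_eps_delta using e by blast
  define c where "c = max (l / 2) (l - d / 2)"
  have c: "0 \<le> c" "c < l" "l - d < c" using d(1) l_pos by (auto simp: c_def)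
  have big: "e \<le> \<bar>p x\<bar>" if "x \<in> {c..l}" for x
  proof -
    have "dist x l < d" using that c by (auto simp: dist_real_def)
    then have "\<bar>p x - p l\<bar> < e" using d(2)[of x] that c by (auto simp: dist_real_def)
    then show ?thesis unfolding e_def by arith
  qed
  have "integrable (lebesgue_on {c..l}) (\<lambda>x. \<mu> x)"
  proof (rule Bochner_Integration.integrable_bound)
    show "integrable (lebesgue_on {c..l}) (\<lambda>x. (1 / e) * (\<mu> x * p x))"
      using integrable_subinterval[OF i, of c l] c by simp
    show "\<mu> \<in> borel_measurable (lebesgue_on {c..l})"
      by (rule measurable_restrict_mono[OF mu_measurable]) (use c in auto)
    show "AE x in lebesgue_on {c..l}. norm (\<mu> x) \<le> norm (1 / e * (\<mu> x * p x))"
    proof (intro AE_I2)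
      fix x assume "x \<in> space (lebesgue_on {c..l})"
      then have x: "x \<in> {c..l}" by simp
      have "\<bar>\<mu> x\<bar> * e \<le> \<bar>\<mu> x\<bar> * \<bar>p x\<bar>" by (intro mult_left_mono big x) simp
      then show "norm (\<mu> x) \<le> norm (1 / e * (\<mu> x * p x))" using e by (simp add: abs_mult field_simps)
    qed
  qed
  then have "integrable M \<mu>" using integrable_combine[OF mu_integrable[OF c(1,2)]] c by simp
  then show False using mu_not_integrable by simp
qed

end

section \<open>The semiflow of the uncontrolled system\<close>

lemma LINT_Icc:
  fixes f :: "real \<Rightarrow> real"
  shows "(LINT x|lebesgue_on {a..b}. f x) = (LINT x|lebesgue. indicator {a..b} x * f x)"
    and "integrable (lebesgue_on {a..b}) f \<longleftrightarrow> integrable lebesgue (\<lambda>x. indicator {a..b} x * f x)"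
  by (rule LINT_lebesgue_on_indicator; simp)+

lemma LINT_reflect:
  fixes f :: "real \<Rightarrow> real"
  assumes f: "f \<in> borel_measurable borel"
  shows "(LINT s|lebesgue_on {a..b}. f (x - s)) = (LINT y|lebesgue_on {x-b..x-a}. f y)"
proof -
  have m: "(\<lambda>s. indicator {a..b} s * f (x - s)) \<in> borel_measurable borel"
    "(\<lambda>s. indicator {x-b..x-a} s * f s) \<in> borel_measurable borel" using f by measurable
  have "(LINT s|lborel. indicator {a..b} s * f (x - s)) = (LINT y|lborel. indicator {a..b} (x + (-1) * y) * f (x - (x + (-1) * y)))"
    using lborel_integral_real_affine[of "-1" "\<lambda>s. indicator {a..b} s * f (x - s)" x] by simp
  also have "\<dots> = (LINT y|lborel. indicator {x-b..x-a} y * f y)"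
    by (rule Bochner_Integration.integral_cong) (auto simp: indicator_def)
  finally show ?thesis using m by (simp add: LINT_lebesgue_on_indicator LINT_lborel_eq_lebesgue)
qed

lemma LINT_shift:
  fixes f :: "real \<Rightarrow> real"
  assumes f: "f \<in> borel_measurable borel"
  shows "(LINT s|lebesgue_on {a..b}. f (s - t)) = (LINT y|lebesgue_on {a-t..b-t}. f y)"
proof -
  have m: "(\<lambda>s. indicator {a..b} s * f (s - t)) \<in> borel_measurable borel" using f by measurable
  have "(LINT s|lebesgue. indicator {a..b} s * f (s - t)) = (LINT y|lebesgue. indicator {a..b} (y + t) * f (y + t - t))"
    using LINT_translate(1)[OF m, of t] by simp
  also have "\<dots> = (LINT y|lebesgue. indicator {a-t..b-t} y * f y)"
    by (rule Bochner_Integration.integral_cong) (auto simp: indicator_def)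
  finally show ?thesis by (simp add: LINT_lebesgue_on_indicator)
qed

context repair_system
begin

text \<open>
  Second components of states are represented by such functions, for which translation and division by \<open>F\<close>
  are meaningful pointwise.
\<close>
definition profile :: "(real \<Rightarrow> real) \<Rightarrow> bool" where
  "profile v \<longleftrightarrow> v \<in> borel_measurable borel \<and> integrable lebesgue v \<and> (\<forall>x. x \<notin> {0..<l} \<longrightarrow> v x = 0)"

text \<open>
  The datum transported along characteristics: the initial state for \<open>y \<ge> 0\<close>, the inflow at time \<open>-y\<close> for
  \<open>y < 0\<close>.  Division by \<open>F y = 0\<close> at \<open>y \<ge> l\<close> gives \<open>0\<close>, which is intended.
\<close>
definition h :: "(real \<Rightarrow> real) \<Rightarrow> (real \<Rightarrow> real) \<Rightarrow> real \<Rightarrow> real" where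
  "h p v y = (if y < 0 then lam1 * p (- y) else v y / F y)"

definition flow :: "(real \<Rightarrow> real) \<Rightarrow> (real \<Rightarrow> real) \<Rightarrow> real \<Rightarrow> state" where
  "flow p v t = (p t, \<lambda>x. F x * h p v (x - t))"

lemma profileD:
  assumes "profile v"
  shows "v \<in> borel_measurable borel" "integrable lebesgue v" "x \<notin> {0..<l} \<Longrightarrow> v x = 0"
  using assms by (auto simp: profile_def)

lemma h_measurable:
  assumes "continuous_on UNIV p" "v \<in> borel_measurable borel"
  shows "h p v \<in> borel_measurable borel"
proof -
  have [measurable]: "p \<in> borel_measurable borel" by (rule borel_measurable_continuous_onI[OF assms(1)])
  note [measurable] = assms(2)
  show ?thesis unfolding h_def[abs_def] by measurable
qed

lemma h_abs: "\<bar>h p v y\<bar> = h (\<lambda>t. \<bar>p t\<bar>) (\<lambda>x. \<bar>v x\<bar>) y"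
  using lam_pos F_nonneg by (simp add: h_def abs_mult)

lemma profile_diff: "profile v \<Longrightarrow> profile v' \<Longrightarrow> profile (\<lambda>x. v x - v' x)"
  by (auto simp: profile_def)
lemma profile_abs: "profile v \<Longrightarrow> profile (\<lambda>x. \<bar>v x\<bar>)"
  by (auto simp: profile_def)

text \<open>
  Mass that was present at time \<open>0\<close> is damped by \<open>F(x)/F(x - t) \<le> 1\<close>, mass that entered later by \<open>F(x) \<le> 1\<close>.
\<close>
lemma transport_le:
  assumes t: "0 \<le> t" and v: "profile v"
  shows "indicator {0..l} x * \<bar>F x * h p v (x - t)\<bar> \<le> indicator {0..t} x * (lam1 * \<bar>p (t - x)\<bar>) + \<bar>v (x - t)\<bar>"
proof (cases "x \<in> {0..l}")
  case True
  show ?thesis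
  proof (cases "x < t")
    case True
    then have "\<bar>F x * h p v (x - t)\<bar> \<le> 1 * (lam1 * \<bar>p (t - x)\<bar>)"
      unfolding abs_mult by (intro mult_mono) (use F_nonneg[of x] F_le_1[of x] lam_pos in \<open>auto simp: h_def abs_mult\<close>)
    then show ?thesis using True \<open>x \<in> {0..l}\<close> by simp
  next
    case False
    have nn: "0 \<le> indicator {0..t} x * (lam1 * \<bar>p (t - x)\<bar>)" using lam_pos by simp
    have "\<bar>F x * h p v (x - t)\<bar> \<le> \<bar>v (x - t)\<bar>"
    proof (cases "x - t < l")
      case True
      have "F x / F (x - t) \<le> 1" using F_antimono[of "x - t" x] F_pos[OF True] t by simp
      then have "F x / F (x - t) * \<bar>v (x - t)\<bar> \<le> 1 * \<bar>v (x - t)\<bar>" by (rule mult_right_mono) simp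
      then show ?thesis using False F_nonneg[of x] F_nonneg[of "x - t"] by (simp add: h_def abs_mult)
    next
      case False
      then show ?thesis using profileD(3)[OF v, of "x - t"] F_l[of "x - t"] \<open>\<not> x < t\<close> by (simp add: h_def)
    qed
    then show ?thesis using nn \<open>x \<in> {0..l}\<close> by simp
  qed
next
  case False
  have "0 \<le> indicator {0..t} x * (lam1 * \<bar>p (t - x)\<bar>)" using lam_pos by simp
  then show ?thesis using False by simp
qed

lemma transport_integrable:
  assumes t: "0 \<le> t" and v: "profile v" and p: "continuous_on UNIV p"
  shows "integrable M (\<lambda>x. F x * h p v (x - t))"
    and "(LINT x|M. \<bar>F x * h p v (x - t)\<bar>) \<le> lam1 * (LINT s|lebesgue_on {0..t}. \<bar>p s\<bar>) + (LINT x|lebesgue. \<bar>v x\<bar>)"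
proof -
  note [measurable] = h_measurable[OF p profileD(1)[OF v]]
  let ?g = "\<lambda>x. indicator {0..t} x * (lam1 * \<bar>p (t - x)\<bar>) + \<bar>v (x - t)\<bar>"
  have g1: "integrable lebesgue (\<lambda>x. indicator {0..t} x * (lam1 * \<bar>p (t - x)\<bar>))"
  proof -
    have "integrable (lebesgue_on {0..t}) (\<lambda>x. lam1 * \<bar>p (t - x)\<bar>)"
      by (rule continuous_imp_integrable_real) (intro continuous_intros continuous_on_compose2[OF p]; auto)
    then show ?thesis by (simp only: LINT_Icc)
  qed
  have vm: "(\<lambda>x. \<bar>v x\<bar>) \<in> borel_measurable borel" using profileD(1)[OF v] by measurable
  have g2: "integrable lebesgue (\<lambda>x. \<bar>v (x - t)\<bar>)" "(LINT x|lebesgue. \<bar>v (x - t)\<bar>) = (LINT x|lebesgue. \<bar>v x\<bar>)"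
    using LINT_translate[OF vm, of "-t"] profileD(2)[OF v] by auto
  have meas: "(\<lambda>x. indicator {0..l} x * (F x * h p v (x - t))) \<in> borel_measurable lebesgue"
    by (rule measurable_completion) simp
  have i: "integrable lebesgue (\<lambda>x. indicator {0..l} x * (F x * h p v (x - t)))"
  proof (rule Bochner_Integration.integrable_bound[OF Bochner_Integration.integrable_add[OF g1 g2(1)] meas])
    show "AE x in lebesgue. norm (indicator {0..l} x * (F x * h p v (x - t))) \<le> norm (?g x)"
    proof (intro AE_I2)
      fix x
      have "norm (indicator {0..l} x * (F x * h p v (x - t))) = indicator {0..l} x * \<bar>F x * h p v (x - t)\<bar>"
        by (simp add: abs_mult)
      also have "\<dots> \<le> ?g x" by (rule transport_le[OF t v])
      finally show "norm (indicator {0..l} x * (F x * h p v (x - t))) \<le> norm (?g x)" by simp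
    qed
  qed
  then show iM: "integrable M (\<lambda>x. F x * h p v (x - t))" by (simp only: LINT_Icc)
  have i': "integrable lebesgue (\<lambda>x. indicator {0..l} x * \<bar>F x * h p v (x - t)\<bar>)"
    using Bochner_Integration.integrable_abs[OF i] by (simp add: abs_mult)
  have "(LINT x|M. \<bar>F x * h p v (x - t)\<bar>) = (LINT x|lebesgue. indicator {0..l} x * \<bar>F x * h p v (x - t)\<bar>)"
    by (simp only: LINT_Icc)
  also have "\<dots> \<le> (LINT x|lebesgue. ?g x)"
    by (rule Bochner_Integration.integral_mono[OF i' Bochner_Integration.integrable_add[OF g1 g2(1)] transport_le[OF t v]])
  also have "\<dots> = (LINT x|lebesgue. indicator {0..t} x * (lam1 * \<bar>p (t - x)\<bar>)) + (LINT x|lebesgue. \<bar>v x\<bar>)"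
    using g1 g2 by simp
  also have "(LINT x|lebesgue. indicator {0..t} x * (lam1 * \<bar>p (t - x)\<bar>)) = (LINT x|lebesgue_on {0..t}. lam1 * \<bar>p (t - x)\<bar>)"
    by (simp only: LINT_Icc)
  also have "\<dots> = lam1 * (LINT x|lebesgue_on {0..t}. \<bar>p (t - x)\<bar>)" by simp
  also have "(LINT x|lebesgue_on {0..t}. \<bar>p (t - x)\<bar>) = (LINT x|lebesgue_on {t-t..t-0}. \<bar>p x\<bar>)"
    by (rule LINT_reflect) (use borel_measurable_continuous_onI[OF p] in measurable)
  finally show "(LINT x|M. \<bar>F x * h p v (x - t)\<bar>) \<le> lam1 * (LINT s|lebesgue_on {0..t}. \<bar>p s\<bar>) + (LINT x|lebesgue. \<bar>v x\<bar>)"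
    by simp
qed

text \<open>
  The last clause is conservation of mass.  It replaces the differential equation of the first component.
\<close>
definition flow_data :: "state \<Rightarrow> (real \<Rightarrow> real) \<Rightarrow> (real \<Rightarrow> real) \<Rightarrow> bool" where
  "flow_data P p v \<longleftrightarrow> P \<in> X_space l \<and> continuous_on UNIV p \<and> profile v \<and> (AE x in M. snd P x = v x) \<and>
     (\<forall>t\<ge>0. p t = fst P + (LINT x|lebesgue. v x) - (LINT x|M. F x * h p v (x - t)))"

text \<open>
  Splitting at \<open>x = t\<close> exhibits the mass balance as a Volterra equation with kernel \<open>\<lambda>\<^sub>1 F\<close>; the second integral
  depends on the initial state only.
\<close>
lemma transport_split:
  assumes t: "0 \<le> t" and v: "profile v" and p: "continuous_on UNIV p"
  shows "(LINT x|M. F x * h p v (x - t)) =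
    (LINT x|lebesgue_on {0..t}. lam1 * F x * p (t - x)) + (LINT y|lebesgue. F (y + t) / F y * v y)"
proof -
  have ne: "AE x in lebesgue. x \<noteq> t" by (rule AE_completion[OF AE_lborel_singleton])
  have k: "integrable lebesgue (\<lambda>x. indicator {0..t} x * (lam1 * F x * p (t - x)))"
  proof -
    have "integrable (lebesgue_on {0..t}) (\<lambda>x. lam1 * F x * p (t - x))"
      by (rule continuous_imp_integrable_real) (intro continuous_intros continuous_on_compose2[OF p] F_continuous; auto)
    then show ?thesis by (simp only: LINT_Icc)
  qed
  note [measurable] = profileD(1)[OF v]
  have wm: "(\<lambda>y. F (y + t) / F y * v y) \<in> borel_measurable borel" by measurable
  have w: "integrable lebesgue (\<lambda>y. F (y + t) / F y * v y)"
  proof (rule Bochner_Integration.integrable_bound[OF profileD(2)[OF v]])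
    show "(\<lambda>y. F (y + t) / F y * v y) \<in> borel_measurable lebesgue"
      by (rule measurable_completion) simp
    show "AE y in lebesgue. norm (F (y + t) / F y * v y) \<le> norm (v y)"
    proof (intro AE_I2)
      fix y
      show "norm (F (y + t) / F y * v y) \<le> norm (v y)"
      proof (cases "y < l")
        case True
        have "F (y + t) / F y \<le> 1" using F_antimono[of y "y + t"] F_pos[OF True] t by simp
        then have "F (y + t) / F y * \<bar>v y\<bar> \<le> 1 * \<bar>v y\<bar>" by (rule mult_right_mono) simp
        then show ?thesis using F_nonneg[of y] F_nonneg[of "y + t"] by (simp add: abs_mult)
      qed (use profileD(3)[OF v, of y] in auto)
    qed
  qed
  have w': "integrable lebesgue (\<lambda>x. F x / F (x - t) * v (x - t))"
    "(LINT x|lebesgue. F x / F (x - t) * v (x - t)) = (LINT y|lebesgue. F (y + t) / F y * v y)"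
    using LINT_translate[OF wm, of "-t"] w by auto
  have "(LINT x|M. F x * h p v (x - t)) = (LINT x|lebesgue. indicator {0..l} x * (F x * h p v (x - t)))"
    by (simp only: LINT_Icc)
  also have "\<dots> = (LINT x|lebesgue. indicator {0..t} x * (lam1 * F x * p (t - x)) + F x / F (x - t) * v (x - t))"
  proof (rule Bochner_Integration.integral_cong_AE)
    have h[measurable]: "h p v \<in> borel_measurable borel" by (rule h_measurable[OF p profileD(1)[OF v]])
    show "(\<lambda>x. indicator {0..l} x * (F x * h p v (x - t))) \<in> borel_measurable lebesgue"
      by (rule measurable_completion) simp
    show "(\<lambda>x. indicator {0..t} x * (lam1 * F x * p (t - x)) + F x / F (x - t) * v (x - t)) \<in> borel_measurable lebesgue"
      using k w'(1) by auto
    show "AE x in lebesgue. indicator {0..l} x * (F x * h p v (x - t)) = indicator {0..t} x * (lam1 * F x * p (t - x)) + F x / F (x - t) * v (x - t)"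
      using ne
    proof eventually_elim
      case (elim x)
      consider "x < 0" | "0 \<le> x" "x < t" | "t < x" "x \<le> l" | "t < x" "l < x" using elim by linarith
      then show ?case
      proof cases
        case 1 then show ?thesis using profileD(3)[OF v, of "x - t"] t by simp
      next
        case 2 then show ?thesis using profileD(3)[OF v, of "x - t"] F_l[of x] by (auto simp: h_def indicator_def)
      next
        case 3 then show ?thesis using t by (auto simp: h_def indicator_def)
      next
        case 4 then show ?thesis using F_l[of x] by (auto simp: indicator_def)
      qed
    qed
  qed
  also have "\<dots> = (LINT x|lebesgue. indicator {0..t} x * (lam1 * F x * p (t - x))) + (LINT y|lebesgue. F (y + t) / F y * v y)"
    using k w' by simp
  finally show ?thesis by (simp only: LINT_Icc)
qed

lemma flow_data_exists:
  assumes P: "P \<in> X_space l"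
  shows "\<exists>p v. flow_data P p v"
proof -
  have Pi: "integrable M (snd P)" using P by (simp add: X_space_def)
  obtain v where v: "v \<in> borel_measurable borel" "\<And>x. x \<notin> {0..<l} \<Longrightarrow> v x = 0" "AE x in M. snd P x = v x"
    using borel_version[OF borel_measurable_integrable[OF Pi]] by blast
  have vM: "v \<in> borel_measurable M"
    by (intro measurable_restrict_space1 measurable_completion) (use v(1) in simp)
  have "integrable M v"
    by (rule integrable_cong_AE_imp[OF Pi vM]) (rule v(3))
  moreover have "(\<lambda>x. indicator {0..l} x * v x) = v"
  proof
    fix x show "indicator {0..l} x * v x = v x" using v(2)[of x] by (cases "x \<in> {0..<l}") auto
  qed
  ultimately have vi: "integrable lebesgue v" by (simp add: LINT_Icc)
  have pv: "profile v" using v(1,2) vi by (simp add: profile_def)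
  define m where "m = fst P + (LINT x|lebesgue. v x)"
  define g where "g t = m - (LINT y|lebesgue. F (y + t) / F y * v y)" for t
  have le: "\<bar>F (y + t) / F y * v y\<bar> \<le> \<bar>v y\<bar>" if "0 \<le> t" for t y
  proof (cases "y < l")
    case True
    have "F (y + t) / F y \<le> 1" using F_antimono[of y "y + t"] F_pos[OF True] that by simp
    then have "F (y + t) / F y * \<bar>v y\<bar> \<le> 1 * \<bar>v y\<bar>" by (rule mult_right_mono) simp
    then show ?thesis using F_nonneg[of y] F_nonneg[of "y + t"] by (simp add: abs_mult)
  qed (use v(2)[of y] in auto)
  note [measurable] = v(1)
  have mm: "(\<lambda>y. F (y + t) / F y * v y) \<in> borel_measurable lebesgue" for t
    by (rule measurable_completion) simp
  have gc: "continuous_on {0..} g"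
    unfolding continuous_on_sequentially comp_def
  proof (intro ballI allI impI)
    fix x :: "nat \<Rightarrow> real" and a assume a: "a \<in> {0..}" "(\<forall>n. x n \<in> {0..}) \<and> x \<longlonglongrightarrow> a"
    have "(\<lambda>n. LINT y|lebesgue. F (y + x n) / F y * v y) \<longlonglongrightarrow> (LINT y|lebesgue. F (y + a) / F y * v y)"
    proof (rule integral_dominated_convergence)
      show "integrable lebesgue (\<lambda>y. \<bar>v y\<bar>)" using vi by simp
      show "AE y in lebesgue. norm (F (y + x n) / F y * v y) \<le> \<bar>v y\<bar>" for n
        using le a by auto
      show "AE y in lebesgue. (\<lambda>n. F (y + x n) / F y * v y) \<longlonglongrightarrow> F (y + a) / F y * v y"
      proof (intro AE_I2)
        fix y
        have "(\<lambda>n. F (y + x n)) \<longlonglongrightarrow> F (y + a)"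
          by (rule isCont_tendsto_compose[OF F_isCont]) (use a in \<open>auto intro!: tendsto_intros\<close>)
        then have "(\<lambda>n. F (y + x n) * (v y / F y)) \<longlonglongrightarrow> F (y + a) * (v y / F y)"
          by (rule tendsto_mult_right)
        then show "(\<lambda>n. F (y + x n) / F y * v y) \<longlonglongrightarrow> F (y + a) / F y * v y" by simp
      qed
    qed (use mm in auto)
    then show "(\<lambda>n. g (x n)) \<longlonglongrightarrow> g a" unfolding g_def by (intro tendsto_intros)
  qed
  have gb: "\<bar>g t\<bar> \<le> \<bar>m\<bar> + (LINT y|lebesgue. \<bar>v y\<bar>)" if t: "0 \<le> t" for t
  proof -
    have "\<bar>LINT y|lebesgue. F (y + t) / F y * v y\<bar> \<le> (LINT y|lebesgue. \<bar>F (y + t) / F y * v y\<bar>)"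
      by (rule integral_abs_bound)
    also have "\<dots> \<le> (LINT y|lebesgue. \<bar>v y\<bar>)"
    proof (rule Bochner_Integration.integral_mono)
      show "integrable lebesgue (\<lambda>y. \<bar>F (y + t) / F y * v y\<bar>)"
        by (intro Bochner_Integration.integrable_abs Bochner_Integration.integrable_bound[OF vi mm]) (use le[OF t] in auto)
    qed (use vi le[OF t] in auto)
    finally show ?thesis unfolding g_def by linarith
  qed
  have "\<exists>p. continuous_on UNIV p \<and> (\<forall>t\<ge>0. p t = g t - (LINT x|lebesgue_on {0..t}. (lam1 * F x) * p (t - x)))"
  proof (rule volterra_solution_exists[OF lam_pos _ _ gc gb])
    show "continuous_on UNIV (\<lambda>x. lam1 * F x)" by (intro continuous_intros F_continuous)
    show "\<bar>lam1 * F x\<bar> \<le> lam1" for x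
      using mult_left_mono[OF F_le_1[of x], of lam1] lam_pos F_nonneg[of x] by (simp add: abs_mult)
  qed
  then obtain p where p: "continuous_on UNIV p" "\<And>t. 0 \<le> t \<Longrightarrow> p t = g t - (LINT x|lebesgue_on {0..t}. (lam1 * F x) * p (t - x))"
    by blast
  have "p t = fst P + (LINT x|lebesgue. v x) - (LINT x|M. F x * h p v (x - t))" if "0 \<le> t" for t
    using p(2)[OF that] transport_split[OF that pv p(1)] unfolding g_def m_def by linarith
  then have "flow_data P p v" using P p(1) pv v(3) by (simp add: flow_data_def)
  then show ?thesis by blast
qed

lemma flow_dataD:
  assumes "flow_data P p v"
  shows "continuous_on UNIV p" "profile v" "AE x in M. snd P x = v x"
    "0 \<le> t \<Longrightarrow> p t = fst P + (LINT x|lebesgue. v x) - (LINT x|M. F x * h p v (x - t))"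
    "integrable M (snd P)"
  using assms by (auto simp: flow_data_def X_space_def)

lemma flow_in_X: "flow_data P p v \<Longrightarrow> 0 \<le> t \<Longrightarrow> flow p v t \<in> X_space l"
  using transport_integrable(1)[of t v p] flow_dataD by (auto simp: X_space_def flow_def)

lemma profile_LINT_M:
  assumes "profile v" shows "(LINT x|M. v x) = (LINT x|lebesgue. v x)" "integrable M v"
proof -
  have "(\<lambda>x. indicator {0..l} x * v x) = v"
  proof
    fix x show "indicator {0..l} x * v x = v x" using profileD(3)[OF assms, of x] by (cases "x \<in> {0..<l}") auto
  qed
  then show "(LINT x|M. v x) = (LINT x|lebesgue. v x)" "integrable M v"
    using profileD(2)[OF assms] by (simp_all add: LINT_Icc)
qed

lemma flow_0:
  assumes d: "flow_data P p v"
  shows "X_eq l (flow p v 0) P" and "\<And>x. x \<in> {0..l} \<Longrightarrow> F x * h p v x = v x"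
proof -
  show e: "F x * h p v x = v x" if "x \<in> {0..l}" for x
    using that F_pos[of x] profileD(3)[OF flow_dataD(2)[OF d], of x] by (cases "x < l") (auto simp: h_def)
  have "(LINT x|M. F x * h p v (x - 0)) = (LINT x|M. v x)"
    by (rule Bochner_Integration.integral_cong) (use e in auto)
  then have "p 0 = fst P" using flow_dataD(4)[OF d, of 0] profile_LINT_M[OF flow_dataD(2)[OF d]] by simp
  moreover have "AE x in M. F x * h p v x = snd P x"
    using flow_dataD(3)[OF d] AE_space[of M] by eventually_elim (use e in auto)
  ultimately show "X_eq l (flow p v 0) P" by (simp add: X_eq_def flow_def)
qed

text \<open>
  The Lipschitz constant of the semiflow on \<open>[0,T]\<close> that Gronwall's inequality provides.
\<close>
definition growth :: "real \<Rightarrow> real" where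
  "growth T = 4 * exp (2 * lam1 * T) * (1 + lam1 * T) + 1"

lemma growth_ge: "0 \<le> T \<Longrightarrow> 1 \<le> growth T"
  using lam_pos by (simp add: growth_def)

text \<open>
  The defining equations are linear, so the difference of two flows again has the transported form, and the
  mass balance gives a Gronwall inequality for its first component.
\<close>
lemma flow_lipschitz:
  assumes d: "flow_data P p v" and d': "flow_data P' p' v'" and t: "0 \<le> t" "t \<le> T"
  shows "X_norm l (X_diff (flow p v t) (flow p' v' t)) \<le> growth T * X_norm l (X_diff P P')"
proof -
  define q where "q t = p t - p' t" for t
  define w where "w x = v x - v' x" for x
  define D where "D = X_norm l (X_diff P P')"
  have q: "continuous_on UNIV q" unfolding q_def by (intro continuous_intros flow_dataD(1)[OF d] flow_dataD(1)[OF d'])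
  have w: "profile w" unfolding w_def by (intro profile_diff flow_dataD(2)[OF d] flow_dataD(2)[OF d'])
  note ti = transport_integrable(1)[OF _ flow_dataD(2)[OF d] flow_dataD(1)[OF d]]
     transport_integrable(1)[OF _ flow_dataD(2)[OF d'] flow_dataD(1)[OF d']]
  have hd: "F x * h q w y = F x * h p v y - F x * h p' v' y" for x y
    by (simp add: h_def q_def w_def diff_divide_distrib right_diff_distrib)
  have "(LINT x|M. \<bar>snd P x - snd P' x\<bar>) = (LINT x|M. \<bar>w x\<bar>)"
  proof (rule integral_cong_AE)
    have "AE x in M. snd P x - snd P' x = w x"
      using flow_dataD(3)[OF d] flow_dataD(3)[OF d'] by eventually_elim (simp add: w_def)
    then show ae: "AE x in M. \<bar>snd P x - snd P' x\<bar> = \<bar>w x\<bar>" by eventually_elim simp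
    show "(\<lambda>x. \<bar>w x\<bar>) \<in> borel_measurable M" using profile_LINT_M(2)[OF w] by auto
    show "(\<lambda>x. \<bar>snd P x - snd P' x\<bar>) \<in> borel_measurable M"
      using flow_dataD(5)[OF d] flow_dataD(5)[OF d'] by auto
  qed
  then have D: "D = \<bar>fst P - fst P'\<bar> + (LINT x|lebesgue. \<bar>w x\<bar>)"
    using profile_LINT_M(1)[OF profile_abs[OF w]] by (simp add: D_def X_norm_def X_diff_def)
  have W0: "0 \<le> (LINT x|lebesgue. \<bar>w x\<bar>)" by simp
  have D0: "0 \<le> D" using D W0 by linarith
  have qi: "integrable (lebesgue_on {0..s}) (\<lambda>r. \<bar>q r\<bar>)" for s
    by (intro Bochner_Integration.integrable_abs continuous_imp_integrable_real continuous_on_subset[OF q]) auto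
  have qle: "\<bar>q s\<bar> \<le> 2 * D + lam1 * (LINT r|lebesgue_on {0..s}. \<bar>q r\<bar>)" if s: "0 \<le> s" for s
  proof -
    have "q s = (fst P - fst P') + (LINT x|lebesgue. w x) - (LINT x|M. F x * h q w (x - s))"
      unfolding hd using flow_dataD(4)[OF d s] flow_dataD(4)[OF d' s] ti[OF s]
        profileD(2)[OF flow_dataD(2)[OF d]] profileD(2)[OF flow_dataD(2)[OF d']]
      by (simp add: q_def w_def)
    moreover have "\<bar>LINT x|lebesgue. w x\<bar> \<le> (LINT x|lebesgue. \<bar>w x\<bar>)" by (rule integral_abs_bound)
    moreover have "\<bar>LINT x|M. F x * h q w (x - s)\<bar> \<le> (LINT x|M. \<bar>F x * h q w (x - s)\<bar>)" by (rule integral_abs_bound)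
    moreover note transport_integrable(2)[OF s w q]
    ultimately show ?thesis using D W0 by linarith
  qed
  have "bounded (q ` {0..T})"
    by (intro compact_imp_bounded compact_continuous_image continuous_on_subset[OF q]) auto
  then obtain B where "\<forall>y\<in>q ` {0..T}. norm y \<le> B" unfolding bounded_iff by blast
  then have B: "\<And>s. s \<in> {0..T} \<Longrightarrow> 0 \<le> \<bar>q s\<bar> \<and> \<bar>q s\<bar> \<le> B" by simp
  define E where "E = 4 * D * exp (2 * lam1 * T)"
  have E0: "0 \<le> E" using D0 by (simp add: E_def)
  have qE: "\<bar>q s\<bar> \<le> E" if s: "s \<in> {0..T}" for s
  proof -
    have "\<bar>q s\<bar> \<le> 2 * (2 * D) * exp (2 * lam1 * s)"
      by (rule gronwall_bounded[OF lam_pos _ qi B qle s]) (use D0 in auto)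
    also have "\<dots> \<le> 2 * (2 * D) * exp (2 * lam1 * T)"
      using s lam_pos D0 by (intro mult_left_mono) auto
    finally show ?thesis by (simp add: E_def)
  qed
  have "(LINT r|lebesgue_on {0..t}. \<bar>q r\<bar>) \<le> (LINT r|lebesgue_on {0..t}. E)"
    by (rule Bochner_Integration.integral_mono[OF qi]) (use qE t in auto)
  also have "\<dots> = t * E" using t by (simp add: measure_restrict_space)
  also have "\<dots> \<le> T * E" by (intro mult_right_mono t E0)
  finally have qint: "lam1 * (LINT r|lebesgue_on {0..t}. \<bar>q r\<bar>) \<le> lam1 * (T * E)" using lam_pos by (intro mult_left_mono) auto
  have "X_norm l (X_diff (flow p v t) (flow p' v' t)) = \<bar>q t\<bar> + (LINT x|M. \<bar>F x * h q w (x - t)\<bar>)"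
    unfolding hd by (simp add: X_norm_def X_diff_def flow_def q_def)
  also have "\<dots> \<le> E + (lam1 * (T * E) + D)"
    using transport_integrable(2)[OF t(1) w q] qint qE[of t] t D by simp
  also have "\<dots> = growth T * D" by (simp add: growth_def E_def algebra_simps)
  finally show ?thesis by (simp add: D_def)
qed

end

context repair_system
begin

lemma profile_cut: "profile v \<Longrightarrow> A \<in> sets borel \<Longrightarrow> profile (\<lambda>x. indicator A x * v x)"
  unfolding profile_def
proof (intro conjI)
  assume v: "v \<in> borel_measurable borel \<and> integrable lebesgue v \<and> (\<forall>x. x \<notin> {0..<l} \<longrightarrow> v x = 0)" and A: "A \<in> sets borel"
  have [measurable]: "v \<in> borel_measurable borel" "A \<in> sets borel" using v A by auto
  show m: "(\<lambda>x. indicator A x * v x) \<in> borel_measurable borel" by measurable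
  show "integrable lebesgue (\<lambda>x. indicator A x * v x)"
  proof (rule Bochner_Integration.integrable_bound)
    show "integrable lebesgue v" using v by blast
    show "(\<lambda>x. indicator A x * v x) \<in> borel_measurable lebesgue" by (rule measurable_completion) (use m in simp)
  qed (auto simp: indicator_def)
  show "\<forall>x. x \<notin> {0..<l} \<longrightarrow> indicator A x * v x = 0" using v by simp
qed

text \<open>
  Near \<open>l\<close> the function \<open>h\<close> is not integrable, although \<open>F h\<close> is; the part of the profile near \<open>l\<close> has to be
  split off before translations of \<open>h\<close> are compared.
\<close>
lemma profile_tail:
  assumes v: "profile v" and e: "0 < e"
  shows "\<exists>a. 0 \<le> a \<and> a < l \<and> (LINT x|lebesgue. \<bar>indicator {a..} x * v x\<bar>) < e"
proof -
  define c where "c n = l - l / real (n+2)" for n :: nat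
  note cs = exhausting_seq[OF l_pos, folded c_def]
  have "(\<lambda>n. LINT x|lebesgue. \<bar>indicator {c n..} x * v x\<bar>) \<longlonglongrightarrow> (LINT x::real|lebesgue. 0)"
  proof (rule integral_dominated_convergence)
    show "integrable lebesgue (\<lambda>x. \<bar>v x\<bar>)" using profileD(2)[OF v] by simp
    show "(\<lambda>x. \<bar>indicator {c n..} x * v x\<bar>) \<in> borel_measurable lebesgue" for n
      using profileD(2)[OF profile_cut[OF v, of "{c n..}"]] by auto
    show "AE x in lebesgue. norm \<bar>indicator {c n..} x * v x\<bar> \<le> \<bar>v x\<bar>" for n
      by (auto simp: indicator_def)
    show "AE x in lebesgue. (\<lambda>n. \<bar>indicator {c n..} x * v x\<bar>) \<longlonglongrightarrow> 0"
    proof (intro AE_I2 tendsto_eventually)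
      fix x
      show "\<forall>\<^sub>F n in sequentially. \<bar>indicator {c n..} x * v x\<bar> = 0"
      proof (cases "x < l")
        case True
        then have "eventually (\<lambda>n. x < c n) sequentially" using cs(3) order_tendstoD(1) by blast
        then show ?thesis by eventually_elim simp
      qed (use profileD(3)[OF v, of x] in simp)
    qed
  qed auto
  then have "eventually (\<lambda>n. (LINT x|lebesgue. \<bar>indicator {c n..} x * v x\<bar>) < e) sequentially"
    using e by (intro order_tendstoD(2)[of _ 0]) auto
  then obtain n where "(LINT x|lebesgue. \<bar>indicator {c n..} x * v x\<bar>) < e"
    unfolding eventually_sequentially by blast
  then show ?thesis using cs(1,2) by blast
qed

lemma h_integrable_Icc:
  assumes p: "continuous_on UNIV p" and v: "profile v" and c: "c < l"
  shows "integrable (lebesgue_on {b..c}) (h p v)"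
proof -
  note [measurable] = h_measurable[OF p profileD(1)[OF v]]
  have "continuous_on {b..c} (\<lambda>y. lam1 * \<bar>p (- y)\<bar>)"
    by (intro continuous_intros continuous_on_compose2[OF p]) auto
  then have i1: "integrable (lebesgue_on {b..c}) (\<lambda>y. lam1 * \<bar>p (- y)\<bar>)"
    by (rule continuous_imp_integrable_real)
  have i2: "integrable (lebesgue_on {b..c}) (\<lambda>y. \<bar>v y\<bar> / F c)"
  proof -
    have "integrable (lebesgue_on {b..c}) v"
      using profileD(2)[OF profile_cut[OF v, of "{b..c}"]] by (simp add: LINT_Icc)
    then show ?thesis by simp
  qed
  show ?thesis
  proof (rule Bochner_Integration.integrable_bound[OF Bochner_Integration.integrable_add[OF i1 i2]])
    show "h p v \<in> borel_measurable (lebesgue_on {b..c})"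
      by (intro measurable_restrict_space1 measurable_completion) simp
    show "AE y in lebesgue_on {b..c}. norm (h p v y) \<le> norm (lam1 * \<bar>p (- y)\<bar> + \<bar>v y\<bar> / F c)"
    proof (intro AE_I2)
      fix y assume "y \<in> space (lebesgue_on {b..c})"
      then have y: "y \<le> c" by simp
      have Fc: "0 < F c" "F c \<le> F y" using F_pos[OF c] F_antimono[OF y] by auto
      then have Fy: "0 < F y" by linarith
      have "\<bar>v y\<bar> / F y \<le> \<bar>v y\<bar> / F c" using Fc Fy by (intro divide_left_mono) auto
      moreover have "0 \<le> lam1 * \<bar>p (- y)\<bar>" "0 \<le> \<bar>v y\<bar> / F c" using lam_pos Fc by auto
      moreover have "\<bar>h p v y\<bar> \<le> lam1 * \<bar>p (- y)\<bar> \<or> \<bar>h p v y\<bar> = \<bar>v y\<bar> / F y"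
        using lam_pos Fy by (auto simp: h_def abs_mult)
      ultimately show "norm (h p v y) \<le> norm (lam1 * \<bar>p (- y)\<bar> + \<bar>v y\<bar> / F c)" by auto
    qed
  qed
qed

text \<open>
  The part of \<open>h\<close> on a bounded interval to the left of some \<open>a < l\<close> is integrable, and its translates are continuous
  in mean; the rest contributes little, uniformly in time, by the bound for transported profiles.
\<close>
lemma flow_continuous:
  assumes d: "flow_data P p v" and t: "0 \<le> t"
  shows "((\<lambda>s. X_norm l (X_diff (flow p v s) (flow p v t))) \<longlongrightarrow> 0) (at t within {0..})"
proof -
  note p = flow_dataD(1)[OF d] and v = flow_dataD(2)[OF d]
  have pt: "((\<lambda>s. \<bar>p s - p t\<bar>) \<longlongrightarrow> 0) (at t within {0..})"
  proof -
    have "(p \<longlongrightarrow> p t) (at t within {0..})"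
      using p by (meson UNIV_I continuous_on_def subset_UNIV tendsto_within_subset)
    then have "((\<lambda>s. \<bar>p s - p t\<bar>) \<longlongrightarrow> \<bar>p t - p t\<bar>) (at t within {0..})" by (intro tendsto_intros)
    then show ?thesis by simp
  qed
  have "((\<lambda>s. LINT x|M. \<bar>F x * h p v (x - s) - F x * h p v (x - t)\<bar>) \<longlongrightarrow> 0) (at t within {0..})"
  proof (rule tendstoI)
    fix e :: real assume e: "0 < e"
    obtain a where a: "0 \<le> a" "a < l" "(LINT x|lebesgue. \<bar>indicator {a..} x * v x\<bar>) < e / 3"
      using profile_tail[OF v, of "e/3"] e by auto
    define w where "w x = indicator {a..} x * v x" for x
    have w: "profile w" unfolding w_def by (rule profile_cut[OF v]) simp
    define f where "f y = indicator {- (t+1)..a} y * (if y < a then h p v y else 0)" for y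
    have hm[measurable]: "h p v \<in> borel_measurable borel" by (rule h_measurable[OF p profileD(1)[OF v]])
    have fm[measurable]: "f \<in> borel_measurable borel" unfolding f_def by measurable
    have fi: "integrable lebesgue f"
    proof (rule Bochner_Integration.integrable_bound)
      show "integrable lebesgue (\<lambda>y. indicator {- (t+1)..a} y * h p v y)"
        using h_integrable_Icc[OF p v a(2), of "- (t+1)"] by (simp only: LINT_Icc)
      show "f \<in> borel_measurable lebesgue" by (rule measurable_completion) (use fm in simp)
    qed (auto simp: f_def indicator_def)
    have split: "h p v (x - s) = f (x - s) + h (\<lambda>_. 0) w (x - s)" if "0 \<le> x" "s \<le> t + 1" for x s
      using that a(1) by (auto simp: f_def h_def w_def indicator_def)
    have c0: "continuous_on UNIV (\<lambda>_::real. 0::real)" by simp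
    have tl: "integrable M (\<lambda>x. F x * h (\<lambda>_. 0) w (x - s))" "(LINT x|M. \<bar>F x * h (\<lambda>_. 0) w (x - s)\<bar>) < e / 3" if "0 \<le> s" for s
      using transport_integrable[OF that w c0] a(3) by (auto simp: w_def[symmetric])
    have fs: "integrable lebesgue (\<lambda>x. \<bar>f (x - s) - f (x - t)\<bar>)" for s
      using LINT_translate(2)[OF fm fi, of "-s"] LINT_translate(2)[OF fm fi, of "-t"] by auto
    have est: "(LINT x|M. \<bar>F x * h p v (x - s) - F x * h p v (x - t)\<bar>) < e / 3 + e / 3 + (LINT x|lebesgue. \<bar>f (x + (t - s)) - f x\<bar>)"
      if s: "0 \<le> s" "s \<le> t + 1" for s
    proof -
      let ?g = "\<lambda>x. indicator {0..l} x * (F x * h p v (x - s) - F x * h p v (x - t))"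
      have fM: "integrable M (\<lambda>x. \<bar>f (x - s) - f (x - t)\<bar>)" "(LINT x|M. \<bar>f (x - s) - f (x - t)\<bar>) \<le> (LINT x|lebesgue. \<bar>f (x - s) - f (x - t)\<bar>)"
      proof -
        have 1: "integrable lebesgue (\<lambda>x. indicator {0..l} x * \<bar>f (x - s) - f (x - t)\<bar>)"
        proof (rule Bochner_Integration.integrable_bound[OF fs[of s]])
          show "(\<lambda>x. indicator {0..l} x * \<bar>f (x - s) - f (x - t)\<bar>) \<in> borel_measurable lebesgue"
            by (rule measurable_completion) simp
        qed (auto simp: indicator_def)
        then show "integrable M (\<lambda>x. \<bar>f (x - s) - f (x - t)\<bar>)" by (simp only: LINT_Icc)
        show "(LINT x|M. \<bar>f (x - s) - f (x - t)\<bar>) \<le> (LINT x|lebesgue. \<bar>f (x - s) - f (x - t)\<bar>)"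
          unfolding LINT_Icc by (rule Bochner_Integration.integral_mono[OF 1 fs]) (auto simp: indicator_def)
      qed
      have tri: "a = b + (u - w) \<Longrightarrow> \<bar>b\<bar> \<le> 1 * c \<Longrightarrow> \<bar>a\<bar> \<le> c + (\<bar>u\<bar> + \<bar>w\<bar>)" for a b c u w :: real
        by linarith
      note j1 = Bochner_Integration.integrable_abs[OF tl(1)[OF s(1)]]
        and j2 = Bochner_Integration.integrable_abs[OF tl(1)[OF t]]
      have bm: "(\<lambda>x. \<bar>f x\<bar>) \<in> borel_measurable borel" "(\<lambda>x. \<bar>f (x - s) - f (x - t)\<bar>) \<in> borel_measurable borel"
        by measurable
      have tr: "(LINT x|lebesgue. \<bar>f (x - s) - f (x - t)\<bar>) = (LINT x|lebesgue. \<bar>f (x + (t - s)) - f x\<bar>)"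
        using LINT_translate(1)[OF bm(2), of t] by (simp add: algebra_simps)
      have "(LINT x|M. \<bar>F x * h p v (x - s) - F x * h p v (x - t)\<bar>)
          \<le> (LINT x|M. \<bar>f (x - s) - f (x - t)\<bar> + (\<bar>F x * h (\<lambda>_. 0) w (x - s)\<bar> + \<bar>F x * h (\<lambda>_. 0) w (x - t)\<bar>))"
      proof (rule Bochner_Integration.integral_mono)
        show "integrable M (\<lambda>x. \<bar>F x * h p v (x - s) - F x * h p v (x - t)\<bar>)"
          using transport_integrable(1)[OF s(1) v p] transport_integrable(1)[OF t v p] by auto
        show "integrable M (\<lambda>x. \<bar>f (x - s) - f (x - t)\<bar> + (\<bar>F x * h (\<lambda>_. 0) w (x - s)\<bar> + \<bar>F x * h (\<lambda>_. 0) w (x - t)\<bar>))"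
          using fM(1) tl(1)[OF s(1)] tl(1)[OF t] by auto
        fix x assume "x \<in> space M"
        then have x: "0 \<le> x" by simp
        have "F x * h p v (x - s) - F x * h p v (x - t) = F x * (f (x - s) - f (x - t)) + (F x * h (\<lambda>_. 0) w (x - s) - F x * h (\<lambda>_. 0) w (x - t))"
          using split[OF x s(2)] split[OF x, of t] by (simp add: algebra_simps)
        moreover have "\<bar>F x * (f (x - s) - f (x - t))\<bar> \<le> 1 * \<bar>f (x - s) - f (x - t)\<bar>"
          unfolding abs_mult using F_nonneg[of x] F_le_1[of x] by (intro mult_right_mono) auto
        ultimately show "\<bar>F x * h p v (x - s) - F x * h p v (x - t)\<bar> \<le> \<bar>f (x - s) - f (x - t)\<bar> + (\<bar>F x * h (\<lambda>_. 0) w (x - s)\<bar> + \<bar>F x * h (\<lambda>_. 0) w (x - t)\<bar>)"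
          by (rule tri)
      qed
      also have "\<dots> = (LINT x|M. \<bar>f (x - s) - f (x - t)\<bar>) + ((LINT x|M. \<bar>F x * h (\<lambda>_. 0) w (x - s)\<bar>) + (LINT x|M. \<bar>F x * h (\<lambda>_. 0) w (x - t)\<bar>))"
        by (subst Bochner_Integration.integral_add[OF fM(1) Bochner_Integration.integrable_add[OF j1 j2]],
            subst Bochner_Integration.integral_add[OF j1 j2], rule refl)
      finally show ?thesis using fM(2) tr tl(2)[OF s(1)] tl(2)[OF t] by linarith
    qed
    have lim0: "((\<lambda>s. LINT x|lebesgue. \<bar>f (x + (t - s)) - f x\<bar>) \<longlongrightarrow> 0) (at t within {0..})"
    proof (rule filterlim_compose[OF L1_translation_continuous[OF fi fm]])
      have "((\<lambda>s. t - s) \<longlongrightarrow> t - t) (at t within {0..})" by (intro tendsto_intros)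
      then show "filterlim (\<lambda>s. t - s) (at 0) (at t within {0..})"
        by (intro filterlim_atI) (auto simp: eventually_at_filter)
    qed
    have ev1: "eventually (\<lambda>s. (LINT x|lebesgue. \<bar>f (x + (t - s)) - f x\<bar>) < e / 3) (at t within {0..})"
      by (rule order_tendstoD(2)[OF lim0]) (use e in simp)
    have ev2: "eventually (\<lambda>s. s \<in> {0..} \<and> s < t + 1) (at t within {0..})"
      unfolding eventually_at by (intro exI[of _ 1]) (auto simp: dist_real_def)
    show "eventually (\<lambda>s. dist (LINT x|M. \<bar>F x * h p v (x - s) - F x * h p v (x - t)\<bar>) 0 < e) (at t within {0..})"
      using ev1 ev2
    proof eventually_elim
      case (elim s)
      have "0 \<le> (LINT x|M. \<bar>F x * h p v (x - s) - F x * h p v (x - t)\<bar>)" by simp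
      then show ?case using est[of s] elim by (simp add: dist_real_def)
    qed
  qed
  from tendsto_add[OF pt this] show ?thesis by (simp add: X_norm_def X_diff_def flow_def)
qed

end

section \<open>The time integral of the semiflow lies in the domain\<close>

lemma integrable_shift:
  fixes f :: "real \<Rightarrow> real"
  assumes f: "f \<in> borel_measurable borel" and i: "integrable (lebesgue_on {a-t..b-t}) f"
  shows "integrable (lebesgue_on {a..b}) (\<lambda>s. f (s - t))"
proof -
  have m: "(\<lambda>s. indicator {a-t..b-t} s * f s) \<in> borel_measurable borel" using f by measurable
  have "integrable lebesgue (\<lambda>s. indicator {a-t..b-t} (s + -t) * f (s + -t))"
    by (rule LINT_translate(2)[OF m]) (use i in \<open>simp only: LINT_Icc\<close>)
  also have "(\<lambda>s. indicator {a-t..b-t} (s + -t) * f (s + -t)) = (\<lambda>s. indicator {a..b} s * f (s - t))"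
    by (auto simp: fun_eq_iff indicator_def)
  finally show ?thesis by (simp only: LINT_Icc)
qed

text \<open>
  Elements of the dual are bounded off a null set, so their products with integrable functions are integrable.
\<close>
lemma dual_times_integrable:
  assumes Q: "Q \<in> X_dual l" and f: "integrable (lebesgue_on {0..l}) f"
  shows "integrable (lebesgue_on {0..l}) (\<lambda>x. f x * snd Q x)"
proof -
  obtain C where C: "snd Q \<in> borel_measurable (lebesgue_on {0..l})" "AE x in lebesgue_on {0..l}. \<bar>snd Q x\<bar> \<le> C"
    using Q by (auto simp: X_dual_def)
  show ?thesis
  proof (rule Bochner_Integration.integrable_bound)
    show "integrable (lebesgue_on {0..l}) (\<lambda>x. C * f x)" using f by simp
    show "(\<lambda>x. f x * snd Q x) \<in> borel_measurable (lebesgue_on {0..l})" using f C(1) by auto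
    show "AE x in lebesgue_on {0..l}. norm (f x * snd Q x) \<le> norm (C * f x)"
      using C(2)
    proof eventually_elim
      case (elim x)
      have "\<bar>f x\<bar> * \<bar>snd Q x\<bar> \<le> \<bar>f x\<bar> * \<bar>C\<bar>" using elim by (intro mult_left_mono) auto
      then show ?case by (simp add: abs_mult mult.commute)
    qed
  qed
qed

context repair_system
begin

text \<open>
  With it, \<open>F x * Kint p v t x\<close> is the second component of the time integral of the flow over \<open>[0,t]\<close>.
\<close>
definition Kint :: "(real \<Rightarrow> real) \<Rightarrow> (real \<Rightarrow> real) \<Rightarrow> real \<Rightarrow> real \<Rightarrow> real" where
  "Kint p v t x = (LINT s|lebesgue_on {0..t}. h p v (x - s))"

lemma Kint_eq:
  assumes p: "continuous_on UNIV p" and v: "profile v"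
  shows "Kint p v t x = (LINT y|lebesgue_on {x - t..x}. h p v y)"
  using LINT_reflect[OF h_measurable[OF p profileD(1)[OF v]], where a=0 and b=t and x=x] by (simp add: Kint_def)

lemma Kint_measurable:
  assumes p: "continuous_on UNIV p" and v: "profile v"
  shows "Kint p v t \<in> borel_measurable borel"
proof -
  note hm[measurable] = h_measurable[OF p profileD(1)[OF v]]
  have m: "(\<lambda>s. indicator {0..t} s * h p v (x - s)) \<in> borel_measurable borel" for x by measurable
  have "Kint p v t = (\<lambda>x. LINT s|lborel. indicator {0..t} s * h p v (x - s))"
    by (simp add: fun_eq_iff Kint_def LINT_Icc LINT_lborel_eq_lebesgue(1)[OF m])
  also have "\<dots> \<in> borel_measurable borel"
    by (rule lborel.borel_measurable_lebesgue_integral) measurable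
  finally show ?thesis .
qed

text \<open>
  \<open>Kint p v t x\<close> is the integral of \<open>h\<close> over \<open>[x - t, x]\<close>, a window that moves with \<open>x\<close>.
\<close>
lemma Kint_deriv:
  assumes p: "continuous_on UNIV p" and v: "profile v" and t: "0 \<le> t" and c: "0 \<le> c" "c < l"
  shows "has_L1_deriv c (Kint p v t) (\<lambda>x. h p v x - h p v (x - t))"
  unfolding has_L1_deriv_def
proof (intro conjI ballI)
  note hm = h_measurable[OF p profileD(1)[OF v]]
  have i1: "integrable (lebesgue_on {0..x}) (h p v)" "integrable (lebesgue_on {-t..x}) (h p v)"
     and i2: "integrable (lebesgue_on {0..x}) (\<lambda>y. h p v (y - t))" if "x \<le> c" for x
  proof -
    show "integrable (lebesgue_on {0..x}) (h p v)" "integrable (lebesgue_on {-t..x}) (h p v)"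
      by (rule h_integrable_Icc[OF p v]; use c that in simp)+
    show "integrable (lebesgue_on {0..x}) (\<lambda>y. h p v (y - t))"
      by (rule integrable_shift[OF hm h_integrable_Icc[OF p v]]) (use c that t in simp)
  qed
  show "integrable (lebesgue_on {0..c}) (\<lambda>x. h p v x - h p v (x - t))" using i1(1) i2 by simp
  fix x assume x: "x \<in> {0..c}"
  let ?I = "\<lambda>a b. LINT y|lebesgue_on {a..b}. h p v y"
  have "?I (-t) x = ?I (-t) (x - t) + ?I (x - t) x"
    by (rule Equivalence_Measurable_On_Borel.integral_combine) (use i1 x t in auto)
  moreover have "?I (-t) x = ?I (-t) 0 + ?I 0 x"
    by (rule Equivalence_Measurable_On_Borel.integral_combine) (use i1 x t in auto)
  moreover have "(LINT y|lebesgue_on {0..x}. h p v (y - t)) = ?I (-t) (x - t)"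
    using LINT_shift[OF hm, where a=0 and b=x and t=t] by simp
  moreover have "(LINT y|lebesgue_on {0..x}. h p v y - h p v (y - t)) = ?I 0 x - (LINT y|lebesgue_on {0..x}. h p v (y - t))"
    using i1(1) i2 x by simp
  moreover have "Kint p v t 0 = ?I (-t) 0" "Kint p v t x = ?I (x - t) x" using Kint_eq[OF p v] by auto
  ultimately show "Kint p v t x = Kint p v t 0 + (LINT y|lebesgue_on {0..x}. h p v y - h p v (y - t))" by linarith
qed

text \<open>
  \<open>F(c) |h|\<close> is dominated by \<open>F |h|\<close> on \<open>[0,c]\<close>, since \<open>F\<close> decreases, and tends to \<open>0\<close> pointwise as \<open>c \<rightarrow> l\<close>.
\<close>
lemma FK_tendsto:
  assumes p: "continuous_on UNIV p" and v: "profile v" and t: "0 \<le> t"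
  shows "(\<lambda>n. F (l - l / real (n+2)) * Kint p v t (l - l / real (n+2))) \<longlonglongrightarrow> 0"
proof -
  define c where "c n = l - l / real (n+2)" for n :: nat
  note cs = exhausting_seq[OF l_pos, folded c_def] and Fc = F_tendsto_l[folded c_def]
  have [measurable]: "h p v \<in> borel_measurable borel" by (rule h_measurable[OF p profileD(1)[OF v]])
  let ?u = "\<lambda>n y. indicator {c n - t..c n} y * (F (c n) * h p v y)"
  have "(\<lambda>n. LINT y|lebesgue. ?u n y) \<longlonglongrightarrow> (LINT y::real|lebesgue. 0)"
  proof (rule integral_dominated_convergence)
    have "integrable (lebesgue_on {-t..0}) (\<lambda>y. lam1 * \<bar>p (- y)\<bar>)"
      by (rule continuous_imp_integrable_real) (intro continuous_intros continuous_on_compose2[OF p]; auto)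
    then show "integrable lebesgue (\<lambda>y. indicator {-t..0} y * (lam1 * \<bar>p (- y)\<bar>) + \<bar>v y\<bar>)"
      unfolding LINT_Icc using profileD(2)[OF v] by simp
    show "?u n \<in> borel_measurable lebesgue" for n
      by (rule measurable_completion) simp
    show "AE y in lebesgue. norm (?u n y) \<le> indicator {-t..0} y * (lam1 * \<bar>p (- y)\<bar>) + \<bar>v y\<bar>" for n
    proof (intro AE_I2)
      fix y
      have nn: "0 \<le> indicator {-t..0} y * (lam1 * \<bar>p (- y)\<bar>)" using lam_pos by simp
      show "norm (?u n y) \<le> indicator {-t..0} y * (lam1 * \<bar>p (- y)\<bar>) + \<bar>v y\<bar>"
      proof (cases "y \<in> {c n - t..c n}")
        case True
        show ?thesis
        proof (cases "y < 0")
          case True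
          have "\<bar>F (c n) * h p v y\<bar> \<le> 1 * (lam1 * \<bar>p (- y)\<bar>)"
            unfolding abs_mult using F_nonneg[of "c n"] F_le_1[of "c n"] lam_pos True
            by (intro mult_mono) (auto simp: h_def abs_mult)
          then show ?thesis using True \<open>y \<in> _\<close> cs(1)[of n] by auto
        next
          case False
          have y: "y \<le> c n" "y < l" using True cs(2)[of n] by auto
          have "F (c n) / F y \<le> 1" using F_antimono[OF y(1)] F_pos[OF y(2)] by simp
          then have "F (c n) / F y * \<bar>v y\<bar> \<le> 1 * \<bar>v y\<bar>" by (rule mult_right_mono) simp
          then have "\<bar>F (c n) * h p v y\<bar> \<le> \<bar>v y\<bar>" using False F_nonneg[of "c n"] F_nonneg[of y] by (simp add: h_def abs_mult)
          then show ?thesis using nn True by simp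
        qed
      qed (use nn in simp)
    qed
    show "AE y in lebesgue. (\<lambda>n. ?u n y) \<longlonglongrightarrow> 0"
    proof (intro AE_I2)
      fix y
      have "(\<lambda>n. F (c n) * \<bar>h p v y\<bar>) \<longlonglongrightarrow> 0 * \<bar>h p v y\<bar>" by (intro tendsto_intros Fc)
      then have z: "(\<lambda>n. F (c n) * \<bar>h p v y\<bar>) \<longlonglongrightarrow> 0" by simp
      show "(\<lambda>n. ?u n y) \<longlonglongrightarrow> 0"
        by (rule tendsto_rabs_zero_cancel, rule real_tendsto_sandwich[OF _ _ tendsto_const z])
           (auto simp: indicator_def abs_mult F_nonneg)
    qed
  qed auto
  moreover have "(LINT y|lebesgue. ?u n y) = F (c n) * Kint p v t (c n)" for n
  proof -
    have "(LINT y|lebesgue. ?u n y) = (LINT y|lebesgue_on {c n - t..c n}. F (c n) * h p v y)"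
      by (simp only: LINT_Icc)
    then show ?thesis by (simp add: Kint_eq[OF p v])
  qed
  ultimately show ?thesis unfolding c_def by simp
qed

lemma Fh_integrable:
  assumes p: "continuous_on UNIV p" and v: "profile v"
  shows "integrable M (\<lambda>x. F x * h p v x)" "(LINT x|M. F x * h p v x) = (LINT x|M. v x)"
proof -
  have e: "F x * h p v x = v x" if "x \<in> {0..l}" for x
    using that F_pos[of x] profileD(3)[OF v, of x] by (cases "x < l") (auto simp: h_def)
  show "integrable M (\<lambda>x. F x * h p v x)"
    by (rule Bochner_Integration.integrable_cong[THEN iffD2, OF refl _ profile_LINT_M(2)[OF v]]) (use e in auto)
  show "(LINT x|M. F x * h p v x) = (LINT x|M. v x)"
    by (rule Bochner_Integration.integral_cong) (use e in auto)
qed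

lemma FK_deriv_sub:
  assumes p: "continuous_on UNIV p" and v: "profile v" and t: "0 \<le> t" and c: "0 \<le> c" "c < l"
  shows "has_L1_deriv c (\<lambda>x. F x * Kint p v t x)
    (\<lambda>x. - (\<mu> x * (F x * Kint p v t x)) + (F x * h p v x - F x * h p v (x - t)))"
  by (rule has_L1_deriv_cong[OF has_L1_deriv_mult[OF F_deriv_sub(1)[OF c] Kint_deriv[OF p v t c]]])
     (auto simp: algebra_simps)

text \<open>
  Integrating the derivative of \<open>F Kint\<close> over \<open>[0,c]\<close> bounds the integral of \<open>\<mu> F Kint\<close> independently of \<open>c\<close>:
  the boundary term at \<open>c\<close> and the outgoing translate have a favourable sign.
\<close>
lemma mu_FK_integrable_nonneg:
  assumes p: "continuous_on UNIV p" and v: "profile v" and t: "0 \<le> t"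
    and pn: "\<And>x. 0 \<le> p x" and vn: "\<And>x. 0 \<le> v x"
  shows "integrable M (\<lambda>x. \<mu> x * (F x * Kint p v t x))"
proof (rule integrable_if_bounded_integrals[OF l_pos, where B="Kint p v t 0 + (LINT x|M. v x)"])
  have hn: "0 \<le> h p v y" for y using pn vn lam_pos F_nonneg by (simp add: h_def)
  have Kn: "0 \<le> Kint p v t y" for y unfolding Kint_def using hn by simp
  show "\<And>x. x \<in> {0..l} \<Longrightarrow> 0 \<le> \<mu> x * (F x * Kint p v t x)" using mu_nonneg F_nonneg Kn by auto
  have [measurable]: "Kint p v t \<in> borel_measurable M" "F \<in> borel_measurable M"
    using Kint_measurable[OF p v, of t] by (intro measurable_restrict_space1 measurable_completion; simp)+
  show "(\<lambda>x. \<mu> x * (F x * Kint p v t x)) \<in> borel_measurable M" using mu_measurable by measurable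
  fix c :: real assume c: "0 \<le> c" "c < l"
  let ?C = "lebesgue_on {0..c}"
  note d = FK_deriv_sub[OF p v t c]
  have j1: "integrable ?C (\<lambda>x. F x * h p v x)"
    by (rule integrable_subinterval[OF Fh_integrable(1)[OF p v]]) (use c in auto)
  have j2: "integrable ?C (\<lambda>x. F x * h p v (x - t))"
    by (rule integrable_subinterval[OF transport_integrable(1)[OF t v p]]) (use c in auto)
  have "integrable ?C (\<lambda>x. (F x * h p v x - F x * h p v (x - t)) - (- (\<mu> x * (F x * Kint p v t x)) + (F x * h p v x - F x * h p v (x - t))))"
    by (intro Bochner_Integration.integrable_diff j1 j2 has_L1_derivD(1)[OF d])
  then show i: "integrable ?C (\<lambda>x. \<mu> x * (F x * Kint p v t x))" by simp
  have "F c * Kint p v t c = F 0 * Kint p v t 0 + (LINT x|?C. - (\<mu> x * (F x * Kint p v t x)) + (F x * h p v x - F x * h p v (x - t)))"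
    by (rule has_L1_derivD(2)[OF d]) (use c in auto)
  also have "(LINT x|?C. - (\<mu> x * (F x * Kint p v t x)) + (F x * h p v x - F x * h p v (x - t))) =
     - (LINT x|?C. \<mu> x * (F x * Kint p v t x)) + ((LINT x|?C. F x * h p v x) - (LINT x|?C. F x * h p v (x - t)))"
    using i j1 j2 by simp
  finally have "(LINT x|?C. \<mu> x * (F x * Kint p v t x)) = Kint p v t 0 + (LINT x|?C. F x * h p v x) - (LINT x|?C. F x * h p v (x - t)) - F c * Kint p v t c"
    by simp
  moreover have "0 \<le> F c * Kint p v t c" using F_nonneg Kn by simp
  moreover have "0 \<le> (LINT x|?C. F x * h p v (x - t))" using F_nonneg hn by simp
  moreover have "(LINT x|?C. F x * h p v x) \<le> (LINT x|M. F x * h p v x)"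
    by (rule integral_mono_lebesgue_on_AE[OF Fh_integrable(1)[OF p v]]) (use F_nonneg hn c in auto)
  ultimately show "(LINT x|?C. \<mu> x * (F x * Kint p v t x)) \<le> Kint p v t 0 + (LINT x|M. v x)"
    using Fh_integrable(2)[OF p v] by linarith
qed

text \<open>
  The nonnegative case applies to the absolute values of the data.
\<close>
lemma mu_FK_integrable:
  assumes p: "continuous_on UNIV p" and v: "profile v" and t: "0 \<le> t"
  shows "integrable M (\<lambda>x. \<mu> x * (F x * Kint p v t x))"
proof (rule Bochner_Integration.integrable_bound)
  have pa: "continuous_on UNIV (\<lambda>x. \<bar>p x\<bar>)" by (intro continuous_intros p)
  show "integrable M (\<lambda>x. \<mu> x * (F x * Kint (\<lambda>x. \<bar>p x\<bar>) (\<lambda>x. \<bar>v x\<bar>) t x))"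
    by (rule mu_FK_integrable_nonneg[OF pa profile_abs[OF v] t]) auto
  have [measurable]: "Kint p v t \<in> borel_measurable M" "F \<in> borel_measurable M"
    using Kint_measurable[OF p v, of t] by (intro measurable_restrict_space1 measurable_completion; simp)+
  show "(\<lambda>x. \<mu> x * (F x * Kint p v t x)) \<in> borel_measurable M" using mu_measurable by measurable
  show "AE x in M. norm (\<mu> x * (F x * Kint p v t x)) \<le> norm (\<mu> x * (F x * Kint (\<lambda>x. \<bar>p x\<bar>) (\<lambda>x. \<bar>v x\<bar>) t x))"
  proof (intro AE_I2)
    fix x
    have "\<bar>Kint p v t x\<bar> \<le> Kint (\<lambda>x. \<bar>p x\<bar>) (\<lambda>x. \<bar>v x\<bar>) t x"
      unfolding Kint_def h_abs[symmetric] by (rule integral_abs_bound)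
    then show "norm (\<mu> x * (F x * Kint p v t x)) \<le> norm (\<mu> x * (F x * Kint (\<lambda>x. \<bar>p x\<bar>) (\<lambda>x. \<bar>v x\<bar>) t x))"
      unfolding real_norm_def abs_mult by (intro mult_left_mono) auto
  qed
qed

end

section \<open>Weak and mild form of scalar equations with jumps\<close>

text \<open>
  One-sided limits give local bounds, and a bisection argument makes them global.
\<close>
lemma regulated_bounded:
  fixes \<phi> :: "real \<Rightarrow> real"
  assumes T: "0 \<le> T"
    and L: "\<And>t. t \<in> {0<..T} \<Longrightarrow> \<exists>r. (\<phi> \<longlongrightarrow> r) (at_left t)"
    and R: "\<And>t. t \<in> {0..<T} \<Longrightarrow> \<exists>r. (\<phi> \<longlongrightarrow> r) (at_right t)"
  shows "\<exists>B. \<forall>t\<in>{0..T}. \<bar>\<phi> t\<bar> \<le> B"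
proof -
  define Q where "Q a b \<longleftrightarrow> (\<exists>B. \<forall>s\<in>{a..b} \<inter> {0..T}. \<bar>\<phi> s\<bar> \<le> B)" for a b
  have locL: "\<exists>d>0. \<exists>B. \<forall>s. x - d < s \<and> s < x \<and> s \<in> {0..T} \<longrightarrow> \<bar>\<phi> s\<bar> \<le> B" if x: "x \<in> {0..T}" for x
  proof (cases "0 < x")
    case True
    then obtain r where "(\<phi> \<longlongrightarrow> r) (at_left x)" using L x by auto
    then have "eventually (\<lambda>s. dist (\<phi> s) r < 1) (at_left x)" by (rule tendstoD) simp
    then obtain b where b: "b < x" "\<And>s. b < s \<Longrightarrow> s < x \<Longrightarrow> dist (\<phi> s) r < 1"
      unfolding eventually_at_left_field by blast
    have "\<bar>\<phi> s\<bar> \<le> \<bar>r\<bar> + 1" if "b < s" "s < x" for s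
      using b(2)[OF that] by (simp add: dist_real_def)
    then show ?thesis using b(1) by (intro exI[of _ "x - b"] conjI exI[of _ "\<bar>r\<bar> + 1"]) auto
  next
    case False
    then show ?thesis using x by (intro exI[of _ 1]) auto
  qed
  have locR: "\<exists>d>0. \<exists>B. \<forall>s. x < s \<and> s < x + d \<and> s \<in> {0..T} \<longrightarrow> \<bar>\<phi> s\<bar> \<le> B" if x: "x \<in> {0..T}" for x
  proof (cases "x < T")
    case True
    then obtain r where "(\<phi> \<longlongrightarrow> r) (at_right x)" using R x by auto
    then have "eventually (\<lambda>s. dist (\<phi> s) r < 1) (at_right x)" by (rule tendstoD) simp
    then obtain b where b: "b > x" "\<And>s. x < s \<Longrightarrow> s < b \<Longrightarrow> dist (\<phi> s) r < 1"
      unfolding eventually_at_right_field by blast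
    have "\<bar>\<phi> s\<bar> \<le> \<bar>r\<bar> + 1" if "x < s" "s < b" for s
      using b(2)[OF that] by (simp add: dist_real_def)
    then show ?thesis using b(1) by (intro exI[of _ "b - x"] conjI exI[of _ "\<bar>r\<bar> + 1"]) auto
  next
    case False
    then show ?thesis using x by (intro exI[of _ 1]) auto
  qed
  have "Q 0 T"
  proof (rule Bolzano[OF T])
    fix a b c assume "Q a b" "Q b c" "a \<le> b" "b \<le> c"
    then obtain B1 B2 where B: "\<And>s. s \<in> {a..b} \<inter> {0..T} \<Longrightarrow> \<bar>\<phi> s\<bar> \<le> B1" "\<And>s. s \<in> {b..c} \<inter> {0..T} \<Longrightarrow> \<bar>\<phi> s\<bar> \<le> B2"
      unfolding Q_def by blast
    show "Q a c"
      unfolding Q_def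
    proof (intro exI[of _ "max B1 B2"] ballI)
      fix s assume s: "s \<in> {a..c} \<inter> {0..T}"
      show "\<bar>\<phi> s\<bar> \<le> max B1 B2"
        using B(1)[of s] B(2)[of s] s by (cases "s \<le> b") auto
    qed
  next
    fix x assume "0 \<le> x" "x \<le> T"
    then have x: "x \<in> {0..T}" by simp
    obtain d1 B1 where 1: "d1 > 0" "\<And>s. x - d1 < s \<and> s < x \<and> s \<in> {0..T} \<Longrightarrow> \<bar>\<phi> s\<bar> \<le> B1" using locL[OF x] by blast
    obtain d2 B2 where 2: "d2 > 0" "\<And>s. x < s \<and> s < x + d2 \<and> s \<in> {0..T} \<Longrightarrow> \<bar>\<phi> s\<bar> \<le> B2" using locR[OF x] by blast
    show "\<exists>d>0. \<forall>a b. a \<le> x \<and> x \<le> b \<and> b - a < d \<longrightarrow> Q a b"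
    proof (intro exI[of _ "min d1 d2"] conjI allI impI)
      show "0 < min d1 d2" using 1 2 by simp
      fix a b assume ab: "a \<le> x \<and> x \<le> b \<and> b - a < min d1 d2"
      show "Q a b"
        unfolding Q_def
      proof (intro exI[of _ "max \<bar>\<phi> x\<bar> (max B1 B2)"] ballI)
        fix s assume s: "s \<in> {a..b} \<inter> {0..T}"
        consider "s < x" | "s = x" | "x < s" by linarith
        then show "\<bar>\<phi> s\<bar> \<le> max \<bar>\<phi> x\<bar> (max B1 B2)"
        proof cases
          case 1
          have "\<bar>\<phi> s\<bar> \<le> B1" by (rule \<open>\<And>s. x - d1 < s \<and> s < x \<and> s \<in> {0..T} \<Longrightarrow> \<bar>\<phi> s\<bar> \<le> B1\<close>) (use 1 s ab in auto)
          then show ?thesis by simp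
        next
          case 3
          have "\<bar>\<phi> s\<bar> \<le> B2" by (rule \<open>\<And>s. x < s \<and> s < x + d2 \<and> s \<in> {0..T} \<Longrightarrow> \<bar>\<phi> s\<bar> \<le> B2\<close>) (use 3 s ab in auto)
          then show ?thesis by simp
        qed simp
      qed
    qed
  qed
  then show ?thesis unfolding Q_def by auto
qed

lemma regulated_integrable:
  fixes \<phi> :: "real \<Rightarrow> real"
  assumes T: "0 \<le> T"
    and L: "\<And>t. t \<in> {0<..T} \<Longrightarrow> (\<phi> \<longlongrightarrow> \<phi> t) (at_left t)"
    and R: "\<And>t. t \<in> {0..<T} \<Longrightarrow> \<exists>r. (\<phi> \<longlongrightarrow> r) (at_right t)"
    and D: "finite D" "\<And>t. t \<in> {0..<T} \<Longrightarrow> t \<notin> D \<Longrightarrow> (\<phi> \<longlongrightarrow> \<phi> t) (at_right t)"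
  shows "integrable (lebesgue_on {0..T}) \<phi>"
proof -
  obtain B where B: "\<And>t. t \<in> {0..T} \<Longrightarrow> \<bar>\<phi> t\<bar> \<le> B"
    using regulated_bounded[OF T _ R] L by meson
  let ?S = "{0<..<T} - D"
  have "isCont \<phi> t" if "t \<in> ?S" for t
  proof -
    have "(\<phi> \<longlongrightarrow> \<phi> t) (at_left t)" "(\<phi> \<longlongrightarrow> \<phi> t) (at_right t)" using that L[of t] D(2)[of t] by auto
    then show ?thesis unfolding isCont_def by (rule filterlim_split_at)
  qed
  then have "continuous_on ?S \<phi>" by (intro continuous_at_imp_continuous_on) blast
  moreover have S: "?S \<in> sets lebesgue"
  proof (rule sets.Diff)
    show "D \<in> sets lebesgue" by (rule negligible_imp_sets[OF negligible_finite[OF D(1)]])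
  qed simp
  ultimately have "\<phi> \<in> borel_measurable (lebesgue_on ?S)"
    by (rule continuous_imp_measurable_on_sets_lebesgue)
  then have m1: "(\<lambda>x. if x \<in> ?S then \<phi> x else 0) \<in> borel_measurable lebesgue"
    by (rule borel_measurable_if_I[OF _ S])
  have "insert 0 (insert T D) \<in> null_sets lebesgue"
    using negligible_finite[OF D(1)] by (simp add: negligible_iff_null_sets[symmetric])
  then have "AE x in lebesgue. x \<notin> insert 0 (insert T D)" by (rule AE_not_in)
  then have ae: "AE x in lebesgue. (if x \<in> ?S then \<phi> x else 0) = (if x \<in> {0..T} then \<phi> x else 0)"
    by eventually_elim auto
  have "(\<lambda>x. if x \<in> {0..T} then \<phi> x else 0) \<in> borel_measurable lebesgue"
    by (rule borel_measurable_AE[OF m1 ae])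
  then have m: "\<phi> \<in> borel_measurable (lebesgue_on {0..T})"
    by (rule borel_measurable_if_D)
  interpret finite_measure "lebesgue_on {0..T}" by (rule finite_measure_lebesgue_on_Icc)
  show ?thesis by (rule integrable_const_bound[of _ B]) (use B m in auto)
qed

text \<open>
  A nonzero left limit would keep \<open>Z\<close> away from \<open>0\<close> on an interval, which is not a null set.
\<close>
lemma zero_at_left_continuity_point:
  fixes Z :: "real \<Rightarrow> real"
  assumes ae: "AE s in lebesgue_on {0..T}. Z s = 0" and t: "0 < t" "t \<le> T" and l: "(Z \<longlongrightarrow> Z t) (at_left t)"
  shows "Z t = 0"
proof (rule ccontr)
  assume "Z t \<noteq> 0"
  then have "eventually (\<lambda>s. Z s \<noteq> 0) (at_left t)" using l tendsto_imp_eventually_ne by blast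
  then obtain b where b: "b < t" "\<And>s. b < s \<Longrightarrow> s < t \<Longrightarrow> Z s \<noteq> 0"
    unfolding eventually_at_left_field by blast
  have "AE s in lebesgue. s \<in> {0..T} \<longrightarrow> Z s = 0" using ae by (subst (asm) AE_restrict_space_iff) auto
  then obtain N where N: "N \<in> null_sets lebesgue" "{s \<in> space lebesgue. \<not> (s \<in> {0..T} \<longrightarrow> Z s = 0)} \<subseteq> N"
    by (auto elim!: AE_E3 simp: eventually_ae_filter)
  have "{max b 0<..<t} \<subseteq> N" using N(2) b t by auto
  then have "negligible {max b 0<..<t}" using N(1) by (metis negligible_iff_null_sets negligible_subset)
  then show False using b(1) t(1) negligible_interval(2)[of "max b 0" t] by (auto simp: box_real)
qed

text \<open>
  Continuous ramps converge boundedly to the indicator of \<open>(-\<infinity>,x)\<close>.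
\<close>
lemma du_Bois_Reymond:
  fixes Z :: "real \<Rightarrow> real"
  assumes Z: "integrable (lebesgue_on {0..T}) Z"
    and z: "\<And>\<eta>. continuous_on UNIV \<eta> \<Longrightarrow> (LINT t|lebesgue_on {0..T}. Z t * \<eta> t) = 0"
  shows "AE t in lebesgue_on {0..T}. Z t = 0"
proof (rule AE_zero_if_indefinite_integral_zero[OF Z])
  fix x assume x: "x \<in> {0..T}"
  \<comment> \<open>ramps that fall from \<open>1\<close> to \<open>0\<close> on \<open>[x - 1/n, x]\<close>\<close>
  define \<eta> where "\<eta> n s = max 0 (min 1 (real n * (x - s)))" for n :: nat and s :: real
  have c: "continuous_on UNIV (\<eta> n)" for n unfolding \<eta>_def by (intro continuous_intros)
  have "(\<lambda>n. LINT s|lebesgue_on {0..T}. Z s * \<eta> n s) \<longlonglongrightarrow> (LINT s|lebesgue_on {0..T}. indicator {..<x} s * Z s)"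
  proof (rule integral_dominated_convergence)
    show "integrable (lebesgue_on {0..T}) (\<lambda>s. \<bar>Z s\<bar>)" using Z by simp
    have im: "(indicator {..<x} :: real \<Rightarrow> real) \<in> borel_measurable (lebesgue_on {0..T})"
      by (intro measurable_restrict_space1 measurable_completion) simp
    show "(\<lambda>s. indicator {..<x} s * Z s) \<in> borel_measurable (lebesgue_on {0..T})"
      using Z im by auto
    show "(\<lambda>s. Z s * \<eta> n s) \<in> borel_measurable (lebesgue_on {0..T})" for n
      using continuous_times_integrable[OF continuous_on_subset[OF c subset_UNIV] Z, of n]
      by (auto simp: mult.commute)
    show "AE s in lebesgue_on {0..T}. norm (Z s * \<eta> n s) \<le> \<bar>Z s\<bar>" for n
    proof (intro AE_I2)
      fix s
      have "\<bar>Z s\<bar> * \<bar>\<eta> n s\<bar> \<le> \<bar>Z s\<bar> * 1" by (intro mult_left_mono) (auto simp: \<eta>_def)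
      then show "norm (Z s * \<eta> n s) \<le> \<bar>Z s\<bar>" by (simp add: abs_mult)
    qed
    show "AE s in lebesgue_on {0..T}. (\<lambda>n. Z s * \<eta> n s) \<longlonglongrightarrow> indicator {..<x} s * Z s"
    proof (intro AE_I2 tendsto_eventually)
      fix s :: real
      show "\<forall>\<^sub>F n in sequentially. Z s * \<eta> n s = indicator {..<x} s * Z s"
      proof (cases "s < x")
        case True
        obtain m :: nat where m: "1 / (x - s) \<le> real m" using real_arch_simple by blast
        have "Z s * \<eta> n s = indicator {..<x} s * Z s" if "m \<le> n" for n
        proof -
          have "1 / (x - s) \<le> real n" using m that by (meson of_nat_le_iff order_trans)
          then have "1 \<le> real n * (x - s)" using True by (simp add: field_simps)
          then show ?thesis using True by (simp add: \<eta>_def)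
        qed
        then show ?thesis unfolding eventually_sequentially by blast
      next
        case False
        have "real n * (x - s) \<le> 0" for n using False by (intro mult_nonneg_nonpos) auto
        then have "min 1 (real n * (x - s)) \<le> 0" for n by (meson min.coboundedI2)
        then have "\<eta> n s = 0" for n unfolding \<eta>_def by (rule max_absorb1)
        then show ?thesis using False by simp
      qed
    qed
  qed
  then have "(LINT s|lebesgue_on {0..T}. indicator {..<x} s * Z s) = 0"
    using z[OF c] by (simp add: LIMSEQ_const_iff)
  moreover have "(LINT s|lebesgue_on {0..T}. indicator {..<x} s * Z s) = (LINT s|lebesgue_on {0..T}. indicator {0..x} s * Z s)"
  proof (rule Bochner_Integration.integral_cong_AE)
    have "AE s in lebesgue. s \<noteq> x" by (rule AE_completion[OF AE_lborel_singleton])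
    then have "AE s in lebesgue. s \<in> {0..T} \<longrightarrow> indicator {..<x} s * Z s = indicator {0..x} s * Z s"
      by eventually_elim (auto simp: indicator_def)
    then show "AE s in lebesgue_on {0..T}. indicator {..<x} s * Z s = indicator {0..x} s * Z s"
      by (subst AE_restrict_space_iff) simp_all
    have "(indicator {..<x} :: real \<Rightarrow> real) \<in> borel_measurable (lebesgue_on {0..T})"
      "(indicator {0..x} :: real \<Rightarrow> real) \<in> borel_measurable (lebesgue_on {0..T})"
      by (intro measurable_restrict_space1 measurable_completion; simp)+
    then show "(\<lambda>s. indicator {..<x} s * Z s) \<in> borel_measurable (lebesgue_on {0..T})"
      "(\<lambda>s. indicator {0..x} s * Z s) \<in> borel_measurable (lebesgue_on {0..T})" using Z by auto
  qed
  moreover have "(LINT s|lebesgue_on {0..T}. indicator {0..x} s * Z s) = (LINT s|lebesgue_on {0..x}. Z s)"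
    by (rule integral_lebesgue_on_restrict) (use x in auto)
  ultimately show "(LINT s|lebesgue_on {0..x}. Z s) = 0" by simp
qed

lemma jump_integral:
  fixes f :: "real \<Rightarrow> real"
  assumes f: "integrable (lebesgue_on {0..T}) f" and s: "s \<in> {0..T}"
  shows "integrable (lebesgue_on {0..T}) (\<lambda>t. if s < t then f t else 0)"
    and "(LINT t|lebesgue_on {0..T}. (if s < t then f t else 0)) = (LINT t|lebesgue_on {0..T}. f t) - (LINT t|lebesgue_on {0..s}. f t)"
proof -
  have im: "(indicator {s<..} :: real \<Rightarrow> real) \<in> borel_measurable (lebesgue_on {0..T})"
    "(indicator {0..s} :: real \<Rightarrow> real) \<in> borel_measurable (lebesgue_on {0..T})"
      by (intro measurable_restrict_space1 measurable_completion; simp)+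
  have i1: "integrable (lebesgue_on {0..T}) (\<lambda>t. indicator {s<..} t * f t)"
    by (rule Bochner_Integration.integrable_bound[OF f borel_measurable_times[OF im(1) borel_measurable_integrable[OF f]]])
       (auto simp: indicator_def)
  have i2: "integrable (lebesgue_on {0..T}) (\<lambda>t. indicator {0..s} t * f t)"
    by (rule Bochner_Integration.integrable_bound[OF f borel_measurable_times[OF im(2) borel_measurable_integrable[OF f]]])
       (auto simp: indicator_def)
  have e: "(\<lambda>t. if s < t then f t else 0) = (\<lambda>t. indicator {s<..} t * f t)" by (auto simp: indicator_def)
  show "integrable (lebesgue_on {0..T}) (\<lambda>t. if s < t then f t else 0)" unfolding e by (rule i1)
  have "(LINT t|lebesgue_on {0..T}. f t) = (LINT t|lebesgue_on {0..T}. indicator {s<..} t * f t + indicator {0..s} t * f t)"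
    by (rule Bochner_Integration.integral_cong) (use s in \<open>auto simp: indicator_def\<close>)
  also have "\<dots> = (LINT t|lebesgue_on {0..T}. indicator {s<..} t * f t) + (LINT t|lebesgue_on {0..T}. indicator {0..s} t * f t)"
    using i1 i2 by simp
  also have "(LINT t|lebesgue_on {0..T}. indicator {0..s} t * f t) = (LINT t|lebesgue_on {0..s}. f t)"
    by (rule integral_lebesgue_on_restrict) (use s in auto)
  finally show "(LINT t|lebesgue_on {0..T}. (if s < t then f t else 0)) = (LINT t|lebesgue_on {0..T}. f t) - (LINT t|lebesgue_on {0..s}. f t)"
    unfolding e by simp
qed

lemma jump_sum_integral:
  fixes f :: "real \<Rightarrow> real" and c \<tau> :: "nat \<Rightarrow> real"
  assumes f: "integrable (lebesgue_on {0..T}) f" and \<tau>: "\<forall>i\<in>{1..N}. 0 \<le> \<tau> i \<and> \<tau> i \<le> T"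
  shows "integrable (lebesgue_on {0..T}) (\<lambda>t. (\<Sum>i=1..N. if \<tau> i < t then c i else 0) * f t)"
    and "(LINT t|lebesgue_on {0..T}. (\<Sum>i=1..N. if \<tau> i < t then c i else 0) * f t) =
     (\<Sum>i=1..N. c i * ((LINT t|lebesgue_on {0..T}. f t) - (LINT t|lebesgue_on {0..\<tau> i}. f t)))"
proof -
  have e: "(\<Sum>i=1..N. if \<tau> i < t then c i else 0) * f t = (\<Sum>i=1..N. c i * (if \<tau> i < t then f t else 0))" for t
    unfolding sum_distrib_right by (intro sum.cong) auto
  have ji: "integrable (lebesgue_on {0..T}) (\<lambda>t. c i * (if \<tau> i < t then f t else 0))" if "i \<in> {1..N}" for i
    using jump_integral(1)[OF f, of "\<tau> i"] \<tau> that by auto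
  show "integrable (lebesgue_on {0..T}) (\<lambda>t. (\<Sum>i=1..N. if \<tau> i < t then c i else 0) * f t)"
    unfolding e by (intro Bochner_Integration.integrable_sum ji)
  have "(LINT t|lebesgue_on {0..T}. (\<Sum>i=1..N. c i * (if \<tau> i < t then f t else 0))) =
     (\<Sum>i=1..N. (LINT t|lebesgue_on {0..T}. c i * (if \<tau> i < t then f t else 0)))"
    by (rule Bochner_Integration.integral_sum[OF ji])
  also have "\<dots> = (\<Sum>i=1..N. c i * ((LINT t|lebesgue_on {0..T}. f t) - (LINT t|lebesgue_on {0..\<tau> i}. f t)))"
  proof (intro sum.cong refl)
    fix i assume i: "i \<in> {1..N}"
    have "(LINT t|lebesgue_on {0..T}. c i * (if \<tau> i < t then f t else 0)) = c i * (LINT t|lebesgue_on {0..T}. (if \<tau> i < t then f t else 0))"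
      by simp
    then show "(LINT t|lebesgue_on {0..T}. c i * (if \<tau> i < t then f t else 0)) = c i * ((LINT t|lebesgue_on {0..T}. f t) - (LINT t|lebesgue_on {0..\<tau> i}. f t))"
      using jump_integral(2)[OF f, of "\<tau> i"] \<tau> i by auto
  qed
  finally show "(LINT t|lebesgue_on {0..T}. (\<Sum>i=1..N. if \<tau> i < t then c i else 0) * f t) =
     (\<Sum>i=1..N. c i * ((LINT t|lebesgue_on {0..T}. f t) - (LINT t|lebesgue_on {0..\<tau> i}. f t)))"
    unfolding e .
qed

text \<open>
  The solution of \<open>w' = V + \<Sum> c i \<delta>(t - \<tau> i)\<close>, \<open>w(0) = w0\<close>, that is continuous from the left: an impulse acts only
  strictly after its time.
\<close>
definition mild :: "nat \<Rightarrow> (nat \<Rightarrow> real) \<Rightarrow> real \<Rightarrow> (real \<Rightarrow> real) \<Rightarrow> (nat \<Rightarrow> real) \<Rightarrow> real \<Rightarrow> real" where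
  "mild N \<tau> w0 V c t = w0 + (LINT s|lebesgue_on {0..t}. V s) + (\<Sum>i=1..N. if \<tau> i < t then c i else 0)"

text \<open>
  The product rule for the continuous part; each jump contributes \<open>\<psi>(T) - \<psi>(\<tau> i) = - \<psi>(\<tau> i)\<close>.
\<close>
lemma mild_weak:
  assumes T: "0 \<le> T" and V: "integrable (lebesgue_on {0..T}) V"
    and \<tau>: "\<forall>i\<in>{1..N}. 0 \<le> \<tau> i \<and> \<tau> i \<le> T"
    and \<psi>: "\<And>t. t \<in> {0..T} \<Longrightarrow> (\<psi> has_real_derivative \<psi>' t) (at t within {0..T})" "continuous_on {0..T} \<psi>'" "\<psi> T = 0"
  shows "integrable (lebesgue_on {0..T}) (\<lambda>t. mild N \<tau> w0 V c t * \<psi>' t)"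
    and "- (LINT t|lebesgue_on {0..T}. mild N \<tau> w0 V c t * \<psi>' t) =
      (LINT t|lebesgue_on {0..T}. V t * \<psi> t) + (\<Sum>i=1..N. c i * \<psi> (\<tau> i)) + w0 * \<psi> 0"
proof -
  let ?T = "lebesgue_on {0..T}" and ?f = "\<lambda>t. w0 + (LINT s|lebesgue_on {0..t}. V s)"
  have d: "has_L1_deriv T \<psi> \<psi>'" by (rule has_L1_deriv_C1[OF \<psi>(1,2)])
  have f: "has_L1_deriv T ?f V" by (rule has_L1_deriv_indefinite[OF V])
  have p: "has_L1_deriv T (\<lambda>t. ?f t * \<psi> t) (\<lambda>t. V t * \<psi> t + ?f t * \<psi>' t)" by (rule has_L1_deriv_mult[OF f d])
  have i1: "integrable ?T (\<lambda>t. V t * \<psi> t)"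
    using continuous_times_integrable[OF has_L1_deriv_continuous_on[OF d] V] by (simp add: mult.commute)
  have i2: "integrable ?T (\<lambda>t. ?f t * \<psi>' t)"
    by (rule continuous_times_integrable[OF has_L1_deriv_continuous_on[OF f] has_L1_derivD(1)[OF d]])
  note j = jump_sum_integral[OF has_L1_derivD(1)[OF d] \<tau>, of c]
  have e: "mild N \<tau> w0 V c t * \<psi>' t = ?f t * \<psi>' t + (\<Sum>i=1..N. if \<tau> i < t then c i else 0) * \<psi>' t" for t
    unfolding mild_def by (rule distrib_right)
  show "integrable ?T (\<lambda>t. mild N \<tau> w0 V c t * \<psi>' t)"
    unfolding e by (rule Bochner_Integration.integrable_add[OF i2 j(1)])
  have s: "(LINT t|?T. mild N \<tau> w0 V c t * \<psi>' t) = (LINT t|?T. ?f t * \<psi>' t) + (LINT t|?T. (\<Sum>i=1..N. if \<tau> i < t then c i else 0) * \<psi>' t)"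
    unfolding e by (rule Bochner_Integration.integral_add[OF i2 j(1)])
  have "?f T * \<psi> T = ?f 0 * \<psi> 0 + (LINT t|?T. V t * \<psi> t + ?f t * \<psi>' t)"
    by (rule has_L1_derivD(2)[OF p]) (use T in simp)
  then have A: "- (LINT t|?T. ?f t * \<psi>' t) = (LINT t|?T. V t * \<psi> t) + w0 * \<psi> 0"
    using Bochner_Integration.integral_add[OF i1 i2] \<psi>(3) by simp
  have "(LINT t|?T. \<psi>' t) - (LINT t|lebesgue_on {0..\<tau> i}. \<psi>' t) = - \<psi> (\<tau> i)" if i: "i \<in> {1..N}" for i
  proof -
    have "\<psi> T = \<psi> 0 + (LINT t|?T. \<psi>' t)" by (rule has_L1_derivD(2)[OF d]) (use T in simp)
    moreover have "\<psi> (\<tau> i) = \<psi> 0 + (LINT t|lebesgue_on {0..\<tau> i}. \<psi>' t)"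
      by (rule has_L1_derivD(2)[OF d]) (use \<tau> i in auto)
    ultimately show ?thesis using \<psi>(3) by simp
  qed
  then have "(\<Sum>i=1..N. c i * ((LINT t|?T. \<psi>' t) - (LINT t|lebesgue_on {0..\<tau> i}. \<psi>' t))) = (\<Sum>i=1..N. - (c i * \<psi> (\<tau> i)))"
    by (intro sum.cong) auto
  then have B: "(LINT t|?T. (\<Sum>i=1..N. if \<tau> i < t then c i else 0) * \<psi>' t) = - (\<Sum>i=1..N. c i * \<psi> (\<tau> i))"
    using j(2) by (simp add: sum_negf)
  show "- (LINT t|?T. mild N \<tau> w0 V c t * \<psi>' t) = (LINT t|?T. V t * \<psi> t) + (\<Sum>i=1..N. c i * \<psi> (\<tau> i)) + w0 * \<psi> 0"
    using s A B by linarith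
qed

lemma mild_left_continuous:
  assumes V: "integrable (lebesgue_on {0..T}) V" and t: "0 < t" "t \<le> T"
  shows "(mild N \<tau> w0 V c \<longlongrightarrow> mild N \<tau> w0 V c t) (at_left t)"
  unfolding mild_def
proof (intro tendsto_intros)
  have "continuous_on {0..T} (\<lambda>t. LINT s|lebesgue_on {0..t}. V s)" by (rule indefinite_integral_continuous_real[OF V])
  then have "((\<lambda>t. LINT s|lebesgue_on {0..t}. V s) \<longlongrightarrow> (LINT s|lebesgue_on {0..t}. V s)) (at t within {0..T})"
    using t by (auto simp: continuous_on_def)
  then have "((\<lambda>t. LINT s|lebesgue_on {0..t}. V s) \<longlongrightarrow> (LINT s|lebesgue_on {0..t}. V s)) (at t within {0..<t})"
    by (rule tendsto_within_subset) (use t in auto)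
  moreover have "at_left t = at t within {0..<t}"
    by (rule at_within_nhd[of _ "{0<..}"]) (use t in auto)
  ultimately show "((\<lambda>t. LINT s|lebesgue_on {0..t}. V s) \<longlongrightarrow> (LINT s|lebesgue_on {0..t}. V s)) (at_left t)" by simp
  fix i
  show "((\<lambda>t. if \<tau> i < t then c i else 0) \<longlongrightarrow> (if \<tau> i < t then c i else 0)) (at_left t)"
  proof (rule tendsto_eventually, cases "\<tau> i < t")
    case True
    then have "eventually (\<lambda>s. \<tau> i < s) (at_left t)" unfolding eventually_at_left_field by blast
    then show "\<forall>\<^sub>F s in at_left t. (if \<tau> i < s then c i else 0) = (if \<tau> i < t then c i else 0)"
      by eventually_elim (use True in simp)
  next
    case False
    have "eventually (\<lambda>s. s < t) (at_left t)" unfolding eventually_at_left_field using lt_ex by blast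
    then show "\<forall>\<^sub>F s in at_left t. (if \<tau> i < s then c i else 0) = (if \<tau> i < t then c i else 0)"
      by eventually_elim (use False in auto)
  qed
qed

text \<open>
  Since \<open>\<psi>'\<close> can be any continuous function, the difference of \<open>w\<close> and the mild expression vanishes almost
  everywhere, and at every point of continuity from the left.
\<close>
lemma weak_imp_mild:
  assumes T: "0 \<le> T" and V: "integrable (lebesgue_on {0..T}) V" and w: "integrable (lebesgue_on {0..T}) w"
    and \<tau>: "\<forall>i\<in>{1..N}. 0 \<le> \<tau> i \<and> \<tau> i \<le> T"
    and weak: "\<And>\<psi> \<psi>'. (\<forall>t\<in>{0..T}. (\<psi> has_real_derivative \<psi>' t) (at t within {0..T})) \<Longrightarrow> continuous_on {0..T} \<psi>' \<Longrightarrow> \<psi> T = 0 \<Longrightarrow>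
       - (LINT t|lebesgue_on {0..T}. w t * \<psi>' t) =
      (LINT t|lebesgue_on {0..T}. V t * \<psi> t) + (\<Sum>i=1..N. c i * \<psi> (\<tau> i)) + w0 * \<psi> 0"
    and t: "0 < t" "t \<le> T" and lc: "(w \<longlongrightarrow> w t) (at_left t)"
  shows "w t = mild N \<tau> w0 V c t"
proof -
  let ?m = "mild N \<tau> w0 V c" and ?T = "lebesgue_on {0..T}"
  have z: "(LINT s|?T. (w s - ?m s) * \<eta> s) = 0" if \<eta>: "continuous_on UNIV \<eta>" for \<eta>
  proof -
    define \<psi> where "\<psi> s = integral {0..s} \<eta> - integral {0..T} \<eta>" for s
    have c: "continuous_on {0..T} \<eta>" by (rule continuous_on_subset[OF \<eta>]) simp
    have \<psi>: "(\<psi> has_real_derivative \<eta> s) (at s within {0..T})" if "s \<in> {0..T}" for s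
    proof -
      have "((\<lambda>s. integral {0..s} \<eta>) has_real_derivative \<eta> s) (at s within {0..T})"
        by (rule integral_has_real_derivative[OF c that])
      then show ?thesis unfolding \<psi>_def by (auto intro!: derivative_eq_intros)
    qed
    note mw = mild_weak[OF T V \<tau> \<psi> c, of w0 c]
    have \<psi>T: "\<psi> T = 0" by (simp add: \<psi>_def)
    have "- (LINT t|?T. w t * \<eta> t) = - (LINT t|?T. ?m t * \<eta> t)"
      using weak[of \<psi> \<eta>] \<psi> c \<psi>T mw(2) by simp
    moreover have wi: "integrable ?T (\<lambda>t. w t * \<eta> t)"
      using continuous_times_integrable[OF c w] by (simp add: mult.commute)
    ultimately show "(LINT s|?T. (w s - ?m s) * \<eta> s) = 0"
      using mw(1)[OF _ \<psi>T] by (simp add: left_diff_distrib)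
  qed
  have mi: "integrable ?T ?m"
  proof -
    have "((\<lambda>s. s - T) has_real_derivative 1) (at s within {0..T})" for s by (auto intro!: derivative_eq_intros)
    then show ?thesis using mild_weak(1)[OF T V \<tau>, of "\<lambda>s. s - T" "\<lambda>_. 1" w0 c] by simp
  qed
  have ae: "AE s in ?T. w s - ?m s = 0"
    by (rule du_Bois_Reymond[OF Bochner_Integration.integrable_diff[OF w mi] z])
  have "((\<lambda>s. w s - ?m s) \<longlongrightarrow> w t - ?m t) (at_left t)"
    by (intro tendsto_diff lc mild_left_continuous[OF V t])
  from zero_at_left_continuity_point[OF ae t this] show ?thesis by simp
qed

section \<open>The semiflow solves the weak equation\<close>

context repair_system
begin

definition flow_integral :: "(real \<Rightarrow> real) \<Rightarrow> (real \<Rightarrow> real) \<Rightarrow> real \<Rightarrow> state" where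
  "flow_integral p v t = (LINT s|lebesgue_on {0..t}. p s, \<lambda>x. F x * Kint p v t x)"

text \<open>
  The outflow at \<open>l\<close> vanishes because \<open>F l = 0\<close>, so the formula on \<open>[0,c]\<close> persists up to \<open>l\<close>.
\<close>
lemma FK_deriv:
  assumes p: "continuous_on UNIV p" and v: "profile v" and t: "0 \<le> t"
  shows "has_L1_deriv l (\<lambda>x. F x * Kint p v t x)
    (\<lambda>x. - (\<mu> x * (F x * Kint p v t x)) + (F x * h p v x - F x * h p v (x - t)))"
proof (rule has_L1_deriv_extend[OF l_pos FK_deriv_sub[OF p v t]])
  show "integrable M (\<lambda>x. - (\<mu> x * (F x * Kint p v t x)) + (F x * h p v x - F x * h p v (x - t)))"
    by (intro Bochner_Integration.integrable_add Bochner_Integration.integrable_diff Bochner_Integration.integrable_minus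
        mu_FK_integrable[OF p v t] Fh_integrable(1)[OF p v] transport_integrable(1)[OF t v p])
  have "F l = 0" by (simp add: F_l)
  then show "(\<lambda>n. F (l - l / real (n+2)) * Kint p v t (l - l / real (n+2))) \<longlonglongrightarrow> F l * Kint p v t l"
    using FK_tendsto[OF p v t] by simp
qed

text \<open>
  This is the boundary condition in the domain of the system operator.
\<close>
lemma Kint_0:
  assumes p: "continuous_on UNIV p" and v: "profile v" and t: "0 \<le> t"
  shows "Kint p v t 0 = lam1 * (LINT s|lebesgue_on {0..t}. p s)"
proof -
  have "Kint p v t 0 = (LINT s|lebesgue_on {0..t}. lam1 * p s)"
    unfolding Kint_def
  proof (rule Bochner_Integration.integral_cong_AE)
    have pm: "p \<in> borel_measurable borel" by (rule borel_measurable_continuous_onI[OF p])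
    note [measurable] = h_measurable[OF p profileD(1)[OF v]] pm
    show "(\<lambda>s. h p v (0 - s)) \<in> borel_measurable (lebesgue_on {0..t})"
      "(\<lambda>s. lam1 * p s) \<in> borel_measurable (lebesgue_on {0..t})"
      by (intro measurable_restrict_space1 measurable_completion; simp)+
    have "AE s in lebesgue. s \<noteq> 0" by (rule AE_completion[OF AE_lborel_singleton])
    then have "AE s in lebesgue. s \<in> {0..t} \<longrightarrow> h p v (0 - s) = lam1 * p s"
      by eventually_elim (auto simp: h_def)
    then show "AE s in lebesgue_on {0..t}. h p v (0 - s) = lam1 * p s"
      by (subst AE_restrict_space_iff) simp_all
  qed
  then show ?thesis by simp
qed

lemma flow_integral_in_dom:
  assumes p: "continuous_on UNIV p" and v: "profile v" and t: "0 \<le> t"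
  shows "flow_integral p v t \<in> sys_dom l lam1 \<mu>"
  unfolding sys_dom_def X_space_def flow_integral_def
proof (intro CollectI conjI)
  note d = FK_deriv[OF p v t]
  show "\<exists>g. has_L1_deriv l (snd (LINT s|lebesgue_on {0..t}. p s, \<lambda>x. F x * Kint p v t x)) g" using d by auto
qed (use continuous_imp_integrable_real[OF has_L1_deriv_continuous_on[OF FK_deriv[OF p v t]]]
   mu_FK_integrable[OF p v t] Kint_0[OF p v t] in simp_all)

text \<open>
  The second component telescopes along characteristics.  For the first, integrate the derivative of
  \<open>F Kint\<close> over \<open>[0,l]\<close> and compare with the conservation of mass.
\<close>
lemma sys_op_flow_integral:
  assumes d: "flow_data P p v" and t: "0 \<le> t" and Q: "Q \<in> X_dual l"
  shows "pairing l (sys_op l lam1 \<mu> (flow_integral p v t)) Q = pairing l (flow p v t) Q - pairing l P Q"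
proof -
  note p = flow_dataD(1)[OF d] and v = flow_dataD(2)[OF d]
  let ?I = "\<lambda>x. F x * Kint p v t x"
  let ?g = "\<lambda>x. - (\<mu> x * (F x * Kint p v t x)) + (F x * h p v x - F x * h p v (x - t))"
  note D = FK_deriv[OF p v t]
  have D': "has_L1_deriv l ?I (L1_deriv l ?I)" unfolding L1_deriv_def by (rule someI[where P="has_L1_deriv l ?I", OF D])
  have ae: "AE x in M. L1_deriv l ?I x = ?g x" by (rule has_L1_deriv_unique[OF D' D])
  note j1 = mu_FK_integrable[OF p v t] and j2 = Fh_integrable[OF p v] and j3 = transport_integrable(1)[OF t v p]
  have "?I l = ?I 0 + (LINT x|M. ?g x)" by (rule has_L1_derivD(2)[OF D]) (use l_pos in simp)
  moreover have "(LINT x|M. ?g x) = - (LINT x|M. \<mu> x * ?I x) + ((LINT x|M. F x * h p v x) - (LINT x|M. F x * h p v (x - t)))"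
    using j1 j2(1) j3 by simp
  moreover have "p t = fst P + (LINT x|M. v x) - (LINT x|M. F x * h p v (x - t))"
    using flow_dataD(4)[OF d t] profile_LINT_M(1)[OF v] by simp
  ultimately have fst: "- lam1 * (LINT s|lebesgue_on {0..t}. p s) + (LINT x|M. \<mu> x * ?I x) = p t - fst P"
    using Kint_0[OF p v t] j2(2) by (simp add: F_l)
  have i3: "integrable M (\<lambda>x. (F x * h p v (x - t)) * snd Q x)" by (rule dual_times_integrable[OF Q j3])
  have i4: "integrable M (\<lambda>x. snd P x * snd Q x)" by (rule dual_times_integrable[OF Q flow_dataD(5)[OF d]])
  have "(LINT x|M. - (L1_deriv l ?I x + \<mu> x * ?I x) * snd Q x) = (LINT x|M. (F x * h p v (x - t)) * snd Q x - snd P x * snd Q x)"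
  proof (rule Bochner_Integration.integral_cong_AE)
    show "(\<lambda>x. - (L1_deriv l ?I x + \<mu> x * ?I x) * snd Q x) \<in> borel_measurable M"
      by (rule borel_measurable_integrable, rule dual_times_integrable[OF Q])
         (intro Bochner_Integration.integrable_minus Bochner_Integration.integrable_add j1 has_L1_derivD(1)[OF D'])
    show "(\<lambda>x. (F x * h p v (x - t)) * snd Q x - snd P x * snd Q x) \<in> borel_measurable M"
      by (intro borel_measurable_integrable Bochner_Integration.integrable_diff i3 i4)
    show "AE x in M. - (L1_deriv l ?I x + \<mu> x * ?I x) * snd Q x = (F x * h p v (x - t)) * snd Q x - snd P x * snd Q x"
      using ae flow_dataD(3)[OF d] AE_space[of M]
    proof eventually_elim
      case (elim x)
      have "F x * h p v x = snd P x" using flow_0(2)[OF d, of x] elim by simp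
      then have e: "- (L1_deriv l ?I x + \<mu> x * ?I x) = F x * h p v (x - t) - snd P x"
        using elim(1) by linarith
      show ?case unfolding e by (rule left_diff_distrib)
    qed
  qed
  also have "\<dots> = (LINT x|M. (F x * h p v (x - t)) * snd Q x) - (LINT x|M. snd P x * snd Q x)"
    by (rule Bochner_Integration.integral_diff[OF i3 i4])
  finally have "(LINT x|M. - (L1_deriv l ?I x + \<mu> x * ?I x) * snd Q x) = (LINT x|M. (F x * h p v (x - t)) * snd Q x) - (LINT x|M. snd P x * snd Q x)" .
  moreover have "pairing l (sys_op l lam1 \<mu> (flow_integral p v t)) Q =
     (- lam1 * (LINT s|lebesgue_on {0..t}. p s) + (LINT x|M. \<mu> x * ?I x)) * fst Q + (LINT x|M. - (L1_deriv l ?I x + \<mu> x * ?I x) * snd Q x)"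
    by (simp add: pairing_def sys_op_def flow_integral_def)
  ultimately show ?thesis unfolding fst by (simp add: pairing_def flow_def algebra_simps)
qed

text \<open>
  A Borel representative with a bound that holds everywhere, as required for Fubini.
\<close>
lemma dual_borel_version:
  assumes R: "R \<in> X_dual l"
  obtains r C where "r \<in> borel_measurable borel" "\<And>x. \<bar>r x\<bar> \<le> C" "AE x in M. snd R x = r x"
proof -
  obtain C where C: "snd R \<in> borel_measurable M" "AE x in M. \<bar>snd R x\<bar> \<le> C"
    using R by (auto simp: X_dual_def)
  obtain r0 where r0: "r0 \<in> borel_measurable borel" "AE x in M. snd R x = r0 x"
    using borel_version[OF C(1)] by blast
  have [measurable]: "r0 \<in> borel_measurable borel" by (rule r0(1))
  define r where "r x = max (- \<bar>C\<bar>) (min \<bar>C\<bar> (r0 x))" for x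
  have "r \<in> borel_measurable borel" unfolding r_def by measurable
  moreover have "\<bar>r x\<bar> \<le> \<bar>C\<bar>" for x unfolding r_def by auto
  moreover have "AE x in M. snd R x = r x" using r0(2) C(2) by eventually_elim (auto simp: r_def)
  ultimately show thesis using that by blast
qed

text \<open>
  Fubini in \<open>(s,x)\<close>, for Borel representatives of all factors.
\<close>
lemma pairing_flow_integral:
  assumes d: "flow_data P p v" and t: "0 \<le> t" and R: "R \<in> X_dual l"
  shows "pairing l (flow_integral p v t) R = (LINT s|lebesgue_on {0..t}. pairing l (flow p v s) R)"
proof -
  note p = flow_dataD(1)[OF d] and v = flow_dataD(2)[OF d]
  obtain r C where r: "r \<in> borel_measurable borel" "\<And>x. \<bar>r x\<bar> \<le> C" "AE x in M. snd R x = r x"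
    using dual_borel_version[OF R] by blast
  have C0: "0 \<le> C" using r(2)[of 0] by linarith
  note [measurable] = r(1) h_measurable[OF p profileD(1)[OF v]]
  have Km[measurable]: "Kint p v t \<in> borel_measurable borel" by (rule Kint_measurable[OF p v])
  define f where "f s x = indicator {0..t} s * (indicator {0..l} x * ((F x * h p v (x - s)) * r x))" for s x :: real
  have fm[measurable]: "case_prod f \<in> borel_measurable (borel \<Otimes>\<^sub>M borel)" unfolding f_def by measurable
  have fm1: "(\<lambda>x. indicator {0..l} x * ((F x * h p v (x - s)) * r x)) \<in> borel_measurable borel" for s by measurable
  have ti: "integrable M (\<lambda>x. (F x * h p v (x - s)) * r x)"
    "(LINT x|M. \<bar>(F x * h p v (x - s)) * r x\<bar>) \<le> C * (lam1 * (LINT s|lebesgue_on {0..s}. \<bar>p s\<bar>) + (LINT x|lebesgue. \<bar>v x\<bar>))" if s: "0 \<le> s" for s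
  proof -
    note b = transport_integrable[OF s v p]
    have rM: "r \<in> borel_measurable M" by (intro measurable_restrict_space1 measurable_completion) simp
    have le: "\<bar>(F x * h p v (x - s)) * r x\<bar> \<le> C * \<bar>F x * h p v (x - s)\<bar>" for x
      using mult_left_mono[OF r(2)[of x], of "\<bar>F x * h p v (x - s)\<bar>"] by (simp add: abs_mult mult.commute)
    have i: "integrable M (\<lambda>x. C * \<bar>F x * h p v (x - s)\<bar>)" using b(1) by simp
    show j: "integrable M (\<lambda>x. (F x * h p v (x - s)) * r x)"
    proof (rule Bochner_Integration.integrable_bound[OF i])
      show "(\<lambda>x. (F x * h p v (x - s)) * r x) \<in> borel_measurable M"
        by (rule borel_measurable_times[OF borel_measurable_integrable[OF b(1)] rM])
    qed (use le order_trans[OF _ abs_ge_self] in \<open>auto intro!: AE_I2\<close>)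
    have "(LINT x|M. \<bar>(F x * h p v (x - s)) * r x\<bar>) \<le> (LINT x|M. C * \<bar>F x * h p v (x - s)\<bar>)"
      by (rule Bochner_Integration.integral_mono[OF Bochner_Integration.integrable_abs[OF j] i le])
    also have "\<dots> = C * (LINT x|M. \<bar>F x * h p v (x - s)\<bar>)" by simp
    also have "\<dots> \<le> C * (lam1 * (LINT s|lebesgue_on {0..s}. \<bar>p s\<bar>) + (LINT x|lebesgue. \<bar>v x\<bar>))"
      by (rule mult_left_mono[OF b(2) C0])
    finally show "(LINT x|M. \<bar>(F x * h p v (x - s)) * r x\<bar>) \<le> C * (lam1 * (LINT s|lebesgue_on {0..s}. \<bar>p s\<bar>) + (LINT x|lebesgue. \<bar>v x\<bar>))" .
  qed
  have pa: "integrable (lebesgue_on {0..t}) (\<lambda>s. \<bar>p s\<bar>)"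
    by (intro Bochner_Integration.integrable_abs continuous_imp_integrable_real continuous_on_subset[OF p]) auto
  define Bd where "Bd = C * (lam1 * (LINT s|lebesgue_on {0..t}. \<bar>p s\<bar>) + (LINT x|lebesgue. \<bar>v x\<bar>))"
  have f_int: "integrable lborel (f s)" and f_bd: "(LINT x|lborel. norm (f s x)) \<le> indicator {0..t} s * Bd" for s
  proof -
    have "integrable lborel (f s) \<and> (LINT x|lborel. norm (f s x)) \<le> indicator {0..t} s * Bd"
    proof (cases "s \<in> {0..t}")
      case True
      have fs: "f s = (\<lambda>x. indicator {0..l} x * ((F x * h p v (x - s)) * r x))" using True by (simp add: f_def fun_eq_iff)
      have ms: "(\<lambda>x. indicator {0..l} x * \<bar>(F x * h p v (x - s)) * r x\<bar>) \<in> borel_measurable borel" by measurable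
      have "integrable lborel (f s)"
        unfolding fs using ti(1)[of s] True fm1 by (simp only: LINT_lborel_eq_lebesgue(2)[OF fm1, symmetric] LINT_Icc atLeastAtMost_iff)
      moreover have "(LINT x|lborel. norm (f s x)) = (LINT x|lborel. indicator {0..l} x * \<bar>(F x * h p v (x - s)) * r x\<bar>)"
        unfolding fs by (simp add: abs_mult)
      moreover have "(LINT x|lborel. indicator {0..l} x * \<bar>(F x * h p v (x - s)) * r x\<bar>) = (LINT x|M. \<bar>(F x * h p v (x - s)) * r x\<bar>)"
        by (simp only: LINT_lborel_eq_lebesgue(1)[OF ms, symmetric] LINT_Icc)
      moreover have "(LINT r|lebesgue_on {0..s}. \<bar>p r\<bar>) \<le> (LINT r|lebesgue_on {0..t}. \<bar>p r\<bar>)"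
        by (rule integral_mono_lebesgue_on_AE[OF pa]) (use True in auto)
      then have "C * (lam1 * (LINT s|lebesgue_on {0..s}. \<bar>p s\<bar>) + (LINT x|lebesgue. \<bar>v x\<bar>)) \<le> Bd"
        unfolding Bd_def using lam_pos C0 by (intro mult_left_mono add_mono) auto
      ultimately show ?thesis using ti(2)[of s] True by simp
    next
      case False
      then have "f s = (\<lambda>_. 0)" by (simp add: f_def fun_eq_iff)
      then show ?thesis using False by simp
    qed
    then show "integrable lborel (f s)" "(LINT x|lborel. norm (f s x)) \<le> indicator {0..t} s * Bd" by auto
  qed
  have prod: "integrable (lborel \<Otimes>\<^sub>M lborel) (case_prod f)"
  proof (rule lborel_pair.Fubini_integrable)
    show "case_prod f \<in> borel_measurable (lborel \<Otimes>\<^sub>M lborel)" using fm by simp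
    have Bi: "integrable lborel (\<lambda>s. indicator {0..t} s * Bd)"
      by (intro integrable_mult_left) (simp add: integrable_indicator_iff emeasure_lborel_Icc_eq)
    show "integrable lborel (\<lambda>s. LINT x|lborel. norm (case_prod f (s, x)))"
    proof (rule Bochner_Integration.integrable_bound[OF Bi])
      show "(\<lambda>s. LINT x|lborel. norm (case_prod f (s, x))) \<in> borel_measurable lborel"
        by (rule lborel.borel_measurable_lebesgue_integral) (use fm in simp)
      show "AE s in lborel. norm (LINT x|lborel. norm (case_prod f (s, x))) \<le> norm (indicator {0..t} s * Bd)"
      proof (intro AE_I2)
        fix s
        have "0 \<le> (LINT x|lborel. norm (f s x))" by simp
        then show "norm (LINT x|lborel. norm (case_prod f (s, x))) \<le> norm (indicator {0..t} s * Bd)"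
          using f_bd[of s] by (simp only: prod.case real_norm_def)
      qed
    qed
  qed (use f_int in auto)
  have swap: "(LINT x|lborel. (LINT s|lborel. f s x)) = (LINT s|lborel. (LINT x|lborel. f s x))"
    by (rule lborel_pair.Fubini_integral[OF prod])
  have m2: "(\<lambda>x. indicator {0..l} x * ((F x * Kint p v t x) * r x)) \<in> borel_measurable borel" by measurable
  have in1: "(LINT s|lborel. f s x) = indicator {0..l} x * ((F x * Kint p v t x) * r x)" for x
  proof -
    have mm: "(\<lambda>s. indicator {0..t} s * h p v (x - s)) \<in> borel_measurable borel" by measurable
    have "(LINT s|lborel. f s x) = (LINT s|lborel. (indicator {0..l} x * F x * r x) * (indicator {0..t} s * h p v (x - s)))"
      by (rule Bochner_Integration.integral_cong) (auto simp: f_def)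
    also have "\<dots> = (indicator {0..l} x * F x * r x) * (LINT s|lborel. indicator {0..t} s * h p v (x - s))" by simp
    also have "(LINT s|lborel. indicator {0..t} s * h p v (x - s)) = Kint p v t x"
      unfolding Kint_def by (simp only: LINT_lborel_eq_lebesgue(1)[OF mm, symmetric] LINT_Icc)
    finally show ?thesis by simp
  qed
  have in2: "(LINT x|lborel. f s x) = indicator {0..t} s * (LINT x|M. (F x * h p v (x - s)) * r x)" for s
  proof -
    have "(LINT x|lborel. f s x) = indicator {0..t} s * (LINT x|lborel. indicator {0..l} x * ((F x * h p v (x - s)) * r x))"
      unfolding f_def by simp
    then show ?thesis by (simp only: LINT_lborel_eq_lebesgue(1)[OF fm1, symmetric] LINT_Icc)
  qed
  have si: "integrable lborel (\<lambda>s. LINT x|lborel. f s x)" by (rule lborel_pair.integrable_fst[OF prod])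
  have m3: "(\<lambda>s. LINT x|lborel. f s x) \<in> borel_measurable borel" using borel_measurable_integrable[OF si] by simp
  have rR: "(LINT x|M. g x * snd R x) = (LINT x|M. g x * r x)" if g: "g \<in> borel_measurable M" for g
  proof (rule Bochner_Integration.integral_cong_AE)
    have Rm: "snd R \<in> borel_measurable M" using R by (auto simp: X_dual_def)
    have rM: "r \<in> borel_measurable M" by (intro measurable_restrict_space1 measurable_completion) simp
    show "(\<lambda>x. g x * snd R x) \<in> borel_measurable M" by (rule borel_measurable_times[OF g Rm])
    show "(\<lambda>x. g x * r x) \<in> borel_measurable M" by (rule borel_measurable_times[OF g rM])
    show "AE x in M. g x * snd R x = g x * r x" using r(3) by eventually_elim simp
  qed
  have k1: "(LINT x|M. (F x * Kint p v t x) * snd R x) = (LINT s|lebesgue_on {0..t}. (LINT x|M. (F x * h p v (x - s)) * snd R x))"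
  proof -
    have "(LINT x|M. (F x * Kint p v t x) * snd R x) = (LINT x|M. (F x * Kint p v t x) * r x)"
      by (rule rR) (intro measurable_restrict_space1 measurable_completion; simp)
    also have "\<dots> = (LINT x|lborel. indicator {0..l} x * ((F x * Kint p v t x) * r x))"
      by (simp only: LINT_Icc LINT_lborel_eq_lebesgue(1)[OF m2])
    also have "\<dots> = (LINT s|lborel. (LINT x|lborel. f s x))" unfolding swap[symmetric] in1 ..
    also have "\<dots> = (LINT s|lebesgue. (LINT x|lborel. f s x))" by (rule LINT_lborel_eq_lebesgue(1)[OF m3, symmetric])
    also have "\<dots> = (LINT s|lebesgue_on {0..t}. (LINT x|M. (F x * h p v (x - s)) * r x))"
      unfolding in2 by (simp only: LINT_Icc(1)[of 0 t])
    also have "\<dots> = (LINT s|lebesgue_on {0..t}. (LINT x|M. (F x * h p v (x - s)) * snd R x))"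
    proof (rule Bochner_Integration.integral_cong[OF refl])
      fix s assume "s \<in> space (lebesgue_on {0..t})"
      then have "0 \<le> s" by simp
      then show "(LINT x|M. (F x * h p v (x - s)) * r x) = (LINT x|M. (F x * h p v (x - s)) * snd R x)"
        by (intro rR[symmetric] borel_measurable_integrable transport_integrable(1)[OF _ v p])
    qed
    finally show ?thesis .
  qed
  have k2: "integrable (lebesgue_on {0..t}) (\<lambda>s. LINT x|M. (F x * h p v (x - s)) * snd R x)"
  proof (rule Bochner_Integration.integrable_cong[THEN iffD1, OF refl])
    have "integrable lebesgue (\<lambda>s. indicator {0..t} s * (LINT x|M. (F x * h p v (x - s)) * r x))"
      using LINT_lborel_eq_lebesgue(2)[OF m3, THEN iffD2, OF si] by (simp only: in2)
    then show "integrable (lebesgue_on {0..t}) (\<lambda>s. LINT x|M. (F x * h p v (x - s)) * r x)" by (simp only: LINT_Icc(2)[of 0 t])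
    fix s assume "s \<in> space (lebesgue_on {0..t})"
    then have "0 \<le> s" by simp
    then show "(LINT x|M. (F x * h p v (x - s)) * r x) = (LINT x|M. (F x * h p v (x - s)) * snd R x)"
      by (intro rR[symmetric] borel_measurable_integrable transport_integrable(1)[OF _ v p])
  qed
  have pi: "integrable (lebesgue_on {0..t}) (\<lambda>s. p s * fst R)"
    by (intro integrable_mult_left continuous_imp_integrable_real continuous_on_subset[OF p]) auto
  have "(LINT s|lebesgue_on {0..t}. pairing l (flow p v s) R) = (LINT s|lebesgue_on {0..t}. p s * fst R) + (LINT s|lebesgue_on {0..t}. (LINT x|M. (F x * h p v (x - s)) * snd R x))"
    unfolding pairing_def flow_def fst_conv snd_conv by (rule Bochner_Integration.integral_add[OF pi k2])
  then show ?thesis using k1 by (simp add: pairing_def flow_integral_def)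
qed

text \<open>
  The defining property of the adjoint relation, evaluated at the element \<open>flow_integral p v t\<close> of the domain.
\<close>
lemma flow_weak:
  assumes d: "flow_data P p v" and t: "0 \<le> t"
    and a: "adjoint_rel l (sys_op l lam1 \<mu>) (sys_dom l lam1 \<mu>) Q R"
  shows "pairing l (flow p v t) Q = pairing l P Q + (LINT s|lebesgue_on {0..t}. pairing l (flow p v s) R)"
proof -
  have Q: "Q \<in> X_dual l" and R: "R \<in> X_dual l" using a by (auto simp: adjoint_rel_def)
  have "pairing l (sys_op l lam1 \<mu> (flow_integral p v t)) Q = pairing l (flow_integral p v t) R"
    using a flow_integral_in_dom[OF flow_dataD(1,2)[OF d] t] by (auto simp: adjoint_rel_def)
  then show ?thesis using sys_op_flow_integral[OF d t Q] pairing_flow_integral[OF d t R] by simp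
qed

end

section \<open>The adjoint relation and its test elements\<close>

lemma pairing_X_diff:
  assumes "P \<in> X_space l" "P' \<in> X_space l" "q \<in> X_dual l"
  shows "pairing l (X_diff P P') q = pairing l P q - pairing l P' q"
proof -
  have "integrable (lebesgue_on {0..l}) (\<lambda>x. snd P x * snd q x)" "integrable (lebesgue_on {0..l}) (\<lambda>x. snd P' x * snd q x)"
    using dual_times_integrable[OF assms(3)] assms(1,2) by (auto simp: X_space_def)
  then show ?thesis by (simp add: pairing_def X_diff_def left_diff_distrib)
qed

lemma X_diff_in: "P \<in> X_space l \<Longrightarrow> P' \<in> X_space l \<Longrightarrow> X_diff P P' \<in> X_space l"
  by (simp add: X_space_def X_diff_def)

lemma X_norm_nonneg: "0 \<le> X_norm l P" by (simp add: X_norm_def)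

lemma pairing_bound:
  assumes q: "q \<in> X_dual l"
  obtains C where "0 \<le> C" "\<And>P. P \<in> X_space l \<Longrightarrow> \<bar>pairing l P q\<bar> \<le> C * X_norm l P"
proof -
  let ?M = "lebesgue_on {0..l}"
  obtain C where C: "AE x in ?M. \<bar>snd q x\<bar> \<le> C" using q by (auto simp: X_dual_def)
  have "\<bar>pairing l P q\<bar> \<le> max \<bar>fst q\<bar> \<bar>C\<bar> * X_norm l P" if P: "P \<in> X_space l" for P
  proof -
    have Pi: "integrable ?M (snd P)" using P by (simp add: X_space_def)
    have "\<bar>LINT x|?M. snd P x * snd q x\<bar> \<le> (LINT x|?M. \<bar>snd P x * snd q x\<bar>)" by (rule integral_abs_bound)
    also have "\<dots> \<le> (LINT x|?M. \<bar>C\<bar> * \<bar>snd P x\<bar>)"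
    proof (rule integral_mono_AE)
      show "integrable ?M (\<lambda>x. \<bar>snd P x * snd q x\<bar>)" by (rule Bochner_Integration.integrable_abs[OF dual_times_integrable[OF q Pi]])
      show "AE x in ?M. \<bar>snd P x * snd q x\<bar> \<le> \<bar>C\<bar> * \<bar>snd P x\<bar>"
        using C
      proof eventually_elim
        case (elim x)
        have "\<bar>snd q x\<bar> * \<bar>snd P x\<bar> \<le> \<bar>C\<bar> * \<bar>snd P x\<bar>" using elim by (intro mult_right_mono) auto
        then show ?case by (simp add: abs_mult mult.commute)
      qed
    qed (use Pi in simp)
    also have "\<dots> = \<bar>C\<bar> * (LINT x|?M. \<bar>snd P x\<bar>)" by simp
    also have "\<dots> \<le> max \<bar>fst q\<bar> \<bar>C\<bar> * (LINT x|?M. \<bar>snd P x\<bar>)" by (intro mult_right_mono) auto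
    finally have 1: "\<bar>LINT x|?M. snd P x * snd q x\<bar> \<le> max \<bar>fst q\<bar> \<bar>C\<bar> * (LINT x|?M. \<bar>snd P x\<bar>)" .
    have "\<bar>fst P * fst q\<bar> \<le> max \<bar>fst q\<bar> \<bar>C\<bar> * \<bar>fst P\<bar>"
      unfolding abs_mult by (subst mult.commute) (intro mult_right_mono, auto)
    then show ?thesis using 1 unfolding pairing_def X_norm_def distrib_left by linarith
  qed
  then show thesis using that[of "max \<bar>fst q\<bar> \<bar>C\<bar>"] by simp
qed

lemma pairing_tendsto:
  assumes q: "q \<in> X_dual l" and P: "eventually (\<lambda>s. P s \<in> X_space l) A" and R: "R \<in> X_space l"
    and lim: "X_tendsto l P R A"
  shows "((\<lambda>s. pairing l (P s) q) \<longlongrightarrow> pairing l R q) A"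
proof -
  obtain C where C: "0 \<le> C" "\<And>P. P \<in> X_space l \<Longrightarrow> \<bar>pairing l P q\<bar> \<le> C * X_norm l P"
    using pairing_bound[OF q] by blast
  have "((\<lambda>s. C * X_norm l (X_diff (P s) R)) \<longlongrightarrow> C * 0) A"
    using lim unfolding X_tendsto_def by (intro tendsto_intros)
  then have z: "((\<lambda>s. C * X_norm l (X_diff (P s) R)) \<longlongrightarrow> 0) A" by simp
  have "((\<lambda>s. pairing l (P s) q - pairing l R q) \<longlongrightarrow> 0) A"
  proof (rule Lim_null_comparison[OF _ z])
    show "eventually (\<lambda>s. norm (pairing l (P s) q - pairing l R q) \<le> C * X_norm l (X_diff (P s) R)) A"
      using P
    proof eventually_elim
      case (elim s)
      show ?case using C(2)[OF X_diff_in[OF elim R]] pairing_X_diff[OF elim R q] by simp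
    qed
  qed
  then show ?thesis by (rule LIM_zero_cancel)
qed

lemma X_eq_iff_norm:
  assumes "P \<in> X_space l" "P' \<in> X_space l"
  shows "X_eq l P P' \<longleftrightarrow> X_norm l (X_diff P P') = 0"
proof -
  let ?M = "lebesgue_on {0..l}"
  have i: "integrable ?M (\<lambda>x. \<bar>snd P x - snd P' x\<bar>)" using assms by (simp add: X_space_def)
  have "0 \<le> (LINT x|?M. \<bar>snd P x - snd P' x\<bar>)" by simp
  then have "X_norm l (X_diff P P') = 0 \<longleftrightarrow> fst P = fst P' \<and> (LINT x|?M. \<bar>snd P x - snd P' x\<bar>) = 0"
    unfolding X_norm_def X_diff_def fst_conv snd_conv by (smt (verit))
  also have "(LINT x|?M. \<bar>snd P x - snd P' x\<bar>) = 0 \<longleftrightarrow> (AE x in ?M. \<bar>snd P x - snd P' x\<bar> = 0)"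
    by (rule integral_nonneg_eq_0_iff_AE[OF i]) simp
  finally show ?thesis by (simp add: X_eq_def)
qed

lemma X_eq_pairing:
  assumes "P \<in> X_space l" "P' \<in> X_space l" "q \<in> X_dual l" "X_eq l P P'"
  shows "pairing l P q = pairing l P' q"
proof -
  obtain C where C: "\<And>P. P \<in> X_space l \<Longrightarrow> \<bar>pairing l P q\<bar> \<le> C * X_norm l P"
    using pairing_bound[OF assms(3)] by blast
  show ?thesis using C[OF X_diff_in[OF assms(1,2)]] X_eq_iff_norm[OF assms(1,2)] assms(4) pairing_X_diff[OF assms(1-3)] by simp
qed

lemma continuous_zero_if_indefinite_integral_zero:
  fixes \<phi> :: "real \<Rightarrow> real"
  assumes c: "continuous_on {0..c} \<phi>" and z: "\<And>x. x \<in> {0..c} \<Longrightarrow> (LINT y|lebesgue_on {0..x}. \<phi> y) = 0"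
    and x: "0 < x" "x \<le> c"
  shows "\<phi> x = 0"
proof (rule zero_at_left_continuity_point[OF AE_zero_if_indefinite_integral_zero[OF continuous_imp_integrable_real[OF c] z] x])
  have "(\<phi> \<longlongrightarrow> \<phi> x) (at x within {0..c})" using c x by (auto simp: continuous_on_def)
  then have "(\<phi> \<longlongrightarrow> \<phi> x) (at x within {0..<x})" by (rule tendsto_within_subset) (use x in auto)
  moreover have "at_left x = at x within {0..<x}" by (rule at_within_nhd[of _ "{0<..}"]) (use x in auto)
  ultimately show "(\<phi> \<longlongrightarrow> \<phi> x) (at_left x)" by simp
qed

text \<open>
  Cauchy's formula for the second and third repeated integral.
\<close>
lemma cauchy_repeated_integral:
  fixes u :: "real \<Rightarrow> real"
  assumes c: "0 \<le> c" and u: "integrable (lebesgue_on {0..c}) u"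
  shows "(LINT x|lebesgue_on {0..c}. (c - x) * u x) = (LINT y|lebesgue_on {0..c}. (LINT x|lebesgue_on {0..y}. u x))" (is ?A)
    and "(LINT x|lebesgue_on {0..c}. (c - x)\<^sup>2 / 2 * u x) = (LINT y|lebesgue_on {0..c}. (LINT x|lebesgue_on {0..y}. (y - x) * u x))" (is ?B)
proof -
  have first: "(LINT x|lebesgue_on {0..c}. r x * u x) = - (LINT y|lebesgue_on {0..c}. r' y * (LINT x|lebesgue_on {0..y}. u x))"
    if d: "\<And>x. (r has_real_derivative r' x) (at x)" and cr: "continuous_on UNIV r'" and rc: "r c = 0"
      and c: "0 \<le> c" and u: "integrable (lebesgue_on {0..c}) u" for r r' u :: "real \<Rightarrow> real" and c
  proof -
    let ?U = "\<lambda>y. LINT x|lebesgue_on {0..y}. u x" and ?C = "lebesgue_on {0..c}"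
    have D: "has_L1_deriv c r r'"
      by (rule has_L1_deriv_C1[OF has_field_derivative_at_within[OF d] continuous_on_subset[OF cr subset_UNIV]])
    have U: "has_L1_deriv c ?U u" using has_L1_deriv_indefinite[OF u, of 0] by simp
    note p = has_L1_deriv_mult[OF D U]
    have "r c * ?U c = r 0 * ?U 0 + (LINT y|?C. r' y * ?U y + r y * u y)"
      by (rule has_L1_derivD(2)[OF p]) (use c in simp)
    moreover have "(LINT y|?C. r' y * ?U y + r y * u y) = (LINT y|?C. r' y * ?U y) + (LINT y|?C. r y * u y)"
      by (intro Bochner_Integration.integral_add continuous_times_integrable[OF has_L1_deriv_continuous_on[OF D] u]
          continuous_imp_integrable_real continuous_intros has_L1_deriv_continuous_on[OF U] continuous_on_subset[OF cr]) auto
    ultimately show ?thesis using rc by simp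
  qed
  have A: "(LINT x|lebesgue_on {0..c}. (c - x) * u x) = (LINT y|lebesgue_on {0..c}. (LINT x|lebesgue_on {0..y}. u x))"
    if "0 \<le> c" "integrable (lebesgue_on {0..c}) u" for c and u :: "real \<Rightarrow> real"
  proof -
    have "((\<lambda>x. c - x) has_real_derivative - 1) (at x)" for x by (auto intro!: derivative_eq_intros)
    from first[OF this _ _ that] show ?thesis by simp
  qed
  show ?A by (rule A[OF c u])
  let ?U = "\<lambda>y. LINT x|lebesgue_on {0..y}. u x"
  have "(LINT x|lebesgue_on {0..c}. (c - x)\<^sup>2 / 2 * u x) = - (LINT y|lebesgue_on {0..c}. - (c - y) * ?U y)"
  proof (rule first[OF _ _ _ c u])
    show "((\<lambda>x. (c - x)\<^sup>2 / 2) has_real_derivative - (c - x)) (at x)" for x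
      by (auto intro!: derivative_eq_intros simp: field_simps)
  qed (auto intro!: continuous_intros)
  also have "\<dots> = (LINT y|lebesgue_on {0..c}. (c - y) * ?U y)"
    by (simp only: mult_minus_left Bochner_Integration.integral_minus minus_minus)
  also have "\<dots> = (LINT y|lebesgue_on {0..c}. (LINT x|lebesgue_on {0..y}. ?U x))"
    by (rule A[OF c continuous_imp_integrable_real[OF indefinite_integral_continuous_real[OF u]]])
  also have "\<dots> = (LINT y|lebesgue_on {0..c}. (LINT x|lebesgue_on {0..y}. (y - x) * u x))"
  proof (rule Bochner_Integration.integral_cong[OF refl])
    fix y assume "y \<in> space (lebesgue_on {0..c})"
    then have y: "0 \<le> y" "{0..y} \<subseteq> {0..c}" by auto
    show "(LINT x|lebesgue_on {0..y}. ?U x) = (LINT x|lebesgue_on {0..y}. (y - x) * u x)"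
      by (rule A[symmetric, OF y(1) integrable_subinterval[OF u y(2)]])
  qed
  finally show ?B .
qed

context repair_system
begin

abbreviation adj where "adj \<equiv> adjoint_rel l (sys_op l lam1 \<mu>) (sys_dom l lam1 \<mu>)"

lemma flow_pairing_continuous:
  assumes d: "flow_data P p v" and q: "q \<in> X_dual l"
  shows "continuous_on {0..} (\<lambda>s. pairing l (flow p v s) q)"
  unfolding continuous_on_def
proof
  fix t :: real assume t: "t \<in> {0..}"
  show "((\<lambda>s. pairing l (flow p v s) q) \<longlongrightarrow> pairing l (flow p v t) q) (at t within {0..})"
  proof (rule pairing_tendsto[OF q])
    show "eventually (\<lambda>s. flow p v s \<in> X_space l) (at t within {0..})"
      unfolding eventually_at by (intro exI[of _ 1]) (auto intro: flow_in_X[OF d])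
    show "X_tendsto l (flow p v) (flow p v t) (at t within {0..})"
      unfolding X_tendsto_def by (rule flow_continuous[OF d]) (use t in simp)
  qed (use flow_in_X[OF d] t in simp)
qed

text \<open>
  The adjoint value is chosen by a description.  By \<open>flow_weak\<close> any two choices pair equally with the flow on
  average over every \<open>[0,t]\<close>, hence, letting \<open>t \<rightarrow> 0\<close>, with every state.  Here the semiflow takes the place of a
  proof that the domain is dense.
\<close>
lemma adjoint_value_unique:
  assumes a: "adj Q R" "adj Q R'" and P: "P \<in> X_space l"
  shows "pairing l P R = pairing l P R'"
proof -
  obtain p v where d: "flow_data P p v" using flow_data_exists[OF P] by blast
  have R: "R \<in> X_dual l" "R' \<in> X_dual l" using a by (auto simp: adjoint_rel_def)
  let ?f = "\<lambda>s. pairing l (flow p v s) R - pairing l (flow p v s) R'"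
  have cont: "continuous_on {0..} ?f" by (intro continuous_intros flow_pairing_continuous[OF d] R)
  have i: "integrable (lebesgue_on {0..x}) (\<lambda>s. pairing l (flow p v s) q)" if "q \<in> X_dual l" for q x
    by (intro continuous_imp_integrable_real continuous_on_subset[OF flow_pairing_continuous[OF d that]]) auto
  have "?f x = 0" if x: "0 < x" "x \<le> 1" for x
  proof (rule continuous_zero_if_indefinite_integral_zero[OF _ _ x])
    show "continuous_on {0..1} ?f" by (rule continuous_on_subset[OF cont]) auto
    fix y :: real assume "y \<in> {0..1}"
    then have "0 \<le> y" by simp
    then show "(LINT s|lebesgue_on {0..y}. ?f s) = 0"
      using flow_weak[OF d _ a(1), of y] flow_weak[OF d _ a(2), of y] i[OF R(1)] i[OF R(2)] by simp
  qed
  then have "eventually (\<lambda>x. ?f x = 0) (at_right 0)"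
    unfolding eventually_at_right_field by (intro exI[of _ 1]) auto
  then have 1: "(?f \<longlongrightarrow> 0) (at_right 0)" by (rule tendsto_eventually)
  have "(?f \<longlongrightarrow> ?f 0) (at 0 within {0..})" using cont by (auto simp: continuous_on_def)
  then have 2: "(?f \<longlongrightarrow> ?f 0) (at_right 0)" by (rule tendsto_within_subset) auto
  have "?f 0 = 0" by (rule tendsto_unique[OF _ 2 1]) simp
  then show ?thesis
    using X_eq_pairing[OF flow_in_X[OF d, of 0] P R(1) flow_0(1)[OF d]] X_eq_pairing[OF flow_in_X[OF d, of 0] P R(2) flow_0(1)[OF d]] by simp
qed

text \<open>
  Conservation of mass: the boundary terms cancel, and nothing leaves at \<open>l\<close>.
\<close>
lemma adj_mass: "adj (1, \<lambda>_. 1) (0, \<lambda>_. 0)"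
  unfolding adjoint_rel_def
proof (intro conjI ballI)
  show "(1, \<lambda>_. 1) \<in> X_dual l" "(0, \<lambda>_. 0) \<in> X_dual l" by (auto simp: X_dual_def)
  fix P assume "P \<in> sys_dom l lam1 \<mu>"
  then have P: "\<exists>g. has_L1_deriv l (snd P) g" "integrable M (\<lambda>x. \<mu> x * snd P x)" "snd P 0 = lam1 * fst P"
    by (auto simp: sys_dom_def)
  then obtain g where "has_L1_deriv l (snd P) g" by blast
  then have D: "has_L1_deriv l (snd P) (L1_deriv l (snd P))"
    by (subst L1_deriv_def) (rule someI[where P="has_L1_deriv l (snd P)"])
  have "snd P l = snd P 0 + (LINT x|M. L1_deriv l (snd P) x)" by (rule has_L1_derivD(2)[OF D]) (use l_pos in simp)
  then have "(LINT x|M. L1_deriv l (snd P) x) = - (lam1 * fst P)"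
    using dom_vanishes_at_l[OF D P(2)] P(3) by simp
  then show "pairing l (sys_op l lam1 \<mu> P) (1, \<lambda>_. 1) = pairing l P (0, \<lambda>_. 0)"
    using has_L1_derivD(1)[OF D] P(2) by (simp add: pairing_def sys_op_def)
qed

lemma dual_cut:
  assumes c: "0 \<le> c" "c < l" and r: "continuous_on UNIV r"
  shows "(a, \<lambda>x. if x \<le> c then r x / F x else 0) \<in> X_dual l"
proof -
  have "continuous_on {0..c} (\<lambda>x. r x / F x)"
    by (intro continuous_intros continuous_on_subset[OF r] F_continuous) (use F_pos c in \<open>auto simp: less_imp_neq[symmetric]\<close>)
  then have "bounded ((\<lambda>x. r x / F x) ` {0..c})" by (intro compact_imp_bounded compact_continuous_image) auto
  then obtain B where "\<forall>y\<in>(\<lambda>x. r x / F x) ` {0..c}. norm y \<le> B" unfolding bounded_iff by blast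
  then have B: "\<bar>r x / F x\<bar> \<le> B" if "x \<in> {0..c}" for x using that by auto
  have [measurable]: "r \<in> borel_measurable borel" by (rule borel_measurable_continuous_onI[OF r])
  have "(\<lambda>x. if x \<le> c then r x / F x else 0) \<in> borel_measurable borel" by measurable
  then have "(\<lambda>x. if x \<le> c then r x / F x else 0) \<in> borel_measurable M"
    by (intro measurable_restrict_space1 measurable_completion) simp
  moreover have "AE x in M. \<bar>if x \<le> c then r x / F x else 0\<bar> \<le> \<bar>B\<bar>"
    by (intro AE_I2) (use B in fastforce)
  ultimately show ?thesis
    unfolding X_dual_def by (intro CollectI conjI exI[of _ "\<bar>B\<bar>"]) (simp_all only: snd_conv)
qed

text \<open>
  For \<open>p\<close> in the domain, \<open>p r / F\<close> is absolutely continuous on \<open>[0,c]\<close> and vanishes at \<open>c\<close>; the factor \<open>1/F\<close>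
  cancels the term with \<open>\<mu>\<close>, which could be unbounded.
\<close>
lemma adj_cut:
  assumes c: "0 \<le> c" "c < l" and d: "\<And>x. (r has_real_derivative r' x) (at x)"
    and cr: "continuous_on UNIV r'" and rc: "r c = 0"
  shows "adj (0, \<lambda>x. if x \<le> c then r x / F x else 0) (lam1 * r 0, \<lambda>x. if x \<le> c then r' x / F x else 0)"
  unfolding adjoint_rel_def
proof (intro conjI ballI)
  have cr0: "continuous_on UNIV r" by (intro continuous_at_imp_continuous_on ballI, rule DERIV_isCont[OF d])
  show "(0, \<lambda>x. if x \<le> c then r x / F x else 0) \<in> X_dual l" by (rule dual_cut[OF c cr0])
  show "(lam1 * r 0, \<lambda>x. if x \<le> c then r' x / F x else 0) \<in> X_dual l" by (rule dual_cut[OF c cr])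
  fix P assume "P \<in> sys_dom l lam1 \<mu>"
  then have P: "\<exists>g. has_L1_deriv l (snd P) g" "integrable M (\<lambda>x. \<mu> x * snd P x)" "snd P 0 = lam1 * fst P"
    by (auto simp: sys_dom_def)
  let ?g = "L1_deriv l (snd P)" and ?p = "snd P" and ?C = "lebesgue_on {0..c}"
  from P(1) obtain g where "has_L1_deriv l (snd P) g" by blast
  then have "has_L1_deriv l ?p ?g"
    by (subst L1_deriv_def) (rule someI[where P="has_L1_deriv l (snd P)"])
  then have D: "has_L1_deriv c ?p ?g" by (rule has_L1_deriv_subinterval) (use c in simp)
  have Dr: "has_L1_deriv c r r'"
    by (rule has_L1_deriv_C1[OF has_field_derivative_at_within[OF d] continuous_on_subset[OF cr subset_UNIV]])
  note G = has_L1_deriv_mult[OF has_L1_deriv_mult[OF D Dr] F_deriv_sub(2)[OF c]]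
  have cF: "continuous_on {0..c} (\<lambda>x. r x / F x)" "continuous_on {0..c} (\<lambda>x. r' x / F x)"
    by (intro continuous_intros continuous_on_subset[OF cr] continuous_on_subset[OF cr0] F_continuous; use F_pos c in \<open>auto simp: less_imp_neq[symmetric]\<close>)+
  have pc: "continuous_on {0..c} ?p" by (rule has_L1_deriv_continuous_on[OF D])
  have mi: "integrable ?C (\<lambda>x. \<mu> x * ?p x)" by (rule integrable_subinterval[OF P(2)]) (use c in auto)
  have i1: "integrable ?C (\<lambda>x. (r x / F x) * (?g x + \<mu> x * ?p x))"
    by (intro continuous_times_integrable cF Bochner_Integration.integrable_add has_L1_derivD(1)[OF D] mi)
  have i2: "integrable ?C (\<lambda>x. ?p x * (r' x / F x))"
    by (intro continuous_imp_integrable_real continuous_on_mult pc cF)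
  have e: "(?g x * r x + ?p x * r' x) * (1 / F x) + ?p x * r x * (\<mu> x / F x) = (r x / F x) * (?g x + \<mu> x * ?p x) + ?p x * (r' x / F x)" for x
    by (simp add: algebra_simps add_divide_distrib)
  have "?p c * r c * (1 / F c) = ?p 0 * r 0 * (1 / F 0) + (LINT x|?C. (?g x * r x + ?p x * r' x) * (1 / F x) + ?p x * r x * (\<mu> x / F x))"
    by (rule has_L1_derivD(2)[OF G]) (use c in simp)
  then have key: "0 = lam1 * fst P * r 0 + ((LINT x|?C. (r x / F x) * (?g x + \<mu> x * ?p x)) + (LINT x|?C. ?p x * (r' x / F x)))"
    unfolding e using Bochner_Integration.integral_add[OF i1 i2] rc P(3) by simp
  have res: "(LINT x|M. a x * (if x \<le> c then b x else 0)) = (LINT x|?C. a x * b x)" for a b :: "real \<Rightarrow> real"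
  proof -
    have "(LINT x|M. a x * (if x \<le> c then b x else 0)) = (LINT x|M. indicator {0..c} x * (a x * b x))"
      by (rule Bochner_Integration.integral_cong) (auto simp: indicator_def)
    then show ?thesis using c by (subst (asm) integral_lebesgue_on_restrict) auto
  qed
  have "pairing l (sys_op l lam1 \<mu> P) (0, \<lambda>x. if x \<le> c then r x / F x else 0) = (LINT x|?C. - (?g x + \<mu> x * ?p x) * (r x / F x))"
    unfolding pairing_def sys_op_def fst_conv snd_conv res by simp
  also have "\<dots> = - (LINT x|?C. (r x / F x) * (?g x + \<mu> x * ?p x))"
    by (simp only: mult_minus_left Bochner_Integration.integral_minus mult.commute[of "_ + _" "_ / _"])
  also have "\<dots> = fst P * (lam1 * r 0) + (LINT x|?C. ?p x * (r' x / F x))" using key by (simp add: mult_ac)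
  also have "\<dots> = pairing l P (lam1 * r 0, \<lambda>x. if x \<le> c then r' x / F x else 0)"
    unfolding pairing_def fst_conv snd_conv res ..
  finally show "pairing l (sys_op l lam1 \<mu> P) (0, \<lambda>x. if x \<le> c then r x / F x else 0) = pairing l P (lam1 * r 0, \<lambda>x. if x \<le> c then r' x / F x else 0)" .
qed

end

section \<open>Uniqueness between impulses\<close>

lemma LINT_has_real_derivative:
  fixes f :: "real \<Rightarrow> real"
  assumes f: "continuous_on {0..T} f" and t: "t \<in> {0..T}"
  shows "((\<lambda>t. LINT s|lebesgue_on {0..t}. f s) has_real_derivative f t) (at t within {0..T})"
proof (rule has_field_derivative_transform_within[OF integral_has_real_derivative[OF f t] zero_less_one t])
  fix x assume "x \<in> {0..T}"
  then have "integrable (lebesgue_on {0..x}) f"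
    by (intro continuous_imp_integrable_real continuous_on_subset[OF f]) auto
  then show "integral {0..x} f = (LINT s|lebesgue_on {0..x}. f s)" by (simp add: lebesgue_integral_eq_integral)
qed

text \<open>
  The hypothesis says that \<open>L(s,y) = \<integral>\<^sub>0\<^sup>s b(r,y) dr\<close> has the continuous partial derivatives \<open>b\<close> and
  \<open>\<lambda> y om - b\<close>.  So \<open>L\<close> grows at the known rate \<open>\<lambda> y om\<close> along the characteristic through \<open>(s,c)\<close>, which starts
  where \<open>L\<close> vanishes: at time \<open>0\<close> or at \<open>y = 0\<close>.
\<close>
lemma transport_duhamel:
  fixes b :: "real \<Rightarrow> real \<Rightarrow> real" and om :: "real \<Rightarrow> real"
  assumes b: "continuous_on ({0..t0} \<times> {0..c}) (\<lambda>(s,y). b s y)"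
    and om: "continuous_on {0..t0} om" "om 0 = 0"
    and k2: "\<And>s y. s \<in> {0..t0} \<Longrightarrow> y \<in> {0..c} \<Longrightarrow>
        (LINT r|lebesgue_on {0..s}. b r y) = (LINT z|lebesgue_on {0..y}. lam * z * om s - b s z)"
    and s: "s \<in> {0..t0}" and c: "0 \<le> c"
  shows "(LINT r|lebesgue_on {0..s}. b r c) = lam * (LINT x|lebesgue_on {0..c}. (c - x) * om (max 0 (s - x)))"
proof -
  define L where "L s y = (LINT r|lebesgue_on {0..s}. b r y)" for s y
  define D where "D s y = lam * y * om s - b s y" for s y
  have bs: "continuous_on {0..t0} (\<lambda>s. b s y)" if "y \<in> {0..c}" for y
  proof -
    have "continuous_on {0..t0} (\<lambda>s. (s, y))" by (intro continuous_intros)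
    moreover have "(\<lambda>s. (s, y)) ` {0..t0} \<subseteq> {0..t0} \<times> {0..c}" using that by auto
    ultimately have "continuous_on {0..t0} (\<lambda>x. case (x, y) of (s, y) \<Rightarrow> b s y)" by (rule continuous_on_compose2[OF b])
    then show ?thesis by simp
  qed
  have by': "continuous_on {0..c} (b s)" if "s \<in> {0..t0}" for s
  proof -
    have "continuous_on {0..c} (\<lambda>y. (s, y))" by (intro continuous_intros)
    moreover have "(\<lambda>y. (s, y)) ` {0..c} \<subseteq> {0..t0} \<times> {0..c}" using that by auto
    ultimately have "continuous_on {0..c} (\<lambda>x. case (s, x) of (s, y) \<Rightarrow> b s y)" by (rule continuous_on_compose2[OF b])
    then show ?thesis by simp
  qed
  have cD: "continuous_on ({0..t0} \<times> {0..c}) (\<lambda>(s,y). D s y)"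
    unfolding D_def case_prod_beta
    using b unfolding case_prod_beta
    by (intro continuous_intros continuous_on_compose2[OF om(1)]) auto
  have part: "((\<lambda>(x, y). L x y) has_derivative (\<lambda>(tx, ty). b x y * tx + blinfun_apply (blinfun_mult_right (D x y)) ty)) (at (x, y) within {0..t0} \<times> {0..c})"
    if x: "x \<in> {0..t0}" and y: "y \<in> {0..c}" for x y
  proof (rule has_derivative_partialsI)
    show "((\<lambda>x. L x y) has_derivative (*) (b x y)) (at x within {0..t0})"
      unfolding L_def using LINT_has_real_derivative[OF bs[OF y] x] by (simp add: has_field_derivative_def)
    show "((\<lambda>y. L x y) has_derivative blinfun_apply (blinfun_mult_right (D x y))) (at y within {0..c})"
      if x: "x \<in> {0..t0}" and y: "y \<in> {0..c}" for x y
    proof -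
      have "continuous_on {0..c} (D x)" unfolding D_def by (intro continuous_intros by'[OF x])
      then have d: "((\<lambda>y. LINT z|lebesgue_on {0..y}. D x z) has_real_derivative D x y) (at y within {0..c})"
        by (rule LINT_has_real_derivative[OF _ y])
      have "((\<lambda>y. L x y) has_real_derivative D x y) (at y within {0..c})"
        by (rule has_field_derivative_transform_within[OF d zero_less_one y]) (simp add: L_def D_def k2[OF x])
      then show ?thesis by (simp add: has_field_derivative_def blinfun_mult_right.rep_eq)
    qed
    have "continuous_on ({0..t0} \<times> {0..c}) (\<lambda>p. blinfun_mult_right (case p of (s, y) \<Rightarrow> D s y))"
      by (rule bounded_linear.continuous_on[OF bounded_linear_blinfun_mult_right cD])
    then show "continuous (at (x, y) within {0..t0} \<times> {0..c}) (\<lambda>(x, y). blinfun_mult_right (D x y))"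
      using x y by (simp add: continuous_on_eq_continuous_within case_prod_beta')
  qed (use y in auto)
  \<comment> \<open>the time at which the characteristic through \<open>(s,c)\<close> enters the quadrant\<close>
  define a where "a = max 0 (s - c)"
  have a: "0 \<le> a" "a \<le> s" "s - c \<le> a" using s c by (auto simp: a_def)
  define H where "H r = L r (c - s + r)" for r
  have deriv: "(H has_vector_derivative lam * (c - s + r) * om r) (at r within {a..s})" if r: "r \<in> {a..s}" for r
  proof -
    have mem: "r \<in> {0..t0}" "c - s + r \<in> {0..c}" using r a s by auto
    have g: "((\<lambda>r. (r, c - s + r)) has_derivative (\<lambda>d. (d, d))) (at r within {a..s})"
      by (auto intro!: derivative_eq_intros)
    have img: "(\<lambda>r. (r, c - s + r)) ` {a..s} \<subseteq> {0..t0} \<times> {0..c}" using a s by auto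
    have f: "((\<lambda>(x, y). L x y) has_derivative (\<lambda>(tx, ty). b r (c - s + r) * tx + blinfun_apply (blinfun_mult_right (D r (c - s + r))) ty))
        (at (r, c - s + r) within (\<lambda>r. (r, c - s + r)) ` {a..s})"
      by (rule has_derivative_subset[OF part[OF mem] img])
    from has_derivative_in_compose[OF g f]
    have "(H has_derivative (\<lambda>d. b r (c - s + r) * d + D r (c - s + r) * d)) (at r within {a..s})"
      by (simp add: H_def[abs_def] blinfun_mult_right.rep_eq)
    then have "(H has_derivative (\<lambda>d. d *\<^sub>R (lam * (c - s + r) * om r))) (at r within {a..s})"
      by (rule has_derivative_eq_rhs) (simp add: D_def fun_eq_iff algebra_simps)
    then show ?thesis by (simp add: has_vector_derivative_def)
  qed
  have hi: "((\<lambda>r. lam * (c - s + r) * om r) has_integral (H s - H a)) {a..s}"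
    by (rule fundamental_theorem_of_calculus[OF a(2) deriv])
  have "H a = 0"
  proof (cases "s \<le> c")
    case True
    then have "a = 0" by (simp add: a_def)
    then show ?thesis by (simp add: H_def L_def)
  next
    case False
    then have "a = s - c" by (simp add: a_def)
    then have "H a = L a 0" by (simp add: H_def)
    also have "\<dots> = 0" using k2[of a 0] a s c by (simp add: L_def)
    finally show ?thesis .
  qed
  then have Ls: "L s c = integral {a..s} (\<lambda>r. lam * (c - s + r) * om r)"
    using hi by (simp add: H_def integral_unique)
  \<comment> \<open>a continuous extension to the line, so that the reflection formula applies\<close>
  define om' where "om' r = om (max 0 (min t0 r))" for r
  have com': "continuous_on UNIV om'" unfolding om'_def
    by (intro continuous_on_compose2[OF om(1)] continuous_intros) (use s in auto)
  let ?\<phi> = "\<lambda>r. lam * (c - s + r) * om' r"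
  have c\<phi>: "continuous_on UNIV ?\<phi>" by (intro continuous_intros com')
  have "L s c = integral {a..s} ?\<phi>"
    unfolding Ls by (rule integral_cong) (use a s in \<open>auto simp: om'_def\<close>)
  also have "\<dots> = (LINT r|lebesgue_on {a..s}. ?\<phi> r)"
    by (rule lebesgue_integral_eq_integral[symmetric])
       (auto intro!: continuous_imp_integrable_real continuous_on_subset[OF c\<phi>])
  also have "\<dots> = (LINT x|lebesgue_on {0..s-a}. ?\<phi> (s - x))"
    using LINT_reflect[OF borel_measurable_continuous_onI[OF c\<phi>], where a=0 and b="s-a" and x=s] by simp
  also have "\<dots> = (LINT x|lebesgue_on {0..c}. indicator {0..s-a} x * ?\<phi> (s - x))"
    by (rule integral_lebesgue_on_restrict[symmetric]) (use a in auto)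
  also have "\<dots> = (LINT x|lebesgue_on {0..c}. lam * ((c - x) * om (max 0 (s - x))))"
  proof (rule Bochner_Integration.integral_cong[OF refl])
    fix x assume "x \<in> space (lebesgue_on {0..c})"
    then have x: "0 \<le> x" "x \<le> c" by auto
    show "indicator {0..s-a} x * ?\<phi> (s - x) = lam * ((c - x) * om (max 0 (s - x)))"
    proof (cases "x \<le> s - a")
      case True
      have "min t0 (s - x) = s - x" using x s by auto
      then have e: "om' (s - x) = om (max 0 (s - x))" unfolding om'_def by (rule arg_cong)
      have "indicator {0..s-a} x = (1::real)" using True x by simp
      moreover have "c - s + (s - x) = c - x" by simp
      ultimately show ?thesis unfolding e by (simp only: mult_1 mult.assoc)
    next
      case False
      then have "max 0 (s - x) = 0" using x by (auto simp: a_def split: if_splits)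
      then show ?thesis using False om(2) by simp
    qed
  qed
  finally show ?thesis by (simp add: L_def)
qed

text \<open>
  Joint continuity from separate continuity that is uniformly Lipschitz in one variable.
\<close>
lemma continuous_on_Times_lipschitz:
  fixes b :: "real \<Rightarrow> real \<Rightarrow> real"
  assumes L: "\<And>s y y'. s \<in> S \<Longrightarrow> y \<in> Y \<Longrightarrow> y' \<in> Y \<Longrightarrow> \<bar>b s y - b s y'\<bar> \<le> K * \<bar>y - y'\<bar>"
    and c: "\<And>y. y \<in> Y \<Longrightarrow> continuous_on S (\<lambda>s. b s y)"
  shows "continuous_on (S \<times> Y) (\<lambda>(s,y). b s y)"
  unfolding continuous_on_def
proof safe
  fix s y assume s: "s \<in> S" and y: "y \<in> Y"
  have "((\<lambda>p. case p of (s', y') \<Rightarrow> b s' y' - b s y) \<longlongrightarrow> 0) (at (s, y) within S \<times> Y)"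
  proof (rule Lim_null_comparison)
    show "eventually (\<lambda>p. norm (case p of (s', y') \<Rightarrow> b s' y' - b s y) \<le> K * \<bar>snd p - y\<bar> + \<bar>b (fst p) y - b s y\<bar>) (at (s, y) within S \<times> Y)"
      unfolding eventually_at
    proof (intro exI[of _ 1] conjI ballI impI)
      fix p assume "p \<in> S \<times> Y"
      then show "norm (case p of (s', y') \<Rightarrow> b s' y' - b s y) \<le> K * \<bar>snd p - y\<bar> + \<bar>b (fst p) y - b s y\<bar>"
        using L[of "fst p" "snd p" y] y by (auto simp: case_prod_beta)
    qed simp
    have f: "(fst \<longlongrightarrow> s) (at (s, y) within S \<times> Y)" and sn: "(snd \<longlongrightarrow> y) (at (s, y) within S \<times> Y)"
      by (auto intro!: tendsto_eq_intros)
    have "((\<lambda>p. b (fst p) y) \<longlongrightarrow> b s y) (at (s, y) within S \<times> Y)"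
    proof (rule continuous_on_tendsto_compose[OF c[OF y] f s])
      show "\<forall>\<^sub>F p in at (s, y) within S \<times> Y. fst p \<in> S" unfolding eventually_at by (intro exI[of _ 1]) auto
    qed
    then have "((\<lambda>p. K * \<bar>snd p - y\<bar> + \<bar>b (fst p) y - b s y\<bar>) \<longlongrightarrow> K * \<bar>y - y\<bar> + \<bar>b s y - b s y\<bar>) (at (s, y) within S \<times> Y)"
      by (intro tendsto_intros sn)
    then show "((\<lambda>p. K * \<bar>snd p - y\<bar> + \<bar>b (fst p) y - b s y\<bar>) \<longlongrightarrow> 0) (at (s, y) within S \<times> Y)" by simp
  qed
  then have "((\<lambda>p. (case p of (s', y') \<Rightarrow> b s' y') - b s y) \<longlongrightarrow> 0) (at (s, y) within S \<times> Y)"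
    by (simp add: case_prod_beta)
  then show "((\<lambda>(s, y). b s y) \<longlongrightarrow> b s y) (at (s, y) within S \<times> Y)" by (rule LIM_zero_cancel)
qed

context repair_system
begin

lemma cut_integral:
  fixes a b :: "real \<Rightarrow> real"
  assumes "0 \<le> c" "c < l"
  shows "(LINT x|M. a x * (if x \<le> c then b x else 0)) = (LINT x|lebesgue_on {0..c}. a x * b x)"
proof -
  have "(LINT x|M. a x * (if x \<le> c then b x else 0)) = (LINT x|M. indicator {0..c} x * (a x * b x))"
    by (rule Bochner_Integration.integral_cong) (auto simp: indicator_def)
  then show ?thesis using assms by (subst (asm) integral_lebesgue_on_restrict) auto
qed

text \<open>
  \<open>W\<close> stands for the difference of two weak solutions on an interval where the impulses no longer contribute.
  Its values at different times are unrelated representatives, so it need not be jointly measurable; therefore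
  only pairings and integrals in \<open>x\<close> are integrated in time.
\<close>
context
  fixes W :: "real \<Rightarrow> state" and t0 Bd :: real
  assumes t0: "0 \<le> t0"
    and W: "\<And>s. s \<in> {0..t0} \<Longrightarrow> W s \<in> X_space l"
    and Bd: "\<And>s. s \<in> {0..t0} \<Longrightarrow> X_norm l (W s) \<le> Bd"
    and Wi: "\<And>q. q \<in> X_dual l \<Longrightarrow> integrable (lebesgue_on {0..t0}) (\<lambda>s. pairing l (W s) q)"
    and weak: "\<And>Q R s. adj Q R \<Longrightarrow> s \<in> {0..t0} \<Longrightarrow> pairing l (W s) Q = (LINT r|lebesgue_on {0..s}. pairing l (W r) R)"
begin

private definition om where "om s = (LINT r|lebesgue_on {0..s}. fst (W r))"
private definition m where "m s c = (LINT x|lebesgue_on {0..c}. snd (W s) x / F x)"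
text \<open>
  By Cauchy's formula this is the primitive of \<open>m s\<close>, as well as the pairing with a test element.
\<close>
private definition b where "b s c = (LINT x|lebesgue_on {0..c}. (c - x) * (snd (W s) x / F x))"

private lemma fst_integrable: "integrable (lebesgue_on {0..t0}) (\<lambda>s. fst (W s))"
proof -
  have "(1, \<lambda>_. 0) \<in> X_dual l" by (auto simp: X_dual_def)
  from Wi[OF this] show ?thesis by (simp add: pairing_def)
qed

private lemma om_cont: "continuous_on {0..t0} om"
  unfolding om_def[abs_def] by (rule indefinite_integral_continuous_real[OF fst_integrable])

private lemma om_0: "om 0 = 0" by (simp add: om_def)

private lemma snd_integrable: "s \<in> {0..t0} \<Longrightarrow> integrable M (snd (W s))"
  using W by (simp add: X_space_def)

private lemma density_integrable:
  assumes s: "s \<in> {0..t0}" and c: "0 \<le> c" "c < l"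
  shows "integrable (lebesgue_on {0..c}) (\<lambda>x. snd (W s) x / F x)"
proof -
  have i: "integrable (lebesgue_on {0..c}) (snd (W s))"
    by (rule integrable_subinterval[OF snd_integrable[OF s]]) (use c in auto)
  have "integrable (lebesgue_on {0..c}) (\<lambda>x. (1 / F x) * snd (W s) x)"
    by (rule continuous_times_integrable[OF has_L1_deriv_continuous_on[OF F_deriv_sub(2)[OF c]] i])
  then show ?thesis by simp
qed

private lemma b_eq_m: "s \<in> {0..t0} \<Longrightarrow> 0 \<le> c \<Longrightarrow> c < l \<Longrightarrow> b s c = (LINT y|lebesgue_on {0..c}. m s y)"
  unfolding b_def m_def by (rule cauchy_repeated_integral(1)[OF _ density_integrable])

private lemma pairing_cut:
  assumes c: "0 \<le> c" "c < l"
  shows "pairing l P (k, \<lambda>x. if x \<le> c then r x / F x else 0) = fst P * k + (LINT x|lebesgue_on {0..c}. r x * (snd P x / F x))"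
  unfolding pairing_def fst_conv snd_conv cut_integral[OF c] by (simp add: mult.commute)

text \<open>
  The test element with \<open>r x = c - x\<close>.
\<close>
private lemma weak_linear:
  assumes s: "s \<in> {0..t0}" and c: "0 \<le> c" "c < l"
  shows "b s c = (LINT r|lebesgue_on {0..s}. fst (W r) * (lam1 * c) + - m r c)"
    and "integrable (lebesgue_on {0..t0}) (\<lambda>r. fst (W r) * (lam1 * c) + - m r c)"
proof -
  have a: "adj (0, \<lambda>x. if x \<le> c then (c - x) / F x else 0) (lam1 * (c - 0), \<lambda>x. if x \<le> c then (- 1) / F x else 0)"
    by (rule adj_cut[OF c]) (auto intro!: derivative_eq_intros)
  have e: "pairing l (W r) (lam1 * (c - 0), \<lambda>x. if x \<le> c then (- 1) / F x else 0) = fst (W r) * (lam1 * c) + - m r c" for r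
    unfolding pairing_cut[OF c] m_def by simp
  show "b s c = (LINT r|lebesgue_on {0..s}. fst (W r) * (lam1 * c) + - m r c)"
    using weak[OF a s] unfolding e unfolding pairing_cut[OF c] b_def by simp
  have "(lam1 * (c - 0), \<lambda>x. if x \<le> c then (- 1) / F x else 0) \<in> X_dual l" using a by (auto simp: adjoint_rel_def)
  from Wi[OF this] show "integrable (lebesgue_on {0..t0}) (\<lambda>r. fst (W r) * (lam1 * c) + - m r c)" unfolding e .
qed

private lemma b_integrable:
  assumes c: "0 \<le> c" "c < l"
  shows "integrable (lebesgue_on {0..t0}) (\<lambda>r. b r c)"
proof -
  have "(0, \<lambda>x. if x \<le> c then (c - x) / F x else 0) \<in> X_dual l"
    by (rule dual_cut[OF c]) (intro continuous_intros)
  from Wi[OF this] show ?thesis unfolding pairing_cut[OF c] b_def by simp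
qed

private lemma b_cont_y:
  assumes s: "s \<in> {0..t0}" and c: "0 \<le> c" "c < l"
  shows "continuous_on {0..c} (m s)" "continuous_on {0..c} (b s)"
proof -
  show mc: "continuous_on {0..c} (m s)"
    unfolding m_def[abs_def] by (rule indefinite_integral_continuous_real[OF density_integrable[OF s c]])
  show "continuous_on {0..c} (b s)"
    by (rule continuous_on_cong[THEN iffD2, OF refl _ indefinite_integral_continuous_real[OF continuous_imp_integrable_real[OF mc]]])
       (use b_eq_m[OF s] c in auto)
qed

text \<open>
  The test element with \<open>r x = (c - x)\<^sup>2 / 2\<close>; it integrates the previous identity once more in \<open>c\<close> and so makes
  all terms continuous in time.
\<close>
private lemma weak_quadratic:
  assumes s: "s \<in> {0..t0}" and c: "0 \<le> c" "c < l"
  shows "(LINT r|lebesgue_on {0..s}. b r c) = (LINT z|lebesgue_on {0..c}. lam1 * z * om s - b s z)"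
proof -
  have "((\<lambda>x. (c - x)\<^sup>2 / 2) has_real_derivative - (c - x)) (at x)" for x
    by (auto intro!: derivative_eq_intros simp: field_simps)
  then have a: "adj (0, \<lambda>x. if x \<le> c then ((c - x)\<^sup>2 / 2) / F x else 0) (lam1 * ((c - 0)\<^sup>2 / 2), \<lambda>x. if x \<le> c then - (c - x) / F x else 0)"
    by (intro adj_cut[OF c]) (auto intro!: continuous_intros)
  have e: "pairing l (W r) (lam1 * ((c - 0)\<^sup>2 / 2), \<lambda>x. if x \<le> c then - (c - x) / F x else 0) = fst (W r) * (lam1 * (c\<^sup>2 / 2)) - b r c" for r
    unfolding pairing_cut[OF c] b_def mult_minus_left by simp
  have "pairing l (W s) (0, \<lambda>x. if x \<le> c then ((c - x)\<^sup>2 / 2) / F x else 0) = (LINT y|lebesgue_on {0..c}. b s y)"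
    unfolding pairing_cut[OF c] b_def
    using cauchy_repeated_integral(2)[OF c(1) density_integrable[OF s c]] by simp
  then have 1: "(LINT y|lebesgue_on {0..c}. b s y) = (LINT r|lebesgue_on {0..s}. fst (W r) * (lam1 * (c\<^sup>2 / 2)) - b r c)"
    using weak[OF a s] unfolding e by simp
  have i1: "integrable (lebesgue_on {0..s}) (\<lambda>r. fst (W r))" "integrable (lebesgue_on {0..s}) (\<lambda>r. b r c)"
    by (rule integrable_subinterval[OF fst_integrable], use s in simp) (rule integrable_subinterval[OF b_integrable[OF c]], use s in simp)
  have 2: "(LINT r|lebesgue_on {0..s}. fst (W r) * (lam1 * (c\<^sup>2 / 2)) - b r c) = om s * (lam1 * (c\<^sup>2 / 2)) - (LINT r|lebesgue_on {0..s}. b r c)"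
    unfolding om_def using i1 by simp
  have d: "has_L1_deriv c (\<lambda>z. lam1 * z\<^sup>2 / 2 * om s) (\<lambda>z. lam1 * z * om s)"
    by (rule has_L1_deriv_C1) (auto intro!: derivative_eq_intros continuous_intros)
  have "lam1 * c\<^sup>2 / 2 * om s = lam1 * 0\<^sup>2 / 2 * om s + (LINT z|lebesgue_on {0..c}. lam1 * z * om s)"
    by (rule has_L1_derivD(2)[OF d]) (use c in simp)
  moreover have "(LINT z|lebesgue_on {0..c}. lam1 * z * om s - b s z) = (LINT z|lebesgue_on {0..c}. lam1 * z * om s) - (LINT z|lebesgue_on {0..c}. b s z)"
    by (rule Bochner_Integration.integral_diff[OF has_L1_derivD(1)[OF d] continuous_imp_integrable_real[OF b_cont_y(2)[OF s c]]])
  moreover have "lam1 * c\<^sup>2 / 2 * om s = om s * (lam1 * (c\<^sup>2 / 2))" "lam1 * 0\<^sup>2 / 2 * om s = 0" by simp_all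
  ultimately show ?thesis using 1 2 by linarith
qed

private lemma m_bound:
  assumes s: "s \<in> {0..t0}" and c: "c < l" and y: "y \<in> {0..c}"
  shows "\<bar>m s y\<bar> \<le> Bd / F c"
proof -
  have yl: "0 \<le> y" "y < l" using c y by auto
  have i: "integrable (lebesgue_on {0..y}) (snd (W s))"
    by (rule integrable_subinterval[OF snd_integrable[OF s]]) (use yl in auto)
  have "\<bar>m s y\<bar> \<le> (LINT x|lebesgue_on {0..y}. \<bar>snd (W s) x / F x\<bar>)" unfolding m_def by (rule integral_abs_bound)
  also have "\<dots> \<le> (LINT x|lebesgue_on {0..y}. \<bar>snd (W s) x\<bar> / F c)"
  proof (rule Bochner_Integration.integral_mono)
    show "integrable (lebesgue_on {0..y}) (\<lambda>x. \<bar>snd (W s) x / F x\<bar>)"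
      by (rule Bochner_Integration.integrable_abs[OF density_integrable[OF s yl]])
    show "integrable (lebesgue_on {0..y}) (\<lambda>x. \<bar>snd (W s) x\<bar> / F c)" using i by simp
    fix x assume "x \<in> space (lebesgue_on {0..y})"
    then have "F c \<le> F x" "0 < F c" using F_antimono[of x c] F_pos[OF c] y by auto
    then show "\<bar>snd (W s) x / F x\<bar> \<le> \<bar>snd (W s) x\<bar> / F c"
      unfolding abs_divide by (intro divide_left_mono) auto
  qed
  also have "\<dots> = (LINT x|lebesgue_on {0..y}. \<bar>snd (W s) x\<bar>) / F c" by simp
  also have "\<dots> \<le> Bd / F c"
  proof (rule divide_right_mono)
    have "(LINT x|lebesgue_on {0..y}. \<bar>snd (W s) x\<bar>) \<le> (LINT x|M. \<bar>snd (W s) x\<bar>)"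
      by (rule integral_mono_lebesgue_on_AE) (use snd_integrable[OF s] yl in auto)
    also have "\<dots> \<le> X_norm l (W s)" by (simp add: X_norm_def)
    finally show "(LINT x|lebesgue_on {0..y}. \<bar>snd (W s) x\<bar>) \<le> Bd" using Bd[OF s] by linarith
  qed (use F_nonneg in simp)
  finally show ?thesis .
qed

private lemma b_joint_continuous:
  assumes c: "0 \<le> c" "c < l"
  shows "continuous_on ({0..t0} \<times> {0..c}) (\<lambda>(s,y). b s y)"
proof (rule continuous_on_Times_lipschitz)
  have lip: "\<bar>b s y - b s y'\<bar> \<le> Bd / F c * \<bar>y - y'\<bar>" if s: "s \<in> {0..t0}" and y: "y \<in> {0..c}" "y' \<in> {0..c}" "y \<le> y'" for s y y'
  proof -
    have mi: "integrable (lebesgue_on {0..y'}) (m s)"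
      by (rule continuous_imp_integrable_real, rule continuous_on_subset[OF b_cont_y(1)[OF s c]]) (use y in auto)
    have "b s y' = b s y + (LINT z|lebesgue_on {y..y'}. m s z)"
      using b_eq_m[OF s, of y] b_eq_m[OF s, of y'] Equivalence_Measurable_On_Borel.integral_combine[OF mi, of y] y c by simp
    moreover have "\<bar>LINT z|lebesgue_on {y..y'}. m s z\<bar> \<le> (LINT z|lebesgue_on {y..y'}. Bd / F c)"
    proof (rule order_trans[OF integral_abs_bound], rule Bochner_Integration.integral_mono)
      show "integrable (lebesgue_on {y..y'}) (\<lambda>z. \<bar>m s z\<bar>)"
        by (rule Bochner_Integration.integrable_abs, rule integrable_subinterval[OF mi]) (use y in auto)
      show "integrable (lebesgue_on {y..y'}) (\<lambda>z. Bd / F c)"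
        by (rule continuous_imp_integrable_real) (intro continuous_intros)
    qed (use m_bound[OF s c(2)] y in auto)
    ultimately show ?thesis using y by (simp add: measure_restrict_space mult.commute)
  qed
  show "\<bar>b s y - b s y'\<bar> \<le> Bd / F c * \<bar>y - y'\<bar>" if "s \<in> {0..t0}" "y \<in> {0..c}" "y' \<in> {0..c}" for s y y'
    using lip[OF that(1), of y y'] lip[OF that(1), of y' y] that by (cases "y \<le> y'") (auto simp: abs_minus_commute)
  fix y assume y: "y \<in> {0..c}"
  then have yl: "0 \<le> y" "y < l" using c by auto
  show "continuous_on {0..t0} (\<lambda>s. b s y)"
    by (rule continuous_on_cong[THEN iffD2, OF refl _ indefinite_integral_continuous_real[OF weak_linear(2)[OF _ yl]]])
       (use weak_linear(1)[OF _ yl] t0 in auto)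
qed

text \<open>
  Differentiating Duhamel's formula twice in \<open>c\<close>.  It says that \<open>w\<^sub>1(x,s)\<close> is \<open>\<lambda>\<^sub>1 F(x) w\<^sub>0(s - x)\<close> for
  \<open>x < s\<close> and \<open>0\<close> otherwise: all of \<open>w\<^sub>1\<close> has entered through the boundary.
\<close>
private lemma m_formula:
  assumes s: "s \<in> {0..t0}" and y: "0 < y" "y < l"
  shows "m s y = lam1 * (om s - om (max 0 (s - y)))"
proof -
  define u where "u x = om (max 0 (s - x))" for x
  have uc: "continuous_on {0..c} u" for c unfolding u_def
    by (intro continuous_on_compose2[OF om_cont] continuous_intros) (use s in auto)
  have c: "0 \<le> y" "y < l" using y by auto
  have duh: "(LINT r|lebesgue_on {0..s}. b r c) = lam1 * (LINT x|lebesgue_on {0..c}. (c - x) * u x)" if c: "c \<in> {0..y}" for c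
  proof -
    have cl: "0 \<le> c" "c < l" using c y by auto
    show ?thesis unfolding u_def
      by (rule transport_duhamel[OF b_joint_continuous[OF cl] om_cont om_0 _ s cl(1)]) (rule weak_quadratic; use cl in auto)
  qed
  let ?U = "\<lambda>z. LINT x|lebesgue_on {0..z}. u x"
  have Uc: "continuous_on {0..c} ?U" for c
    by (rule indefinite_integral_continuous_real[OF continuous_imp_integrable_real[OF uc]])
  have b2: "lam1 * z * om s - b s z - lam1 * ?U z = 0" if z: "0 < z" "z \<le> y" for z
  proof (rule continuous_zero_if_indefinite_integral_zero[OF _ _ z])
    show "continuous_on {0..y} (\<lambda>z. lam1 * z * om s - b s z - lam1 * ?U z)"
      by (intro continuous_intros b_cont_y(2)[OF s c] Uc)
    fix c assume cy: "c \<in> {0..y}"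
    then have cl: "0 \<le> c" "c < l" using y by auto
    have j1: "integrable (lebesgue_on {0..c}) (\<lambda>z. lam1 * z * om s - b s z)"
      by (intro continuous_imp_integrable_real continuous_intros b_cont_y(2)[OF s cl])
    have j2: "integrable (lebesgue_on {0..c}) (\<lambda>z. lam1 * ?U z)"
      by (intro continuous_imp_integrable_real continuous_intros Uc)
    have "(LINT z|lebesgue_on {0..c}. lam1 * z * om s - b s z - lam1 * ?U z) = (LINT z|lebesgue_on {0..c}. lam1 * z * om s - b s z) - (LINT z|lebesgue_on {0..c}. lam1 * ?U z)"
      by (rule Bochner_Integration.integral_diff[OF j1 j2])
    also have "(LINT z|lebesgue_on {0..c}. lam1 * ?U z) = lam1 * (LINT z|lebesgue_on {0..c}. ?U z)" by simp
    also have "(LINT z|lebesgue_on {0..c}. ?U z) = (LINT x|lebesgue_on {0..c}. (c - x) * u x)"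
      by (rule cauchy_repeated_integral(1)[OF cl(1) continuous_imp_integrable_real[OF uc], symmetric])
    finally show "(LINT z|lebesgue_on {0..c}. lam1 * z * om s - b s z - lam1 * ?U z) = 0"
      using duh[OF cy] weak_quadratic[OF s cl] by linarith
  qed
  have "lam1 * om s - m s z - lam1 * u z = 0" if z: "0 < z" "z \<le> y" for z
  proof (rule continuous_zero_if_indefinite_integral_zero[OF _ _ z])
    show "continuous_on {0..y} (\<lambda>z. lam1 * om s - m s z - lam1 * u z)"
      by (intro continuous_intros b_cont_y(1)[OF s c] uc)
    fix c assume cy: "c \<in> {0..y}"
    then have cl: "0 \<le> c" "c < l" using y by auto
    have j1: "integrable (lebesgue_on {0..c}) (m s)" by (rule continuous_imp_integrable_real[OF b_cont_y(1)[OF s cl]])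
    have j2: "integrable (lebesgue_on {0..c}) (\<lambda>z. lam1 * u z)"
      by (intro continuous_imp_integrable_real continuous_intros uc)
    have j3: "integrable (lebesgue_on {0..c}) (\<lambda>z. lam1 * om s)"
      by (intro continuous_imp_integrable_real continuous_intros)
    have "(LINT z|lebesgue_on {0..c}. lam1 * om s - m s z - lam1 * u z) = (LINT z|lebesgue_on {0..c}. lam1 * om s) - (LINT z|lebesgue_on {0..c}. m s z) - (LINT z|lebesgue_on {0..c}. lam1 * u z)"
      by (simp only: Bochner_Integration.integral_diff[OF Bochner_Integration.integrable_diff[OF j3 j1] j2] Bochner_Integration.integral_diff[OF j3 j1])
    also have "\<dots> = lam1 * c * om s - b s c - lam1 * ?U c"
      using cl by (simp add: b_eq_m[OF s cl] measure_restrict_space)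
    also have "\<dots> = 0"
    proof (cases "c = 0")
      case False then show ?thesis using b2[of c] cy by auto
    qed (simp add: b_def)
    finally show "(LINT z|lebesgue_on {0..c}. lam1 * om s - m s z - lam1 * u z) = 0" .
  qed
  from this[of y] y show ?thesis by (simp add: u_def right_diff_distrib)
qed

text \<open>
  Integration by parts writes the mass as an average of \<open>m\<close> with weights \<open>F c\<close> and \<open>\<mu> F\<close>, of total mass \<open>1\<close>.
\<close>
private lemma partial_mass_bound:
  assumes s: "s \<in> {0..t0}" and c: "0 \<le> c" "c < l"
  shows "\<bar>LINT x|lebesgue_on {0..c}. snd (W s) x\<bar> \<le> lam1 * (LINT r|lebesgue_on {0..s}. \<bar>fst (W r)\<bar>)"
proof -
  define K where "K = lam1 * (LINT r|lebesgue_on {0..s}. \<bar>fst (W r)\<bar>)"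
  let ?C = "lebesgue_on {0..c}"
  have is': "integrable (lebesgue_on {0..s}) (\<lambda>r. fst (W r))"
    by (rule integrable_subinterval[OF fst_integrable]) (use s in auto)
  have nn: "0 \<le> (LINT r|lebesgue_on {0..s}. \<bar>fst (W r)\<bar>)" by simp
  have mK: "\<bar>m s y\<bar> \<le> K" if y: "y \<in> {0..c}" for y
  proof (cases "y = 0")
    case True
    then show ?thesis using nn lam_pos by (simp add: m_def K_def)
  next
    case False
    define a where "a = max 0 (s - y)"
    have a: "0 \<le> a" "a \<le> s" using y s by (auto simp: a_def)
    have "om s = om a + (LINT r|lebesgue_on {a..s}. fst (W r))"
      unfolding om_def by (rule Equivalence_Measurable_On_Borel.integral_combine[OF is' a])
    moreover have "\<bar>LINT r|lebesgue_on {a..s}. fst (W r)\<bar> \<le> (LINT r|lebesgue_on {a..s}. \<bar>fst (W r)\<bar>)"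
      by (rule integral_abs_bound)
    moreover have "(LINT r|lebesgue_on {a..s}. \<bar>fst (W r)\<bar>) \<le> (LINT r|lebesgue_on {0..s}. \<bar>fst (W r)\<bar>)"
      by (rule integral_mono_lebesgue_on_AE) (use is' a in auto)
    ultimately have "\<bar>om s - om a\<bar> \<le> (LINT r|lebesgue_on {0..s}. \<bar>fst (W r)\<bar>)" by linarith
    then have "lam1 * \<bar>om s - om a\<bar> \<le> K" unfolding K_def using lam_pos by (intro mult_left_mono) auto
    moreover have "m s y = lam1 * (om s - om a)" unfolding a_def by (rule m_formula[OF s]) (use False y c in auto)
    ultimately show ?thesis using lam_pos by (simp add: abs_mult)
  qed
  have dm: "has_L1_deriv c (m s) (\<lambda>x. snd (W s) x / F x)"
    using has_L1_deriv_indefinite[OF density_integrable[OF s c], of 0] by (simp add: m_def[abs_def])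
  note dF = F_deriv_sub(1)[OF c]
  note G = has_L1_deriv_mult[OF dF dm]
  have Fx: "F x \<noteq> 0" if "x \<in> {0..c}" for x using F_pos[of x] that c by auto
  have iu: "integrable ?C (snd (W s))" by (rule integrable_subinterval[OF snd_integrable[OF s]]) (use c in auto)
  have imu: "integrable ?C (\<lambda>x. \<mu> x * F x)" by (rule integrable_subinterval[OF mu_times_F_integrable]) (use c in auto)
  have imm: "integrable ?C (\<lambda>x. m s x * (\<mu> x * F x))" by (rule continuous_times_integrable[OF b_cont_y(1)[OF s c] imu])
  have "F c * m s c = F 0 * m s 0 + (LINT x|?C. - (\<mu> x * F x) * m s x + F x * (snd (W s) x / F x))"
    by (rule has_L1_derivD(2)[OF G]) (use c in simp)
  also have "(LINT x|?C. - (\<mu> x * F x) * m s x + F x * (snd (W s) x / F x)) = (LINT x|?C. snd (W s) x - m s x * (\<mu> x * F x))"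
    by (rule Bochner_Integration.integral_cong) (use Fx in auto)
  also have "\<dots> = (LINT x|?C. snd (W s) x) - (LINT x|?C. m s x * (\<mu> x * F x))" using iu imm by simp
  finally have e: "(LINT x|?C. snd (W s) x) = F c * m s c + (LINT x|?C. m s x * (\<mu> x * F x))" by (simp add: m_def)
  have "\<bar>LINT x|?C. m s x * (\<mu> x * F x)\<bar> \<le> (LINT x|?C. \<bar>m s x * (\<mu> x * F x)\<bar>)" by (rule integral_abs_bound)
  also have "\<dots> \<le> (LINT x|?C. K * (\<mu> x * F x))"
  proof (rule Bochner_Integration.integral_mono)
    show "integrable ?C (\<lambda>x. \<bar>m s x * (\<mu> x * F x)\<bar>)" by (rule Bochner_Integration.integrable_abs[OF imm])
    show "integrable ?C (\<lambda>x. K * (\<mu> x * F x))" using imu by simp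
    fix x assume "x \<in> space ?C"
    then have x: "x \<in> {0..c}" "0 \<le> \<mu> x * F x" using mu_nonneg[of x] F_nonneg[of x] c by auto
    then show "\<bar>m s x * (\<mu> x * F x)\<bar> \<le> K * (\<mu> x * F x)"
      unfolding abs_mult[of "m s x"] using mK[OF x(1)] by (simp add: mult_right_mono)
  qed
  also have "\<dots> = K * (LINT x|?C. \<mu> x * F x)" by simp
  also have "(LINT x|?C. \<mu> x * F x) = 1 - F c"
  proof -
    have "F c = F 0 + (LINT x|?C. - (\<mu> x * F x))" by (rule has_L1_derivD(2)[OF dF]) (use c in simp)
    then show ?thesis by simp
  qed
  finally have "\<bar>LINT x|?C. m s x * (\<mu> x * F x)\<bar> \<le> K * (1 - F c)" .
  moreover have "\<bar>F c * m s c\<bar> \<le> F c * K"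
    unfolding abs_mult using F_nonneg[of c] mK[of c] c by (simp add: mult_left_mono)
  ultimately have "\<bar>LINT x|?C. snd (W s) x\<bar> \<le> F c * K + K * (1 - F c)" unfolding e by linarith
  also have "\<dots> = K" by (simp add: algebra_simps)
  finally show ?thesis unfolding K_def .
qed

private lemma partial_mass_bound':
  assumes s: "s \<in> {0..t0}" and c: "0 \<le> c" "c \<le> l"
  shows "\<bar>LINT x|lebesgue_on {0..c}. snd (W s) x\<bar> \<le> lam1 * (LINT r|lebesgue_on {0..s}. \<bar>fst (W r)\<bar>)"
proof (cases "c < l")
  case True
  then show ?thesis using partial_mass_bound[OF s c(1)] by simp
next
  case False
  then have [simp]: "c = l" using c by simp
  define k where "k n = l - l / real (n+2)" for n :: nat
  note ks = exhausting_seq[OF l_pos, folded k_def]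
  have "(\<lambda>n. LINT x|lebesgue_on {0..k n}. snd (W s) x) \<longlonglongrightarrow> (LINT x|M. snd (W s) x)"
    by (rule continuous_on_tendsto_compose[OF indefinite_integral_continuous_real[OF snd_integrable[OF s]] ks(3)])
       (use ks l_pos in \<open>auto simp: less_imp_le\<close>)
  then have "(\<lambda>n. \<bar>LINT x|lebesgue_on {0..k n}. snd (W s) x\<bar>) \<longlonglongrightarrow> \<bar>LINT x|M. snd (W s) x\<bar>" by (rule tendsto_rabs)
  then have "\<bar>LINT x|M. snd (W s) x\<bar> \<le> lam1 * (LINT r|lebesgue_on {0..s}. \<bar>fst (W r)\<bar>)"
    by (rule LIMSEQ_le_const2) (use partial_mass_bound[OF s ks(1) ks(2)] in blast)
  then show ?thesis by simp
qed

text \<open>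
  Conservation of mass bounds \<open>w\<^sub>0\<close> by the mass of \<open>w\<^sub>1\<close>, and that in turn by the past of \<open>w\<^sub>0\<close>.
\<close>
lemma impulse_free_zero:
  assumes s: "s \<in> {0..t0}"
  shows "X_norm l (W s) = 0"
proof -
  have mass: "fst (W r) = - (LINT x|M. snd (W r) x)" if "r \<in> {0..t0}" for r
    using weak[OF adj_mass that] by (simp add: pairing_def)
  have fi: "integrable (lebesgue_on {0..t0}) (\<lambda>r. \<bar>fst (W r)\<bar>)" using fst_integrable by simp
  have z: "\<bar>fst (W r)\<bar> \<le> 2 * 0 * exp (2 * lam1 * r)" if r: "r \<in> {0..t0}" for r
  proof (rule gronwall_bounded[OF lam_pos _ fi _ _ r])
    show "0 \<le> \<bar>fst (W t)\<bar> \<and> \<bar>fst (W t)\<bar> \<le> Bd" if t: "t \<in> {0..t0}" for t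
    proof -
      have "0 \<le> (LINT x|M. \<bar>snd (W t) x\<bar>)" by simp
      then show ?thesis using Bd[OF t] unfolding X_norm_def by (intro conjI; linarith)
    qed
    show "\<bar>fst (W t)\<bar> \<le> 0 + lam1 * (LINT s|lebesgue_on {0..t}. \<bar>fst (W s)\<bar>)" if t: "t \<in> {0..t0}" for t
      using partial_mass_bound'[OF t, of l] mass[OF t] l_pos by simp
  qed simp
  have f0: "fst (W r) = 0" if "r \<in> {0..t0}" for r using z[OF that] by simp
  have "(LINT r|lebesgue_on {0..s}. \<bar>fst (W r)\<bar>) = (LINT r|lebesgue_on {0..s}. 0)"
    by (rule Bochner_Integration.integral_cong) (use f0 s in auto)
  then have "(LINT x|lebesgue_on {0..c}. snd (W s) x) = 0" if "c \<in> {0..l}" for c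
    using partial_mass_bound'[OF s, of c] that by simp
  then have "AE x in M. snd (W s) x = 0"
    by (rule AE_zero_if_indefinite_integral_zero[OF snd_integrable[OF s]])
  then have "(LINT x|M. \<bar>snd (W s) x\<bar>) = 0"
    by (intro integral_eq_zero_AE) (auto elim: eventually_mono)
  then show ?thesis using f0[OF s] by (simp add: X_norm_def)
qed

end

end

section \<open>Weak solutions with impulses\<close>

lemma X_norm_triangle:
  assumes "P \<in> X_space l" "P' \<in> X_space l"
  shows "\<bar>X_norm l P - X_norm l P'\<bar> \<le> X_norm l (X_diff P P')"
proof -
  let ?M = "lebesgue_on {0..l}"
  have i: "integrable ?M (snd P)" "integrable ?M (snd P')" using assms by (auto simp: X_space_def)
  have "\<bar>(LINT x|?M. \<bar>snd P x\<bar>) - (LINT x|?M. \<bar>snd P' x\<bar>)\<bar> = \<bar>LINT x|?M. \<bar>snd P x\<bar> - \<bar>snd P' x\<bar>\<bar>"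
    using i by simp
  also have "\<dots> \<le> (LINT x|?M. \<bar>\<bar>snd P x\<bar> - \<bar>snd P' x\<bar>\<bar>)" by (rule integral_abs_bound)
  also have "\<dots> \<le> (LINT x|?M. \<bar>snd P x - snd P' x\<bar>)"
    by (rule Bochner_Integration.integral_mono) (use i in auto)
  finally show ?thesis unfolding X_norm_def X_diff_def fst_conv snd_conv by linarith
qed

lemma X_norm_tendsto:
  assumes P: "eventually (\<lambda>s. P s \<in> X_space l) A" and R: "R \<in> X_space l" and lim: "X_tendsto l P R A"
  shows "((\<lambda>s. X_norm l (P s)) \<longlongrightarrow> X_norm l R) A"
proof -
  have "((\<lambda>s. X_norm l (P s) - X_norm l R) \<longlongrightarrow> 0) A"
  proof (rule Lim_null_comparison[OF _ lim[unfolded X_tendsto_def]])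
    show "eventually (\<lambda>s. norm (X_norm l (P s) - X_norm l R) \<le> X_norm l (X_diff (P s) R)) A"
      using P by eventually_elim (use X_norm_triangle[OF _ R] in simp)
  qed
  then show ?thesis by (rule LIM_zero_cancel)
qed

lemma eventually_at_left_Icc: "t \<in> {0<..T} \<Longrightarrow> eventually (\<lambda>s. s \<in> {0..T}) (at_left (t::real))"
  unfolding eventually_at_left_field by (intro exI[of _ 0]) auto

lemma eventually_at_right_Icc: "t \<in> {0..<T} \<Longrightarrow> eventually (\<lambda>s. s \<in> {0..T}) (at_right (t::real))"
  unfolding eventually_at_right_field by (intro exI[of _ T]) auto

lemma PWC_leftD:
  assumes "P \<in> PWC_left l T"
  shows "\<And>t. t \<in> {0..T} \<Longrightarrow> P t \<in> X_space l"
    and "\<And>t. t \<in> {0<..T} \<Longrightarrow> X_tendsto l P (P t) (at_left t)"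
    and "\<And>t. t \<in> {0..<T} \<Longrightarrow> \<exists>R\<in>X_space l. X_tendsto l P R (at_right t)"
    and "finite {t\<in>{0..<T}. \<not> X_tendsto l P (P t) (at_right t)}"
  using assms unfolding PWC_left_def by blast+

lemma PWC_left_eventually:
  assumes "P \<in> PWC_left l T"
  shows "t \<in> {0<..T} \<Longrightarrow> eventually (\<lambda>s. P s \<in> X_space l) (at_left t)"
    and "t \<in> {0..<T} \<Longrightarrow> eventually (\<lambda>s. P s \<in> X_space l) (at_right t)"
  by (erule eventually_mono[OF eventually_at_left_Icc PWC_leftD(1)[OF assms]], assumption)
     (erule eventually_mono[OF eventually_at_right_Icc PWC_leftD(1)[OF assms]], assumption)

lemma PWC_left_bounded:
  assumes P: "P \<in> PWC_left l T" and T: "0 \<le> T"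
  obtains B where "\<And>t. t \<in> {0..T} \<Longrightarrow> X_norm l (P t) \<le> B"
proof -
  have "\<exists>B. \<forall>t\<in>{0..T}. \<bar>X_norm l (P t)\<bar> \<le> B"
  proof (rule regulated_bounded[OF T])
    fix t assume t: "t \<in> {0<..T}"
    then have "P t \<in> X_space l" using PWC_leftD(1)[OF P, of t] by simp
    from X_norm_tendsto[OF PWC_left_eventually(1)[OF P t] this PWC_leftD(2)[OF P t]]
    show "\<exists>r. ((\<lambda>t. X_norm l (P t)) \<longlongrightarrow> r) (at_left t)" by blast
  next
    fix t assume t: "t \<in> {0..<T}"
    obtain R where "R \<in> X_space l" "X_tendsto l P R (at_right t)" using PWC_leftD(3)[OF P t] by blast
    from X_norm_tendsto[OF PWC_left_eventually(2)[OF P t] this]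
    show "\<exists>r. ((\<lambda>t. X_norm l (P t)) \<longlongrightarrow> r) (at_right t)" by blast
  qed
  then obtain B where "\<forall>t\<in>{0..T}. \<bar>X_norm l (P t)\<bar> \<le> B" by blast
  then have "X_norm l (P t) \<le> B" if "t \<in> {0..T}" for t using that abs_le_D1 by blast
  then show thesis using that by blast
qed

lemma PWC_left_pairing:
  assumes P: "P \<in> PWC_left l T" and q: "q \<in> X_dual l" and T: "0 \<le> T"
  shows "t \<in> {0<..T} \<Longrightarrow> ((\<lambda>s. pairing l (P s) q) \<longlongrightarrow> pairing l (P t) q) (at_left t)"
    and "integrable (lebesgue_on {0..T}) (\<lambda>s. pairing l (P s) q)"
proof -
  show L: "((\<lambda>s. pairing l (P s) q) \<longlongrightarrow> pairing l (P t) q) (at_left t)" if t: "t \<in> {0<..T}" for t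
    by (rule pairing_tendsto[OF q PWC_left_eventually(1)[OF P t] PWC_leftD(1)[OF P] PWC_leftD(2)[OF P t]]) (use t in auto)
  show "integrable (lebesgue_on {0..T}) (\<lambda>s. pairing l (P s) q)"
  proof (rule regulated_integrable[OF T L _ PWC_leftD(4)[OF P]])
    fix t assume t: "t \<in> {0..<T}"
    obtain R where "R \<in> X_space l" "X_tendsto l P R (at_right t)" using PWC_leftD(3)[OF P t] by blast
    from pairing_tendsto[OF q PWC_left_eventually(2)[OF P t] this]
    show "\<exists>r. ((\<lambda>s. pairing l (P s) q) \<longlongrightarrow> r) (at_right t)" by blast
  next
    fix t assume t: "t \<in> {0..<T}" and "t \<notin> {t \<in> {0..<T}. \<not> X_tendsto l P (P t) (at_right t)}"
    then have "X_tendsto l P (P t) (at_right t)" by blast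
    from pairing_tendsto[OF q PWC_left_eventually(2)[OF P t] PWC_leftD(1)[OF P] this]
    show "((\<lambda>s. pairing l (P s) q) \<longlongrightarrow> pairing l (P t) q) (at_right t)" using t by simp
  qed
qed

text \<open>
  Write \<open>c u - c' u' = c (u - u') + (c - c') u'\<close>.  The factor \<open>2\<close> accounts for the two components.
\<close>
lemma impulse_lipschitz:
  assumes c: "c \<in> borel_measurable (lebesgue_on {0..l})" "\<And>x. x \<in> {0..l} \<Longrightarrow> \<bar>c x\<bar> \<le> 1"
    and c': "c' \<in> borel_measurable (lebesgue_on {0..l})" "\<And>x. x \<in> {0..l} \<Longrightarrow> \<bar>c' x\<bar> \<le> 1"
    and \<delta>: "0 \<le> \<delta>" "\<And>x. x \<in> {0..l} \<Longrightarrow> \<bar>c x - c' x\<bar> \<le> \<delta>"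
    and P: "P \<in> X_space l" "P' \<in> X_space l"
  shows "X_norm l (X_diff (impulse l c P) (impulse l c' P')) \<le> 2 * (X_norm l (X_diff P P') + \<delta> * X_norm l P')"
    and "impulse l c P \<in> X_space l"
proof -
  let ?M = "lebesgue_on {0..l}"
  have i: "integrable ?M (snd P)" "integrable ?M (snd P')" using P by (auto simp: X_space_def)
  have im: "integrable ?M (\<lambda>x. k x * u x)" if k: "k \<in> borel_measurable ?M" "\<And>x. x \<in> {0..l} \<Longrightarrow> \<bar>k x\<bar> \<le> 1" and u: "integrable ?M u" for k u :: "real \<Rightarrow> real"
  proof (rule Bochner_Integration.integrable_bound[OF u borel_measurable_times[OF k(1) borel_measurable_integrable[OF u]]], intro AE_I2)
    fix x assume "x \<in> space ?M"
    then have "\<bar>k x\<bar> * \<bar>u x\<bar> \<le> 1 * \<bar>u x\<bar>" by (intro mult_right_mono k) auto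
    then show "norm (k x * u x) \<le> norm (u x)" by (simp add: abs_mult)
  qed
  note i1 = im[OF c i(1)] and i2 = im[OF c' i(2)]
  show "impulse l c P \<in> X_space l" using i1 by (simp add: X_space_def impulse_def)
  have "(LINT x|?M. \<bar>c x * snd P x - c' x * snd P' x\<bar>) \<le> (LINT x|?M. \<bar>snd P x - snd P' x\<bar> + \<delta> * \<bar>snd P' x\<bar>)"
  proof (rule Bochner_Integration.integral_mono)
    fix x assume "x \<in> space ?M"
    then have x: "x \<in> {0..l}" by simp
    have "c x * snd P x - c' x * snd P' x = c x * (snd P x - snd P' x) + (c x - c' x) * snd P' x" by (simp add: algebra_simps)
    moreover have "\<bar>c x * (snd P x - snd P' x)\<bar> \<le> 1 * \<bar>snd P x - snd P' x\<bar>" unfolding abs_mult by (intro mult_right_mono c x) auto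
    moreover have "\<bar>(c x - c' x) * snd P' x\<bar> \<le> \<delta> * \<bar>snd P' x\<bar>" unfolding abs_mult by (intro mult_right_mono \<delta> x) auto
    moreover have "z = u + w \<Longrightarrow> \<bar>u\<bar> \<le> 1 * a \<Longrightarrow> \<bar>w\<bar> \<le> d \<Longrightarrow> \<bar>z\<bar> \<le> a + d" for z u w a d :: real by linarith
    ultimately show "\<bar>c x * snd P x - c' x * snd P' x\<bar> \<le> \<bar>snd P x - snd P' x\<bar> + \<delta> * \<bar>snd P' x\<bar>" by blast
  qed (use i i1 i2 in auto)
  also have "\<dots> = (LINT x|?M. \<bar>snd P x - snd P' x\<bar>) + \<delta> * (LINT x|?M. \<bar>snd P' x\<bar>)" using i by simp
  also have "\<dots> \<le> X_norm l (X_diff P P') + \<delta> * X_norm l P'"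
    using \<delta>(1) by (intro add_mono mult_left_mono) (auto simp: X_norm_def X_diff_def)
  finally have A: "(LINT x|?M. \<bar>c x * snd P x - c' x * snd P' x\<bar>) \<le> X_norm l (X_diff P P') + \<delta> * X_norm l P'" .
  have d: "(LINT x|?M. c x * snd P x) - (LINT x|?M. c' x * snd P' x) = (LINT x|?M. c x * snd P x - c' x * snd P' x)"
    using i1 i2 by simp
  have "\<bar>(LINT x|?M. c x * snd P x) - (LINT x|?M. c' x * snd P' x)\<bar> \<le> (LINT x|?M. \<bar>c x * snd P x - c' x * snd P' x\<bar>)"
    unfolding d by (rule integral_abs_bound)
  moreover have "(LINT x|?M. \<bar>- (c x * snd P x) - - (c' x * snd P' x)\<bar>) = (LINT x|?M. \<bar>c x * snd P x - c' x * snd P' x\<bar>)"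
    by (rule Bochner_Integration.integral_cong) auto
  moreover have "X_norm l (X_diff (impulse l c P) (impulse l c' P')) =
      \<bar>(LINT x|?M. c x * snd P x) - (LINT x|?M. c' x * snd P' x)\<bar> + (LINT x|?M. \<bar>- (c x * snd P x) - - (c' x * snd P' x)\<bar>)"
    by (simp only: X_norm_def X_diff_def impulse_def fst_conv snd_conv)
  moreover have "d \<le> j \<Longrightarrow> i = j \<Longrightarrow> n = d + i \<Longrightarrow> j \<le> a \<Longrightarrow> n \<le> 2 * a" for d i j n a :: real by linarith
  ultimately show "X_norm l (X_diff (impulse l c P) (impulse l c' P')) \<le> 2 * (X_norm l (X_diff P P') + \<delta> * X_norm l P')"
    using A by blast
qed

lemma U_ad_measurable:
  assumes \<omega>: "modulus_of_continuity \<omega>" and b: "b \<in> U_ad l N \<omega>" and i: "i \<in> {1..N}"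
  shows "continuous_on {0..l} (b i)" "b i \<in> borel_measurable (lebesgue_on {0..l})" "\<And>x. x \<in> {0..l} \<Longrightarrow> \<bar>b i x\<bar> \<le> 1"
proof -
  have B: "\<And>x. x \<in> {0..l} \<Longrightarrow> 0 \<le> b i x \<and> b i x \<le> 1"
    "\<And>x y. x \<in> {0..l} \<Longrightarrow> y \<in> {0..l} \<Longrightarrow> \<bar>b i x - b i y\<bar> \<le> \<omega> \<bar>x - y\<bar>"
    using b i by (auto simp: U_ad_def)
  show c: "continuous_on {0..l} (b i)"
    unfolding continuous_on_iff
  proof (intro ballI allI impI)
    fix x e :: real assume x: "x \<in> {0..l}" and e: "0 < e"
    have "(\<omega> \<longlongrightarrow> 0) (at_right 0)" using \<omega> by (simp add: modulus_of_continuity_def)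
    then have "eventually (\<lambda>r. \<omega> r < e) (at_right 0)" using e by (rule order_tendstoD)
    then obtain d where d: "0 < d" "\<And>r. 0 < r \<Longrightarrow> r < d \<Longrightarrow> \<omega> r < e"
      unfolding eventually_at_right_field by blast
    show "\<exists>d>0. \<forall>y\<in>{0..l}. dist y x < d \<longrightarrow> dist (b i y) (b i x) < e"
    proof (intro exI[of _ d] conjI ballI impI d(1))
      fix y assume y: "y \<in> {0..l}" "dist y x < d"
      show "dist (b i y) (b i x) < e"
      proof (cases "y = x")
        case False
        then have "\<omega> \<bar>y - x\<bar> < e" using d(2)[of "\<bar>y - x\<bar>"] y by (simp add: dist_real_def)
        then show ?thesis using B(2)[OF y(1) x] by (simp add: dist_real_def)
      qed (use e in simp)
    qed
  qed
  show "b i \<in> borel_measurable (lebesgue_on {0..l})" using continuous_imp_integrable_real[OF c] by auto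
  show "\<And>x. x \<in> {0..l} \<Longrightarrow> \<bar>b i x\<bar> \<le> 1" using B(1) by fastforce
qed

lemma X_eq_sym: "X_eq l P P' \<Longrightarrow> X_eq l P' P"
  unfolding X_eq_def by (auto elim: eventually_mono)

lemma X_eq_trans: "X_eq l P P' \<Longrightarrow> X_eq l P' P'' \<Longrightarrow> X_eq l P P''"
  unfolding X_eq_def by (auto elim: eventually_elim2)

context repair_system
begin

lemma adjoint_op_adj: "adj Q R \<Longrightarrow> adj Q (adjoint_op l (sys_op l lam1 \<mu>) (sys_dom l lam1 \<mu>) Q)"
  unfolding adjoint_op_def by (rule someI)

text \<open>
  The description in the weak equation may be replaced by any adjoint value.
\<close>
lemma weak_solution_mild:
  assumes ws: "weak_solution l T lam1 \<mu> N \<tau> P0 b P" and T: "0 < T"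
    and \<tau>: "\<forall>i\<in>{1..N}. 0 \<le> \<tau> i \<and> \<tau> i \<le> T"
    and a: "adj Q R" and t: "t \<in> {0<..T}"
  shows "pairing l (P t) Q = mild N \<tau> (pairing l P0 Q) (\<lambda>s. pairing l (P s) R) (\<lambda>i. pairing l (impulse l (b i) (P (\<tau> i))) Q) t"
proof -
  let ?R = "adjoint_op l (sys_op l lam1 \<mu>) (sys_dom l lam1 \<mu>) Q"
  have T0: "0 \<le> T" using T by simp
  have P: "P \<in> PWC_left l T" using ws by (simp add: weak_solution_def)
  have a': "adj Q ?R" by (rule adjoint_op_adj[OF a])
  have Q: "Q \<in> X_dual l" and R: "?R \<in> X_dual l" using a' by (auto simp: adjoint_rel_def)
  have Qd: "Q \<in> adjoint_dom l (sys_op l lam1 \<mu>) (sys_dom l lam1 \<mu>)" using a unfolding adjoint_dom_def by blast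
  have "pairing l (P t) Q = mild N \<tau> (pairing l P0 Q) (\<lambda>s. pairing l (P s) ?R) (\<lambda>i. pairing l (impulse l (b i) (P (\<tau> i))) Q) t"
  proof (rule weak_imp_mild[OF T0 PWC_left_pairing(2)[OF P R T0] PWC_left_pairing(2)[OF P Q T0] \<tau>])
    fix \<psi> \<psi>' assume "\<forall>t\<in>{0..T}. (\<psi> has_real_derivative \<psi>' t) (at t within {0..T})" "continuous_on {0..T} \<psi>'" "\<psi> T = 0"
    then show "- (LINT t|lebesgue_on {0..T}. pairing l (P t) Q * \<psi>' t) =
      (LINT t|lebesgue_on {0..T}. pairing l (P t) ?R * \<psi> t) + (\<Sum>i=1..N. pairing l (impulse l (b i) (P (\<tau> i))) Q * \<psi> (\<tau> i)) + pairing l P0 Q * \<psi> 0"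
      using ws Qd unfolding weak_solution_def by blast
  qed (use t PWC_left_pairing(1)[OF P Q T0 t] in auto)
  moreover have "(LINT s|lebesgue_on {0..t}. pairing l (P s) ?R) = (LINT s|lebesgue_on {0..t}. pairing l (P s) R)"
    by (rule Bochner_Integration.integral_cong[OF refl], rule adjoint_value_unique[OF a' a], rule PWC_leftD(1)[OF P]) (use t in auto)
  ultimately show ?thesis by (simp add: mild_def)
qed

lemma mild_weak_solution:
  assumes P: "P \<in> PWC_left l T" and ini: "X_eq l (P 0) P0" and T: "0 < T"
    and \<tau>: "\<forall>i\<in>{1..N}. 0 \<le> \<tau> i \<and> \<tau> i \<le> T"
    and m: "\<And>Q R t. adj Q R \<Longrightarrow> t \<in> {0..T} \<Longrightarrow> pairing l (P t) Q = mild N \<tau> (pairing l P0 Q) (\<lambda>s. pairing l (P s) R) (\<lambda>i. pairing l (impulse l (b i) (P (\<tau> i))) Q) t"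
  shows "weak_solution l T lam1 \<mu> N \<tau> P0 b P"
  unfolding weak_solution_def
proof (intro conjI P ini ballI allI impI)
  fix Q \<psi> \<psi>' assume "Q \<in> adjoint_dom l (sys_op l lam1 \<mu>) (sys_dom l lam1 \<mu>)"
    and \<psi>: "(\<forall>t\<in>{0..T}. (\<psi> has_real_derivative \<psi>' t) (at t within {0..T})) \<and> continuous_on {0..T} \<psi>' \<and> \<psi> T = 0"
  then obtain R where a: "adj Q R" unfolding adjoint_dom_def by blast
  let ?R = "adjoint_op l (sys_op l lam1 \<mu>) (sys_dom l lam1 \<mu>) Q"
  have a': "adj Q ?R" by (rule adjoint_op_adj[OF a])
  have R: "?R \<in> X_dual l" using a' by (auto simp: adjoint_rel_def)
  have T0: "0 \<le> T" using T by simp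
  have "(LINT t|lebesgue_on {0..T}. pairing l (P t) Q * \<psi>' t) = (LINT t|lebesgue_on {0..T}. mild N \<tau> (pairing l P0 Q) (\<lambda>s. pairing l (P s) ?R) (\<lambda>i. pairing l (impulse l (b i) (P (\<tau> i))) Q) t * \<psi>' t)"
    by (rule Bochner_Integration.integral_cong[OF refl]) (use m[OF a'] in simp)
  then show "- (LINT t|lebesgue_on {0..T}. pairing l (P t) Q * \<psi>' t) =
      (LINT t|lebesgue_on {0..T}. pairing l (P t) ?R * \<psi> t) + (\<Sum>i=1..N. pairing l (impulse l (b i) (P (\<tau> i))) Q * \<psi> (\<tau> i)) + pairing l P0 Q * \<psi> 0"
    using mild_weak(2)[OF T0 PWC_left_pairing(2)[OF P R T0] \<tau>, of \<psi> \<psi>'] \<psi> by simp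
qed

text \<open>
  Induction on the number of impulses before \<open>t\<close>.  At an earlier impulse time fewer impulses have occurred, so
  both solutions agree there and receive the same impulse; their difference solves the equation without
  impulses on all of \<open>[0,t]\<close>.
\<close>
theorem weak_solution_unique:
  assumes ws: "weak_solution l T lam1 \<mu> N \<tau> P0 b P" "weak_solution l T lam1 \<mu> N \<tau> P0 b P'" and T: "0 < T"
    and \<tau>: "\<forall>i\<in>{1..N}. 0 \<le> \<tau> i \<and> \<tau> i \<le> T" and \<omega>: "modulus_of_continuity \<omega>" and b: "b \<in> U_ad l N \<omega>"
  shows "t \<in> {0..T} \<Longrightarrow> X_eq l (P t) (P' t)"
proof (induction "card {i\<in>{1..N}. \<tau> i < t}" arbitrary: t rule: less_induct)
  case less
  have T0: "0 \<le> T" using T by simp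
  have P: "P \<in> PWC_left l T" "P' \<in> PWC_left l T" using ws by (auto simp: weak_solution_def)
  note PX = PWC_leftD(1)[OF P(1)] PWC_leftD(1)[OF P(2)]
  have eq0: "X_eq l (P 0) (P' 0)" using ws X_eq_trans X_eq_sym unfolding weak_solution_def by blast
  have imp: "pairing l (impulse l (b i) (P (\<tau> i))) Q = pairing l (impulse l (b i) (P' (\<tau> i))) Q"
    if i: "i \<in> {1..N}" "\<tau> i < t" and Q: "Q \<in> X_dual l" for i Q
  proof -
    have "{j\<in>{1..N}. \<tau> j < \<tau> i} \<subset> {j\<in>{1..N}. \<tau> j < t}" using i by auto
    then have "card {j\<in>{1..N}. \<tau> j < \<tau> i} < card {j\<in>{1..N}. \<tau> j < t}" by (intro psubset_card_mono) auto
    moreover have \<tau>i: "\<tau> i \<in> {0..T}" using \<tau> i by auto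
    ultimately have e: "X_eq l (P (\<tau> i)) (P' (\<tau> i))" by (rule less.hyps)
    note bi = U_ad_measurable(2,3)[OF \<omega> b i(1)]
    note X = PX(1)[OF \<tau>i] PX(2)[OF \<tau>i]
    have "X_norm l (X_diff (impulse l (b i) (P (\<tau> i))) (impulse l (b i) (P' (\<tau> i)))) \<le> 2 * (X_norm l (X_diff (P (\<tau> i)) (P' (\<tau> i))) + 0 * X_norm l (P' (\<tau> i)))"
      by (rule impulse_lipschitz(1)[OF bi bi _ _ X]) auto
    also have "\<dots> = 0" using e X_eq_iff_norm[OF X] by simp
    finally have "X_norm l (X_diff (impulse l (b i) (P (\<tau> i))) (impulse l (b i) (P' (\<tau> i)))) = 0" using X_norm_nonneg by (metis order_antisym)
    moreover have iX: "impulse l (b i) (P (\<tau> i)) \<in> X_space l" "impulse l (b i) (P' (\<tau> i)) \<in> X_space l"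
      by (rule impulse_lipschitz(2)[OF bi bi, of 0 _ "P (\<tau> i)"]; use X in simp)+
    ultimately show ?thesis using X_eq_pairing[OF iX Q] X_eq_iff_norm[OF iX] by blast
  qed
  obtain B1 where B1: "\<And>t. t \<in> {0..T} \<Longrightarrow> X_norm l (P t) \<le> B1" using PWC_left_bounded[OF P(1) T0] by blast
  obtain B2 where B2: "\<And>t. t \<in> {0..T} \<Longrightarrow> X_norm l (P' t) \<le> B2" using PWC_left_bounded[OF P(2) T0] by blast
  have sub: "s \<in> {0..T}" if "s \<in> {0..t}" for s using that less.prems by auto
  have pi: "integrable (lebesgue_on {0..s}) (\<lambda>r. pairing l (P r) q)" "integrable (lebesgue_on {0..s}) (\<lambda>r. pairing l (P' r) q)"
    if "q \<in> X_dual l" "s \<in> {0..t}" for q s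
    by (rule integrable_subinterval[OF PWC_left_pairing(2)[OF P(1) that(1) T0]], use sub[OF that(2)] in simp)
       (rule integrable_subinterval[OF PWC_left_pairing(2)[OF P(2) that(1) T0]], use sub[OF that(2)] in simp)
  have "X_norm l (X_diff (P t) (P' t)) = 0"
  proof (rule impulse_free_zero[where W="\<lambda>s. X_diff (P s) (P' s)" and ?t0.0=t and Bd="B1 + B2"])
    show "0 \<le> t" "t \<in> {0..t}" using less.prems by auto
    show "X_diff (P s) (P' s) \<in> X_space l" if "s \<in> {0..t}" for s by (rule X_diff_in[OF PX[OF sub[OF that]]])
    show "X_norm l (X_diff (P s) (P' s)) \<le> B1 + B2" if s: "s \<in> {0..t}" for s
    proof -
      let ?M = "lebesgue_on {0..l}"
      have i: "integrable ?M (snd (P s))" "integrable ?M (snd (P' s))" using PX[OF sub[OF s]] by (auto simp: X_space_def)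
      have "(LINT x|?M. \<bar>snd (P s) x - snd (P' s) x\<bar>) \<le> (LINT x|?M. \<bar>snd (P s) x\<bar> + \<bar>snd (P' s) x\<bar>)"
        by (rule Bochner_Integration.integral_mono) (use i in auto)
      also have "\<dots> = (LINT x|?M. \<bar>snd (P s) x\<bar>) + (LINT x|?M. \<bar>snd (P' s) x\<bar>)" using i by simp
      finally show ?thesis using B1[OF sub[OF s]] B2[OF sub[OF s]] unfolding X_norm_def X_diff_def fst_conv snd_conv by linarith
    qed
    show "integrable (lebesgue_on {0..t}) (\<lambda>s. pairing l (X_diff (P s) (P' s)) q)" if q: "q \<in> X_dual l" for q
    proof (rule Bochner_Integration.integrable_cong[THEN iffD2, OF refl])
      show "integrable (lebesgue_on {0..t}) (\<lambda>s. pairing l (P s) q - pairing l (P' s) q)"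
        using pi[OF q, of t] less.prems by auto
      fix s assume "s \<in> space (lebesgue_on {0..t})"
      then have "s \<in> {0..t}" by simp
      then show "pairing l (X_diff (P s) (P' s)) q = pairing l (P s) q - pairing l (P' s) q"
        by (intro pairing_X_diff PX sub q)
    qed
    fix Q R s assume a: "adj Q R" and s: "s \<in> {0..t}"
    have Q: "Q \<in> X_dual l" and R: "R \<in> X_dual l" using a by (auto simp: adjoint_rel_def)
    have "(LINT r|lebesgue_on {0..s}. pairing l (X_diff (P r) (P' r)) R) = (LINT r|lebesgue_on {0..s}. pairing l (P r) R - pairing l (P' r) R)"
    proof (rule Bochner_Integration.integral_cong[OF refl])
      fix r assume "r \<in> space (lebesgue_on {0..s})"
      then have "r \<in> {0..T}" using s sub by auto
      then show "pairing l (X_diff (P r) (P' r)) R = pairing l (P r) R - pairing l (P' r) R"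
        by (intro pairing_X_diff PX R)
    qed
    also have "\<dots> = (LINT r|lebesgue_on {0..s}. pairing l (P r) R) - (LINT r|lebesgue_on {0..s}. pairing l (P' r) R)"
      using pi[OF R s] by simp
    finally have e: "(LINT r|lebesgue_on {0..s}. pairing l (X_diff (P r) (P' r)) R) = (LINT r|lebesgue_on {0..s}. pairing l (P r) R) - (LINT r|lebesgue_on {0..s}. pairing l (P' r) R)" .
    show "pairing l (X_diff (P s) (P' s)) Q = (LINT r|lebesgue_on {0..s}. pairing l (X_diff (P r) (P' r)) R)"
    proof (cases "s = 0")
      case True
      have z: "0 \<in> {0..T}" using T by simp
      have "pairing l (P 0) Q = pairing l (P' 0) Q" by (rule X_eq_pairing[OF PX[OF z] Q eq0])
      then show ?thesis using True pairing_X_diff[OF PX[OF z] Q] by simp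
    next
      case False
      then have s': "s \<in> {0<..T}" using s sub by auto
      have "(\<Sum>i=1..N. if \<tau> i < s then pairing l (impulse l (b i) (P (\<tau> i))) Q else 0) = (\<Sum>i=1..N. if \<tau> i < s then pairing l (impulse l (b i) (P' (\<tau> i))) Q else 0)"
        by (rule sum.cong[OF refl]) (use imp Q s in auto)
      then show ?thesis
        unfolding e pairing_X_diff[OF PX[OF sub[OF s]] Q]
        using weak_solution_mild[OF ws(1) T \<tau> a s'] weak_solution_mild[OF ws(2) T \<tau> a s'] unfolding mild_def by linarith
    qed
  qed
  then show ?case using X_eq_iff_norm[OF PX[OF less.prems]] by simp
qed

end

section \<open>Construction of the controlled trajectory\<close>

definition jump :: "real \<Rightarrow> (real \<Rightarrow> real) \<Rightarrow> state \<Rightarrow> state" where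
  "jump l c P = (fst P + fst (impulse l c P), \<lambda>x. snd P x + snd (impulse l c P) x)"

lemma jump_in_X: "P \<in> X_space l \<Longrightarrow> impulse l c P \<in> X_space l \<Longrightarrow> jump l c P \<in> X_space l"
  by (simp add: jump_def X_space_def)

lemma pairing_jump:
  assumes "P \<in> X_space l" "impulse l c P \<in> X_space l" "q \<in> X_dual l"
  shows "pairing l (jump l c P) q = pairing l P q + pairing l (impulse l c P) q"
proof -
  have "integrable (lebesgue_on {0..l}) (\<lambda>x. snd P x * snd q x)" "integrable (lebesgue_on {0..l}) (\<lambda>x. snd (impulse l c P) x * snd q x)"
    using dual_times_integrable[OF assms(3)] assms(1,2) by (auto simp: X_space_def)
  then show ?thesis by (simp add: pairing_def jump_def distrib_right)
qed

lemma X_tendsto_cong: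
  assumes "eventually (\<lambda>s. P s = P' s) A" "X_tendsto l P R A" shows "X_tendsto l P' R A"
  using assms(2) unfolding X_tendsto_def
  by (rule Lim_transform_eventually) (use assms(1) in eventually_elim, simp)

context repair_system
begin

text \<open>
  A description selects representatives and the Volterra solution.  Every choice has
  the properties below.
\<close>
definition S :: "state \<Rightarrow> real \<Rightarrow> state" where
  "S P = (SOME f. \<exists>p v. flow_data P p v \<and> f = flow p v)"

lemma S_flow:
  assumes "P \<in> X_space l" obtains p v where "flow_data P p v" "S P = flow p v"
proof -
  obtain p v where "flow_data P p v" using flow_data_exists[OF assms] by blast
  then have "\<exists>f. \<exists>p v. flow_data P p v \<and> f = flow p v" by blast
  then have "\<exists>p v. flow_data P p v \<and> S P = flow p v" unfolding S_def by (rule someI_ex)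
  then show thesis using that by blast
qed

lemma S_in_X: "P \<in> X_space l \<Longrightarrow> 0 \<le> t \<Longrightarrow> S P t \<in> X_space l"
  by (rule S_flow[of P]) (auto intro: flow_in_X)

lemma S_0: "P \<in> X_space l \<Longrightarrow> X_eq l (S P 0) P"
  by (rule S_flow[of P]) (auto intro: flow_0)

lemma S_lipschitz:
  assumes "P \<in> X_space l" "P' \<in> X_space l" "0 \<le> t" "t \<le> T"
  shows "X_norm l (X_diff (S P t) (S P' t)) \<le> growth T * X_norm l (X_diff P P')"
proof -
  obtain p v where 1: "flow_data P p v" "S P = flow p v" using S_flow[OF assms(1)] by blast
  obtain p' v' where 2: "flow_data P' p' v'" "S P' = flow p' v'" using S_flow[OF assms(2)] by blast
  show ?thesis unfolding 1(2) 2(2) by (rule flow_lipschitz[OF 1(1) 2(1) assms(3,4)])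
qed

text \<open>
  Comparison with the flow that stays at the zero state.
\<close>
lemma S_bound:
  assumes P: "P \<in> X_space l" and t: "0 \<le> t" "t \<le> T"
  shows "X_norm l (S P t) \<le> growth T * X_norm l P"
proof -
  obtain p v where 1: "flow_data P p v" "S P = flow p v" using S_flow[OF P] by blast
  have h0: "h (\<lambda>_. 0) (\<lambda>_. 0) = (\<lambda>_. 0)" by (auto simp: h_def fun_eq_iff)
  have z: "flow_data (0, \<lambda>_. 0) (\<lambda>_. 0) (\<lambda>_. 0)"
    by (simp add: flow_data_def X_space_def profile_def h0)
  have "X_norm l (X_diff (flow p v t) (flow (\<lambda>_. 0) (\<lambda>_. 0) t)) \<le> growth T * X_norm l (X_diff P (0, \<lambda>_. 0))"
    by (rule flow_lipschitz[OF 1(1) z t])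
  then show ?thesis unfolding 1(2) by (simp add: X_norm_def X_diff_def flow_def h0)
qed

lemma S_tendsto:
  assumes P: "P \<in> X_space l" and t: "0 \<le> t"
  shows "X_tendsto l (S P) (S P t) (at t within {0..})"
proof -
  obtain p v where 1: "flow_data P p v" "S P = flow p v" using S_flow[OF P] by blast
  show ?thesis unfolding 1(2) X_tendsto_def by (rule flow_continuous[OF 1(1) t])
qed

lemma S_weak:
  assumes P: "P \<in> X_space l" and t: "0 \<le> t" and a: "adj Q R"
  shows "pairing l (S P t) Q = pairing l P Q + (LINT s|lebesgue_on {0..t}. pairing l (S P s) R)"
proof -
  obtain p v where 1: "flow_data P p v" "S P = flow p v" using S_flow[OF P] by blast
  show ?thesis unfolding 1(2) by (rule flow_weak[OF 1(1) t a])
qed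

lemma S_pairing_continuous:
  assumes P: "P \<in> X_space l" and q: "q \<in> X_dual l"
  shows "continuous_on {0..} (\<lambda>s. pairing l (S P s) q)"
proof -
  obtain p v where 1: "flow_data P p v" "S P = flow p v" using S_flow[OF P] by blast
  show ?thesis unfolding 1(2) by (rule flow_pairing_continuous[OF 1(1) q])
qed

lemma S_shift:
  assumes P: "P \<in> X_space l" and a: "0 \<le> a"
  shows "t > a \<Longrightarrow> X_tendsto l (\<lambda>s. S P (s - a)) (S P (t - a)) (at_left t)"
    and "t \<ge> a \<Longrightarrow> X_tendsto l (\<lambda>s. S P (s - a)) (S P (t - a)) (at_right t)"
proof -
  have f: "((\<lambda>s. s - a) \<longlongrightarrow> t - a) A" if "A \<le> at t" for A
    by (rule tendsto_mono[OF that]) (intro tendsto_intros)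
  show "X_tendsto l (\<lambda>s. S P (s - a)) (S P (t - a)) (at_left t)" if t: "t > a"
  proof -
    have "filterlim (\<lambda>s. s - a) (at (t - a) within {0..}) (at_left t)"
    proof (rule filterlim_at_withinI)
      show "((\<lambda>s. s - a) \<longlongrightarrow> t - a) (at_left t)" by (rule f) (simp add: at_le)
      have "eventually (\<lambda>s. a < s \<and> s < t) (at_left t)" unfolding eventually_at_left_field using t by blast
      then show "\<forall>\<^sub>F s in at_left t. s - a \<in> {0..} - {t - a}" by eventually_elim auto
    qed
    then show ?thesis using filterlim_compose[OF S_tendsto[OF P, of "t - a", unfolded X_tendsto_def]] t by (simp add: X_tendsto_def)
  qed
  show "X_tendsto l (\<lambda>s. S P (s - a)) (S P (t - a)) (at_right t)" if t: "t \<ge> a"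
  proof -
    have "filterlim (\<lambda>s. s - a) (at (t - a) within {0..}) (at_right t)"
    proof (rule filterlim_at_withinI)
      show "((\<lambda>s. s - a) \<longlongrightarrow> t - a) (at_right t)" by (rule f) (simp add: at_le)
      have "eventually (\<lambda>s. t < s) (at_right t)" by (rule eventually_at_right_less)
      then show "\<forall>\<^sub>F s in at_right t. s - a \<in> {0..} - {t - a}" by eventually_elim (use t in auto)
    qed
    then show ?thesis using filterlim_compose[OF S_tendsto[OF P, of "t - a", unfolded X_tendsto_def]] t by (simp add: X_tendsto_def)
  qed
qed

text \<open>
  The trajectory under the first \<open>i\<close> impulses only; the next one changes it strictly after its time.
\<close>
primrec traj :: "(nat \<Rightarrow> real) \<Rightarrow> state \<Rightarrow> (nat \<Rightarrow> real \<Rightarrow> real) \<Rightarrow> nat \<Rightarrow> real \<Rightarrow> state" where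
  "traj \<tau> P0 b 0 = S P0"
| "traj \<tau> P0 b (Suc i) = (\<lambda>t. if t \<le> \<tau> (Suc i) then traj \<tau> P0 b i t
     else S (jump l (b (Suc i)) (traj \<tau> P0 b i (\<tau> (Suc i)))) (t - \<tau> (Suc i)))"

context
  fixes T :: real and N :: nat and \<tau> :: "nat \<Rightarrow> real" and P0 :: state and \<omega> :: "real \<Rightarrow> real"
  assumes T: "0 < T" and \<omega>: "modulus_of_continuity \<omega>" and P0: "P0 \<in> X_space l"
    and mono: "strict_mono_on {1..N} \<tau>" and \<tau>: "\<forall>i\<in>{1..N}. 0 \<le> \<tau> i \<and> \<tau> i \<le> T"
begin

lemma impulse_in_X:
  assumes b: "b \<in> U_ad l N \<omega>" and i: "i \<in> {1..N}" and P: "P \<in> X_space l"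
  shows "impulse l (b i) P \<in> X_space l"
  by (rule impulse_lipschitz(2)[OF U_ad_measurable(2,3)[OF \<omega> b i] U_ad_measurable(2,3)[OF \<omega> b i], of 0 _ P]) (use P in auto)

lemma traj_in_X:
  assumes b: "b \<in> U_ad l N \<omega>"
  shows "i \<le> N \<Longrightarrow> 0 \<le> t \<Longrightarrow> traj \<tau> P0 b i t \<in> X_space l"
proof (induction i arbitrary: t)
  case (Suc i)
  have i: "Suc i \<in> {1..N}" using Suc.prems by simp
  have "traj \<tau> P0 b i (\<tau> (Suc i)) \<in> X_space l" using Suc \<tau> i by simp
  then have "jump l (b (Suc i)) (traj \<tau> P0 b i (\<tau> (Suc i))) \<in> X_space l" by (intro jump_in_X impulse_in_X[OF b i])
  then show ?case using Suc by (simp add: S_in_X)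
qed (simp add: S_in_X P0)

lemma traj_jump_in_X:
  assumes b: "b \<in> U_ad l N \<omega>" and i: "Suc i \<le> N"
  shows "impulse l (b (Suc i)) (traj \<tau> P0 b i (\<tau> (Suc i))) \<in> X_space l"
    "jump l (b (Suc i)) (traj \<tau> P0 b i (\<tau> (Suc i))) \<in> X_space l"
    "traj \<tau> P0 b i (\<tau> (Suc i)) \<in> X_space l"
proof -
  have i': "Suc i \<in> {1..N}" using i by simp
  show 1: "traj \<tau> P0 b i (\<tau> (Suc i)) \<in> X_space l" using traj_in_X[OF b] \<tau> i i' by simp
  show 2: "impulse l (b (Suc i)) (traj \<tau> P0 b i (\<tau> (Suc i))) \<in> X_space l" by (rule impulse_in_X[OF b i' 1])
  show "jump l (b (Suc i)) (traj \<tau> P0 b i (\<tau> (Suc i))) \<in> X_space l" by (rule jump_in_X[OF 1 2])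
qed

lemma traj_left:
  assumes b: "b \<in> U_ad l N \<omega>"
  shows "i \<le> N \<Longrightarrow> 0 < t \<Longrightarrow> X_tendsto l (traj \<tau> P0 b i) (traj \<tau> P0 b i t) (at_left t)"
proof (induction i)
  case 0
  then show ?case using S_shift(1)[OF P0, of 0 t] by simp
next
  case (Suc i)
  show ?case
  proof (cases "t \<le> \<tau> (Suc i)")
    case True
    have "eventually (\<lambda>s. s < t) (at_left t)" unfolding eventually_at_left_field using lt_ex by blast
    then have "eventually (\<lambda>s. traj \<tau> P0 b i s = traj \<tau> P0 b (Suc i) s) (at_left t)"
      by eventually_elim (use True in simp)
    from X_tendsto_cong[OF this Suc.IH] True Suc.prems show ?thesis by simp
  next
    case False
    let ?J = "jump l (b (Suc i)) (traj \<tau> P0 b i (\<tau> (Suc i)))"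
    have "eventually (\<lambda>s. \<tau> (Suc i) < s) (at_left t)" unfolding eventually_at_left_field using False by (intro exI[of _ "\<tau> (Suc i)"]) auto
    then have "eventually (\<lambda>s. S ?J (s - \<tau> (Suc i)) = traj \<tau> P0 b (Suc i) s) (at_left t)"
      by eventually_elim simp
    from X_tendsto_cong[OF this S_shift(1)[OF traj_jump_in_X(2)[OF b]]] False Suc.prems \<tau> show ?thesis by simp
  qed
qed

lemma traj_right:
  assumes b: "b \<in> U_ad l N \<omega>"
  shows "i \<le> N \<Longrightarrow> 0 \<le> t \<Longrightarrow> (\<exists>R\<in>X_space l. X_tendsto l (traj \<tau> P0 b i) R (at_right t)) \<and>
     (t \<notin> \<tau> ` {1..i} \<longrightarrow> X_tendsto l (traj \<tau> P0 b i) (traj \<tau> P0 b i t) (at_right t))"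
proof (induction i)
  case 0
  then have "X_tendsto l (S P0) (S P0 t) (at_right t)" using S_shift(2)[OF P0, of 0 t] by simp
  then show ?case using S_in_X[OF P0 0(2)] by auto
next
  case (Suc i)
  let ?a = "\<tau> (Suc i)" and ?J = "jump l (b (Suc i)) (traj \<tau> P0 b i (\<tau> (Suc i)))"
  have a0: "0 \<le> ?a" using \<tau> Suc.prems by simp
  note J = traj_jump_in_X(2)[OF b Suc.prems(1)]
  show ?case
  proof (cases "t < ?a")
    case True
    have "eventually (\<lambda>s. s < ?a) (at_right t)" unfolding eventually_at_right_field using True by (intro exI[of _ ?a]) auto
    then have "eventually (\<lambda>s. traj \<tau> P0 b i s = traj \<tau> P0 b (Suc i) s) (at_right t)"
      by eventually_elim simp
    note c = X_tendsto_cong[OF this]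
    have IH: "\<exists>R\<in>X_space l. X_tendsto l (traj \<tau> P0 b i) R (at_right t)"
      "t \<notin> \<tau> ` {1..i} \<Longrightarrow> X_tendsto l (traj \<tau> P0 b i) (traj \<tau> P0 b i t) (at_right t)"
      using Suc by auto
    have "\<exists>R\<in>X_space l. X_tendsto l (traj \<tau> P0 b (Suc i)) R (at_right t)" using IH(1) c by blast
    moreover have "X_tendsto l (traj \<tau> P0 b (Suc i)) (traj \<tau> P0 b (Suc i) t) (at_right t)" if "t \<notin> \<tau> ` {1..Suc i}"
    proof -
      have "t \<notin> \<tau> ` {1..i}" using that by auto
      from c[OF IH(2)[OF this]] show ?thesis using True by simp
    qed
    ultimately show ?thesis by blast
  next
    case False
    have "eventually (\<lambda>s. t < s) (at_right t)" by (rule eventually_at_right_less)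
    then have "eventually (\<lambda>s. S ?J (s - ?a) = traj \<tau> P0 b (Suc i) s) (at_right t)"
      by eventually_elim (use False in simp)
    from X_tendsto_cong[OF this S_shift(2)[OF J a0]] False
    have c: "X_tendsto l (traj \<tau> P0 b (Suc i)) (S ?J (t - ?a)) (at_right t)" by simp
    have "S ?J (t - ?a) \<in> X_space l" by (rule S_in_X[OF J]) (use False in simp)
    moreover have "traj \<tau> P0 b (Suc i) t = S ?J (t - ?a)" if "t \<notin> \<tau> ` {1..Suc i}"
    proof -
      have "t \<noteq> ?a" using that by auto
      then show ?thesis using False by simp
    qed
    ultimately show ?thesis using c by metis
  qed
qed

lemma traj_PWC:
  assumes b: "b \<in> U_ad l N \<omega>" and i: "i \<le> N"
  shows "traj \<tau> P0 b i \<in> PWC_left l T"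
  unfolding PWC_left_def
proof (intro CollectI conjI ballI)
  show "finite {t \<in> {0..<T}. \<not> X_tendsto l (traj \<tau> P0 b i) (traj \<tau> P0 b i t) (at_right t)}"
    by (rule finite_subset[of _ "\<tau> ` {1..i}"]) (use traj_right[OF b i] in auto)
qed (use traj_in_X[OF b i] traj_left[OF b i] traj_right[OF b i] in auto)

lemma traj_before: "t \<le> \<tau> (Suc i) \<Longrightarrow> traj \<tau> P0 b (Suc i) t = traj \<tau> P0 b i t" by simp

lemma tau_less: "j \<in> {1..i} \<Longrightarrow> Suc i \<le> N \<Longrightarrow> \<tau> j < \<tau> (Suc i)"
  using mono by (auto simp: strict_mono_on_def)

text \<open>
  Up to the new impulse nothing changes; afterwards the weak equation of the semiflow started from the jump
  is added, and all earlier impulses already count in full.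
\<close>
lemma traj_mild:
  assumes b: "b \<in> U_ad l N \<omega>" and a: "adj Q R"
  shows "i \<le> N \<Longrightarrow> t \<in> {0..T} \<Longrightarrow> pairing l (traj \<tau> P0 b i t) Q =
    mild i \<tau> (pairing l P0 Q) (\<lambda>s. pairing l (traj \<tau> P0 b i s) R) (\<lambda>j. pairing l (impulse l (b j) (traj \<tau> P0 b i (\<tau> j))) Q) t"
proof (induction i arbitrary: t)
  case 0
  then show ?case using S_weak[OF P0 _ a, of t] by (simp add: mild_def)
next
  case (Suc i)
  let ?a = "\<tau> (Suc i)" and ?old = "traj \<tau> P0 b i" and ?new = "traj \<tau> P0 b (Suc i)"
  let ?J = "jump l (b (Suc i)) (traj \<tau> P0 b i (\<tau> (Suc i)))"
  have Q: "Q \<in> X_dual l" and R: "R \<in> X_dual l" using a by (auto simp: adjoint_rel_def)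
  have aT: "?a \<in> {0..T}" using \<tau> Suc.prems(1) by auto
  note J = traj_jump_in_X[OF b Suc.prems(1)]
  have oldN: "i \<le> N" using Suc.prems(1) by simp
  have newat: "?new (\<tau> j) = ?old (\<tau> j)" if "j \<in> {1..Suc i}" for j
    using that tau_less[of j i] Suc.prems(1) by (cases "j = Suc i") auto
  have int_eq: "(LINT s|lebesgue_on {0..r}. pairing l (?new s) R) = (LINT s|lebesgue_on {0..r}. pairing l (?old s) R)" if "r \<le> ?a" for r
    by (rule Bochner_Integration.integral_cong[OF refl]) (use that in simp)
  have IH: "pairing l (?old r) Q = pairing l P0 Q + (LINT s|lebesgue_on {0..r}. pairing l (?old s) R)
     + (\<Sum>j=1..i. if \<tau> j < r then pairing l (impulse l (b j) (?old (\<tau> j))) Q else 0)" if "r \<in> {0..T}" for r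
    using Suc.IH[OF oldN that] by (simp add: mild_def)
  show ?case
  proof (cases "t \<le> ?a")
    case True
    have "(\<Sum>j=1..Suc i. if \<tau> j < t then pairing l (impulse l (b j) (?new (\<tau> j))) Q else 0) = (\<Sum>j=1..i. if \<tau> j < t then pairing l (impulse l (b j) (?old (\<tau> j))) Q else 0)"
    proof -
      have "(\<Sum>j=1..i. if \<tau> j < t then pairing l (impulse l (b j) (?new (\<tau> j))) Q else 0) = (\<Sum>j=1..i. if \<tau> j < t then pairing l (impulse l (b j) (?old (\<tau> j))) Q else 0)"
        by (rule sum.cong[OF refl]) (simp add: newat del: traj.simps)
      then show ?thesis using True by (simp del: traj.simps)
    qed
    then show ?thesis unfolding mild_def using IH[OF Suc.prems(2)] int_eq[OF True] traj_before[OF True] by simp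
  next
    case False
    \<comment> \<open>clamping makes the integrand continuous on the line, hence Borel; it differs from the trajectory at \<open>?a\<close> only\<close>
    define f where "f y = pairing l (S ?J (max 0 y)) R" for y
    have fc: "continuous_on UNIV f" unfolding f_def
      by (rule continuous_on_compose2[OF S_pairing_continuous[OF J(2) R]]) (auto intro!: continuous_intros)
    have newi: "integrable (lebesgue_on {0..t}) (\<lambda>s. pairing l (?new s) R)"
      by (rule integrable_subinterval[OF PWC_left_pairing(2)[OF traj_PWC[OF b Suc.prems(1)] R]]) (use T Suc.prems in auto)
    have newi': "integrable (lebesgue_on {?a..t}) (\<lambda>s. pairing l (?new s) R)"
      by (rule integrable_subinterval[OF newi]) (use aT in auto)
    have split: "(LINT s|lebesgue_on {0..t}. pairing l (?new s) R) = (LINT s|lebesgue_on {0..?a}. pairing l (?new s) R) + (LINT s|lebesgue_on {?a..t}. pairing l (?new s) R)"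
      by (rule Equivalence_Measurable_On_Borel.integral_combine[OF newi]) (use aT False in auto)
    have "(LINT s|lebesgue_on {?a..t}. pairing l (?new s) R) = (LINT s|lebesgue_on {?a..t}. f (s - ?a))"
    proof (rule Bochner_Integration.integral_cong_AE)
      show "(\<lambda>s. pairing l (?new s) R) \<in> borel_measurable (lebesgue_on {?a..t})" using newi' by auto
      show "(\<lambda>s. f (s - ?a)) \<in> borel_measurable (lebesgue_on {?a..t})"
        by (intro borel_measurable_integrable continuous_imp_integrable_real continuous_on_compose2[OF fc]) (auto intro!: continuous_intros)
      have "AE s in lebesgue. s \<noteq> ?a" by (rule AE_completion[OF AE_lborel_singleton])
      then have "AE s in lebesgue. s \<in> {?a..t} \<longrightarrow> pairing l (?new s) R = f (s - ?a)"
        by eventually_elim (auto simp: f_def max_def)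
      then show "AE s in lebesgue_on {?a..t}. pairing l (?new s) R = f (s - ?a)"
        by (subst AE_restrict_space_iff) simp_all
    qed
    also have "\<dots> = (LINT y|lebesgue_on {0..t - ?a}. f y)"
      using LINT_shift[OF borel_measurable_continuous_onI[OF fc], where a="?a" and b=t and t="?a"] by simp
    also have "\<dots> = (LINT y|lebesgue_on {0..t - ?a}. pairing l (S ?J y) R)"
      by (rule Bochner_Integration.integral_cong) (auto simp: f_def max_def)
    finally have tail: "(LINT s|lebesgue_on {?a..t}. pairing l (?new s) R) = (LINT y|lebesgue_on {0..t - ?a}. pairing l (S ?J y) R)" .
    have "pairing l (?new t) Q = pairing l ?J Q + (LINT s|lebesgue_on {0..t - ?a}. pairing l (S ?J s) R)"
      using S_weak[OF J(2) _ a, of "t - ?a"] False by simp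
    moreover have "pairing l ?J Q = pairing l (?old ?a) Q + pairing l (impulse l (b (Suc i)) (?old ?a)) Q"
      by (rule pairing_jump[OF J(3,1) Q])
    moreover have "(\<Sum>j=1..i. if \<tau> j < ?a then pairing l (impulse l (b j) (?old (\<tau> j))) Q else 0)
       + pairing l (impulse l (b (Suc i)) (?old ?a)) Q = (\<Sum>j=1..Suc i. if \<tau> j < t then pairing l (impulse l (b j) (?new (\<tau> j))) Q else 0)"
    proof -
      have "(\<Sum>j=1..i. if \<tau> j < ?a then pairing l (impulse l (b j) (?old (\<tau> j))) Q else 0) = (\<Sum>j=1..i. if \<tau> j < t then pairing l (impulse l (b j) (?new (\<tau> j))) Q else 0)"
      proof (rule sum.cong[OF refl])
        fix j assume j: "j \<in> {1..i}"
        then have "\<tau> j < ?a" by (rule tau_less[OF _ Suc.prems(1)])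
        moreover have "?new (\<tau> j) = ?old (\<tau> j)" by (rule newat) (use j in auto)
        ultimately show "(if \<tau> j < ?a then pairing l (impulse l (b j) (?old (\<tau> j))) Q else 0) = (if \<tau> j < t then pairing l (impulse l (b j) (?new (\<tau> j))) Q else 0)"
          using False by (simp del: traj.simps)
      qed
      then show ?thesis using False newat[of "Suc i"] by (simp del: traj.simps)
    qed
    moreover note IH[OF aT] int_eq[of ?a] split tail
    ultimately show ?thesis unfolding mild_def by linarith
  qed
qed

lemma traj_0: 
  assumes b: "b \<in> U_ad l N \<omega>" shows "i \<le> N \<Longrightarrow> X_eq l (traj \<tau> P0 b i 0) P0"
proof (induction i)
  case (Suc i)
  then show ?case using \<tau> by simp
qed (use S_0[OF P0] in simp)

theorem traj_weak_solution:
  assumes b: "b \<in> U_ad l N \<omega>"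
  shows "weak_solution l T lam1 \<mu> N \<tau> P0 b (traj \<tau> P0 b N)"
  by (rule mild_weak_solution[OF traj_PWC[OF b order_refl] traj_0[OF b order_refl] T \<tau>]) (rule traj_mild[OF b _ order_refl])

end

end

section \<open>Continuous dependence, compactness and the optimal control\<close>

lemma jump_lipschitz:
  assumes P: "P \<in> X_space l" "P' \<in> X_space l" "impulse l c P \<in> X_space l" "impulse l c' P' \<in> X_space l"
  shows "X_norm l (X_diff (jump l c P) (jump l c' P')) \<le> X_norm l (X_diff P P') + X_norm l (X_diff (impulse l c P) (impulse l c' P'))"
proof -
  let ?M = "lebesgue_on {0..l}"
  have i: "integrable ?M (snd P)" "integrable ?M (snd P')" "integrable ?M (snd (impulse l c P))" "integrable ?M (snd (impulse l c' P'))"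
    using P by (auto simp: X_space_def)
  have "(LINT x|?M. \<bar>(snd P x + snd (impulse l c P) x) - (snd P' x + snd (impulse l c' P') x)\<bar>)
     \<le> (LINT x|?M. \<bar>snd P x - snd P' x\<bar> + \<bar>snd (impulse l c P) x - snd (impulse l c' P') x\<bar>)"
    by (rule Bochner_Integration.integral_mono) (use i in auto)
  also have "\<dots> = (LINT x|?M. \<bar>snd P x - snd P' x\<bar>) + (LINT x|?M. \<bar>snd (impulse l c P) x - snd (impulse l c' P') x\<bar>)"
    using i by simp
  finally show ?thesis unfolding X_norm_def X_diff_def jump_def fst_conv snd_conv by linarith
qed

lemma jump_zero_bound:
  assumes P: "P \<in> X_space l" and c: "c \<in> borel_measurable (lebesgue_on {0..l})" "\<And>x. x \<in> {0..l} \<Longrightarrow> \<bar>c x\<bar> \<le> 1"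
  shows "X_norm l (jump l c P) \<le> 3 * X_norm l P"
proof -
  have z: "(0, \<lambda>_. 0) \<in> X_space l" by (simp add: X_space_def)
  have iX: "impulse l c P \<in> X_space l" "impulse l c (0, \<lambda>_. 0) \<in> X_space l"
    by (rule impulse_lipschitz(2)[OF c c, of 0 _ P]; use P in simp) (rule impulse_lipschitz(2)[OF c c, of 0 _ "(0, \<lambda>_. 0)"]; use z in simp)
  have "X_norm l (X_diff (impulse l c P) (impulse l c (0, \<lambda>_. 0))) \<le> 2 * (X_norm l (X_diff P (0, \<lambda>_. 0)) + 0 * X_norm l (0, \<lambda>_. 0))"
    by (rule impulse_lipschitz(1)[OF c c _ _ P z]) auto
  moreover have "i \<le> 2 * (d + 0 * n) \<Longrightarrow> j \<le> d + i \<Longrightarrow> j \<le> 3 * d" for i j d n :: real by simp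
  ultimately have "X_norm l (X_diff (jump l c P) (jump l c (0, \<lambda>_. 0))) \<le> 3 * X_norm l (X_diff P (0, \<lambda>_. 0))"
    using jump_lipschitz[OF P z iX] by blast
  then show ?thesis by (simp add: X_norm_def X_diff_def jump_def impulse_def)
qed

context repair_system
begin

context
  fixes T :: real and N :: nat and \<tau> :: "nat \<Rightarrow> real" and P0 :: state and \<omega> :: "real \<Rightarrow> real"
  assumes T: "0 < T" and \<omega>: "modulus_of_continuity \<omega>" and P0: "P0 \<in> X_space l"
    and mono: "strict_mono_on {1..N} \<tau>" and \<tau>: "\<forall>i\<in>{1..N}. 0 \<le> \<tau> i \<and> \<tau> i \<le> T"
begin

lemma traj_bounded:
  "i \<le> N \<Longrightarrow> \<exists>K\<ge>0. \<forall>b\<in>U_ad l N \<omega>. \<forall>t\<in>{0..T}. X_norm l (traj \<tau> P0 b i t) \<le> K"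
proof (induction i)
  case 0
  show ?case
  proof (intro exI[of _ "growth T * X_norm l P0"] conjI ballI)
    show "0 \<le> growth T * X_norm l P0" using growth_ge[of T] T X_norm_nonneg[of l P0] by (intro mult_nonneg_nonneg) auto
    fix b t assume "t \<in> {0..T}"
    then show "X_norm l (traj \<tau> P0 b 0 t) \<le> growth T * X_norm l P0" using S_bound[OF P0, of t T] by simp
  qed
next
  case (Suc i)
  then obtain K where K: "K \<ge> 0" "\<And>b t. b \<in> U_ad l N \<omega> \<Longrightarrow> t \<in> {0..T} \<Longrightarrow> X_norm l (traj \<tau> P0 b i t) \<le> K" by auto
  have i: "Suc i \<in> {1..N}" using Suc.prems by simp
  have g: "1 \<le> growth T" using growth_ge T by simp
  show ?case
  proof (intro exI[of _ "growth T * (3 * K)"] conjI ballI)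
    show "0 \<le> growth T * (3 * K)" using g K by simp
    fix b t assume b: "b \<in> U_ad l N \<omega>" and t: "t \<in> {0..T}"
    note J = traj_jump_in_X[OF T \<omega> P0 mono \<tau> b Suc.prems]
    show "X_norm l (traj \<tau> P0 b (Suc i) t) \<le> growth T * (3 * K)"
    proof (cases "t \<le> \<tau> (Suc i)")
      case True
      have "K \<le> growth T * (3 * K)" using mult_mono[OF g, of K "3 * K"] g K by simp
      then show ?thesis using K(2)[OF b t] True by simp
    next
      case False
      have "X_norm l (jump l (b (Suc i)) (traj \<tau> P0 b i (\<tau> (Suc i)))) \<le> 3 * X_norm l (traj \<tau> P0 b i (\<tau> (Suc i)))"
        by (rule jump_zero_bound[OF J(3) U_ad_measurable(2,3)[OF \<omega> b i]])
      also have "\<dots> \<le> 3 * K" using K(2)[OF b, of "\<tau> (Suc i)"] \<tau> i by auto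
      finally have "growth T * X_norm l (jump l (b (Suc i)) (traj \<tau> P0 b i (\<tau> (Suc i)))) \<le> growth T * (3 * K)"
        using g by (intro mult_left_mono) auto
      moreover have "X_norm l (S (jump l (b (Suc i)) (traj \<tau> P0 b i (\<tau> (Suc i)))) (t - \<tau> (Suc i))) \<le> growth T * X_norm l (jump l (b (Suc i)) (traj \<tau> P0 b i (\<tau> (Suc i))))"
        by (rule S_bound[OF J(2)]) (use False t bspec[OF \<tau> i] in auto)
      ultimately show ?thesis using False by simp
    qed
  qed
qed

definition ctrl_close :: "real \<Rightarrow> (nat \<Rightarrow> real \<Rightarrow> real) \<Rightarrow> (nat \<Rightarrow> real \<Rightarrow> real) \<Rightarrow> bool" where
  "ctrl_close \<delta> b b' \<longleftrightarrow> (\<forall>j\<in>{1..N}. \<forall>x\<in>{0..l}. \<bar>b j x - b' j x\<bar> \<le> \<delta>)"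

text \<open>
  One constant serves all pairs of controls; each impulse enlarges it by the growth of the semiflow and of
  the impulse.
\<close>
lemma traj_lipschitz:
  "i \<le> N \<Longrightarrow> \<exists>K\<ge>0. \<forall>b\<in>U_ad l N \<omega>. \<forall>b'\<in>U_ad l N \<omega>. \<forall>\<delta>\<ge>0. ctrl_close \<delta> b b' \<longrightarrow>
     (\<forall>t\<in>{0..T}. X_norm l (X_diff (traj \<tau> P0 b i t) (traj \<tau> P0 b' i t)) \<le> K * \<delta>)"
proof (induction i)
  case 0
  show ?case by (intro exI[of _ 0]) (simp add: X_norm_def X_diff_def)
next
  case (Suc i)
  then obtain K where K: "K \<ge> 0" "\<And>b b' \<delta> t. b \<in> U_ad l N \<omega> \<Longrightarrow> b' \<in> U_ad l N \<omega> \<Longrightarrow> 0 \<le> \<delta> \<Longrightarrow> ctrl_close \<delta> b b' \<Longrightarrow> t \<in> {0..T} \<Longrightarrow>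
     X_norm l (X_diff (traj \<tau> P0 b i t) (traj \<tau> P0 b' i t)) \<le> K * \<delta>" by (auto dest: Suc_leD)
  obtain B where B: "B \<ge> 0" "\<And>b t. b \<in> U_ad l N \<omega> \<Longrightarrow> t \<in> {0..T} \<Longrightarrow> X_norm l (traj \<tau> P0 b i t) \<le> B"
    using traj_bounded[of i] Suc.prems by auto
  have i: "Suc i \<in> {1..N}" using Suc.prems by simp
  have g: "1 \<le> growth T" using growth_ge T by simp
  \<comment> \<open>the jump contributes \<open>3 K \<delta>\<close> through the states and \<open>2 B \<delta>\<close> through the controls\<close>
  define K' where "K' = growth T * (3 * K + 2 * B)"
  have K': "0 \<le> K'" "K \<le> K'" using g K(1) B(1) mult_mono[OF g, of K "3 * K + 2 * B"] by (auto simp: K'_def)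
  show ?case
  proof (intro exI[of _ K'] conjI ballI allI impI K'(1))
    fix b b' \<delta> t assume b: "b \<in> U_ad l N \<omega>" "b' \<in> U_ad l N \<omega>" and \<delta>: "0 \<le> \<delta>" "ctrl_close \<delta> b b'" and t: "t \<in> {0..T}"
    show "X_norm l (X_diff (traj \<tau> P0 b (Suc i) t) (traj \<tau> P0 b' (Suc i) t)) \<le> K' * \<delta>"
    proof (cases "t \<le> \<tau> (Suc i)")
      case True
      have "K * \<delta> \<le> K' * \<delta>" using K'(2) \<delta>(1) by (rule mult_right_mono)
      then show ?thesis using K(2)[OF b \<delta> t] True by simp
    next
      case False
      have aT: "\<tau> (Suc i) \<in> {0..T}" using \<tau> i by auto
      note J = traj_jump_in_X[OF T \<omega> P0 mono \<tau> b(1) Suc.prems] and J' = traj_jump_in_X[OF T \<omega> P0 mono \<tau> b(2) Suc.prems]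
      let ?P = "traj \<tau> P0 b i (\<tau> (Suc i))" and ?P' = "traj \<tau> P0 b' i (\<tau> (Suc i))"
      have cl: "\<And>x. x \<in> {0..l} \<Longrightarrow> \<bar>b (Suc i) x - b' (Suc i) x\<bar> \<le> \<delta>" using \<delta>(2) i by (simp add: ctrl_close_def)
      have "X_norm l (X_diff (impulse l (b (Suc i)) ?P) (impulse l (b' (Suc i)) ?P')) \<le> 2 * (X_norm l (X_diff ?P ?P') + \<delta> * X_norm l ?P')"
        by (rule impulse_lipschitz(1)[OF U_ad_measurable(2,3)[OF \<omega> b(1) i] U_ad_measurable(2,3)[OF \<omega> b(2) i] \<delta>(1) cl J(3) J'(3)])
      moreover have "\<delta> * X_norm l ?P' \<le> \<delta> * B" by (rule mult_left_mono[OF B(2)[OF b(2) aT] \<delta>(1)])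
      moreover note K(2)[OF b \<delta> aT] jump_lipschitz[OF J(3) J'(3) J(1) J'(1)]
      moreover have "i \<le> 2 * (d + n) \<Longrightarrow> n \<le> m \<Longrightarrow> d \<le> k \<Longrightarrow> j \<le> d + i \<Longrightarrow> j \<le> 3 * k + 2 * m" for i d n m k j :: real
        unfolding distrib_left by linarith
      ultimately have "X_norm l (X_diff (jump l (b (Suc i)) ?P) (jump l (b' (Suc i)) ?P')) \<le> 3 * (K * \<delta>) + 2 * (\<delta> * B)" by blast
      also have "\<dots> = (3 * K + 2 * B) * \<delta>" by (simp add: algebra_simps)
      finally have "growth T * X_norm l (X_diff (jump l (b (Suc i)) ?P) (jump l (b' (Suc i)) ?P')) \<le> growth T * ((3 * K + 2 * B) * \<delta>)"
        using g by (intro mult_left_mono) auto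
      moreover have "X_norm l (X_diff (S (jump l (b (Suc i)) ?P) (t - \<tau> (Suc i))) (S (jump l (b' (Suc i)) ?P') (t - \<tau> (Suc i)))) \<le> growth T * X_norm l (X_diff (jump l (b (Suc i)) ?P) (jump l (b' (Suc i)) ?P'))"
        by (rule S_lipschitz[OF J(2) J'(2)]) (use False t aT in auto)
      ultimately show ?thesis using False by (simp add: K'_def mult.assoc)
    qed
  qed
qed

lemma mass_dual: "(0, \<lambda>_. 1) \<in> X_dual l" by (auto simp: X_dual_def)

lemma mass_eq_pairing: "(LINT x|M. snd P x) = pairing l P (0, \<lambda>_. 1)" by (simp add: pairing_def)

lemma mass_le: "\<bar>LINT x|M. snd P x\<bar> \<le> X_norm l P"
  using integral_abs_bound[of M "snd P"] unfolding X_norm_def by linarith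

lemma cost_lipschitz:
  assumes \<beta>: "\<forall>i\<in>{1..N}. 0 \<le> \<beta> i"
  shows "\<exists>C\<ge>0. \<forall>b\<in>U_ad l N \<omega>. \<forall>b'\<in>U_ad l N \<omega>. \<forall>\<delta>\<ge>0. ctrl_close \<delta> b b' \<longrightarrow>
     \<bar>cost l T N \<beta> b (traj \<tau> P0 b N) - cost l T N \<beta> b' (traj \<tau> P0 b' N)\<bar> \<le> C * \<delta>"
proof -
  obtain B where B: "B \<ge> 0" "\<And>b t. b \<in> U_ad l N \<omega> \<Longrightarrow> t \<in> {0..T} \<Longrightarrow> X_norm l (traj \<tau> P0 b N t) \<le> B"
    using traj_bounded[of N] by auto
  obtain K where K: "K \<ge> 0" "\<And>b b' \<delta> t. b \<in> U_ad l N \<omega> \<Longrightarrow> b' \<in> U_ad l N \<omega> \<Longrightarrow> 0 \<le> \<delta> \<Longrightarrow> ctrl_close \<delta> b b' \<Longrightarrow> t \<in> {0..T} \<Longrightarrow>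
     X_norm l (X_diff (traj \<tau> P0 b N t) (traj \<tau> P0 b' N t)) \<le> K * \<delta>" using traj_lipschitz[of N] by auto
  define D where "D = K * (2 * B)"
  have D0: "0 \<le> D" using K(1) B(1) by (simp add: D_def)
  define E where "E = (\<Sum>i=1..N. \<beta> i * (2 * l))"
  have E0: "0 \<le> E" unfolding E_def using \<beta> l_pos by (intro sum_nonneg) auto
  show ?thesis
  proof (intro exI[of _ "T * D + E + D"] conjI ballI allI impI)
    show "0 \<le> T * D + E + D" using D0 E0 T by simp
    fix b b' \<delta> assume b: "b \<in> U_ad l N \<omega>" "b' \<in> U_ad l N \<omega>" and \<delta>: "0 \<le> \<delta>" "ctrl_close \<delta> b b'"
    let ?P = "traj \<tau> P0 b N" and ?P' = "traj \<tau> P0 b' N"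
    define f where "f t = (LINT x|M. snd (?P t) x)" for t
    define f' where "f' t = (LINT x|M. snd (?P' t) x)" for t
    have T0: "0 \<le> T" using T by simp
    have X: "?P t \<in> X_space l" "?P' t \<in> X_space l" if "t \<in> {0..T}" for t
      using traj_in_X[OF T \<omega> P0 mono \<tau> b(1) order_refl] traj_in_X[OF T \<omega> P0 mono \<tau> b(2) order_refl] that by auto
    have fi: "integrable (lebesgue_on {0..T}) f" "integrable (lebesgue_on {0..T}) f'"
      unfolding f_def f'_def mass_eq_pairing
      by (rule PWC_left_pairing(2)[OF traj_PWC[OF T \<omega> P0 mono \<tau> b(1) order_refl] mass_dual T0],
          rule PWC_left_pairing(2)[OF traj_PWC[OF T \<omega> P0 mono \<tau> b(2) order_refl] mass_dual T0])
    have fB: "\<bar>f t\<bar> \<le> B" "\<bar>f' t\<bar> \<le> B" if "t \<in> {0..T}" for t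
      using order_trans[OF mass_le B(2)[OF b(1) that]] order_trans[OF mass_le B(2)[OF b(2) that]] by (auto simp: f_def f'_def)
    have fd: "\<bar>f t - f' t\<bar> \<le> K * \<delta>" if t: "t \<in> {0..T}" for t
    proof -
      have "f t - f' t = (LINT x|M. snd (X_diff (?P t) (?P' t)) x)"
        unfolding f_def f'_def mass_eq_pairing by (rule pairing_X_diff[OF X[OF t] mass_dual, symmetric])
      then show ?thesis using order_trans[OF mass_le K(2)[OF b \<delta> t]] by simp
    qed
    have sq: "\<bar>\<bar>f t\<bar>\<^sup>2 - \<bar>f' t\<bar>\<^sup>2\<bar> \<le> D * \<delta>" if t: "t \<in> {0..T}" for t
    proof -
      have "\<bar>f t\<bar>\<^sup>2 - \<bar>f' t\<bar>\<^sup>2 = (f t - f' t) * (f t + f' t)" by (simp add: power2_eq_square algebra_simps)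
      then have "\<bar>\<bar>f t\<bar>\<^sup>2 - \<bar>f' t\<bar>\<^sup>2\<bar> = \<bar>f t - f' t\<bar> * \<bar>f t + f' t\<bar>" by (simp add: abs_mult)
      also have "\<dots> \<le> (K * \<delta>) * (2 * B)" using fd[OF t] fB[OF t] K(1) \<delta>(1) by (intro mult_mono) auto
      finally show ?thesis by (simp add: D_def mult_ac)
    qed
    have sqi: "integrable (lebesgue_on {0..T}) (\<lambda>t. \<bar>g t\<bar>\<^sup>2)" if "integrable (lebesgue_on {0..T}) g" "\<And>t. t \<in> {0..T} \<Longrightarrow> \<bar>g t\<bar> \<le> B" for g :: "real \<Rightarrow> real"
    proof (rule Bochner_Integration.integrable_bound)
      show "integrable (lebesgue_on {0..T}) (\<lambda>t. B * g t)" using that(1) by simp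
      show "(\<lambda>t. \<bar>g t\<bar>\<^sup>2) \<in> borel_measurable (lebesgue_on {0..T})" using that(1) by auto
      show "AE t in lebesgue_on {0..T}. norm (\<bar>g t\<bar>\<^sup>2) \<le> norm (B * g t)"
      proof (intro AE_I2)
        fix t assume "t \<in> space (lebesgue_on {0..T})"
        then have "\<bar>g t\<bar> \<le> B" using that(2) by simp
        then have "\<bar>g t\<bar> * \<bar>g t\<bar> \<le> B * \<bar>g t\<bar>" by (rule mult_right_mono) simp
        moreover have "norm (\<bar>g t\<bar>\<^sup>2) = \<bar>g t\<bar> * \<bar>g t\<bar>" by (simp add: power2_eq_square)
        moreover have "norm (B * g t) = B * \<bar>g t\<bar>" using B(1) by (simp add: abs_mult)
        ultimately show "norm (\<bar>g t\<bar>\<^sup>2) \<le> norm (B * g t)" by simp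
      qed
    qed
    note s = sqi[OF fi(1) fB(1)] sqi[OF fi(2) fB(2)]
    have I1: "\<bar>(LINT t|lebesgue_on {0..T}. \<bar>f t\<bar>\<^sup>2) - (LINT t|lebesgue_on {0..T}. \<bar>f' t\<bar>\<^sup>2)\<bar> \<le> T * (D * \<delta>)"
    proof -
      have d: "(LINT t|lebesgue_on {0..T}. \<bar>f t\<bar>\<^sup>2) - (LINT t|lebesgue_on {0..T}. \<bar>f' t\<bar>\<^sup>2) = (LINT t|lebesgue_on {0..T}. \<bar>f t\<bar>\<^sup>2 - \<bar>f' t\<bar>\<^sup>2)"
        by (rule Bochner_Integration.integral_diff[OF s, symmetric])
      have "\<bar>LINT t|lebesgue_on {0..T}. \<bar>f t\<bar>\<^sup>2 - \<bar>f' t\<bar>\<^sup>2\<bar> \<le> (LINT t|lebesgue_on {0..T}. \<bar>\<bar>f t\<bar>\<^sup>2 - \<bar>f' t\<bar>\<^sup>2\<bar>)"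
        by (rule integral_abs_bound)
      also have "\<dots> \<le> (LINT t|lebesgue_on {0..T}. D * \<delta>)"
        by (rule Bochner_Integration.integral_mono[OF Bochner_Integration.integrable_abs[OF Bochner_Integration.integrable_diff[OF s]]])
           (use sq in \<open>auto intro!: continuous_imp_integrable_real\<close>)
      also have "\<dots> = T * (D * \<delta>)" using T by (simp add: measure_restrict_space)
      finally show ?thesis unfolding d .
    qed
    have T1: "T \<in> {0..T}" using T by simp
    have I3: "\<bar>\<bar>f T\<bar>\<^sup>2 - \<bar>f' T\<bar>\<^sup>2\<bar> \<le> D * \<delta>" by (rule sq[OF T1])
    have I2: "\<bar>(\<Sum>i=1..N. \<beta> i * (LINT x|M. \<bar>b i x\<bar>\<^sup>2)) - (\<Sum>i=1..N. \<beta> i * (LINT x|M. \<bar>b' i x\<bar>\<^sup>2))\<bar> \<le> E * \<delta>"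
    proof -
      have each: "\<bar>(LINT x|M. \<bar>b i x\<bar>\<^sup>2) - (LINT x|M. \<bar>b' i x\<bar>\<^sup>2)\<bar> \<le> 2 * l * \<delta>" if i: "i \<in> {1..N}" for i
      proof -
        note u = U_ad_measurable[OF \<omega> b(1) i] and u' = U_ad_measurable[OF \<omega> b(2) i]
        have j: "integrable M (\<lambda>x. \<bar>b i x\<bar>\<^sup>2)" "integrable M (\<lambda>x. \<bar>b' i x\<bar>\<^sup>2)"
          by (intro continuous_imp_integrable_real continuous_intros u(1) u'(1))+
        have d: "(LINT x|M. \<bar>b i x\<bar>\<^sup>2) - (LINT x|M. \<bar>b' i x\<bar>\<^sup>2) = (LINT x|M. \<bar>b i x\<bar>\<^sup>2 - \<bar>b' i x\<bar>\<^sup>2)"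
          by (rule Bochner_Integration.integral_diff[OF j, symmetric])
        have "\<bar>LINT x|M. \<bar>b i x\<bar>\<^sup>2 - \<bar>b' i x\<bar>\<^sup>2\<bar> \<le> (LINT x|M. \<bar>\<bar>b i x\<bar>\<^sup>2 - \<bar>b' i x\<bar>\<^sup>2\<bar>)" by (rule integral_abs_bound)
        also have "\<dots> \<le> (LINT x|M. \<delta> * 2)"
        proof (rule Bochner_Integration.integral_mono[OF Bochner_Integration.integrable_abs[OF Bochner_Integration.integrable_diff[OF j]]])
          show "integrable M (\<lambda>x. \<delta> * 2)" by (intro continuous_imp_integrable_real continuous_intros)
          fix x assume "x \<in> space M"
          then have x: "x \<in> {0..l}" by simp
          have "\<bar>b i x\<bar>\<^sup>2 - \<bar>b' i x\<bar>\<^sup>2 = (b i x - b' i x) * (b i x + b' i x)" by (simp add: power2_eq_square algebra_simps)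
          then have "\<bar>\<bar>b i x\<bar>\<^sup>2 - \<bar>b' i x\<bar>\<^sup>2\<bar> = \<bar>b i x - b' i x\<bar> * \<bar>b i x + b' i x\<bar>" by (simp add: abs_mult)
          also have "\<dots> \<le> \<delta> * 2"
            using \<delta> i x u(3)[OF x] u'(3)[OF x] by (intro mult_mono) (auto simp: ctrl_close_def)
          finally show "\<bar>\<bar>b i x\<bar>\<^sup>2 - \<bar>b' i x\<bar>\<^sup>2\<bar> \<le> \<delta> * 2" .
        qed
        also have "\<dots> = 2 * l * \<delta>" using l_pos by (simp add: measure_restrict_space)
        finally show ?thesis unfolding d .
      qed
      have "\<bar>(\<Sum>i=1..N. \<beta> i * (LINT x|M. \<bar>b i x\<bar>\<^sup>2)) - (\<Sum>i=1..N. \<beta> i * (LINT x|M. \<bar>b' i x\<bar>\<^sup>2))\<bar>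
         = \<bar>\<Sum>i=1..N. \<beta> i * ((LINT x|M. \<bar>b i x\<bar>\<^sup>2) - (LINT x|M. \<bar>b' i x\<bar>\<^sup>2))\<bar>"
        by (simp only: right_diff_distrib sum_subtractf)
      also have "\<dots> \<le> (\<Sum>i=1..N. \<bar>\<beta> i * ((LINT x|M. \<bar>b i x\<bar>\<^sup>2) - (LINT x|M. \<bar>b' i x\<bar>\<^sup>2))\<bar>)" by (rule sum_abs)
      also have "\<dots> \<le> (\<Sum>i=1..N. \<beta> i * (2 * l * \<delta>))"
      proof (rule sum_mono)
        fix i assume i: "i \<in> {1..N}"
        show "\<bar>\<beta> i * ((LINT x|M. \<bar>b i x\<bar>\<^sup>2) - (LINT x|M. \<bar>b' i x\<bar>\<^sup>2))\<bar> \<le> \<beta> i * (2 * l * \<delta>)"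
          unfolding abs_mult using mult_left_mono[OF each[OF i], of "\<beta> i"] \<beta> i by simp
      qed
      also have "\<dots> = E * \<delta>" unfolding E_def sum_distrib_right by (simp add: mult_ac)
      finally show ?thesis .
    qed
    have lin: "\<bar>a - a'\<bar> \<le> A \<Longrightarrow> \<bar>c - c'\<bar> \<le> C \<Longrightarrow> \<bar>d - d'\<bar> \<le> G \<Longrightarrow> 0 \<le> A \<Longrightarrow> 0 \<le> C \<Longrightarrow> 0 \<le> G \<Longrightarrow>
      \<bar>(1/2 * a + 1/2 * c + 1/2 * d) - (1/2 * a' + 1/2 * c' + 1/2 * d')\<bar> \<le> A + C + G" for a a' A c c' C d d' G :: real
      by linarith
    have "\<bar>cost l T N \<beta> b ?P - cost l T N \<beta> b' ?P'\<bar> \<le> T * (D * \<delta>) + E * \<delta> + D * \<delta>"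
      unfolding cost_def
      by (rule lin[OF I1[unfolded f_def f'_def] I2 I3[unfolded f_def f'_def]]) (use T D0 E0 \<delta>(1) in auto)
    then show "\<bar>cost l T N \<beta> b ?P - cost l T N \<beta> b' ?P'\<bar> \<le> (T * D + E + D) * \<delta>" by (simp add: algebra_simps)
  qed
qed

text \<open>
  The cost depends on a solution only through its masses, which are pairings with \<open>(0,1)\<close>.
\<close>
lemma cost_unique:
  assumes b: "b \<in> U_ad l N \<omega>" and ws: "weak_solution l T lam1 \<mu> N \<tau> P0 b P" "weak_solution l T lam1 \<mu> N \<tau> P0 b P'"
  shows "cost l T N \<beta> b P = cost l T N \<beta> b P'"
proof -
  have e: "(LINT x|M. snd (P t) x) = (LINT x|M. snd (P' t) x)" if t: "t \<in> {0..T}" for t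
  proof -
    have X: "P t \<in> X_space l" "P' t \<in> X_space l" using ws t PWC_leftD(1) unfolding weak_solution_def by blast+
    show ?thesis unfolding mass_eq_pairing
      by (rule X_eq_pairing[OF X mass_dual weak_solution_unique[OF ws T \<tau> \<omega> b t]])
  qed
  have "(LINT t|lebesgue_on {0..T}. \<bar>LINT x|M. snd (P t) x\<bar>\<^sup>2) = (LINT t|lebesgue_on {0..T}. \<bar>LINT x|M. snd (P' t) x\<bar>\<^sup>2)"
    by (rule Bochner_Integration.integral_cong[OF refl]) (use e in simp)
  then show ?thesis unfolding cost_def using e[of T] T by simp
qed

lemma J_eq_cost:
  assumes b: "b \<in> U_ad l N \<omega>"
  shows "J l T lam1 \<mu> N \<tau> \<beta> P0 b = cost l T N \<beta> b (traj \<tau> P0 b N)"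
  unfolding J_def
proof (rule the_equality)
  have w: "weak_solution l T lam1 \<mu> N \<tau> P0 b (traj \<tau> P0 b N)" by (rule traj_weak_solution[OF T \<omega> P0 mono \<tau> b])
  then show "\<exists>P. weak_solution l T lam1 \<mu> N \<tau> P0 b P \<and> cost l T N \<beta> b (traj \<tau> P0 b N) = cost l T N \<beta> b P" by blast
  fix c assume "\<exists>P. weak_solution l T lam1 \<mu> N \<tau> P0 b P \<and> c = cost l T N \<beta> b P"
  then show "c = cost l T N \<beta> b (traj \<tau> P0 b N)" using cost_unique[OF b _ w] by blast
qed

text \<open>
  The controls \<open>b\<^sub>1, \<dots>, b\<^sub>N\<close> are regarded as one function on \<open>{1..N} \<times> [0,l]\<close>, whose slices are at distance at
  least \<open>1\<close>, so Arzela--Ascoli applies once.  The constraints pass to pointwise limits.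
\<close>
lemma U_ad_compact:
  assumes u: "\<And>n. u n \<in> U_ad l N \<omega>"
  obtains v and k :: "nat \<Rightarrow> nat" where "v \<in> U_ad l N \<omega>" "strict_mono k"
    "\<And>e. 0 < e \<Longrightarrow> \<exists>n0. \<forall>n\<ge>n0. ctrl_close e (u (k n)) v"
proof -
  define K where "K = (real ` {1..N}) \<times> {0..l}"
  define G where "G n p = u n (nat \<lfloor>fst p\<rfloor>) (snd p)" for n and p :: "real \<times> real"
  have B: "0 \<le> u n i x \<and> u n i x \<le> 1" if "i \<in> {1..N}" "x \<in> {0..l}" for n i x
    using u[of n] that by (auto simp: U_ad_def)
  have L: "\<bar>u n i x - u n i y\<bar> \<le> \<omega> \<bar>x - y\<bar>" if "i \<in> {1..N}" "x \<in> {0..l}" "y \<in> {0..l}" for n i x y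
    using u[of n] that unfolding U_ad_def by blast
  have cK: "compact K" unfolding K_def by (rule compact_Times[OF finite_imp_compact compact_Icc]) simp
  obtain g k where g: "continuous_on K g" "strict_mono (k :: nat \<Rightarrow> nat)"
    "\<And>e. 0 < e \<Longrightarrow> \<exists>N. \<forall>n x. n \<ge> N \<and> x \<in> K \<longrightarrow> norm (G (k n) x - g x) < e"
  proof (rule Arzela_Ascoli[OF cK, of G 1])
    show "norm (G n p) \<le> 1" if "p \<in> K" for n p
      using that B by (force simp: K_def G_def)
    fix p e assume p: "p \<in> K" and e: "(0::real) < e"
    obtain i x where ix: "p = (real i, x)" "i \<in> {1..N}" "x \<in> {0..l}" using p by (auto simp: K_def)
    have w: "(\<omega> \<longlongrightarrow> 0) (at_right 0)" "\<omega> 0 = 0" using \<omega> by (auto simp: modulus_of_continuity_def)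
    have "eventually (\<lambda>r. \<omega> r < e) (at_right 0)" using w(1) e by (rule order_tendstoD)
    then obtain d where d: "0 < d" "\<And>r. 0 < r \<Longrightarrow> r < d \<Longrightarrow> \<omega> r < e"
      unfolding eventually_at_right_field by blast
    show "\<exists>d>0. \<forall>n q. q \<in> K \<and> norm (p - q) < d \<longrightarrow> norm (G n p - G n q) < e"
    proof (intro exI[of _ "min d 1"] conjI allI impI)
      show "0 < min d 1" using d by simp
      fix n q assume q: "q \<in> K \<and> norm (p - q) < min d 1"
      then obtain j y where jy: "q = (real j, y)" "j \<in> {1..N}" "y \<in> {0..l}" by (auto simp: K_def)
      have pq: "p - q = (real i - real j, x - y)" by (simp add: ix(1) jy(1))
      have "norm (real i - real j) \<le> norm (p - q)" unfolding pq by (rule norm_fst_le)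
      moreover have "norm (x - y) \<le> norm (p - q)" unfolding pq by (rule norm_snd_le)
      ultimately have "\<bar>real i - real j\<bar> < 1" "\<bar>x - y\<bar> < d" using q by auto
      then have ij: "i = j" by linarith
      have "\<omega> \<bar>x - y\<bar> < e" using d(2)[of "\<bar>x - y\<bar>"] \<open>\<bar>x - y\<bar> < d\<close> w(2) e by (cases "x = y") auto
      then show "norm (G n p - G n q) < e" using L[OF ix(2,3) jy(3), of n] ij by (simp add: G_def ix(1) jy(1))
    qed
  qed blast
  define v where "v i x = g (real i, x)" for i x
  have Gu: "G n (real i, x) = u n i x" for n i x by (simp add: G_def)
  have lim: "(\<lambda>n. u (k n) i x) \<longlonglongrightarrow> v i x" if "i \<in> {1..N}" "x \<in> {0..l}" for i x
    unfolding LIMSEQ_iff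
  proof (intro allI impI)
    fix e :: real assume "0 < e"
    then obtain n0 where "\<forall>n p. n \<ge> n0 \<and> p \<in> K \<longrightarrow> norm (G (k n) p - g p) < e" using g(3) by blast
    then show "\<exists>no. \<forall>n\<ge>no. norm (u (k n) i x - v i x) < e"
      using that by (intro exI[of _ n0]) (auto simp: K_def v_def Gu[symmetric])
  qed
  have "v \<in> U_ad l N \<omega>"
    unfolding U_ad_def
  proof (intro CollectI ballI conjI)
    fix i x assume i: "i \<in> {1..N}" and x: "x \<in> {0..l}"
    show "0 \<le> v i x" by (rule LIMSEQ_le_const[OF lim[OF i x]]) (use B[OF i x] in blast)
    show "v i x \<le> 1" by (rule LIMSEQ_le_const2[OF lim[OF i x]]) (use B[OF i x] in blast)
    fix y assume y: "y \<in> {0..l}"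
    have "(\<lambda>n. \<bar>u (k n) i x - u (k n) i y\<bar>) \<longlonglongrightarrow> \<bar>v i x - v i y\<bar>" by (intro tendsto_intros lim i x y)
    then show "\<bar>v i x - v i y\<bar> \<le> \<omega> \<bar>x - y\<bar>" by (rule LIMSEQ_le_const2) (use L[OF i x y] in blast)
  qed
  moreover have "\<exists>n0. \<forall>n\<ge>n0. ctrl_close e (u (k n)) v" if e: "0 < e" for e
  proof -
    obtain n0 where n0: "\<forall>n p. n \<ge> n0 \<and> p \<in> K \<longrightarrow> norm (G (k n) p - g p) < e" using g(3)[OF e] by blast
    have "ctrl_close e (u (k n)) v" if n: "n \<ge> n0" for n
      unfolding ctrl_close_def
    proof (intro ballI)
      fix j x assume "j \<in> {1..N}" "x \<in> {0..l}"
      then have "(real j, x) \<in> K" by (auto simp: K_def)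
      then have "norm (G (k n) (real j, x) - g (real j, x)) < e" using n0 n by blast
      then show "\<bar>u (k n) j x - v j x\<bar> \<le> e" by (simp add: Gu v_def)
    qed
    then show ?thesis by blast
  qed
  ultimately show thesis using that g(2) by blast
qed

lemma cost_nonneg:
  assumes \<beta>: "\<forall>i\<in>{1..N}. 0 \<le> \<beta> i"
  shows "0 \<le> cost l T N \<beta> b P"
  unfolding cost_def using \<beta> by (intro add_nonneg_nonneg mult_nonneg_nonneg sum_nonneg) auto

text \<open>
  A minimizing sequence has a uniformly convergent subsequence, and the cost is continuous along it.
\<close>
theorem optimal_control_exists:
  assumes \<beta>: "\<forall>i\<in>{1..N}. 0 \<le> \<beta> i"
  shows "\<exists>U\<in>U_ad l N \<omega>. \<exists>P.
           weak_solution l T lam1 \<mu> N \<tau> P0 U P \<and>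
           cost l T N \<beta> U P = J l T lam1 \<mu> N \<tau> \<beta> P0 U \<and>
           J l T lam1 \<mu> N \<tau> \<beta> P0 U = (INF V\<in>U_ad l N \<omega>. J l T lam1 \<mu> N \<tau> \<beta> P0 V)"
proof -
  let ?U = "U_ad l N \<omega>" and ?J = "J l T lam1 \<mu> N \<tau> \<beta> P0"
  define m where "m = (INF V\<in>?U. ?J V)"
  have "(\<lambda>_ _. 0) \<in> ?U" using \<omega> by (simp add: U_ad_def modulus_of_continuity_def)
  then have ne: "?J ` ?U \<noteq> {}" by blast
  have bdd: "bdd_below (?J ` ?U)"
    by (rule bdd_belowI[of _ 0]) (use J_eq_cost cost_nonneg[OF \<beta>] in auto)
  have "\<exists>V\<in>?U. ?J V < m + inverse (real (Suc n))" for n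
  proof -
    have "Inf (?J ` ?U) < m + inverse (real (Suc n))" unfolding m_def by simp
    then show ?thesis using cInf_lessD[OF ne] by blast
  qed
  then obtain u where u: "\<And>n. u n \<in> ?U" "\<And>n. ?J (u n) < m + inverse (real (Suc n))" by metis
  obtain v k where v: "v \<in> ?U" and k: "strict_mono (k :: nat \<Rightarrow> nat)"
    and cl: "\<And>e. 0 < e \<Longrightarrow> \<exists>n0. \<forall>n\<ge>n0. ctrl_close e (u (k n)) v"
    by (rule U_ad_compact[where u=u, OF u(1)]) (rule that; assumption)
  obtain C where C: "C \<ge> 0" "\<And>b b' \<delta>. b \<in> ?U \<Longrightarrow> b' \<in> ?U \<Longrightarrow> \<delta> \<ge> 0 \<Longrightarrow> ctrl_close \<delta> b b' \<Longrightarrow>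
     \<bar>cost l T N \<beta> b (traj \<tau> P0 b N) - cost l T N \<beta> b' (traj \<tau> P0 b' N)\<bar> \<le> C * \<delta>"
    using cost_lipschitz[OF \<beta>] by auto
  have "?J v \<le> m"
  proof (rule field_le_epsilon)
    fix e :: real assume e: "0 < e"
    \<comment> \<open>\<open>C + 1\<close> avoids a division by zero when \<open>C = 0\<close>\<close>
    define d where "d = e / (2 * (C + 1))"
    have d: "0 < d" "C * d \<le> e / 2" using e C(1) by (auto simp: d_def field_simps)
    obtain n0 where n0: "\<forall>n\<ge>n0. ctrl_close d (u (k n)) v" using cl[OF d(1)] by blast
    obtain n1 where n1: "inverse (real (Suc n1)) < e / 2" using reals_Archimedean[of "e/2"] e by auto
    define n where "n = max n0 n1"
    have "n1 \<le> k n" using seq_suble[OF k, of n] by (simp add: n_def)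
    then have "inverse (real (Suc (k n))) \<le> inverse (real (Suc n1))" by (intro le_imp_inverse_le) auto
    moreover have "\<bar>?J (u (k n)) - ?J v\<bar> \<le> C * d"
      unfolding J_eq_cost[OF u(1)] J_eq_cost[OF v]
      by (rule C(2)[OF u(1) v]) (use d n0 in \<open>auto simp: n_def\<close>)
    ultimately show "?J v \<le> m + e" using u(2)[of "k n"] d(2) n1 by linarith
  qed
  moreover have "m \<le> ?J v" unfolding m_def by (rule cINF_lower[OF bdd v])
  ultimately have "?J v = m" by simp
  then show ?thesis
    using v traj_weak_solution[OF T \<omega> P0 mono \<tau> v] J_eq_cost[OF v] unfolding m_def by metis
qed

end

end

theorem theorem3p2:
  fixes l T lam1 :: real and \<mu> \<omega> :: "real \<Rightarrow> real"
    and N :: nat and \<tau> \<beta> :: "nat \<Rightarrow> real" and P0 :: state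
  assumes "0 < l" and "0 < T" and "0 < lam1"
    and "repair_rate l \<mu>"
    and "modulus_of_continuity \<omega>"
    and "P0 \<in> X_space l" and "X_nonneg l P0" and "X_norm l P0 = 1"
    and "strict_mono_on {1..N} \<tau>" and "\<forall>i\<in>{1..N}. 0 \<le> \<tau> i \<and> \<tau> i \<le> T"
    and "\<forall>i\<in>{1..N}. 0 \<le> \<beta> i"
  shows "\<exists>U\<in>U_ad l N \<omega>. \<exists>P.
           weak_solution l T lam1 \<mu> N \<tau> P0 U P \<and>
           cost l T N \<beta> U P = J l T lam1 \<mu> N \<tau> \<beta> P0 U \<and>
           J l T lam1 \<mu> N \<tau> \<beta> P0 U = (INF V\<in>U_ad l N \<omega>. J l T lam1 \<mu> N \<tau> \<beta> P0 V)"
proof -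
  interpret repair_system l lam1 \<mu> by unfold_locales (use assms in auto)
  show ?thesis
    by (rule optimal_control_exists[OF \<open>0 < T\<close> assms(5,6,9,10,11)])
qed

end
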